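(* Let $u\in\mathcal{W}_\infty(I)$ be a solution of the unsteady elasto-plastic torsion problem and $z=z^{\mathrm a}\,dt\,dx+z^{\mathrm s}\in\operatorname{ba}(Q;\mathbb{R}^d)$ an associated dual flux, as described in the context. Then, for every $v\in\mathcal{W}_\infty(I)$ with $v(0)=u_0$ in $H$ and $\nabla v(t)\in K(t)$ for a.e. $t\in I$, $$\begin{aligned}&\tfrac12\|\nabla(v-u)\|_Q^2+\Bigl(\tfrac{|z^{\mathrm a}|}{\zeta}-1,\ \zeta^2-\nabla u\cdot\nabla v\Bigr)_{\{|\nabla u|=\zeta\}}+|\zeta z^{\mathrm s}|(Q)-\langle z^{\mathrm s},\nabla v\rangle_{L^\infty(Q;\mathbb{R}^d)}+\tfrac12\|(v-u)(T)\|_H^2\\&\quad+\inf_y\Bigl\{I_{\phi^*}(y^{\mathrm a})-(y^{\mathrm a},\nabla u)_Q+\tfrac12\|\nabla u\|_Q^2+|\zeta y^{\mathrm s}|(Q)-\langle y^{\mathrm s},\nabla u\rangle_{L^\infty(Q;\mathbb{R}^d)}\Bigr\}\\&=\inf_y\Bigl\{I_{\phi^*}(y^{\mathrm a})-(y^{\mathrm a},\nabla v)_Q+\tfrac12\|\nabla v\|_Q^2+|\zeta y^{\mathrm s}|(Q)-\langle y^{\mathrm s},\nabla v\rangle_{L^\infty(Q;\mathbb{R}^d)}\Bigr\},\end{aligned}$$ where both infima are over all $y=y^{\mathrm a}\,dt\,dx+y^{\mathrm s}\in\operatorname{ba}(Q;\mathbb{R}^d)$ with $L^*y=f-\partial_tv$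 in $(L^\infty_{\mathrm w^*}(I;V))^*$.
   Context: Spaces. $\Omega\subseteq\mathbb{R}^d$ is a bounded Lipschitz domain with boundary split into disjoint relatively open sets $\Gamma_D\ne\emptyset$ and $\Gamma_N$, $\overline\Gamma_D\cup\overline\Gamma_N=\partial\Omega$; $I=(0,T)$, $0<T<\infty$; $Q=I\times\Omega$. $V=W^{1,\infty}_D(\Omega)$ (zero trace on $\Gamma_D$) with norm $\|\nabla\cdot\|_{L^\infty(\Omega)}$, $Y=L^\infty(\Omega;\mathbb{R}^d)$ with predual $Y_*=L^1(\Omega;\mathbb{R}^d)$, $H=L^2(\Omega)$. $V$ has the separable predual $V_*=Y_*/{}^\perp(\nabla V)$, ${}^\perp(\nabla V)=\{y\in Y_*\mid\int_\Omega y\cdot\nabla v\,dx=0\ \forall v\in V\}$; $V\subset H\subset V_*$, where $h\in H$ acts on $V$ by $v\mapsto(h,v)_H$. $L^\infty_{\mathrm w^*}(I;V)$ is the space of $v\colon I\to V$ such that $t\mapsto\int_\Omega\nabla v(t)\cdot w\,dx$ is measurable for all $w\in Y_*$ and $\|v(\cdot)\|_V\in L^\infty(I)$; it is the dual of $L^1(I;V_* )$. $\mathcal{W}_\infty(I)=\{v\in L^\infty_{\mathrm w^*}(I;V)\mid\partial_tv\in L^1(I;V_* )\}\hookrightarrow C^0(\overline I;H)$. Elements of $L^1(I;V_* )$ are regarded as elements of $(L^\infty_{\mathrm w^*}(I;V))^*$. $\operatorname{ba}(Q;\mathbb{R}^d)=(L^\infty(Q;\mathbb{R}^d))^*$ is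 the space of bounded finitely additive $\mathbb{R}^d$-valued measures on the Lebesgue sets of $Q$ vanishing on Lebesgue-null sets. Every $y\in\operatorname{ba}(Q;\mathbb{R}^d)$ has a unique Yosida--Hewitt decomposition $y=y^{\mathrm a}\,dt\,dx+y^{\mathrm s}$ with $y^{\mathrm a}\in L^1(Q;\mathbb{R}^d)$ and $y^{\mathrm s}$ purely finitely additive. $|\zeta y^{\mathrm s}|(Q)$ is the total variation of $\zeta y^{\mathrm s}$, i.e. $\sup\{\langle y^{\mathrm s},q\rangle\mid q\in L^\infty(Q;\mathbb{R}^d),|q|\le\zeta\text{ a.e.}\}$. $L^*\colon\operatorname{ba}(Q;\mathbb{R}^d)\to(L^\infty_{\mathrm w^*}(I;V))^*$ is the adjoint of $\nabla\colon L^\infty_{\mathrm w^*}(I;V)\to L^\infty(Q;\mathbb{R}^d)$; on a fixed time slice $L^*\colon Y^*\to V^*$ is the adjoint of $\nabla\colon V\to Y$. $(a,b)_\omega=\int_\omega a\cdot b$ for measurable $\omega\subseteq Q$, $\|\cdot\|_Q$ is the $L^2(Q)$-norm. Problem. $\zeta\in L^\infty(Q)$, weakly continuous in time with values in $H$ on $\overline I$, $\zeta\ge\zeta_0$ a.e. in $Q$ for a constant $\zeta_0>0$. $K(t)=\{y\in Y\mid|y|\le\zeta(t)\text{ a.e. in }\Omega\}$; $N_{K(t)}(y)=\{y^*\in Y^*\mid\langle y^*,\varphi-y\rangle_Y\le0\ \forall\varphi\in K(t)\}$. $\phi(t,x,a)=\frac12|a|^2$ if $|a|\le\zeta(t,x)$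 and $+\infty$ otherwise; its conjugate in $a$ is $\phi^*(t,x,a)=\frac12|a|^2-\frac12(|a|-\zeta(t,x))_+^2$, and $I_{\phi^*}(y^{\mathrm a})=\int_Q\phi^*(t,x,y^{\mathrm a}(t,x))\,dt\,dx$. $f\in L^1(I;V_* )$, $u_0\in V$ with $\nabla u_0\in K(0)$. It is assumed that there is a solution $u\in\mathcal{W}_\infty(I)$ of $\partial_tu(t)+(-\Delta)u(t)+L^*N_{K(t)}(\nabla u(t))\ni f(t)$ in $V^*$ for a.e. $t\in I$, $u(0)=u_0$ in $H$, where $\langle(-\Delta)v,w\rangle_V=\int_\Omega\nabla v\cdot\nabla w\,dx$. Dual flux: with $I_G(y)=\int_Q\phi(t,x,y)\,dt\,dx$ on $L^\infty(Q;\mathbb{R}^d)$, $z=z^{\mathrm a}\,dt\,dx+z^{\mathrm s}\in\operatorname{ba}(Q;\mathbb{R}^d)$ is such that $z\in\partial I_G(\nabla u)$ and $L^*z+\partial_tu=f$ in $(L^\infty_{\mathrm w^*}(I;V))^*$; the first condition is equivalent to $\nabla u=\Pi_\zeta(z^{\mathrm a})$ a.e. in $Q$ ($\Pi_{\zeta(t,x)}$ the projection of $\mathbb{R}^d$ onto the closed ball of radius $\zeta(t,x)$) together with $|\zeta z^{\mathrm s}|(Q)=\langle z^{\mathrm s},\nabla u\rangle_{L^\infty(Q;\mathbb{R}^d)}$. *)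

theory Defs
  imports "HOL-Analysis.Analysis" "HOL-Probability.Essential_Supremum"
begin

section \<open>Domain and boundary\<close>

definition bounded_lipschitz_domain :: "'a::euclidean_space set \<Rightarrow> bool" where
  "bounded_lipschitz_domain \<Omega> \<longleftrightarrow>
     open \<Omega> \<and> connected \<Omega> \<and> \<Omega> \<noteq> {} \<and> bounded \<Omega> \<and>
     (\<forall>x\<in>frontier \<Omega>. \<exists>r>0. \<exists>n g C. norm n = 1 \<and> C-lipschitz_on {y. y \<bullet> n = 0} g \<and>
        (\<forall>y\<in>ball x r. y \<in> \<Omega> \<longleftrightarrow> g (y - (y \<bullet> n) *\<^sub>R n) < y \<bullet> n))"

definition boundary_split :: "'a::euclidean_space set \<Rightarrow> 'a set \<Rightarrow> 'a set \<Rightarrow> bool" where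
  "boundary_split \<Omega> \<Gamma>D \<Gamma>N \<longleftrightarrow>
     openin (top_of_set (frontier \<Omega>)) \<Gamma>D \<and> openin (top_of_set (frontier \<Omega>)) \<Gamma>N \<and>
     \<Gamma>D \<inter> \<Gamma>N = {} \<and> \<Gamma>D \<noteq> {} \<and> closure \<Gamma>D \<union> closure \<Gamma>N = frontier \<Omega>"

section \<open>Lebesgue spaces\<close>

text \<open>Elements of Lebesgue, Sobolev and Bochner spaces are represented by functions; all notions
  below that are evaluated on them are invariant under changes on null sets.\<close>

definition Linf :: "'a measure \<Rightarrow> ('a \<Rightarrow> 'b::euclidean_space) set" where
  "Linf M = {q \<in> borel_measurable M. \<exists>C. AE x in M. norm (q x) \<le> C}"

definition Linf_norm :: "'a measure \<Rightarrow> ('a \<Rightarrow> 'b::euclidean_space) \<Rightarrow> real" where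
  "Linf_norm M q = real_of_ereal (esssup M (\<lambda>x. ereal (norm (q x))))"

definition L2 :: "'a measure \<Rightarrow> ('a \<Rightarrow> 'b::euclidean_space) set" where
  "L2 M = {q \<in> borel_measurable M. integrable M (\<lambda>x. (norm (q x))\<^sup>2)}"

definition L2_inner :: "'a measure \<Rightarrow> ('a \<Rightarrow> 'b::euclidean_space) \<Rightarrow> ('a \<Rightarrow> 'b) \<Rightarrow> real" where
  "L2_inner M p q = (LINT x|M. p x \<bullet> q x)"

definition L2_norm :: "'a measure \<Rightarrow> ('a \<Rightarrow> 'b::euclidean_space) \<Rightarrow> real" where
  "L2_norm M q = sqrt (LINT x|M. (norm (q x))\<^sup>2)"

definition Linf_dual :: "'a measure \<Rightarrow> (('a \<Rightarrow> 'b::euclidean_space) \<Rightarrow> real) set" where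
  "Linf_dual M = {y.
     (\<forall>p\<in>Linf M. \<forall>q\<in>Linf M. y (\<lambda>x. p x + q x) = y p + y q) \<and>
     (\<forall>c. \<forall>q\<in>Linf M. y (\<lambda>x. c *\<^sub>R q x) = c * y q) \<and>
     (\<exists>C. \<forall>q\<in>Linf M. \<bar>y q\<bar> \<le> C * Linf_norm M q)}"

section \<open>The space V and its predual\<close>

primrec Ck :: "nat \<Rightarrow> ('a::euclidean_space \<Rightarrow> real) \<Rightarrow> bool" where
  "Ck 0 \<phi> \<longleftrightarrow> continuous_on UNIV \<phi>"
| "Ck (Suc k) \<phi> \<longleftrightarrow> (\<forall>x. \<phi> differentiable (at x)) \<and>
     (\<forall>b\<in>Basis. Ck k (\<lambda>x. frechet_derivative \<phi> (at x) b))"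

definition test_functions :: "'a::euclidean_space set \<Rightarrow> ('a \<Rightarrow> real) set" where
  "test_functions S = {\<phi>. (\<forall>k. Ck k \<phi>) \<and>
     compact (closure {x. \<phi> x \<noteq> 0}) \<and> closure {x. \<phi> x \<noteq> 0} \<subseteq> S}"

definition weak_gradient ::
  "'a::euclidean_space set \<Rightarrow> ('a \<Rightarrow> real) \<Rightarrow> ('a \<Rightarrow> 'a) \<Rightarrow> bool" where
  "weak_gradient \<Omega> v g \<longleftrightarrow> (\<forall>\<phi>\<in>test_functions \<Omega>. \<forall>b\<in>Basis.
     (LINT x|lebesgue_on \<Omega>. v x * frechet_derivative \<phi> (at x) b) =
     - (LINT x|lebesgue_on \<Omega>. (g x \<bullet> b) * \<phi> x))"

definition W1inf :: "'a::euclidean_space set \<Rightarrow> ('a \<Rightarrow> real) set" where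
  "W1inf \<Omega> = {v \<in> Linf (lebesgue_on \<Omega>). \<exists>g\<in>Linf (lebesgue_on \<Omega>). weak_gradient \<Omega> v g}"

definition grad :: "'a::euclidean_space set \<Rightarrow> ('a \<Rightarrow> real) \<Rightarrow> 'a \<Rightarrow> 'a" where
  "grad \<Omega> v = (SOME g. g \<in> Linf (lebesgue_on \<Omega>) \<and> weak_gradient \<Omega> v g)"

text \<open>On a bounded Lipschitz domain a function in \<open>W1inf\<close> has a representative that is continuous up
  to the boundary; its trace is the restriction of this representative to the boundary.\<close>

definition W1infD :: "'a::euclidean_space set \<Rightarrow> 'a set \<Rightarrow> ('a \<Rightarrow> real) set" where
  "W1infD \<Omega> \<Gamma>D = {v \<in> W1inf \<Omega>. \<exists>w. continuous_on (closure \<Omega>) w \<and>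
     (AE x in lebesgue_on \<Omega>. w x = v x) \<and> (\<forall>x\<in>\<Gamma>D. w x = 0)}"

definition V_norm :: "'a::euclidean_space set \<Rightarrow> ('a \<Rightarrow> real) \<Rightarrow> real" where
  "V_norm \<Omega> v = Linf_norm (lebesgue_on \<Omega>) (grad \<Omega> v)"

text \<open>The predual of \<open>V = W1infD \<Omega> \<Gamma>D\<close> is the quotient of \<open>L\<^sup>1(\<Omega>;\<real>\<^sup>d)\<close> by the annihilator of the
  gradients. The coset of \<open>y\<close> is identified with the functional \<open>v \<mapsto> \<integral> y \<bullet> \<nabla>v\<close> on \<open>V\<close>: two
  integrable fields lie in the same coset iff they induce the same functional. Hence
  \<open>predual_coset \<Omega> \<Gamma>D F\<close> is the coset belonging to \<open>F\<close>, and \<open>predual_norm\<close> is the quotient norm.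
  Values of functionals outside \<open>V\<close> are irrelevant.\<close>

definition predual_coset ::
  "'a::euclidean_space set \<Rightarrow> 'a set \<Rightarrow> (('a \<Rightarrow> real) \<Rightarrow> real) \<Rightarrow> ('a \<Rightarrow> 'a) set" where
  "predual_coset \<Omega> \<Gamma>D F = {y. integrable (lebesgue_on \<Omega>) y \<and>
     (\<forall>v\<in>W1infD \<Omega> \<Gamma>D. F v = (LINT x|lebesgue_on \<Omega>. y x \<bullet> grad \<Omega> v x))}"

definition predual :: "'a::euclidean_space set \<Rightarrow> 'a set \<Rightarrow> (('a \<Rightarrow> real) \<Rightarrow> real) set" where
  "predual \<Omega> \<Gamma>D = {F. predual_coset \<Omega> \<Gamma>D F \<noteq> {}}"

definition predual_norm ::
  "'a::euclidean_space set \<Rightarrow> 'a set \<Rightarrow> (('a \<Rightarrow> real) \<Rightarrow> real) \<Rightarrow> real" where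
  "predual_norm \<Omega> \<Gamma>D F = (INF y\<in>predual_coset \<Omega> \<Gamma>D F. LINT x|lebesgue_on \<Omega>. norm (y x))"

section \<open>Time-dependent functions\<close>

text \<open>Throughout, \<open>I = {0<..<T}\<close> and \<open>Q = I \<times> \<Omega>\<close>.\<close>

definition Qm :: "real \<Rightarrow> 'a::euclidean_space set \<Rightarrow> (real \<times> 'a) measure" where
  "Qm T \<Omega> = lebesgue_on ({0<..<T} \<times> \<Omega>)"

text \<open>The Bochner space \<open>L\<^sup>1(I;V\<^sub>*)\<close>: strongly measurable functions with integrable norm. It is
  written out because \<open>V\<^sub>*\<close> depends on the domain and is therefore not a type.\<close>

definition predual_simple ::
  "'a::euclidean_space set \<Rightarrow> 'a set \<Rightarrow> real \<Rightarrow> (real \<Rightarrow> ('a \<Rightarrow> real) \<Rightarrow> real) \<Rightarrow> bool" where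
  "predual_simple \<Omega> \<Gamma>D T s \<longleftrightarrow> (\<forall>t\<in>{0<..<T}. s t \<in> predual \<Omega> \<Gamma>D) \<and> finite (s ` {0<..<T}) \<and>
     (\<forall>F. {t\<in>{0<..<T}. s t = F} \<in> sets lebesgue)"

definition L1_predual ::
  "'a::euclidean_space set \<Rightarrow> 'a set \<Rightarrow> real \<Rightarrow> (real \<Rightarrow> ('a \<Rightarrow> real) \<Rightarrow> real) set" where
  "L1_predual \<Omega> \<Gamma>D T = {f. (\<forall>t\<in>{0<..<T}. f t \<in> predual \<Omega> \<Gamma>D) \<and>
     (\<exists>s. (\<forall>n. predual_simple \<Omega> \<Gamma>D T (s n)) \<and>
        (AE t in lebesgue_on {0<..<T}.
           (\<lambda>n. predual_norm \<Omega> \<Gamma>D (\<lambda>w. f t w - s n t w)) \<longlonglongrightarrow> 0)) \<and>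
     integrable (lebesgue_on {0<..<T}) (\<lambda>t. predual_norm \<Omega> \<Gamma>D (f t))}"

definition Linf_wstar ::
  "'a::euclidean_space set \<Rightarrow> 'a set \<Rightarrow> real \<Rightarrow> (real \<Rightarrow> 'a \<Rightarrow> real) set" where
  "Linf_wstar \<Omega> \<Gamma>D T = {v. (\<forall>t\<in>{0<..<T}. v t \<in> W1infD \<Omega> \<Gamma>D) \<and>
     (\<forall>w. integrable (lebesgue_on \<Omega>) w \<longrightarrow>
        (\<lambda>t. LINT x|lebesgue_on \<Omega>. grad \<Omega> (v t) x \<bullet> w x) \<in> borel_measurable (lebesgue_on {0<..<T})) \<and>
     (\<lambda>t. V_norm \<Omega> (v t)) \<in> Linf (lebesgue_on {0<..<T})}"

text \<open>An element of \<open>L\<^sup>1(I;V\<^sub>*)\<close> as a functional on \<open>Linf_wstar\<close>.\<close>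

definition L1_pairing ::
  "real \<Rightarrow> (real \<Rightarrow> ('a \<Rightarrow> real) \<Rightarrow> real) \<Rightarrow> (real \<Rightarrow> 'a \<Rightarrow> real) \<Rightarrow> real" where
  "L1_pairing T g w = (LINT t|lebesgue_on {0<..<T}. g t (w t))"

text \<open>Weak time derivative of \<open>v\<close>, regarded as a \<open>V\<^sub>*\<close>-valued Bochner function through
  \<open>V \<subseteq> H \<subseteq> V\<^sub>*\<close>. The first conjunct holds for every \<open>v \<in> Linf_wstar \<Omega> \<Gamma>D T\<close>, since \<open>V\<^sub>*\<close> is
  separable. The identity of the two \<open>V\<^sub>*\<close>-valued integrals is tested with the elements of \<open>V\<close>.\<close>

definition has_time_deriv :: "'a::euclidean_space set \<Rightarrow> 'a set \<Rightarrow> real \<Rightarrow>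
    (real \<Rightarrow> 'a \<Rightarrow> real) \<Rightarrow> (real \<Rightarrow> ('a \<Rightarrow> real) \<Rightarrow> real) \<Rightarrow> bool" where
  "has_time_deriv \<Omega> \<Gamma>D T v g \<longleftrightarrow>
     (\<lambda>t. L2_inner (lebesgue_on \<Omega>) (v t)) \<in> L1_predual \<Omega> \<Gamma>D T \<and> g \<in> L1_predual \<Omega> \<Gamma>D T \<and>
     (\<forall>\<phi>\<in>test_functions {0<..<T}. \<forall>w\<in>W1infD \<Omega> \<Gamma>D.
        (LINT t|lebesgue_on {0<..<T}. deriv \<phi> t * L2_inner (lebesgue_on \<Omega>) (v t) w) =
        - (LINT t|lebesgue_on {0<..<T}. \<phi> t * g t w))"

definition Winf ::
  "'a::euclidean_space set \<Rightarrow> 'a set \<Rightarrow> real \<Rightarrow> (real \<Rightarrow> 'a \<Rightarrow> real) set" where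
  "Winf \<Omega> \<Gamma>D T = {v \<in> Linf_wstar \<Omega> \<Gamma>D T. \<exists>g. has_time_deriv \<Omega> \<Gamma>D T v g}"

definition time_deriv :: "'a::euclidean_space set \<Rightarrow> 'a set \<Rightarrow> real \<Rightarrow>
    (real \<Rightarrow> 'a \<Rightarrow> real) \<Rightarrow> real \<Rightarrow> ('a \<Rightarrow> real) \<Rightarrow> real" where
  "time_deriv \<Omega> \<Gamma>D T v = (SOME g. has_time_deriv \<Omega> \<Gamma>D T v g)"

text \<open>The representative of \<open>v\<close> in \<open>C\<^sup>0([0,T];H)\<close>; point values \<open>v(t)\<close> in \<open>H\<close> refer to it.\<close>

definition is_C0H_rep :: "'a::euclidean_space set \<Rightarrow> real \<Rightarrow>
    (real \<Rightarrow> 'a \<Rightarrow> real) \<Rightarrow> (real \<Rightarrow> 'a \<Rightarrow> real) \<Rightarrow> bool" where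
  "is_C0H_rep \<Omega> T v c \<longleftrightarrow> (\<forall>t\<in>{0..T}. c t \<in> L2 (lebesgue_on \<Omega>)) \<and>
     (\<forall>t\<in>{0..T}. ((\<lambda>s. L2_norm (lebesgue_on \<Omega>) (\<lambda>x. c s x - c t x)) \<longlongrightarrow> 0) (at t within {0..T})) \<and>
     (AE t in lebesgue_on {0<..<T}. AE x in lebesgue_on \<Omega>. c t x = v t x)"

definition C0H_rep :: "'a::euclidean_space set \<Rightarrow> real \<Rightarrow>
    (real \<Rightarrow> 'a \<Rightarrow> real) \<Rightarrow> real \<Rightarrow> 'a \<Rightarrow> real" where
  "C0H_rep \<Omega> T v = (SOME c. is_C0H_rep \<Omega> T v c)"

text \<open>The gradient as a map from \<open>Linf_wstar\<close> to \<open>L\<^sup>\<infinity>(Q;\<real>\<^sup>d)\<close>: the jointly measurable field whose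
  slices are the gradients of the slices.\<close>

definition st_grad :: "'a::euclidean_space set \<Rightarrow> real \<Rightarrow>
    (real \<Rightarrow> 'a \<Rightarrow> real) \<Rightarrow> real \<times> 'a \<Rightarrow> 'a" where
  "st_grad \<Omega> T v = (SOME G. G \<in> Linf (Qm T \<Omega>) \<and>
     (AE t in lebesgue_on {0<..<T}. AE x in lebesgue_on \<Omega>. G (t, x) = grad \<Omega> (v t) x))"

text \<open>\<open>L\<^sup>*y\<close> for \<open>y\<close> in the dual of \<open>L\<^sup>\<infinity>(Q;\<real>\<^sup>d)\<close>, as a functional on \<open>Linf_wstar\<close>.\<close>

definition Lstar :: "'a::euclidean_space set \<Rightarrow> real \<Rightarrow>
    ((real \<times> 'a \<Rightarrow> 'a) \<Rightarrow> real) \<Rightarrow> (real \<Rightarrow> 'a \<Rightarrow> real) \<Rightarrow> real" where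
  "Lstar \<Omega> T y w = y (st_grad \<Omega> T w)"

section \<open>Finitely additive measures\<close>

text \<open>An element of \<open>ba\<close> is represented as a functional \<open>y \<in> Linf_dual M\<close>; the component in direction
  \<open>b\<close> of the associated finitely additive measure is \<open>A \<mapsto> y (\<chi>\<^sub>A b)\<close>. Pure finite additivity is
  in the sense of Yosida and Hewitt.\<close>

definition pos_variation :: "'a measure \<Rightarrow> ('a set \<Rightarrow> real) \<Rightarrow> 'a set \<Rightarrow> real" where
  "pos_variation M m A = (SUP B\<in>{B \<in> sets M. B \<subseteq> A}. m B)"

definition pfa_nonneg :: "'a measure \<Rightarrow> ('a set \<Rightarrow> real) \<Rightarrow> bool" where
  "pfa_nonneg M m \<longleftrightarrow> (\<forall>N. finite_measure N \<and> sets N = sets M \<and> (\<forall>A\<in>sets M. measure N A \<le> m A) \<longrightarrow>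
     (\<forall>A\<in>sets M. measure N A = 0))"

definition purely_finitely_additive ::
  "'a measure \<Rightarrow> (('a \<Rightarrow> 'b::euclidean_space) \<Rightarrow> real) \<Rightarrow> bool" where
  "purely_finitely_additive M y \<longleftrightarrow> (\<forall>b\<in>Basis.
     pfa_nonneg M (pos_variation M (\<lambda>A. y (\<lambda>x. indicator A x *\<^sub>R b))) \<and>
     pfa_nonneg M (pos_variation M (\<lambda>A. - y (\<lambda>x. indicator A x *\<^sub>R b))))"

definition yosida_hewitt :: "'a measure \<Rightarrow> (('a \<Rightarrow> 'b::euclidean_space) \<Rightarrow> real) \<Rightarrow>
    ('a \<Rightarrow> 'b) \<Rightarrow> (('a \<Rightarrow> 'b) \<Rightarrow> real) \<Rightarrow> bool" where
  "yosida_hewitt M y ya ys \<longleftrightarrow> y \<in> Linf_dual M \<and> integrable M ya \<and>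
     ys \<in> Linf_dual M \<and> purely_finitely_additive M ys \<and>
     (\<forall>q\<in>Linf M. y q = (LINT x|M. ya x \<bullet> q x) + ys q)"

definition weighted_variation ::
  "'a measure \<Rightarrow> ('a \<Rightarrow> real) \<Rightarrow> (('a \<Rightarrow> 'b::euclidean_space) \<Rightarrow> real) \<Rightarrow> real" where
  "weighted_variation M \<zeta> ys = (SUP q\<in>{q \<in> Linf M. AE x in M. norm (q x) \<le> \<zeta> x}. ys q)"

section \<open>Elasto-plastic torsion\<close>

definition Kset :: "'a::euclidean_space set \<Rightarrow> (real \<Rightarrow> 'a \<Rightarrow> real) \<Rightarrow> real \<Rightarrow> ('a \<Rightarrow> 'a) set" where
  "Kset \<Omega> \<zeta> t = {y \<in> Linf (lebesgue_on \<Omega>). AE x in lebesgue_on \<Omega>. norm (y x) \<le> \<zeta> t x}"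

definition normal_cone :: "'a measure \<Rightarrow> ('a \<Rightarrow> 'b::euclidean_space) set \<Rightarrow>
    ('a \<Rightarrow> 'b) \<Rightarrow> (('a \<Rightarrow> 'b) \<Rightarrow> real) set" where
  "normal_cone M K y = {ys \<in> Linf_dual M. \<forall>\<phi>\<in>K. ys (\<lambda>x. \<phi> x - y x) \<le> 0}"

text \<open>\<open>\<phi>(t,x,\<cdot>)\<close> and its conjugate depend on \<open>(t,x)\<close> only through \<open>r = \<zeta>(t,x)\<close>.\<close>

definition phi :: "real \<Rightarrow> 'a::euclidean_space \<Rightarrow> ereal" where
  "phi r a = (if norm a \<le> r then ereal ((norm a)\<^sup>2 / 2) else \<infinity>)"

definition phi_conj :: "real \<Rightarrow> 'a::euclidean_space \<Rightarrow> real" where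
  "phi_conj r a = (norm a)\<^sup>2 / 2 - (max 0 (norm a - r))\<^sup>2 / 2"

lemma phi_conj_eq_conjugate:
  fixes a :: "'a::euclidean_space"
  assumes r: "r > 0"
  shows "ereal (phi_conj r a) = (SUP b. ereal (a \<bullet> b) - phi r b)"
proof (rule sym, rule SUP_eqI)
  fix b :: 'a
  show "ereal (a \<bullet> b) - phi r b \<le> ereal (phi_conj r a)"
  proof (cases "norm b \<le> r")
    case True
    have "a \<bullet> b \<le> norm a * norm b" by (rule norm_cauchy_schwarz)
    moreover have "norm a * norm b - (norm b)\<^sup>2 / 2 \<le> phi_conj r a"
    proof (cases "norm a \<le> r")
      case True
      have "0 \<le> (norm a - norm b)\<^sup>2" by simp
      with True show ?thesis by (simp add: phi_conj_def power2_eq_square algebra_simps)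
    next
      case False
      have "0 \<le> (r - norm b) * (2 * norm a - r - norm b)"
        using False \<open>norm b \<le> r\<close> by (intro mult_nonneg_nonneg) auto
      with False show ?thesis by (simp add: phi_conj_def power2_eq_square field_simps)
    qed
    ultimately show ?thesis using True by (simp add: phi_def)
  qed (simp add: phi_def)
next
  fix y assume y: "\<And>b. b \<in> UNIV \<Longrightarrow> ereal (a \<bullet> b) - phi r b \<le> y"
  show "ereal (phi_conj r a) \<le> y"
  proof (cases "norm a \<le> r")
    case True
    have "ereal (phi_conj r a) = ereal (a \<bullet> a) - phi r a"
      using True by (simp add: phi_conj_def phi_def power2_norm_eq_inner)
    with y[of a] show ?thesis by simp
  next
    case False
    define b where "b = (r / norm a) *\<^sub>R a"
    have na: "norm a > 0" using False r by linarith
    have nb: "norm b = r" using na r by (simp add: b_def)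
    have ab: "a \<bullet> b = r * norm a"
      using na by (simp add: b_def power2_norm_eq_inner[symmetric] power2_eq_square)
    have "ereal (phi_conj r a) = ereal (a \<bullet> b) - phi r b"
      using False nb by (simp add: phi_conj_def phi_def ab power2_eq_square field_simps)
    with y[of b] show ?thesis by simp
  qed
qed

definition I_G :: "'a measure \<Rightarrow> ('a \<Rightarrow> real) \<Rightarrow> ('a \<Rightarrow> 'b::euclidean_space) \<Rightarrow> ereal" where
  "I_G M \<zeta> q = enn2ereal (\<integral>\<^sup>+x. e2ennreal (phi (\<zeta> x) (q x)) \<partial>M)"

definition I_phi_conj :: "'a measure \<Rightarrow> ('a \<Rightarrow> real) \<Rightarrow> ('a \<Rightarrow> 'b::euclidean_space) \<Rightarrow> real" where
  "I_phi_conj M \<zeta> ya = (LINT x|M. phi_conj (\<zeta> x) (ya x))"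

definition subdifferential :: "'a measure \<Rightarrow> (('a \<Rightarrow> 'b::euclidean_space) \<Rightarrow> ereal) \<Rightarrow>
    ('a \<Rightarrow> 'b) \<Rightarrow> (('a \<Rightarrow> 'b) \<Rightarrow> real) set" where
  "subdifferential M F p = {z \<in> Linf_dual M. \<bar>F p\<bar> \<noteq> \<infinity> \<and>
     (\<forall>q\<in>Linf M. F p + ereal (z (\<lambda>x. q x - p x)) \<le> F q)}"

definition admissible_yield ::
  "'a::euclidean_space set \<Rightarrow> real \<Rightarrow> (real \<Rightarrow> 'a \<Rightarrow> real) \<Rightarrow> real \<Rightarrow> bool" where
  "admissible_yield \<Omega> T \<zeta> \<zeta>0 \<longleftrightarrow>
     (\<lambda>(t, x). \<zeta> t x) \<in> Linf (Qm T \<Omega>) \<and>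
     (\<forall>t\<in>{0..T}. \<zeta> t \<in> L2 (lebesgue_on \<Omega>)) \<and>
     (\<forall>h\<in>L2 (lebesgue_on \<Omega>). continuous_on {0..T} (\<lambda>t. L2_inner (lebesgue_on \<Omega>) (\<zeta> t) h)) \<and>
     \<zeta>0 > 0 \<and> (AE (t, x) in Qm T \<Omega>. \<zeta> t x \<ge> \<zeta>0)"

definition torsion_solution :: "'a::euclidean_space set \<Rightarrow> 'a set \<Rightarrow> real \<Rightarrow>
    (real \<Rightarrow> 'a \<Rightarrow> real) \<Rightarrow> (real \<Rightarrow> ('a \<Rightarrow> real) \<Rightarrow> real) \<Rightarrow> ('a \<Rightarrow> real) \<Rightarrow>
    (real \<Rightarrow> 'a \<Rightarrow> real) \<Rightarrow> bool" where
  "torsion_solution \<Omega> \<Gamma>D T \<zeta> f u0 u \<longleftrightarrow> u \<in> Winf \<Omega> \<Gamma>D T \<and>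
     (AE t in lebesgue_on {0<..<T}.
        \<exists>ys\<in>normal_cone (lebesgue_on \<Omega>) (Kset \<Omega> \<zeta> t) (grad \<Omega> (u t)). \<forall>w\<in>W1infD \<Omega> \<Gamma>D.
          time_deriv \<Omega> \<Gamma>D T u t w + (LINT x|lebesgue_on \<Omega>. grad \<Omega> (u t) x \<bullet> grad \<Omega> w x)
            + ys (grad \<Omega> w) = f t w) \<and>
     (AE x in lebesgue_on \<Omega>. C0H_rep \<Omega> T u 0 x = u0 x)"

definition dual_flux :: "'a::euclidean_space set \<Rightarrow> 'a set \<Rightarrow> real \<Rightarrow>
    (real \<Rightarrow> 'a \<Rightarrow> real) \<Rightarrow> (real \<Rightarrow> ('a \<Rightarrow> real) \<Rightarrow> real) \<Rightarrow>
    (real \<Rightarrow> 'a \<Rightarrow> real) \<Rightarrow> ((real \<times> 'a \<Rightarrow> 'a) \<Rightarrow> real) \<Rightarrow> bool" where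
  "dual_flux \<Omega> \<Gamma>D T \<zeta> f u z \<longleftrightarrow>
     z \<in> subdifferential (Qm T \<Omega>) (I_G (Qm T \<Omega>) (\<lambda>(t, x). \<zeta> t x)) (st_grad \<Omega> T u) \<and>
     (\<forall>w\<in>Linf_wstar \<Omega> \<Gamma>D T.
        Lstar \<Omega> T z w + L1_pairing T (time_deriv \<Omega> \<Gamma>D T u) w = L1_pairing T f w)"

text \<open>The fields \<open>y = y\<^sup>a dt dx + y\<^sup>s\<close> with \<open>L\<^sup>*y = f - \<partial>\<^sub>tv\<close>, listed together with their
  (unique) Yosida--Hewitt decompositions.\<close>

definition equilibrated :: "'a::euclidean_space set \<Rightarrow> 'a set \<Rightarrow> real \<Rightarrow>
    (real \<Rightarrow> ('a \<Rightarrow> real) \<Rightarrow> real) \<Rightarrow> (real \<Rightarrow> 'a \<Rightarrow> real) \<Rightarrow>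
    (((real \<times> 'a \<Rightarrow> 'a) \<Rightarrow> real) \<times> (real \<times> 'a \<Rightarrow> 'a) \<times> ((real \<times> 'a \<Rightarrow> 'a) \<Rightarrow> real)) set" where
  "equilibrated \<Omega> \<Gamma>D T f v = {(y, ya, ys). yosida_hewitt (Qm T \<Omega>) y ya ys \<and>
     (\<forall>w\<in>Linf_wstar \<Omega> \<Gamma>D T.
        Lstar \<Omega> T y w = L1_pairing T (\<lambda>t h. f t h - time_deriv \<Omega> \<Gamma>D T v t h) w)}"

end

theory Submission
  imports Defs
begin

text \<open>An admissible \<open>y\<close> acts on gradients as \<open>f - \<partial>\<^sub>t v\<close>, so the two minimised functionals differ by
  a constant that does not involve \<open>y\<close>, and it suffices to compute that constant. Inserting
  \<open>L\<^sup>* z + \<partial>\<^sub>t u = f\<close> turns it into the action of \<open>z\<close> on \<open>\<nabla>u - \<nabla>v\<close> plus the action of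
  \<open>\<partial>\<^sub>t v - \<partial>\<^sub>t u\<close> on \<open>v - u\<close>. Integration by parts in \<open>W\<^sub>\<infinity>\<close> makes the latter the terminal term
  \<open>\<parallel>(v - u)(T)\<parallel>\<^sup>2 / 2\<close>, because \<open>u\<close> and \<open>v\<close> have the same initial value. The former is evaluated with
  \<open>\<nabla>u = \<Pi>(z\<^sup>a)\<close>: where \<open>|\<nabla>u| < \<zeta>\<close> the density \<open>z\<^sup>a\<close> equals \<open>\<nabla>u\<close>, where \<open>|\<nabla>u| = \<zeta>\<close> it is
  \<open>(|z\<^sup>a| / \<zeta>) \<nabla>u\<close>, and \<open>|\<zeta> z\<^sup>s|(Q)\<close> is the action of \<open>z\<^sup>s\<close> on \<open>\<nabla>u\<close>. Both facts about \<open>z\<close> follow from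
  the subgradient inequality, since \<open>z\<^sup>s\<close> is carried by sets of arbitrarily small measure.\<close>

section \<open>Essentially bounded functions and their dual\<close>

text \<open>Objects selected by \<open>SOME\<close> must first be shown to exist: the continuous
  representative \<open>C0H_rep\<close> and, hardest, the jointly measurable gradient
  \<open>st_grad\<close>, because \<open>Linf_wstar\<close> only provides measurability of pairings
  with one fixed integrable field at a time. The two parts of \<open>z\<close> occur in one common
  inequality. They are separated by competitors that equal one field on sets where the singular part
  is small and another field off them; in the limit the density sees the first field and the
  singular part the second. Functions in \<open>Linf_wstar\<close> are measurable in a weak sense
  only and cannot be approximated by simple functions in the norm of \<open>V\<close>. Integration
  by parts therefore uses Riemann sums over partitions made of good times: the product of
  \<open>u\<close> and \<open>v\<close> in \<open>H\<close> telescopes, and the sums converge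
  because a sequence that is bounded in \<open>V\<close> and converges in \<open>H\<close> converges
  against every element of the predual. The infima range over a set that may be empty, so the
  constant is moved out of them in the extended reals.\<close>

lemma AE_Linf_norm:
  fixes q :: "'a \<Rightarrow> 'b::euclidean_space"
  assumes "q \<in> Linf M"
  shows "AE x in M. norm (q x) \<le> Linf_norm M q" and "0 \<le> Linf_norm M q"
proof -
  let ?s = "esssup M (\<lambda>x. ereal (norm (q x)))"
  have [measurable]: "q \<in> borel_measurable M" using assms by (simp add: Linf_def)
  obtain C where C: "AE x in M. norm (q x) \<le> C" using assms by (auto simp: Linf_def)
  have "?s \<le> ereal C" using C by (intro esssup_I) auto
  have ae: "AE x in M. ereal (norm (q x)) \<le> ?s" by (rule esssup_AE)
  have "(AE x in M. norm (q x) \<le> Linf_norm M q) \<and> 0 \<le> Linf_norm M q"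
  proof (cases ?s)
    case (real r)
    have "0 \<le> r"
    proof (rule ccontr)
      assume "\<not> 0 \<le> r"
      \<comment> \<open>A negative a.e. bound on a norm fails at every point, so the measure would
        be null and the essential supremum \<open>-\<infinity>\<close> instead of real.\<close>
      have "AE x in M. ereal (norm (q x)) \<le> -\<infinity>"
        using ae
      proof (eventually_elim)
        case (elim x)
        then have "norm (q x) \<le> r" using real by simp
        then show ?case using \<open>\<not> 0 \<le> r\<close> norm_ge_zero[of "q x"] by linarith
      qed
      then have "?s \<le> -\<infinity>" by (intro esssup_I) auto
      then show False using real by simp
    qed
    then show ?thesis using ae real by (simp add: Linf_norm_def)
  next
    case PInf
    then show ?thesis using \<open>?s \<le> ereal C\<close> by simp
  next
    \<comment> \<open>This happens only for a null measure: \<open>real_of_ereal\<close> yields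
      \<open>0\<close> and the a.e. claim is vacuous.\<close>
    case MInf
    then show ?thesis using ae by (auto simp: Linf_norm_def)
  qed
  then show "AE x in M. norm (q x) \<le> Linf_norm M q" "0 \<le> Linf_norm M q" by auto
qed

lemma Linf_norm_le:
  fixes q :: "'a \<Rightarrow> 'b::euclidean_space"
  assumes "q \<in> borel_measurable M" "AE x in M. norm (q x) \<le> C" "0 \<le> C"
  shows "Linf_norm M q \<le> C"
proof -
  have "esssup M (\<lambda>x. ereal (norm (q x))) \<le> ereal C"
    using assms by (intro esssup_I) auto
  then show ?thesis
    using assms(3) by (cases "esssup M (\<lambda>x. ereal (norm (q x)))") (auto simp: Linf_norm_def)
qed

lemma LinfI: "q \<in> borel_measurable M \<Longrightarrow> AE x in M. norm (q x) \<le> C \<Longrightarrow> q \<in> Linf M"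
  by (auto simp: Linf_def)

lemma Linf_measurable: "q \<in> Linf M \<Longrightarrow> q \<in> borel_measurable M"
  by (simp add: Linf_def)

lemma Linf_bound:
  assumes "q \<in> Linf M" obtains C where "0 \<le> C" "AE x in M. norm (q x) \<le> C"
  using AE_Linf_norm[OF assms] by blast

lemma Linf_add:
  assumes "p \<in> Linf M" "q \<in> Linf M" shows "(\<lambda>x. p x + q x) \<in> Linf M"
proof -
  obtain C D where "AE x in M. norm (p x) \<le> C" "AE x in M. norm (q x) \<le> D"
    using assms by (auto simp: Linf_def)
  then have "AE x in M. norm (p x + q x) \<le> C + D"
    by eventually_elim (metis add_mono norm_triangle_le)
  with assms show ?thesis by (auto simp: Linf_def)
qed

lemma Linf_scaleR:
  assumes "q \<in> Linf M" shows "(\<lambda>x. c *\<^sub>R q x) \<in> Linf M"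
proof -
  obtain C where "AE x in M. norm (q x) \<le> C" using assms by (auto simp: Linf_def)
  then have "AE x in M. norm (c *\<^sub>R q x) \<le> \<bar>c\<bar> * C"
    by eventually_elim (simp add: mult_left_mono)
  with assms show ?thesis by (auto simp: Linf_def)
qed

lemma Linf_diff:
  assumes "p \<in> Linf M" "q \<in> Linf M" shows "(\<lambda>x. p x - q x) \<in> Linf M"
  using Linf_add[OF assms(1) Linf_scaleR[OF assms(2), of "-1"]] by simp

lemma Linf_zero: "(\<lambda>x. 0) \<in> Linf M"
  by (auto simp: Linf_def)

lemma Linf_indicator:
  assumes "q \<in> Linf M" "A \<in> sets M" shows "(\<lambda>x. indicator A x *\<^sub>R q x) \<in> Linf M"
proof -
  obtain C where C: "0 \<le> C" "AE x in M. norm (q x) \<le> C" using Linf_bound[OF assms(1)] .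
  have "AE x in M. norm (indicator A x *\<^sub>R q x) \<le> C"
    using C(2) by eventually_elim (use C(1) in \<open>auto simp: indicator_def\<close>)
  then show ?thesis
    using assms by (intro LinfI) (auto dest: Linf_measurable)
qed

lemma Linf_sum:
  assumes "finite S" "\<And>i. i \<in> S \<Longrightarrow> p i \<in> Linf M"
  shows "(\<lambda>x. \<Sum>i\<in>S. p i x) \<in> Linf M"
  using assms by (induction S) (auto simp: Linf_zero Linf_add)

lemma Linf_if:
  assumes "p \<in> Linf M" "q \<in> Linf M" "A \<in> sets M"
  shows "(\<lambda>x. if x \<in> A then p x else q x) \<in> Linf M"
proof -
  have "(\<lambda>x. if x \<in> A then p x else q x) = (\<lambda>x. q x + indicator A x *\<^sub>R (p x - q x))"
    by (auto simp: indicator_def)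
  moreover have "(\<lambda>x. q x + indicator A x *\<^sub>R (p x - q x)) \<in> Linf M"
    by (intro Linf_add Linf_indicator Linf_diff assms)
  ultimately show ?thesis by simp
qed

lemma Linf_dual_add:
  "y \<in> Linf_dual M \<Longrightarrow> p \<in> Linf M \<Longrightarrow> q \<in> Linf M \<Longrightarrow> y (\<lambda>x. p x + q x) = y p + y q"
  by (simp add: Linf_dual_def)

lemma Linf_dual_scaleR:
  "y \<in> Linf_dual M \<Longrightarrow> q \<in> Linf M \<Longrightarrow> y (\<lambda>x. c *\<^sub>R q x) = c * y q"
  by (simp add: Linf_dual_def)

lemma Linf_dual_diff:
  assumes "y \<in> Linf_dual M" "p \<in> Linf M" "q \<in> Linf M"
  shows "y (\<lambda>x. p x - q x) = y p - y q"
  using Linf_dual_add[OF assms(1,2) Linf_scaleR[OF assms(3), of "-1"]]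
    Linf_dual_scaleR[OF assms(1,3), of "-1"] by simp

lemma Linf_dual_zero: "y \<in> Linf_dual M \<Longrightarrow> y (\<lambda>x. 0) = 0"
  using Linf_dual_scaleR[OF _ Linf_zero, of y M 0] by simp

lemma Linf_dual_sum:
  assumes "y \<in> Linf_dual M" "finite S" "\<And>i. i \<in> S \<Longrightarrow> p i \<in> Linf M"
  shows "y (\<lambda>x. \<Sum>i\<in>S. p i x) = (\<Sum>i\<in>S. y (p i))"
  using assms(2,3)
  by (induction S) (auto simp: Linf_dual_zero[OF assms(1)] Linf_dual_add[OF assms(1)] Linf_sum)

text \<open>Makes the constant nonnegative and admits any a.e. bound in place of
  \<open>Linf_norm\<close>, so that later estimates never touch the essential supremum.\<close>

lemma Linf_dual_bound:
  fixes y :: "('a \<Rightarrow> 'b::euclidean_space) \<Rightarrow> real"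
  assumes "y \<in> Linf_dual M"
  obtains C where "0 \<le> C"
    "\<And>q B. q \<in> borel_measurable M \<Longrightarrow> AE x in M. norm (q x) \<le> B \<Longrightarrow> 0 \<le> B \<Longrightarrow> \<bar>y q\<bar> \<le> C * B"
proof -
  obtain C where C: "\<And>q. q \<in> Linf M \<Longrightarrow> \<bar>y q\<bar> \<le> C * Linf_norm M q"
    using assms unfolding Linf_dual_def by blast
  show ?thesis
  proof (rule that[of "\<bar>C\<bar>"])
    fix q :: "'a \<Rightarrow> 'b" and B
    assume *: "q \<in> borel_measurable M" "AE x in M. norm (q x) \<le> B" "0 \<le> B"
    then have q: "q \<in> Linf M" by (auto intro: LinfI)
    have "\<bar>y q\<bar> \<le> C * Linf_norm M q" by (rule C[OF q])
    also have "\<dots> \<le> \<bar>C\<bar> * Linf_norm M q"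
      using AE_Linf_norm(2)[OF q] by (intro mult_right_mono) auto
    also have "\<dots> \<le> \<bar>C\<bar> * B"
      using Linf_norm_le[OF *] by (intro mult_left_mono) auto
    finally show "\<bar>y q\<bar> \<le> \<bar>C\<bar> * B" .
  qed simp
qed

text \<open>Functionals act on functions and not on classes; boundedness makes them blind to null
  sets, because the difference of the two arguments has the a.e. bound \<open>0\<close>.\<close>

lemma Linf_dual_cong_AE:
  assumes y: "y \<in> Linf_dual M" and pq: "p \<in> Linf M" "q \<in> Linf M" and ae: "AE x in M. p x = q x"
  shows "y p = y q"
proof -
  obtain C where "0 \<le> C" and C: "\<And>q B. q \<in> borel_measurable M \<Longrightarrow> AE x in M. norm (q x) \<le> B \<Longrightarrow> 0 \<le> B \<Longrightarrow> \<bar>y q\<bar> \<le> C * B"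
    by (rule Linf_dual_bound[OF y], rule that)
  have "\<bar>y (\<lambda>x. p x - q x)\<bar> \<le> C * 0"
    using ae by (intro C) (auto intro: Linf_measurable Linf_diff pq)
  then show ?thesis using Linf_dual_diff[OF y pq] by simp
qed

definition additive_on :: "'a measure \<Rightarrow> ('a set \<Rightarrow> real) \<Rightarrow> bool" where
  "additive_on M m \<longleftrightarrow>
     (\<forall>A\<in>sets M. \<forall>B\<in>sets M. A \<inter> B = {} \<longrightarrow> m (A \<union> B) = m A + m B)"

section \<open>Purely finitely additive set functions\<close>

lemma additive_onD:
  "additive_on M m \<Longrightarrow> A \<in> sets M \<Longrightarrow> B \<in> sets M \<Longrightarrow> A \<inter> B = {} \<Longrightarrow> m (A \<union> B) = m A + m B"
  by (auto simp: additive_on_def)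

lemma additive_on_empty: "additive_on M m \<Longrightarrow> m {} = 0"
  using additive_onD[of M m "{}" "{}"] by auto

lemma additive_on_mono:
  assumes "additive_on M m" "\<And>A. A \<in> sets M \<Longrightarrow> 0 \<le> m A" "A \<in> sets M" "B \<in> sets M" "A \<subseteq> B"
  shows "m A \<le> m B"
proof -
  have "m (A \<union> (B - A)) = m A + m (B - A)" using assms by (intro additive_onD) auto
  moreover have "A \<union> (B - A) = B" using assms by auto
  ultimately show ?thesis using assms(2)[of "B - A"] assms by auto
qed

lemma additive_on_disjoint_union:
  assumes "additive_on M m" "finite J" "\<And>j. j \<in> J \<Longrightarrow> A j \<in> sets M" "disjoint_family_on A J"
  shows "m (\<Union>j\<in>J. A j) = (\<Sum>j\<in>J. m (A j))"
  using assms(2-)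
proof (induction J)
  case empty
  then show ?case using additive_on_empty[OF assms(1)] by simp
next
  case (insert k J)
  have "disjoint_family_on A J"
    using insert.prems(2) by (auto simp: disjoint_family_on_def)
  with insert have IH: "m (\<Union>j\<in>J. A j) = (\<Sum>j\<in>J. m (A j))" by auto
  have "m (A k \<union> (\<Union>j\<in>J. A j)) = m (A k) + m (\<Union>j\<in>J. A j)"
  proof (rule additive_onD[OF assms(1)])
    show "(\<Union>j\<in>J. A j) \<in> sets M" using insert by (intro sets.finite_UN) auto
    show "A k \<inter> (\<Union>j\<in>J. A j) = {}"
      using insert.prems(2) insert.hyps(2) by (fastforce simp: disjoint_family_on_def)
  qed (use insert in auto)
  then show ?case using insert IH by simp
qed

lemma pos_variation_bdd:
  assumes "\<And>B. B \<in> sets M \<Longrightarrow> m B \<le> K"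
  shows "bdd_above (m ` {B \<in> sets M. B \<subseteq> A})"
  using assms by (auto intro!: bdd_aboveI)

lemma pos_variation_upper:
  assumes "\<And>B. B \<in> sets M \<Longrightarrow> m B \<le> K" "B \<in> sets M" "B \<subseteq> A"
  shows "m B \<le> pos_variation M m A"
  unfolding pos_variation_def
  using assms(2,3) by (intro cSUP_upper pos_variation_bdd[of M m K]) (auto intro: assms(1))

lemma pos_variation_nonneg:
  assumes "additive_on M m" "\<And>B. B \<in> sets M \<Longrightarrow> m B \<le> K"
  shows "0 \<le> pos_variation M m A"
  using pos_variation_upper[of M m K "{}" A] assms additive_on_empty[OF assms(1)] by auto

text \<open>A measurable part of \<open>A \<union> B\<close> splits into a part of \<open>A\<close>
  and a part of \<open>B\<close>, and such parts can be united again; the bound \<open>K\<close>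
  keeps the suprema meaningful in the reals.\<close>

lemma pos_variation_additive:
  assumes add: "additive_on M m" and K: "\<And>B. B \<in> sets M \<Longrightarrow> m B \<le> K"
  shows "additive_on M (pos_variation M m)"
  unfolding additive_on_def
proof (intro ballI impI antisym)
  fix A B assume AB: "A \<in> sets M" "B \<in> sets M" "A \<inter> B = {}"
  note up = pos_variation_upper[of M m K, OF K]
  show "pos_variation M m (A \<union> B) \<le> pos_variation M m A + pos_variation M m B"
    unfolding pos_variation_def[of M m "A \<union> B"]
  proof (rule cSUP_least)
    fix C assume C: "C \<in> {C \<in> sets M. C \<subseteq> A \<union> B}"
    have "m C = m ((C \<inter> A) \<union> (C \<inter> B))" using C by (intro arg_cong[where f=m]) auto
    also have "\<dots> = m (C \<inter> A) + m (C \<inter> B)"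
      using AB C by (intro additive_onD[OF add]) auto
    also have "\<dots> \<le> pos_variation M m A + pos_variation M m B"
      using AB C by (intro add_mono up) auto
    finally show "m C \<le> pos_variation M m A + pos_variation M m B" .
  qed auto
  have "pos_variation M m A \<le> pos_variation M m (A \<union> B) - pos_variation M m B"
    unfolding pos_variation_def[of M m A]
  proof (rule cSUP_least)
    fix C assume C: "C \<in> {C \<in> sets M. C \<subseteq> A}"
    have "pos_variation M m B \<le> pos_variation M m (A \<union> B) - m C"
      unfolding pos_variation_def[of M m B]
    proof (rule cSUP_least)
      fix D assume D: "D \<in> {D \<in> sets M. D \<subseteq> B}"
      have "m C + m D = m (C \<union> D)"
        using AB C D by (subst additive_onD[OF add]) auto
      also have "\<dots> \<le> pos_variation M m (A \<union> B)" using C D by (intro up) auto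
      finally show "m D \<le> pos_variation M m (A \<union> B) - m C" by simp
    qed auto
    then show "m C \<le> pos_variation M m (A \<union> B) - pos_variation M m B" by simp
  qed auto
  then show "pos_variation M m A + pos_variation M m B \<le> pos_variation M m (A \<union> B)" by simp
qed

text \<open>The infimum below is the meet of \<open>m\<close> and \<open>M\<close> in the lattice of additive set functions. It is
  countably additive because \<open>M\<close> dominates it, so pure finite additivity of \<open>m\<close> forces it to vanish.\<close>

lemma pfa_small_set:
  assumes fin: "finite_measure M" and add: "additive_on M m"
    and nn: "\<And>A. A \<in> sets M \<Longrightarrow> 0 \<le> m A" and pfa: "pfa_nonneg M m" and e: "0 < e"
  shows "\<exists>A\<in>sets M. m A < e \<and> measure M (space M - A) < e"
proof -
  interpret finite_measure M by (rule fin)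
  define n where "n A = (INF B\<in>{B \<in> sets M. B \<subseteq> A}. m B + measure M (A - B))" for A
  have bdd: "bdd_below ((\<lambda>B. m B + measure M (A - B)) ` {B \<in> sets M. B \<subseteq> A})" for A
    using nn by (intro bdd_belowI[of _ 0]) auto
  have low: "n A \<le> m B + measure M (A - B)" if "B \<in> sets M" "B \<subseteq> A" for A B
    unfolding n_def using that by (intro cINF_lower bdd) auto
  have n0: "0 \<le> n A" for A
    unfolding n_def using nn by (intro cINF_greatest) (auto intro: exI[of _ "{}"])
  have n_meas: "n A \<le> measure M A" for A
    using low[of "{}" A] additive_on_empty[OF add] by simp
  have n_m: "n A \<le> m A" if "A \<in> sets M" for A
    using low[of A A] that by simp
  have n_add: "n (A \<union> B) = n A + n B" if AB: "A \<in> sets M" "B \<in> sets M" "A \<inter> B = {}" for A B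
  proof (rule antisym)
    show "n A + n B \<le> n (A \<union> B)"
      unfolding n_def[of "A \<union> B"]
    proof (rule cINF_greatest)
      fix C assume C: "C \<in> {C \<in> sets M. C \<subseteq> A \<union> B}"
      have 1: "m C = m (C \<inter> A) + m (C \<inter> B)"
      proof -
        have "m C = m ((C \<inter> A) \<union> (C \<inter> B))" using C by (intro arg_cong[where f=m]) auto
        also have "\<dots> = m (C \<inter> A) + m (C \<inter> B)"
          using AB C by (intro additive_onD[OF add]) auto
        finally show ?thesis .
      qed
      have 2: "measure M (A \<union> B - C) = measure M (A - C \<inter> A) + measure M (B - C \<inter> B)"
      proof -
        have "measure M (A \<union> B - C) = measure M ((A - C \<inter> A) \<union> (B - C \<inter> B))"
          by (intro arg_cong[where f="measure M"]) auto
        also have "\<dots> = measure M (A - C \<inter> A) + measure M (B - C \<inter> B)"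
          using AB C by (intro finite_measure_Union) auto
        finally show ?thesis .
      qed
      have "n A \<le> m (C \<inter> A) + measure M (A - C \<inter> A)" "n B \<le> m (C \<inter> B) + measure M (B - C \<inter> B)"
        using AB C by (auto intro!: low)
      then show "n A + n B \<le> m C + measure M (A \<union> B - C)" using 1 2 by simp
    qed auto
    have "n (A \<union> B) - n B \<le> n A"
      unfolding n_def[of A]
    proof (rule cINF_greatest)
      fix C assume C: "C \<in> {C \<in> sets M. C \<subseteq> A}"
      have "n (A \<union> B) - (m C + measure M (A - C)) \<le> n B"
        unfolding n_def[of B]
      proof (rule cINF_greatest)
        fix D assume D: "D \<in> {D \<in> sets M. D \<subseteq> B}"
        have "n (A \<union> B) \<le> m (C \<union> D) + measure M (A \<union> B - (C \<union> D))"
          using C D by (intro low) auto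
        also have "m (C \<union> D) = m C + m D"
          using AB C D by (intro additive_onD[OF add]) auto
        also have "A \<union> B - (C \<union> D) = (A - C) \<union> (B - D)" using AB C D by auto
        also have "measure M \<dots> = measure M (A - C) + measure M (B - D)"
          using AB C D by (intro finite_measure_Union) auto
        finally show "n (A \<union> B) - (m C + measure M (A - C)) \<le> m D + measure M (B - D)" by simp
      qed auto
      then show "n (A \<union> B) - n B \<le> m C + measure M (A - C)" by simp
    qed auto
    then show "n (A \<union> B) \<le> n A + n B" by simp
  qed
  have "n {} = 0" using n_meas[of "{}"] n0[of "{}"] by simp
  have pos: "positive (sets M) (\<lambda>A. ennreal (n A))"
    using \<open>n {} = 0\<close> by (simp add: positive_def)
  have ca: "countably_additive (sets M) (\<lambda>A. ennreal (n A))"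
  proof (rule sets.empty_continuous_imp_countably_additive[OF pos])
    show "additive (sets M) (\<lambda>A. ennreal (n A))"
      using n_add n0 by (simp add: additive_def)
    fix A :: "nat \<Rightarrow> 'a set"
    assume A: "range A \<subseteq> sets M" "decseq A" "(\<Inter>i. A i) = {}"
    have "(\<lambda>i. measure M (A i)) \<longlonglongrightarrow> measure M (\<Inter>i. A i)"
      by (rule finite_Lim_measure_decseq) (use A in auto)
    then have "(\<lambda>i. measure M (A i)) \<longlonglongrightarrow> 0" using A by simp
    then have "(\<lambda>i. n (A i)) \<longlonglongrightarrow> 0"
      by (rule tendsto_sandwich[OF _ _ tendsto_const, rotated 2]) (auto simp: n0 n_meas)
    then show "(\<lambda>i. ennreal (n (A i))) \<longlonglongrightarrow> 0"
      by (metis ennreal_0 tendsto_ennrealI)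
  qed auto
  define N where "N = measure_of (space M) (sets M) (\<lambda>A. ennreal (n A))"
  have sN: "sets N = sets M" "space N = space M" by (simp_all add: N_def)
  have eN: "emeasure N A = ennreal (n A)" if "A \<in> sets M" for A
    using emeasure_measure_of_sigma[OF sets.sigma_algebra_axioms pos ca that]
    by (simp add: N_def)
  have mN: "measure N A = n A" if "A \<in> sets M" for A
    using eN[OF that] n0 by (simp add: measure_def)
  have "finite_measure N" by (rule finite_measureI) (simp add: sN eN)
  with pfa have "\<forall>A\<in>sets M. measure N A = 0"
    unfolding pfa_nonneg_def using sN mN n_m by auto
  then have "n (space M) = 0" using mN[of "space M"] by auto
  \<comment> \<open>Some set brings the sum below \<open>e\<close>; both summands are nonnegative,
    so each of them is below \<open>e\<close>.\<close>
  then have "(INF B\<in>{B \<in> sets M. B \<subseteq> space M}. m B + measure M (space M - B)) < e"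
    using e by (simp add: n_def)
  then obtain B where "B \<in> sets M" "m B + measure M (space M - B) < e"
    by (subst (asm) cINF_less_iff[OF _ bdd]) auto
  moreover have "0 \<le> m B" "0 \<le> measure M (space M - B)" using nn \<open>B \<in> sets M\<close> by auto
  ultimately show ?thesis by (intro bexI[of _ B] conjI) linarith+
qed

text \<open>Intersecting the sets found for the single members keeps each \<open>m\<close> small by
  monotonicity, while the measures of the complements add up; hence the halving of
  \<open>e\<close>.\<close>

lemma pfa_small_set_finite:
  assumes fin: "finite_measure M" and S: "finite S"
    and add: "\<And>m. m \<in> S \<Longrightarrow> additive_on M m"
    and nn: "\<And>m A. m \<in> S \<Longrightarrow> A \<in> sets M \<Longrightarrow> 0 \<le> m A"
    and pfa: "\<And>m. m \<in> S \<Longrightarrow> pfa_nonneg M m" and e: "0 < e"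
  shows "\<exists>A\<in>sets M. (\<forall>m\<in>S. m A < e) \<and> measure M (space M - A) < e"
  using S add nn pfa e
proof (induction S arbitrary: e)
  case empty
  then show ?case by (intro bexI[of _ "space M"]) auto
next
  case (insert m S)
  interpret finite_measure M by (rule fin)
  have "\<exists>A\<in>sets M. (\<forall>m\<in>S. m A < e/2) \<and> measure M (space M - A) < e/2"
    using insert.prems by (intro insert.IH) auto
  then obtain A where A: "A \<in> sets M" "\<forall>m\<in>S. m A < e/2" "measure M (space M - A) < e/2" by blast
  have "\<exists>B\<in>sets M. m B < e/2 \<and> measure M (space M - B) < e/2"
    by (rule pfa_small_set[OF fin]) (use insert.prems in auto)
  then obtain B where B: "B \<in> sets M" "m B < e/2" "measure M (space M - B) < e/2" by blast
  have *: "m' (A \<inter> B) \<le> m' A" "m' (A \<inter> B) \<le> m' B" if "m' \<in> insert m S" for m'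
    using insert.prems(1,2)[OF that] A B
    by (auto intro!: additive_on_mono[of M m'])
  have "measure M (space M - A \<inter> B) \<le> measure M ((space M - A) \<union> (space M - B))"
    using A B by (intro finite_measure_mono) auto
  also have "\<dots> \<le> measure M (space M - A) + measure M (space M - B)"
    using A B by (intro measure_subadditive) auto
  also have "\<dots> < e" using A B by simp
  finally have "measure M (space M - A \<inter> B) < e" .
  moreover have "\<forall>m'\<in>insert m S. m' (A \<inter> B) < e"
    using * A B \<open>0 < e\<close> by (fastforce intro: le_less_trans)
  ultimately show ?case using A B by (intro bexI[of _ "A \<inter> B"]) auto
qed

lemma Linf_dual_additive_on:
  fixes y :: "('a \<Rightarrow> 'b::euclidean_space) \<Rightarrow> real"
  assumes y: "y \<in> Linf_dual M"
  shows "additive_on M (\<lambda>A. y (\<lambda>x. indicator A x *\<^sub>R b))"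
proof -
  have const: "(\<lambda>x. b) \<in> Linf M" by (intro LinfI[of _ _ "norm b"]) auto
  show ?thesis
    unfolding additive_on_def
  proof (intro ballI impI)
    fix A B assume AB: "A \<in> sets M" "B \<in> sets M" "A \<inter> B = {}"
    have "(\<lambda>x. indicator (A \<union> B) x *\<^sub>R b) = (\<lambda>x. indicator A x *\<^sub>R b + indicator B x *\<^sub>R b)"
      by (simp only: indicator_disj_union[OF AB(3)] scaleR_left_distrib)
    then show "y (\<lambda>x. indicator (A \<union> B) x *\<^sub>R b)
        = y (\<lambda>x. indicator A x *\<^sub>R b) + y (\<lambda>x. indicator B x *\<^sub>R b)"
      using Linf_dual_add[OF y Linf_indicator[OF const AB(1)] Linf_indicator[OF const AB(2)]] by simp
  qed
qed

lemma additive_on_uminus: "additive_on M m \<Longrightarrow> additive_on M (\<lambda>A. - m A)"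
  by (auto simp: additive_on_def)

lemma Linf_dual_component_bounded:
  fixes y :: "('a \<Rightarrow> 'b::euclidean_space) \<Rightarrow> real"
  assumes y: "y \<in> Linf_dual M"
  obtains K where "\<And>A. A \<in> sets M \<Longrightarrow> \<bar>y (\<lambda>x. indicator A x *\<^sub>R b)\<bar> \<le> K"
proof -
  obtain C where "0 \<le> C" and C: "\<And>q B. q \<in> borel_measurable M \<Longrightarrow> AE x in M. norm (q x) \<le> B \<Longrightarrow> 0 \<le> B \<Longrightarrow> \<bar>y q\<bar> \<le> C * B"
    by (rule Linf_dual_bound[OF y], rule that)
  have "\<bar>y (\<lambda>x. indicator A x *\<^sub>R b)\<bar> \<le> C * norm b" if "A \<in> sets M" for A
  proof (rule C)
    show "AE x in M. norm (indicator A x *\<^sub>R b) \<le> norm b"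
      by (intro AE_I2) (simp add: indicator_def)
  qed (use that in measurable)
  then show ?thesis by (rule that)
qed

text \<open>The integrand is discretised by \<open>\<lfloor>k g\<rfloor> / k\<close>, which takes finitely many values.\<close>

lemma Linf_dual_le_variation:
  fixes y :: "('a \<Rightarrow> 'b::euclidean_space) \<Rightarrow> real" and g :: "'a \<Rightarrow> real"
  assumes y: "y \<in> Linf_dual M" and g[measurable]: "g \<in> borel_measurable M"
    and gC: "\<And>x. \<bar>g x\<bar> \<le> C" and C: "0 \<le> C" and A[measurable]: "A \<in> sets M"
  shows "\<bar>y (\<lambda>x. indicator A x *\<^sub>R (g x *\<^sub>R b))\<bar>
    \<le> C * (pos_variation M (\<lambda>A. y (\<lambda>x. indicator A x *\<^sub>R b)) A
         + pos_variation M (\<lambda>A. - y (\<lambda>x. indicator A x *\<^sub>R b)) A)"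
proof -
  define m where "m = (\<lambda>A. y (\<lambda>x. indicator A x *\<^sub>R b))"
  define P where "P = pos_variation M m"
  define N where "N = pos_variation M (\<lambda>A. - m A)"
  obtain K where K0: "\<And>A. A \<in> sets M \<Longrightarrow> \<bar>y (\<lambda>x. indicator A x *\<^sub>R b)\<bar> \<le> K"
    by (rule Linf_dual_component_bounded[OF y, of b], rule that)
  then have K: "\<bar>m A\<bar> \<le> K" if "A \<in> sets M" for A
    using that by (simp add: m_def)
  have add: "additive_on M m" unfolding m_def by (rule Linf_dual_additive_on[OF y])
  have K': "\<And>A. A \<in> sets M \<Longrightarrow> m A \<le> K" "\<And>A. A \<in> sets M \<Longrightarrow> - m A \<le> K"
    using K by fastforce+
  have PN_add: "additive_on M P" "additive_on M N"
    unfolding P_def N_def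
    by (auto intro!: pos_variation_additive add additive_on_uminus K')
  have mPN: "\<bar>m B\<bar> \<le> P B + N B" if "B \<in> sets M" for B
  proof -
    have "m B \<le> P B" unfolding P_def by (rule pos_variation_upper[of M m K]) (use K' that in auto)
    moreover have "- m B \<le> N B" unfolding N_def
      by (rule pos_variation_upper[of M "\<lambda>A. - m A" K]) (use K' that in auto)
    moreover have "0 \<le> P B" "0 \<le> N B" unfolding P_def N_def
      by (auto intro!: pos_variation_nonneg[of M _ K] add additive_on_uminus K')
    ultimately show ?thesis by linarith
  qed
  obtain D where D: "0 \<le> D" "\<And>q B. q \<in> borel_measurable M \<Longrightarrow> AE x in M. norm (q x) \<le> B \<Longrightarrow> 0 \<le> B \<Longrightarrow> \<bar>y q\<bar> \<le> D * B"
    by (rule Linf_dual_bound[OF y], rule that)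
  have const: "(\<lambda>x. b) \<in> Linf M" by (intro LinfI[of _ _ "norm b"]) auto
  have gb: "(\<lambda>x. g x *\<^sub>R b) \<in> Linf M"
  proof (intro LinfI[of _ _ "C * norm b"] AE_I2)
    fix x show "norm (g x *\<^sub>R b) \<le> C * norm b"
      unfolding norm_scaleR real_norm_def by (intro mult_right_mono gC) simp
  qed measurable
  have main: "\<bar>y (\<lambda>x. indicator A x *\<^sub>R (g x *\<^sub>R b))\<bar> \<le> (C + 1 / real k) * (P A + N A) + D * (norm b / real k)"
    if k: "0 < k" for k :: nat
  proof -
    \<comment> \<open>All values that the floor can take, so that the level sets \<open>B j\<close>
      with \<open>j \<in> J\<close> partition \<open>A\<close>.\<close>
    define J where "J = {\<lfloor>- (real k * C)\<rfloor>..\<lfloor>real k * C\<rfloor>}"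
    define B where "B j = A \<inter> {x \<in> space M. \<lfloor>real k * g x\<rfloor> = j}" for j
    define h where "h x = (\<Sum>j\<in>J. (real_of_int j / real k) *\<^sub>R (indicator (B j) x *\<^sub>R b))" for x
    have finJ: "finite J" by (simp add: J_def)
    have Bs[measurable]: "B j \<in> sets M" for j unfolding B_def by measurable
    have inJ: "\<lfloor>real k * g x\<rfloor> \<in> J" for x
    proof -
      have "g x \<le> C" "- C \<le> g x" using gC[of x] by auto
      then have "real k * g x \<le> real k * C" "real k * (- C) \<le> real k * g x"
        by (intro mult_left_mono; simp)+
      then show ?thesis by (auto simp: J_def intro: floor_mono)
    qed
    have dj: "disjoint_family_on B J" by (auto simp: disjoint_family_on_def B_def)
    have UB: "(\<Union>j\<in>J. B j) = A"
      using inJ sets.sets_into_space[OF A] by (auto simp: B_def)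
    have hL: "(\<lambda>x. (real_of_int j / real k) *\<^sub>R (indicator (B j) x *\<^sub>R b)) \<in> Linf M" for j
      by (intro Linf_scaleR Linf_indicator const Bs)
    have hL': "h \<in> Linf M" unfolding h_def by (intro Linf_sum finJ hL)
    have hx: "h x = indicator A x *\<^sub>R ((real_of_int \<lfloor>real k * g x\<rfloor> / real k) *\<^sub>R b)" if "x \<in> space M" for x
    proof (cases "x \<in> A")
      case True
      have "h x = (\<Sum>j\<in>J. if j = \<lfloor>real k * g x\<rfloor> then (real_of_int j / real k) *\<^sub>R b else 0)"
        unfolding h_def using True that by (intro sum.cong) (auto simp: B_def indicator_def)
      then show ?thesis using True finJ inJ by (simp add: sum.delta)
    next
      case False
      then show ?thesis unfolding h_def by (simp add: B_def)
    qed
    have "y h = (\<Sum>j\<in>J. (real_of_int j / real k) * m (B j))"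
      unfolding h_def m_def
      by (simp only: Linf_dual_sum[OF y finJ hL] Linf_dual_scaleR[OF y Linf_indicator[OF const Bs]])
    then have "\<bar>y h\<bar> \<le> (\<Sum>j\<in>J. \<bar>real_of_int j / real k\<bar> * \<bar>m (B j)\<bar>)"
      using sum_abs[of "\<lambda>j. (real_of_int j / real k) * m (B j)" J] by (simp add: abs_mult)
    also have "\<dots> \<le> (\<Sum>j\<in>J. (C + 1 / real k) * (P (B j) + N (B j)))"
    proof (intro sum_mono mult_mono mPN)
      fix j assume "j \<in> J"
      then have "\<lfloor>- (real k * C)\<rfloor> \<le> j" "j \<le> \<lfloor>real k * C\<rfloor>" by (auto simp: J_def)
      \<comment> \<open>The floor of \<open>- (real k * C)\<close> can lie almost one below its
        argument; this produces the extra \<open>1 / real k\<close>.\<close>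
      then have "\<bar>real_of_int j\<bar> \<le> real k * C + 1" by linarith
      then have "\<bar>real_of_int j\<bar> / real k \<le> (real k * C + 1) / real k"
        using k by (intro divide_right_mono) auto
      then show "\<bar>real_of_int j / real k\<bar> \<le> C + 1 / real k" using k by (simp add: field_simps)
    qed (use C in auto)
    also have "\<dots> = (C + 1 / real k) * ((\<Sum>j\<in>J. P (B j)) + (\<Sum>j\<in>J. N (B j)))"
      by (simp only: sum_distrib_left[symmetric] sum.distrib)
    also have "(\<Sum>j\<in>J. P (B j)) = P A"
      using additive_on_disjoint_union[OF PN_add(1) finJ _ dj] UB by simp
    also have "(\<Sum>j\<in>J. N (B j)) = N A"
      using additive_on_disjoint_union[OF PN_add(2) finJ _ dj] UB by simp
    finally have 1: "\<bar>y h\<bar> \<le> (C + 1 / real k) * (P A + N A)" .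
    \<comment> \<open>The discretisation error is at most \<open>norm b / real k\<close> uniformly,
      and boundedness of \<open>y\<close> turns it into the second error term.\<close>
    have "\<bar>y (\<lambda>x. indicator A x *\<^sub>R (g x *\<^sub>R b) - h x)\<bar> \<le> D * (norm b / real k)"
    proof (rule D(2))
      show "(\<lambda>x. indicator A x *\<^sub>R (g x *\<^sub>R b) - h x) \<in> borel_measurable M"
        by (intro Linf_measurable Linf_diff Linf_indicator gb hL' A)
      show "AE x in M. norm (indicator A x *\<^sub>R (g x *\<^sub>R b) - h x) \<le> norm b / real k"
      proof (rule AE_I2)
        fix x assume x: "x \<in> space M"
        have "indicator A x *\<^sub>R (g x *\<^sub>R b) - h x
          = (indicator A x * (g x - real_of_int \<lfloor>real k * g x\<rfloor> / real k)) *\<^sub>R b"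
          using hx[OF x] by (simp add: algebra_simps)
        moreover have "\<bar>g x - real_of_int \<lfloor>real k * g x\<rfloor> / real k\<bar> \<le> 1 / real k"
        proof -
          have "\<bar>real k * g x - real_of_int \<lfloor>real k * g x\<rfloor>\<bar> \<le> 1" by linarith
          then have "\<bar>real k * g x - real_of_int \<lfloor>real k * g x\<rfloor>\<bar> / real k \<le> 1 / real k"
            using k by (intro divide_right_mono) auto
          moreover have "\<bar>real k * g x - real_of_int \<lfloor>real k * g x\<rfloor>\<bar> / real k
              = \<bar>g x - real_of_int \<lfloor>real k * g x\<rfloor> / real k\<bar>"
          proof -
            have "g x - real_of_int \<lfloor>real k * g x\<rfloor> / real k = (real k * g x - real_of_int \<lfloor>real k * g x\<rfloor>) / real k"
              using k by (simp add: diff_divide_distrib)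
            then show ?thesis by (simp only: abs_divide abs_of_nat)
          qed
          ultimately show ?thesis by simp
        qed
        then have "\<bar>g x - real_of_int \<lfloor>real k * g x\<rfloor> / real k\<bar> * norm b \<le> 1 / real k * norm b"
          by (intro mult_right_mono) auto
        ultimately show "norm (indicator A x *\<^sub>R (g x *\<^sub>R b) - h x) \<le> norm b / real k"
          by (auto simp: indicator_def)
      qed
    qed auto
    moreover have "y (\<lambda>x. indicator A x *\<^sub>R (g x *\<^sub>R b) - h x) = y (\<lambda>x. indicator A x *\<^sub>R (g x *\<^sub>R b)) - y h"
      by (intro Linf_dual_diff[OF y] Linf_indicator gb hL' A)
    ultimately show ?thesis using 1 by linarith
  qed
  have lim: "(\<lambda>k. (C + 1 / real k) * (P A + N A) + D * (norm b / real k))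
      \<longlonglongrightarrow> (C + 0) * (P A + N A) + D * 0"
    by (intro tendsto_intros lim_const_over_n)
  have "\<bar>y (\<lambda>x. indicator A x *\<^sub>R (g x *\<^sub>R b))\<bar> \<le> (C + 0) * (P A + N A) + D * 0"
  proof (rule tendsto_lowerbound[OF lim])
    show "\<forall>\<^sub>F k in sequentially. \<bar>y (\<lambda>x. indicator A x *\<^sub>R (g x *\<^sub>R b))\<bar>
        \<le> (C + 1 / real k) * (P A + N A) + D * (norm b / real k)"
      using eventually_gt_at_top[of 0] by (rule eventually_mono) (rule main)
  qed simp
  then show ?thesis by (simp add: P_def N_def m_def)
qed

text \<open>The small-set property is applied at level \<open>(1/2)^n\<close> to the positive and
  negative variations of all components. Summability lets Borel-Cantelli put almost every point
  eventually into \<open>A n\<close>, although \<open>y\<close> fades on these sets. Hence a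
  modification on \<open>A n\<close> is felt in the limit by every integral but not by
  \<open>y\<close>.\<close>

lemma pfa_concentrated:
  fixes y :: "('a \<Rightarrow> 'b::euclidean_space) \<Rightarrow> real"
  assumes fin: "finite_measure M" and y: "y \<in> Linf_dual M" and pfa: "purely_finitely_additive M y"
  obtains A :: "nat \<Rightarrow> 'a set" where "\<And>n. A n \<in> sets M"
    "AE x in M. eventually (\<lambda>n. x \<in> A n) sequentially"
    "\<And>q. q \<in> Linf M \<Longrightarrow> (\<lambda>n. y (\<lambda>x. indicator (A n) x *\<^sub>R q x)) \<longlonglongrightarrow> 0"
proof -
  interpret finite_measure M by (rule fin)
  define m where "m b = (\<lambda>A. y (\<lambda>x. indicator A x *\<^sub>R b))" for b :: 'b
  define P where "P b = pos_variation M (m b)" for b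
  define N where "N b = pos_variation M (\<lambda>A. - m b A)" for b
  have PN: "additive_on M (P b)" "additive_on M (N b)" "0 \<le> P b B" "0 \<le> N b B" for b B
  proof -
    obtain K where K0: "\<And>A. A \<in> sets M \<Longrightarrow> \<bar>y (\<lambda>x. indicator A x *\<^sub>R b)\<bar> \<le> K"
      by (rule Linf_dual_component_bounded[OF y, of b], rule that)
    then have K: "\<bar>m b A\<bar> \<le> K" if "A \<in> sets M" for A
      using that by (simp add: m_def)
    have add: "additive_on M (m b)" unfolding m_def by (rule Linf_dual_additive_on[OF y])
    have K': "\<And>A. A \<in> sets M \<Longrightarrow> m b A \<le> K" "\<And>A. A \<in> sets M \<Longrightarrow> - m b A \<le> K"
      using K by fastforce+
    note add' = additive_on_uminus[OF add]
    show "additive_on M (P b)" unfolding P_def by (rule pos_variation_additive[OF add K'(1)])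
    show "additive_on M (N b)" unfolding N_def by (rule pos_variation_additive[OF add' K'(2)])
    show "0 \<le> P b B" unfolding P_def by (rule pos_variation_nonneg[OF add K'(1)])
    show "0 \<le> N b B" unfolding N_def by (rule pos_variation_nonneg[OF add' K'(2)])
  qed
  have pfaPN: "pfa_nonneg M (P b)" "pfa_nonneg M (N b)" if "b \<in> Basis" for b
    using pfa that by (auto simp: purely_finitely_additive_def P_def N_def m_def)
  define S where "S = P ` Basis \<union> N ` Basis"
  have S: "additive_on M s \<and> (\<forall>A. 0 \<le> s A) \<and> pfa_nonneg M s" if "s \<in> S" for s
    using that PN pfaPN unfolding S_def by (elim UnE imageE) simp_all
  have "\<exists>A\<in>sets M. (\<forall>m\<in>S. m A < (1/2)^n) \<and> measure M (space M - A) < (1/2)^n" for n :: nat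
  proof (rule pfa_small_set_finite[OF fin])
    show "finite S" by (simp add: S_def)
  qed (use S in simp_all)
  then have "\<exists>A. A \<in> sets M \<and> (\<forall>b\<in>Basis. P b A < (1/2)^n \<and> N b A < (1/2)^n)
      \<and> measure M (space M - A) < (1/2)^n" for n
    unfolding S_def by (simp only: ball_Un ball_simps Bex_def ball_conj_distrib conj_assoc)
  then have "\<forall>n. \<exists>A. A \<in> sets M \<and> (\<forall>b\<in>Basis. P b A < (1/2)^n \<and> N b A < (1/2)^n)
      \<and> measure M (space M - A) < (1/2)^n" ..
  then obtain A where A': "\<forall>n. A n \<in> sets M \<and> (\<forall>b\<in>Basis. P b (A n) < (1/2)^n \<and> N b (A n) < (1/2)^n)
      \<and> measure M (space M - A n) < (1/2)^n"
    unfolding choice_iff by (elim exE)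
  then have A: "\<And>n. A n \<in> sets M"
    "\<And>n b. b \<in> Basis \<Longrightarrow> P b (A n) < (1/2)^n" "\<And>n b. b \<in> Basis \<Longrightarrow> N b (A n) < (1/2)^n"
    "\<And>n. measure M (space M - A n) < (1/2)^n"
    by simp_all
  show ?thesis
  proof (rule that[OF A(1)])
    have "AE x in M. eventually (\<lambda>n. x \<in> space M - (space M - A n)) sequentially"
    proof (rule borel_cantelli_AE1)
      show "summable (\<lambda>n. measure M (space M - A n))"
      proof (rule summable_comparison_test'[OF summable_geometric[of "1/2 :: real"]])
        show "norm (measure M (space M - A n)) \<le> (1/2)^n" for n
          using less_imp_le[OF A(4)[of n]] by simp
      qed simp
    qed (use A(1) in \<open>auto simp: less_top[symmetric]\<close>)
    then show "AE x in M. eventually (\<lambda>n. x \<in> A n) sequentially"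
    proof (rule AE_mp, intro AE_I2 impI)
      fix x assume "x \<in> space M" and ev: "\<forall>\<^sub>F n in sequentially. x \<in> space M - (space M - A n)"
      show "\<forall>\<^sub>F n in sequentially. x \<in> A n"
        using ev by (rule eventually_mono) auto
    qed
    fix q :: "'a \<Rightarrow> 'b" assume q: "q \<in> Linf M"
    obtain C where C: "0 \<le> C" "AE x in M. norm (q x) \<le> C" using Linf_bound[OF q] .
    have [measurable]: "q \<in> borel_measurable M" using q by (rule Linf_measurable)
    \<comment> \<open>The estimate by variations needs a bound at every point, which costs a change
      on a null set.\<close>
    define q' where "q' x = (if norm (q x) \<le> C then q x else 0)" for x
    have q'C: "norm (q' x) \<le> C" for x using C by (simp add: q'_def)
    have [measurable]: "q' \<in> borel_measurable M" unfolding q'_def by measurable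
    have q'L: "q' \<in> Linf M" by (rule LinfI[of _ _ C]) (auto simp: q'C)
    \<comment> \<open>One term for each basis vector, and in each term two variations below
      \<open>(1/2)^n\<close>.\<close>
    have bound: "\<bar>y (\<lambda>x. indicator (A n) x *\<^sub>R q x)\<bar> \<le> real DIM('b) * (2 * C) * (1/2)^n" for n
    proof -
      have L: "(\<lambda>x. indicator (A n) x *\<^sub>R ((q' x \<bullet> b) *\<^sub>R b)) \<in> Linf M" if "b \<in> Basis" for b
      proof (intro Linf_indicator A(1) LinfI[of _ _ C] AE_I2)
        fix x
        have "\<bar>q' x \<bullet> b\<bar> \<le> C" using Basis_le_norm[OF that, of "q' x"] q'C[of x] by linarith
        then show "norm ((q' x \<bullet> b) *\<^sub>R b) \<le> C" using that by simp
      qed measurable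
      have eq1: "y (\<lambda>x. indicator (A n) x *\<^sub>R q x) = y (\<lambda>x. indicator (A n) x *\<^sub>R q' x)"
      proof (rule Linf_dual_cong_AE[OF y])
        show "AE x in M. indicator (A n) x *\<^sub>R q x = indicator (A n) x *\<^sub>R q' x"
          using C(2) by eventually_elim (simp add: q'_def)
      qed (intro Linf_indicator A(1) q q'L)+
      have eq2: "indicator (A n) x *\<^sub>R q' x
          = (\<Sum>b\<in>Basis. indicator (A n) x *\<^sub>R ((q' x \<bullet> b) *\<^sub>R b))" for x
        by (simp only: scaleR_sum_right[symmetric] euclidean_representation)
      have eq: "y (\<lambda>x. indicator (A n) x *\<^sub>R q x)
          = (\<Sum>b\<in>Basis. y (\<lambda>x. indicator (A n) x *\<^sub>R ((q' x \<bullet> b) *\<^sub>R b)))"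
        unfolding eq1 unfolding eq2 by (rule Linf_dual_sum[OF y finite_Basis L])
      have "\<bar>\<Sum>b\<in>Basis. y (\<lambda>x. indicator (A n) x *\<^sub>R ((q' x \<bullet> b) *\<^sub>R b))\<bar> \<le> (\<Sum>b\<in>(Basis::'b set). 2 * C * (1/2)^n)"
      proof (rule order_trans[OF sum_abs sum_mono])
        fix b :: 'b assume b: "b \<in> Basis"
        have "\<bar>y (\<lambda>x. indicator (A n) x *\<^sub>R ((q' x \<bullet> b) *\<^sub>R b))\<bar> \<le> C * (P b (A n) + N b (A n))"
          unfolding P_def N_def m_def
        proof (rule Linf_dual_le_variation[OF y, where g = "\<lambda>x. q' x \<bullet> b" and b = b])
          show "\<bar>q' x \<bullet> b\<bar> \<le> C" for x
            using Basis_le_norm[OF b, of "q' x"] q'C[of x] by linarith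
          show "(\<lambda>x. q' x \<bullet> b) \<in> borel_measurable M" by measurable
        qed (rule C(1), rule A(1))
        also have "\<dots> \<le> C * ((1/2)^n + (1/2)^n)"
          using A(2)[OF b, of n] A(3)[OF b, of n] C(1) by (intro mult_left_mono add_mono) simp_all
        also have "\<dots> = 2 * C * (1/2)^n"
          by (simp only: distrib_left mult_2 distrib_right)
        finally show "\<bar>y (\<lambda>x. indicator (A n) x *\<^sub>R ((q' x \<bullet> b) *\<^sub>R b))\<bar> \<le> 2 * C * (1/2)^n" .
      qed
      then show ?thesis unfolding eq by (simp only: sum_constant mult.assoc)
    qed
    have "(\<lambda>n. (1/2 :: real)^n) \<longlonglongrightarrow> 0"
      by (rule LIMSEQ_power_zero) simp
    then have lim: "(\<lambda>n. real DIM('b) * (2 * C) * (1/2)^n) \<longlonglongrightarrow> 0"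
      by (rule tendsto_mult_right_zero)
    show "(\<lambda>n. y (\<lambda>x. indicator (A n) x *\<^sub>R q x)) \<longlonglongrightarrow> 0"
      by (rule Lim_null_comparison[OF _ lim]) (simp add: bound)
  qed
qed

section \<open>Subgradients of the constrained Dirichlet integrand\<close>

lemma Linf_norm_sq_integrable:
  fixes q :: "'a \<Rightarrow> 'b::euclidean_space"
  assumes "finite_measure M" "q \<in> Linf M"
  shows "integrable M (\<lambda>x. (norm (q x))\<^sup>2)"
proof -
  interpret finite_measure M by fact
  obtain C where C: "0 \<le> C" "AE x in M. norm (q x) \<le> C" by (rule Linf_bound[OF assms(2)])
  have [measurable]: "q \<in> borel_measurable M" by (rule Linf_measurable[OF assms(2)])
  show ?thesis
  proof (rule integrable_const_bound[of _ "C\<^sup>2"])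
    show "AE x in M. norm ((norm (q x))\<^sup>2) \<le> C\<^sup>2"
      using C(2) by eventually_elim (simp add: power_mono)
  qed measurable
qed

lemma integrable_inner_Linf:
  fixes q ya :: "'a \<Rightarrow> 'b::euclidean_space"
  assumes "integrable M ya" "q \<in> Linf M"
  shows "integrable M (\<lambda>x. ya x \<bullet> q x)"
proof -
  obtain C where C: "0 \<le> C" "AE x in M. norm (q x) \<le> C" by (rule Linf_bound[OF assms(2)])
  have [measurable]: "q \<in> borel_measurable M" "ya \<in> borel_measurable M"
    using Linf_measurable[OF assms(2)] assms(1) by auto
  show ?thesis
  proof (rule Bochner_Integration.integrable_bound[of M "\<lambda>x. C *\<^sub>R ya x"])
    show "integrable M (\<lambda>x. C *\<^sub>R ya x)" using assms(1) by (rule integrable_scaleR_right)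
    show "AE x in M. norm (ya x \<bullet> q x) \<le> norm (C *\<^sub>R ya x)"
      using C(2)
    proof eventually_elim
      case (elim x)
      have "\<bar>ya x \<bullet> q x\<bar> \<le> norm (ya x) * norm (q x)" by (rule Cauchy_Schwarz_ineq2)
      also have "\<dots> \<le> norm (ya x) * C" by (rule mult_left_mono[OF elim]) simp
      finally show ?case using C(1) by (simp add: mult.commute)
    qed
  qed measurable
qed

lemma I_G_eq:
  fixes q :: "'a \<Rightarrow> 'b::euclidean_space"
  assumes "finite_measure M" "q \<in> Linf M" "AE x in M. norm (q x) \<le> \<zeta> x"
  shows "I_G M \<zeta> q = ereal ((LINT x|M. (norm (q x))\<^sup>2) / 2)"
proof -
  note int = Linf_norm_sq_integrable[OF assms(1,2)]
  have "(\<integral>\<^sup>+x. e2ennreal (phi (\<zeta> x) (q x)) \<partial>M) = (\<integral>\<^sup>+x. ennreal ((norm (q x))\<^sup>2 / 2) \<partial>M)"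
  proof (rule nn_integral_cong_AE)
    show "AE x in M. e2ennreal (phi (\<zeta> x) (q x)) = ennreal ((norm (q x))\<^sup>2 / 2)"
      using assms(3) by eventually_elim (simp add: phi_def)
  qed
  also have "\<dots> = ennreal (LINT x|M. (norm (q x))\<^sup>2 / 2)"
    using int by (intro nn_integral_eq_integral integrable_divide) auto
  also have "(LINT x|M. (norm (q x))\<^sup>2 / 2) = (LINT x|M. (norm (q x))\<^sup>2) / 2"
    by simp
  finally show ?thesis
    by (simp add: I_G_def enn2ereal_ennreal integral_nonneg_AE)
qed

text \<open>A finite integral leaves the integrand finite a.e., and \<open>phi\<close> is infinite
  exactly where the bound fails. Since \<open>subdifferential\<close> demands a finite value at its
  base point, this gives the gradient constraint for \<open>p\<close> below.\<close>

lemma I_G_finite_imp_le: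
  fixes q :: "'a \<Rightarrow> 'b::euclidean_space"
  assumes [measurable]: "q \<in> borel_measurable M" "\<zeta> \<in> borel_measurable M"
    and fin: "\<bar>I_G M \<zeta> q\<bar> \<noteq> \<infinity>"
  shows "AE x in M. norm (q x) \<le> \<zeta> x"
proof -
  have "(\<integral>\<^sup>+x. e2ennreal (phi (\<zeta> x) (q x)) \<partial>M) \<noteq> \<infinity>"
    using fin unfolding I_G_def by auto
  moreover have "(\<lambda>x. e2ennreal (phi (\<zeta> x) (q x))) \<in> borel_measurable M"
    unfolding phi_def by measurable
  ultimately have "AE x in M. e2ennreal (phi (\<zeta> x) (q x)) \<noteq> \<infinity>"
    by (rule nn_integral_PInf_AE[rotated])
  then show ?thesis
    by eventually_elim (auto simp: phi_def split: if_splits)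
qed

text \<open>Here \<open>q\<close> is the projection of \<open>a\<close> onto the ball of radius
  \<open>r\<close>. The right side minus the left side equals
  \<open>(q - a) \<bullet> (b - q)\<close>, which is nonnegative by the obtuse angle property of
  projections. The result is the quadratic growth of a strongly convex function around its
  constrained minimiser.\<close>

lemma projection_obtuse:
  fixes a b :: "'b::euclidean_space"
  assumes r: "0 < r" and b: "norm b \<le> r"
  defines "q \<equiv> (if norm a \<le> r then a else (r / norm a) *\<^sub>R a)"
  shows "(norm (b - q))\<^sup>2 / 2 \<le> ((norm b)\<^sup>2 / 2 - a \<bullet> b) - ((norm q)\<^sup>2 / 2 - a \<bullet> q)"
proof -
  have "0 \<le> (q - a) \<bullet> (b - q)"
  proof (cases "norm a \<le> r")
    case True
    then show ?thesis by (simp add: q_def)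
  next
    case False
    define s where "s = r / norm a"
    have na: "0 < norm a" using False r by linarith
    have s: "s \<le> 1" using False na by (simp add: s_def)
    have q: "q = s *\<^sub>R a" using False by (simp add: q_def s_def)
    have "a \<bullet> b \<le> norm a * norm b" by (rule norm_cauchy_schwarz)
    also have "\<dots> \<le> norm a * r" using b by (intro mult_left_mono) auto
    also have "\<dots> = s * (a \<bullet> a)"
      using na by (simp add: s_def dot_square_norm power2_eq_square)
    finally have "a \<bullet> b \<le> s * (a \<bullet> a)" .
    then have "0 \<le> (1 - s) * (s * (a \<bullet> a) - a \<bullet> b)" using s by simp
    also have "\<dots> = (q - a) \<bullet> (b - q)"
      by (simp add: q inner_diff_left inner_diff_right algebra_simps)
    finally show ?thesis .
  qed
  then show ?thesis
    by (simp add: power2_norm_eq_inner inner_diff_left inner_diff_right inner_commute field_simps)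
qed

text \<open>The subgradient inequality is tested with the field that equals \<open>r\<close> on the
  sets \<open>A n\<close> of \<open>pfa_concentrated\<close> and \<open>q\<close> elsewhere. By
  dominated convergence the integrals tend to those of \<open>r\<close>, whereas \<open>zs\<close>
  ignores the modification and stays at \<open>q\<close>. The density and the singular part can thus
  be tested with different fields.\<close>

lemma flux_inequality:
  fixes p :: "'a \<Rightarrow> 'b::euclidean_space"
  assumes fin: "finite_measure M" and p: "p \<in> Linf M" "AE x in M. norm (p x) \<le> \<zeta> x"
    and z: "z \<in> subdifferential M (I_G M \<zeta>) p" and yh: "yosida_hewitt M z za zs"
    and q: "q \<in> Linf M" "AE x in M. norm (q x) \<le> \<zeta> x"
    and r: "r \<in> Linf M" "AE x in M. norm (r x) \<le> \<zeta> x"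
  shows "(LINT x|M. (norm (p x))\<^sup>2) / 2 + ((LINT x|M. za x \<bullet> r x) + zs q) - ((LINT x|M. za x \<bullet> p x) + zs p)
    \<le> (LINT x|M. (norm (r x))\<^sup>2) / 2"
proof -
  have zs: "zs \<in> Linf_dual M" "purely_finitely_additive M zs" and za: "integrable M za"
    and zd: "\<And>q. q \<in> Linf M \<Longrightarrow> z q = (LINT x|M. za x \<bullet> q x) + zs q"
    using yh by (auto simp: yosida_hewitt_def)
  have zL: "z \<in> Linf_dual M" using yh by (simp add: yosida_hewitt_def)
  have meas: "za \<in> borel_measurable M" "q \<in> borel_measurable M" "r \<in> borel_measurable M"
    using za Linf_measurable[OF q(1)] Linf_measurable[OF r(1)] by auto
  note [measurable] = meas
  have sub: "\<And>w. w \<in> Linf M \<Longrightarrow> I_G M \<zeta> p + ereal (z (\<lambda>x. w x - p x)) \<le> I_G M \<zeta> w"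
    using z by (auto simp: subdifferential_def)
  have ineq: "(LINT x|M. (norm (p x))\<^sup>2) / 2 + ((LINT x|M. za x \<bullet> w x) + zs w) - ((LINT x|M. za x \<bullet> p x) + zs p)
      \<le> (LINT x|M. (norm (w x))\<^sup>2) / 2"
    if w: "w \<in> Linf M" "AE x in M. norm (w x) \<le> \<zeta> x" for w
  proof -
    have "z (\<lambda>x. w x - p x) = z w - z p" by (rule Linf_dual_diff[OF zL w(1) p(1)])
    then show ?thesis
      using sub[OF w(1)] unfolding I_G_eq[OF fin p] I_G_eq[OF fin w] by (simp add: zd w(1) p(1))
  qed
  obtain A :: "nat \<Rightarrow> 'a set" where A: "\<And>n. A n \<in> sets M"
    "AE x in M. eventually (\<lambda>n. x \<in> A n) sequentially"
    "\<And>q. q \<in> Linf M \<Longrightarrow> (\<lambda>n. zs (\<lambda>x. indicator (A n) x *\<^sub>R q x)) \<longlonglongrightarrow> 0"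
    by (rule pfa_concentrated[OF fin zs], rule that)
  define w where "w n x = (if x \<in> A n then r x else q x)" for n x
  have wL: "w n \<in> Linf M" for n
    unfolding w_def by (rule Linf_if[OF r(1) q(1) A(1)])
  have wz: "AE x in M. norm (w n x) \<le> \<zeta> x" for n
    using q(2) r(2) by eventually_elim (simp add: w_def)
  have [measurable]: "w n \<in> borel_measurable M" for n by (rule Linf_measurable[OF wL])
  have ev: "AE x in M. eventually (\<lambda>n. w n x = r x) sequentially"
    using A(2)
  proof eventually_elim
    case (elim x)
    then show ?case by (rule eventually_mono) (simp add: w_def)
  qed
  have lim1: "(\<lambda>n. zs (w n)) \<longlonglongrightarrow> zs q"
  proof -
    have rq: "(\<lambda>x. r x - q x) \<in> Linf M" by (rule Linf_diff[OF r(1) q(1)])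
    have "zs (w n) = zs q + zs (\<lambda>x. indicator (A n) x *\<^sub>R (r x - q x))" for n
    proof -
      have "w n = (\<lambda>x. q x + indicator (A n) x *\<^sub>R (r x - q x))"
        by (simp add: w_def fun_eq_iff indicator_def)
      then show ?thesis
        using Linf_dual_add[OF zs(1) q(1) Linf_indicator[OF rq A(1)[of n]]] by simp
    qed
    moreover have "(\<lambda>n. zs q + zs (\<lambda>x. indicator (A n) x *\<^sub>R (r x - q x))) \<longlonglongrightarrow> zs q + 0"
      by (intro tendsto_add tendsto_const A(3)[OF rq])
    ultimately show ?thesis by simp
  qed
  have lim2: "(\<lambda>n. LINT x|M. za x \<bullet> w n x) \<longlonglongrightarrow> (LINT x|M. za x \<bullet> r x)"
  proof (rule integral_dominated_convergence[where w="\<lambda>x. \<bar>za x \<bullet> r x\<bar> + \<bar>za x \<bullet> q x\<bar>"])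
    show "integrable M (\<lambda>x. \<bar>za x \<bullet> r x\<bar> + \<bar>za x \<bullet> q x\<bar>)"
      by (intro Bochner_Integration.integrable_add integrable_abs integrable_inner_Linf za q(1) r(1))
    show "AE x in M. (\<lambda>n. za x \<bullet> w n x) \<longlonglongrightarrow> za x \<bullet> r x"
      using ev
    proof eventually_elim
      case (elim x)
      show ?case by (rule tendsto_eventually) (use elim in \<open>rule eventually_mono, simp\<close>)
    qed
    show "AE x in M. norm (za x \<bullet> w n x) \<le> \<bar>za x \<bullet> r x\<bar> + \<bar>za x \<bullet> q x\<bar>" for n
      by (rule AE_I2) (simp add: w_def)
  qed measurable
  have lim3: "(\<lambda>n. LINT x|M. (norm (w n x))\<^sup>2) \<longlonglongrightarrow> (LINT x|M. (norm (r x))\<^sup>2)"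
  proof (rule integral_dominated_convergence[where w="\<lambda>x. (norm (r x))\<^sup>2 + (norm (q x))\<^sup>2"])
    show "integrable M (\<lambda>x. (norm (r x))\<^sup>2 + (norm (q x))\<^sup>2)"
      by (intro Bochner_Integration.integrable_add Linf_norm_sq_integrable[OF fin] q(1) r(1))
    show "AE x in M. (\<lambda>n. (norm (w n x))\<^sup>2) \<longlonglongrightarrow> (norm (r x))\<^sup>2"
      using ev
    proof eventually_elim
      case (elim x)
      show ?case by (rule tendsto_eventually) (use elim in \<open>rule eventually_mono, simp\<close>)
    qed
    show "AE x in M. norm ((norm (w n x))\<^sup>2) \<le> (norm (r x))\<^sup>2 + (norm (q x))\<^sup>2" for n
      by (rule AE_I2) (simp add: w_def)
  qed measurable
  show ?thesis
  proof (rule LIMSEQ_le)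
    show "(\<lambda>n. (LINT x|M. (norm (w n x))\<^sup>2) / 2) \<longlonglongrightarrow> (LINT x|M. (norm (r x))\<^sup>2) / 2"
      by (intro tendsto_divide lim3 tendsto_const) simp
    show "(\<lambda>n. (LINT x|M. (norm (p x))\<^sup>2) / 2 + ((LINT x|M. za x \<bullet> w n x) + zs (w n)) - ((LINT x|M. za x \<bullet> p x) + zs p))
      \<longlonglongrightarrow> (LINT x|M. (norm (p x))\<^sup>2) / 2 + ((LINT x|M. za x \<bullet> r x) + zs q) - ((LINT x|M. za x \<bullet> p x) + zs p)"
      by (intro tendsto_add tendsto_diff tendsto_const lim1 lim2)
    show "\<exists>N. \<forall>n\<ge>N. (LINT x|M. (norm (p x))\<^sup>2) / 2 + ((LINT x|M. za x \<bullet> w n x) + zs (w n)) - ((LINT x|M. za x \<bullet> p x) + zs p)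
      \<le> (LINT x|M. (norm (w n x))\<^sup>2) / 2"
      by (intro exI allI impI ineq wL wz)
  qed
qed

text \<open>Testing with \<open>r = p\<close> and arbitrary \<open>q\<close> shows that
  \<open>zs\<close> attains its weighted variation at \<open>p\<close>. Testing with
  \<open>q = p\<close> and \<open>r\<close> the projection of \<open>za\<close> gives the reverse of
  the integrated \<open>projection_obtuse\<close>, so the squared distance between \<open>p\<close>
  and the projection integrates to zero.\<close>

lemma flux_structure:
  fixes p :: "'a \<Rightarrow> 'b::euclidean_space"
  assumes fin: "finite_measure M" and \<zeta>: "\<zeta> \<in> Linf M" "AE x in M. 0 < \<zeta> x" and p: "p \<in> Linf M"
    and z: "z \<in> subdifferential M (I_G M \<zeta>) p" and yh: "yosida_hewitt M z za zs"
  shows "weighted_variation M \<zeta> zs = zs p"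
    and "AE x in M. 0 < \<zeta> x \<and> p x = (if norm (za x) \<le> \<zeta> x then za x else (\<zeta> x / norm (za x)) *\<^sub>R za x)"
proof -
  have za: "integrable M za" using yh by (auto simp: yosida_hewitt_def)
  have meas: "za \<in> borel_measurable M" "p \<in> borel_measurable M" "\<zeta> \<in> borel_measurable M"
    using za Linf_measurable[OF p(1)] Linf_measurable[OF \<zeta>(1)] by auto
  note [measurable] = meas
  have p\<zeta>: "AE x in M. norm (p x) \<le> \<zeta> x"
    using z by (intro I_G_finite_imp_le meas) (simp add: subdifferential_def)
  note ineq = flux_inequality[OF fin p p\<zeta> z yh]
  show "weighted_variation M \<zeta> zs = zs p"
    unfolding weighted_variation_def
  proof (rule cSup_eq_maximum)
    show "zs p \<in> zs ` {q \<in> Linf M. AE x in M. norm (q x) \<le> \<zeta> x}" using p p\<zeta> by auto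
    fix s assume "s \<in> zs ` {q \<in> Linf M. AE x in M. norm (q x) \<le> \<zeta> x}"
    then obtain q where "q \<in> Linf M" "AE x in M. norm (q x) \<le> \<zeta> x" "s = zs q" by auto
    then show "s \<le> zs p" using ineq[of q p] p p\<zeta> by simp
  qed
  define q where "q x = (if norm (za x) \<le> \<zeta> x then za x else (\<zeta> x / norm (za x)) *\<^sub>R za x)" for x
  have [measurable]: "q \<in> borel_measurable M" unfolding q_def by measurable
  have q\<zeta>: "AE x in M. norm (q x) \<le> \<zeta> x"
    using \<zeta>(2) by eventually_elim (simp add: q_def)
  obtain C where C: "0 \<le> C" "AE x in M. norm (\<zeta> x) \<le> C" by (rule Linf_bound[OF \<zeta>(1)])
  have q: "q \<in> Linf M"
  proof (rule LinfI)
    show "AE x in M. norm (q x) \<le> C" using q\<zeta> C(2) by eventually_elim simp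
  qed measurable
  have pq: "(\<lambda>x. p x - q x) \<in> Linf M" by (rule Linf_diff[OF p q])
  have ints: "integrable M (\<lambda>x. (norm (p x))\<^sup>2)" "integrable M (\<lambda>x. (norm (q x))\<^sup>2)"
    "integrable M (\<lambda>x. (norm (p x - q x))\<^sup>2)" "integrable M (\<lambda>x. za x \<bullet> p x)" "integrable M (\<lambda>x. za x \<bullet> q x)"
    using Linf_norm_sq_integrable[OF fin] integrable_inner_Linf[OF za] p q pq by auto
  have "(LINT x|M. (norm (p x - q x))\<^sup>2 / 2)
    \<le> (LINT x|M. ((norm (p x))\<^sup>2 / 2 - za x \<bullet> p x) - ((norm (q x))\<^sup>2 / 2 - za x \<bullet> q x))"
  proof (rule integral_mono_AE)
    show "AE x in M. (norm (p x - q x))\<^sup>2 / 2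
        \<le> ((norm (p x))\<^sup>2 / 2 - za x \<bullet> p x) - ((norm (q x))\<^sup>2 / 2 - za x \<bullet> q x)"
      using \<zeta>(2) p\<zeta>
    proof eventually_elim
      case (elim x)
      show ?case unfolding q_def by (rule projection_obtuse[OF elim])
    qed
  qed (intro Bochner_Integration.integrable_diff integrable_divide ints)+
  also have "\<dots> = ((LINT x|M. (norm (p x))\<^sup>2) / 2 - (LINT x|M. za x \<bullet> p x))
      - ((LINT x|M. (norm (q x))\<^sup>2) / 2 - (LINT x|M. za x \<bullet> q x))"
    using ints by simp
  also have "\<dots> \<le> 0" using ineq[of p q] p p\<zeta> q q\<zeta> by simp
  finally have "(LINT x|M. (norm (p x - q x))\<^sup>2) \<le> 0" by simp
  moreover have "0 \<le> (LINT x|M. (norm (p x - q x))\<^sup>2)" by (intro integral_nonneg_AE) simp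
  ultimately have "(LINT x|M. (norm (p x - q x))\<^sup>2) = 0" by simp
  then have "AE x in M. (norm (p x - q x))\<^sup>2 = 0"
    by (subst (asm) integral_nonneg_eq_0_iff_AE[OF ints(3)]) simp_all
  with \<zeta>(2) show "AE x in M. 0 < \<zeta> x \<and> p x = (if norm (za x) \<le> \<zeta> x then za x else (\<zeta> x / norm (za x)) *\<^sub>R za x)"
    by eventually_elim (auto simp: q_def)
qed

text \<open>Outside the ball \<open>a - q\<close> is the multiple \<open>norm a / r - 1\<close> of
  \<open>q\<close>, and \<open>norm q = r\<close>. Inside, \<open>a = q\<close>; the first branch is
  then taken only for \<open>norm a = r\<close>, where its factor vanishes.\<close>

lemma projection_gap:
  fixes a b :: "'b::euclidean_space"
  assumes r: "0 < r"
  defines "q \<equiv> (if norm a \<le> r then a else (r / norm a) *\<^sub>R a)"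
  shows "(a - q) \<bullet> (q - b) = (if norm q = r then (norm a / r - 1) * (r\<^sup>2 - q \<bullet> b) else 0)"
proof (cases "norm a \<le> r")
  case True
  then show ?thesis using r by (simp add: q_def)
next
  case False
  have na: "0 < norm a" using False r by linarith
  have q: "q = (r / norm a) *\<^sub>R a" using False by (simp add: q_def)
  have nq: "norm q = r" using na r by (simp add: q)
  have a: "a = (norm a / r) *\<^sub>R q" using na r by (simp add: q)
  have "(a - q) = (norm a / r - 1) *\<^sub>R q" by (subst a) (simp add: scaleR_diff_left)
  then have "(a - q) \<bullet> (q - b) = (norm a / r - 1) * (q \<bullet> q - q \<bullet> b)"
    by (simp add: inner_diff_right right_diff_distrib)
  then show ?thesis using nq by (simp add: dot_square_norm)
qed

text \<open>Pointwise, \<open>za \<bullet> (p - v)\<close> plus half the difference of the squared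
  norms of \<open>v\<close> and \<open>p\<close> is half the squared norm of \<open>v - p\<close>
  plus \<open>(za - p) \<bullet> (p - v)\<close>; \<open>projection_gap\<close> evaluates the last
  product. The value \<open>zs p\<close> becomes the weighted variation.\<close>

lemma flux_identity:
  fixes p v :: "'a \<Rightarrow> 'b::euclidean_space"
  assumes fin: "finite_measure M" and \<zeta>: "\<zeta> \<in> Linf M" "AE x in M. 0 < \<zeta> x"
    and p: "p \<in> Linf M" and v: "v \<in> Linf M"
    and z: "z \<in> subdifferential M (I_G M \<zeta>) p" and yh: "yosida_hewitt M z za zs"
  shows "z p - z v + (LINT x|M. (norm (v x))\<^sup>2) / 2 - (LINT x|M. (norm (p x))\<^sup>2) / 2
    = (LINT x|M. (norm (v x - p x))\<^sup>2) / 2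
      + (LINT x|M. (if norm (p x) = \<zeta> x then (norm (za x) / \<zeta> x - 1) * ((\<zeta> x)\<^sup>2 - p x \<bullet> v x) else 0))
      + weighted_variation M \<zeta> zs - zs v"
proof -
  have za: "integrable M za" and zd: "\<And>q. q \<in> Linf M \<Longrightarrow> z q = (LINT x|M. za x \<bullet> q x) + zs q"
    using yh by (auto simp: yosida_hewitt_def)
  note str = flux_structure[OF fin \<zeta> p z yh]
  have vp: "(\<lambda>x. v x - p x) \<in> Linf M" by (rule Linf_diff[OF v p])
  note ints = Linf_norm_sq_integrable[OF fin p] Linf_norm_sq_integrable[OF fin v]
    Linf_norm_sq_integrable[OF fin vp] integrable_inner_Linf[OF za p] integrable_inner_Linf[OF za v]
  have meas: "za \<in> borel_measurable M" "p \<in> borel_measurable M" "v \<in> borel_measurable M" "\<zeta> \<in> borel_measurable M"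
    using za Linf_measurable[OF p(1)] Linf_measurable[OF v] Linf_measurable[OF \<zeta>(1)] by auto
  note [measurable] = meas
  have "(LINT x|M. (if norm (p x) = \<zeta> x then (norm (za x) / \<zeta> x - 1) * ((\<zeta> x)\<^sup>2 - p x \<bullet> v x) else 0))
    = (LINT x|M. (za x \<bullet> p x - za x \<bullet> v x) + ((norm (v x))\<^sup>2 / 2 - (norm (p x))\<^sup>2 / 2) - (norm (v x - p x))\<^sup>2 / 2)"
  proof (rule integral_cong_AE)
    show "(\<lambda>x. if norm (p x) = \<zeta> x then (norm (za x) / \<zeta> x - 1) * ((\<zeta> x)\<^sup>2 - p x \<bullet> v x) else 0)
      \<in> borel_measurable M"
      by measurable
    show "AE x in M. (if norm (p x) = \<zeta> x then (norm (za x) / \<zeta> x - 1) * ((\<zeta> x)\<^sup>2 - p x \<bullet> v x) else 0)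
      = (za x \<bullet> p x - za x \<bullet> v x) + ((norm (v x))\<^sup>2 / 2 - (norm (p x))\<^sup>2 / 2) - (norm (v x - p x))\<^sup>2 / 2"
      using str(2)
    proof eventually_elim
      case (elim x)
      have sq: "(norm (v x - p x))\<^sup>2 = (norm (v x))\<^sup>2 - 2 * (p x \<bullet> v x) + (norm (p x))\<^sup>2"
        by (simp add: power2_norm_eq_inner inner_diff_left inner_diff_right inner_commute)
      have in1: "(za x - p x) \<bullet> (p x - v x) = za x \<bullet> p x - za x \<bullet> v x - (norm (p x))\<^sup>2 + p x \<bullet> v x"
        by (simp add: power2_norm_eq_inner inner_diff_left inner_diff_right)
      have "(za x \<bullet> p x - za x \<bullet> v x) + ((norm (v x))\<^sup>2 / 2 - (norm (p x))\<^sup>2 / 2) - (norm (v x - p x))\<^sup>2 / 2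
        = (za x - p x) \<bullet> (p x - v x)"
        unfolding sq in1 by (simp add: field_simps)
      also have "\<dots> = (if norm (p x) = \<zeta> x then (norm (za x) / \<zeta> x - 1) * ((\<zeta> x)\<^sup>2 - p x \<bullet> v x) else 0)"
        unfolding conjunct2[OF elim] by (rule projection_gap[OF conjunct1[OF elim]])
      finally show ?case ..
    qed
  qed measurable
  also have "\<dots> = ((LINT x|M. za x \<bullet> p x) - (LINT x|M. za x \<bullet> v x))
      + ((LINT x|M. (norm (v x))\<^sup>2) / 2 - (LINT x|M. (norm (p x))\<^sup>2) / 2) - (LINT x|M. (norm (v x - p x))\<^sup>2) / 2"
    using ints by simp
  finally show ?thesis
    using str(1) zd[OF p] zd[OF v] by simp
qed

section \<open>Test functions\<close>

text \<open>\<open>Ck\<close> is phrased with \<open>frechet_derivative\<close>, which is a choice;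
  uniqueness of the derivative allows any explicit \<open>D\<close> instead.\<close>

lemma CkI:
  assumes "\<And>x. (\<phi> has_derivative D x) (at x)" "\<And>b. b \<in> Basis \<Longrightarrow> Ck k (\<lambda>x. D x b)"
  shows "Ck (Suc k) \<phi>"
proof -
  have "frechet_derivative \<phi> (at x) = D x" for x
    using frechet_derivative_at[OF assms(1)] by simp
  then show ?thesis using assms by (auto simp: differentiable_def)
qed

lemma Ck_deriv:
  assumes "Ck (Suc k) \<phi>"
  shows "(\<phi> has_derivative frechet_derivative \<phi> (at x)) (at x)"
    and "b \<in> Basis \<Longrightarrow> Ck k (\<lambda>x. frechet_derivative \<phi> (at x) b)"
  using assms by (auto simp: frechet_derivative_works[symmetric])

lemma Ck_SucD: "Ck (Suc k) \<phi> \<Longrightarrow> Ck k \<phi>"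
proof (induction k arbitrary: \<phi>)
  case 0
  then show ?case
    by (auto intro!: continuous_at_imp_continuous_on differentiable_imp_continuous_within)
next
  case (Suc k)
  show ?case
  proof (rule CkI)
    show "(\<phi> has_derivative frechet_derivative \<phi> (at x)) (at x)" for x
      by (rule Ck_deriv(1)[OF Suc.prems])
    show "Ck k (\<lambda>x. frechet_derivative \<phi> (at x) b)" if "b \<in> Basis" for b
      by (rule Suc.IH[OF Ck_deriv(2)[OF Suc.prems that]])
  qed
qed

lemma Ck_const: "Ck k (\<lambda>x. c)"
proof (induction k arbitrary: c)
  case (Suc k)
  show ?case by (rule CkI[of _ "\<lambda>_ _. 0"]) (auto simp: Suc)
qed simp

lemma Ck_add: "Ck k f \<Longrightarrow> Ck k g \<Longrightarrow> Ck k (\<lambda>x. f x + g x)"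
proof (induction k arbitrary: f g)
  case 0
  then show ?case by (auto intro: continuous_on_add)
next
  case (Suc k)
  show ?case
  proof (rule CkI)
    show "((\<lambda>x. f x + g x) has_derivative (\<lambda>h. frechet_derivative f (at x) h + frechet_derivative g (at x) h)) (at x)" for x
      by (intro has_derivative_add Ck_deriv(1)[OF Suc.prems(1)] Ck_deriv(1)[OF Suc.prems(2)])
    show "Ck k (\<lambda>x. frechet_derivative f (at x) b + frechet_derivative g (at x) b)" if "b \<in> Basis" for b
      by (intro Suc.IH Ck_deriv(2)[OF Suc.prems(1) that] Ck_deriv(2)[OF Suc.prems(2) that])
  qed
qed

lemma Ck_mult: "Ck k f \<Longrightarrow> Ck k g \<Longrightarrow> Ck k (\<lambda>x. f x * g x)"
proof (induction k arbitrary: f g)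
  case 0
  then show ?case by (auto intro: continuous_on_mult)
next
  case (Suc k)
  show ?case
  proof (rule CkI)
    show "((\<lambda>x. f x * g x) has_derivative
      (\<lambda>h. f x * frechet_derivative g (at x) h + frechet_derivative f (at x) h * g x)) (at x)" for x
      by (intro has_derivative_mult Ck_deriv(1)[OF Suc.prems(1)] Ck_deriv(1)[OF Suc.prems(2)])
    \<comment> \<open>The product rule retains undifferentiated factors, whose smoothness has to be
      lowered from \<open>Suc k\<close> to \<open>k\<close>.\<close>
    show "Ck k (\<lambda>x. f x * frechet_derivative g (at x) b + frechet_derivative f (at x) b * g x)" if "b \<in> Basis" for b
      by (intro Ck_add Suc.IH Ck_deriv(2)[OF Suc.prems(1) that] Ck_deriv(2)[OF Suc.prems(2) that]
          Ck_SucD[OF Suc.prems(1)] Ck_SucD[OF Suc.prems(2)])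
  qed
qed

lemma Ck_prod: "finite I \<Longrightarrow> (\<And>i. i \<in> I \<Longrightarrow> Ck k (f i)) \<Longrightarrow> Ck k (\<lambda>x. \<Prod>i\<in>I. f i x)"
  by (induction I rule: finite_induct) (auto intro: Ck_const Ck_mult)

text \<open>The family \<open>flat n\<close> is closed under differentiation up to linear combinations.\<close>

definition flat :: "nat \<Rightarrow> real \<Rightarrow> real" where
  "flat n t = (if 0 < t then exp (- 1 / t) / t ^ n else 0)"

lemma power_le_exp: "0 \<le> x \<Longrightarrow> x ^ n / fact n \<le> exp (x::real)"
proof -
  assume x: "0 \<le> x"
  have "(\<Sum>i\<in>{n}. inverse (fact i) * x ^ i) \<le> (\<Sum>i. inverse (fact i) * x ^ i)"
    using x by (intro sum_le_suminf summable_exp) auto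
  then show ?thesis by (simp add: exp_def field_simps)
qed

text \<open>The single term of order \<open>n + 2\<close> in the series of
  \<open>exp (1 / t)\<close> beats the pole \<open>t ^ n\<close> and leaves a factor
  \<open>t\<^sup>2\<close>, one power more than a vanishing difference quotient at \<open>0\<close>
  requires.\<close>

lemma flat_le: "\<bar>flat n t\<bar> \<le> fact (n + 2) * t\<^sup>2"
proof (cases "0 < t")
  case True
  define F :: real where "F = fact (n + 2)"
  have F: "0 < F" by (simp add: F_def)
  have "(1 / t) ^ (n + 2) / F \<le> exp (1 / t)"
    unfolding F_def using True by (intro power_le_exp) simp
  then have "(1 / t) ^ (n + 2) / F * (F * t ^ (n + 2)) \<le> exp (1 / t) * (F * t ^ (n + 2))"
    using F True by (intro mult_right_mono) auto
  then have "1 \<le> exp (1 / t) * (F * t ^ (n + 2))"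
    using True F by (simp add: power_one_over)
  then have "exp (- 1 / t) \<le> F * t ^ (n + 2)"
    by (simp add: exp_minus field_simps)
  then have "exp (- 1 / t) / t ^ n \<le> F * t ^ (n + 2) / t ^ n"
    using True by (intro divide_right_mono) auto
  also have "\<dots> = F * t\<^sup>2" using True by (simp add: power_add power2_eq_square)
  finally show ?thesis using True by (simp add: flat_def F_def del: fact_Suc)
qed (simp add: flat_def)

lemma flat_deriv: "(flat n has_real_derivative (- real n * flat (Suc n) t + flat (n + 2) t)) (at t)"
proof (cases "t = 0")
  case True
  \<comment> \<open>The junction of the two branches is the only point where no differentiation
    formula applies.\<close>
  have "((\<lambda>h. (flat n (0 + h) - flat n 0) / h) \<longlongrightarrow> 0) (at 0)"
  proof (rule Lim_null_comparison)
    show "\<forall>\<^sub>F h in at 0. norm ((flat n (0 + h) - flat n 0) / h) \<le> fact (n + 2) * \<bar>h\<bar>"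
    proof (rule eventually_at_filter[THEN iffD2], intro always_eventually allI impI)
      fix h :: real assume "h \<noteq> 0"
      have "\<bar>flat n h\<bar> / \<bar>h\<bar> \<le> fact (n + 2) * h\<^sup>2 / \<bar>h\<bar>"
        by (intro divide_right_mono flat_le) simp
      also have "\<dots> = fact (n + 2) * \<bar>h\<bar>"
      proof -
        have "h\<^sup>2 / \<bar>h\<bar> = \<bar>h\<bar>"
          using \<open>h \<noteq> 0\<close> by (cases "0 < h") (auto simp: power2_eq_square)
        then show ?thesis by (simp only: times_divide_eq_right[symmetric])
      qed
      finally show "norm ((flat n (0 + h) - flat n 0) / h) \<le> fact (n + 2) * \<bar>h\<bar>"
        by (simp add: flat_def abs_divide del: fact_Suc)
    qed
    show "((\<lambda>h. fact (n + 2) * \<bar>h\<bar>) \<longlongrightarrow> 0) (at (0::real))"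
      by (intro tendsto_mult_right_zero tendsto_rabs_zero) simp
  qed
  then have "(flat n has_real_derivative 0) (at 0)" by (rule DERIV_def[THEN iffD2])
  moreover have "- real n * flat (Suc n) 0 + flat (n + 2) 0 = 0" by (simp add: flat_def)
  ultimately show ?thesis using True by simp
next
  case False
  show ?thesis
  proof (cases "0 < t")
    case True
    have "((\<lambda>t. exp (- 1 / t) / t ^ n) has_real_derivative (- real n * flat (Suc n) t + flat (n + 2) t)) (at t)"
    proof -
      have "((\<lambda>t. exp (- 1 / t) / t ^ n) has_real_derivative
        ((exp (- 1 / t) * (1 / t\<^sup>2)) * t ^ n - exp (- 1 / t) * (real n * t ^ (n - 1))) / (t ^ n * t ^ n)) (at t)"
        using True by (auto intro!: derivative_eq_intros simp: power2_eq_square)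
      moreover have "((exp (- 1 / t) * (1 / t\<^sup>2)) * t ^ n - exp (- 1 / t) * (real n * t ^ (n - 1))) / (t ^ n * t ^ n)
        = - real n * flat (Suc n) t + flat (n + 2) t"
        using True by (cases n) (simp_all add: flat_def field_simps power2_eq_square)
      ultimately show ?thesis by simp
    qed
    moreover have "\<forall>\<^sub>F s in nhds t. flat n s = exp (- 1 / s) / s ^ n"
      using eventually_nhds_in_open[of "{0<..}" t] True
      by (auto elim!: eventually_mono simp: flat_def)
    ultimately show ?thesis
      by (subst DERIV_cong_ev[OF refl _ refl]) auto
  next
    case neg: False
    have "\<forall>\<^sub>F s in nhds t. flat n s = 0"
      using eventually_nhds_in_open[of "{..<0}" t] neg False
      by (auto elim!: eventually_mono simp: flat_def)
    moreover have "- real n * flat (Suc n) t + flat (n + 2) t = 0" using neg by (simp add: flat_def)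
    ultimately show ?thesis
      using DERIV_cong_ev[OF refl, of "flat n" "\<lambda>_. 0" t _ _] by simp
  qed
qed

text \<open>The induction is for all \<open>n\<close> at once: a derivative is a combination of
  \<open>flat (Suc n)\<close> and \<open>flat (n + 2)\<close> at the same affine argument, times the
  constant \<open>b \<bullet> e\<close>.\<close>

lemma Ck_flat_affine: "Ck k (\<lambda>x::'a::euclidean_space. flat n (x \<bullet> e + c))"
proof (induction k arbitrary: n)
  case 0
  have "continuous_on UNIV (flat n)"
    using flat_deriv by (intro continuous_at_imp_continuous_on ballI DERIV_isCont)
  then show ?case
    by (auto intro!: continuous_on_compose2[of UNIV "flat n"] continuous_intros)
next
  case (Suc k)
  show ?case
  proof (rule CkI)
    fix x :: 'a
    have "((\<lambda>x. x \<bullet> e + c) has_derivative (\<lambda>h. h \<bullet> e)) (at x)"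
      by (auto intro!: derivative_eq_intros)
    from has_derivative_compose[OF this flat_deriv[unfolded has_field_derivative_def]]
    show "((\<lambda>x. flat n (x \<bullet> e + c)) has_derivative
      (\<lambda>h. (- real n * flat (Suc n) (x \<bullet> e + c) + flat (n + 2) (x \<bullet> e + c)) * (h \<bullet> e))) (at x)" .
  next
    fix b :: 'a
    show "Ck k (\<lambda>x. (- real n * flat (Suc n) (x \<bullet> e + c) + flat (n + 2) (x \<bullet> e + c)) * (b \<bullet> e))"
      by (intro Ck_add Ck_mult Ck_const Suc)
  qed
qed

text \<open>The two arguments are \<open>n\<close> times the distances of the coordinate from the
  two faces, spelled as \<open>x \<bullet> e + c\<close> to match \<open>Ck_flat_affine\<close>. As
  \<open>n\<close> grows, each factor tends to \<open>1\<close> inside the box and stays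
  \<open>0\<close> outside.\<close>

definition box_bump :: "'a::euclidean_space \<Rightarrow> 'a \<Rightarrow> nat \<Rightarrow> 'a \<Rightarrow> real" where
  "box_bump a c n x = (\<Prod>b\<in>Basis. flat 0 (x \<bullet> (real n *\<^sub>R b) + - (real n * (a \<bullet> b)))
     * flat 0 (x \<bullet> (- real n *\<^sub>R b) + real n * (c \<bullet> b)))"

lemma flat0_bounds: "0 \<le> flat 0 t" "flat 0 t \<le> 1"
  by (auto simp: flat_def)

lemma box_bump_bounds: "0 \<le> box_bump a c n x" "box_bump a c n x \<le> 1"
  unfolding box_bump_def
  by (auto intro!: prod_nonneg prod_le_1 mult_nonneg_nonneg mult_le_one flat0_bounds)

lemma box_bump_support: "box_bump a c n x \<noteq> 0 \<Longrightarrow> x \<in> box a c"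
proof (rule ccontr)
  assume nz: "box_bump a c n x \<noteq> 0" and "x \<notin> box a c"
  then obtain b where b: "b \<in> Basis" "x \<bullet> b \<le> a \<bullet> b \<or> c \<bullet> b \<le> x \<bullet> b"
    by (auto simp: box_def not_less)
  then have "real n * (x \<bullet> b) \<le> real n * (a \<bullet> b) \<or> real n * (c \<bullet> b) \<le> real n * (x \<bullet> b)"
    by (auto intro: mult_left_mono)
  then have "flat 0 (x \<bullet> (real n *\<^sub>R b) + - (real n * (a \<bullet> b)))
     * flat 0 (x \<bullet> (- real n *\<^sub>R b) + real n * (c \<bullet> b)) = 0"
    by (auto simp: flat_def)
  with b(1) have "box_bump a c n x = 0" unfolding box_bump_def by (intro prod_zero) auto
  with nz show False by simp
qed

lemma box_bump_test:
  assumes "cbox a c \<subseteq> S"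
  shows "box_bump a c n \<in> test_functions S"
proof -
  have sub: "closure {x. box_bump a c n x \<noteq> 0} \<subseteq> cbox a c"
  proof (rule closure_minimal)
    show "{x. box_bump a c n x \<noteq> 0} \<subseteq> cbox a c"
      using box_bump_support[of a c n] box_subset_cbox[of a c] by auto
  qed (rule closed_cbox)
  moreover have "compact (closure {x. box_bump a c n x \<noteq> 0})"
    using sub by (meson bounded_cbox bounded_subset closed_closure compact_eq_bounded_closed)
  moreover have "Ck k (box_bump a c n)" for k
    unfolding box_bump_def by (intro Ck_prod Ck_mult Ck_flat_affine) simp
  ultimately show ?thesis using assms by (auto simp: test_functions_def)
qed

lemma flat0_scaled_tendsto: "0 < t \<Longrightarrow> (\<lambda>n. flat 0 (real n * t)) \<longlonglongrightarrow> 1"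
proof -
  assume t: "0 < t"
  have "(\<lambda>n. exp (- (1 / t) / real n)) \<longlonglongrightarrow> exp 0"
    by (intro tendsto_exp lim_const_over_n)
  moreover have "\<forall>\<^sub>F n in sequentially. flat 0 (real n * t) = exp (- (1 / t) / real n)"
    using eventually_gt_at_top[of 0]
    by (rule eventually_mono) (use t in \<open>simp add: flat_def field_simps\<close>)
  ultimately show ?thesis using tendsto_cong by fastforce
qed

lemma box_bump_tendsto: "(\<lambda>n. box_bump a c n x) \<longlonglongrightarrow> indicator (box a c) x"
proof (cases "x \<in> box a c")
  case True
  have "(\<lambda>n. box_bump a c n x) \<longlonglongrightarrow> (\<Prod>b\<in>(Basis::'a set). 1 * 1)"
    unfolding box_bump_def
  proof (intro tendsto_prod tendsto_mult)
    fix b :: 'a assume b: "b \<in> Basis"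
    have "(\<lambda>n. flat 0 (real n * (x \<bullet> b - a \<bullet> b))) \<longlonglongrightarrow> 1" "(\<lambda>n. flat 0 (real n * (c \<bullet> b - x \<bullet> b))) \<longlonglongrightarrow> 1"
      using True b by (auto intro!: flat0_scaled_tendsto simp: box_def)
    then show "(\<lambda>n. flat 0 (x \<bullet> (real n *\<^sub>R b) + - (real n * (a \<bullet> b)))) \<longlonglongrightarrow> 1"
      "(\<lambda>n. flat 0 (x \<bullet> (- real n *\<^sub>R b) + real n * (c \<bullet> b))) \<longlonglongrightarrow> 1"
      by (simp_all add: algebra_simps)
  qed
  then show ?thesis using True by simp
next
  case False
  then have "box_bump a c n x = 0" for n using box_bump_support by blast
  then show ?thesis using False by simp
qed

lemma test_function_continuous: "\<phi> \<in> test_functions S \<Longrightarrow> continuous_on UNIV \<phi>"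
  unfolding test_functions_def mem_Collect_eq using Ck.simps(1) by metis

lemma test_function_bounded:
  assumes "\<phi> \<in> test_functions S" obtains B where "\<And>x. \<bar>\<phi> x\<bar> \<le> B" "0 \<le> B"
proof -
  let ?K = "closure {x. \<phi> x \<noteq> 0}"
  have "compact (\<phi> ` ?K)"
  proof (rule compact_continuous_image)
    show "continuous_on ?K \<phi>"
      by (rule continuous_on_subset[OF test_function_continuous[OF assms]]) simp
    show "compact ?K" using assms by (simp add: test_functions_def)
  qed
  then have "bounded (\<phi> ` ?K)" by (rule compact_imp_bounded)
  then obtain B where B: "\<forall>y\<in>\<phi> ` ?K. norm y \<le> B" unfolding bounded_iff by (elim exE)
  have "\<bar>\<phi> x\<bar> \<le> max B 0" for x
  proof (cases "\<phi> x = 0")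
    case False
    then have "x \<in> ?K" using subsetD[OF closure_subset, of x "{x. \<phi> x \<noteq> 0}"] by simp
    then have "norm (\<phi> x) \<le> B" using B by (intro bspec[OF B] imageI)
    then show ?thesis by simp
  qed simp
  then show ?thesis by (rule that) simp
qed

lemma continuous_measurable_lebesgue_on:
  fixes f :: "'a::euclidean_space \<Rightarrow> 'b::euclidean_space"
  assumes "continuous_on UNIV f"
  shows "f \<in> borel_measurable (lebesgue_on S)"
proof -
  have "f \<in> borel_measurable lborel" using borel_measurable_continuous_onI[OF assms] by simp
  from measurable_restrict_space1[OF measurable_completion[OF this]] show ?thesis .
qed

section \<open>Weak convergence from testing with smooth functions\<close>

text \<open>Serves two ends. With a constant \<open>H\<close> it describes bounded sequences that
  are to converge weakly to zero; with a constant sequence \<open>h n = g\<close> and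
  \<open>H = \<bar>g\<bar>\<close> the limit statement becomes the vanishing of integrals of
  \<open>g\<close>.\<close>

locale dominated_sequence =
  fixes M :: "'a measure" and h :: "nat \<Rightarrow> 'a \<Rightarrow> real" and H :: "'a \<Rightarrow> real"
  assumes h_meas: "\<And>n. h n \<in> borel_measurable M" and H_int: "integrable M H"
    and h_le: "\<And>n. AE x in M. \<bar>h n x\<bar> \<le> H x"
begin

definition wnull :: "('a \<Rightarrow> real) \<Rightarrow> bool" where
  "wnull f \<longleftrightarrow> (\<lambda>n. LINT x|M. h n x * f x) \<longlonglongrightarrow> 0"

lemma int_H: "f \<in> borel_measurable M \<Longrightarrow> (\<And>x. \<bar>f x\<bar> \<le> B) \<Longrightarrow> integrable M (\<lambda>x. H x * f x)"
proof (rule Bochner_Integration.integrable_bound[of M "\<lambda>x. B * H x"])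
  assume f: "f \<in> borel_measurable M" "\<And>x. \<bar>f x\<bar> \<le> B"
  show "integrable M (\<lambda>x. B * H x)" using H_int by (rule integrable_mult_right)
  show "(\<lambda>x. H x * f x) \<in> borel_measurable M"
    using f(1) borel_measurable_integrable[OF H_int] by (rule borel_measurable_times[rotated])
  show "AE x in M. norm (H x * f x) \<le> norm (B * H x)"
  proof (rule AE_I2)
    fix x
    have "\<bar>f x\<bar> \<le> \<bar>B\<bar>" using f(2)[of x] by linarith
    then have "\<bar>f x\<bar> * \<bar>H x\<bar> \<le> \<bar>B\<bar> * \<bar>H x\<bar>" by (rule mult_right_mono) simp
    then show "norm (H x * f x) \<le> norm (B * H x)" by (simp add: abs_mult mult.commute)
  qed
qed

lemma int_h:
  assumes f: "f \<in> borel_measurable M" "\<And>x. \<bar>f x\<bar> \<le> B"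
  shows "integrable M (\<lambda>x. h n x * f x)"
proof (rule Bochner_Integration.integrable_bound[OF int_H[OF f]])
  show "(\<lambda>x. h n x * f x) \<in> borel_measurable M"
    using h_meas f(1) by (rule borel_measurable_times)
  show "AE x in M. norm (h n x * f x) \<le> norm (H x * f x)"
    using h_le[of n]
  proof eventually_elim
    case (elim x)
    then have "\<bar>h n x\<bar> * \<bar>f x\<bar> \<le> \<bar>H x\<bar> * \<bar>f x\<bar>" by (intro mult_right_mono) auto
    then show ?case by (simp add: abs_mult)
  qed
qed

lemma wnull_add:
  assumes f: "f \<in> borel_measurable M" "\<And>x. \<bar>f x\<bar> \<le> B" and g: "g \<in> borel_measurable M" "\<And>x. \<bar>g x\<bar> \<le> C"
    and "wnull f" "wnull g"
  shows "wnull (\<lambda>x. f x + g x)"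
proof -
  have "(LINT x|M. h n x * (f x + g x)) = (LINT x|M. h n x * f x) + (LINT x|M. h n x * g x)" for n
    unfolding distrib_left by (rule Bochner_Integration.integral_add[OF int_h[OF f] int_h[OF g]])
  then show ?thesis using tendsto_add[OF assms(5,6)[unfolded wnull_def]] by (simp add: wnull_def)
qed

lemma wnull_diff:
  assumes f: "f \<in> borel_measurable M" "\<And>x. \<bar>f x\<bar> \<le> B" and g: "g \<in> borel_measurable M" "\<And>x. \<bar>g x\<bar> \<le> C"
    and "wnull f" "wnull g"
  shows "wnull (\<lambda>x. f x - g x)"
proof -
  have "(LINT x|M. h n x * (f x - g x)) = (LINT x|M. h n x * f x) - (LINT x|M. h n x * g x)" for n
    unfolding right_diff_distrib by (rule Bochner_Integration.integral_diff[OF int_h[OF f] int_h[OF g]])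
  then show ?thesis using tendsto_diff[OF assms(5,6)[unfolded wnull_def]] by (simp add: wnull_def)
qed

text \<open>The error made by passing from \<open>f\<close> to \<open>g k\<close> is at most the
  integral of \<open>H * \<bar>f - g k\<bar>\<close>, which is independent of \<open>n\<close> and
  tends to zero in \<open>k\<close> by dominated convergence.\<close>

lemma wnull_limit:
  assumes g: "\<And>k. g k \<in> borel_measurable M" "\<And>k x. \<bar>g k x\<bar> \<le> B" "\<And>k. wnull (g k)"
    and f: "f \<in> borel_measurable M" "\<And>x. \<bar>f x\<bar> \<le> B" and lim: "\<And>x. x \<in> space M \<Longrightarrow> (\<lambda>k. g k x) \<longlonglongrightarrow> f x"
  shows "wnull f"
proof -
  have d: "(\<lambda>x. \<bar>f x - g k x\<bar>) \<in> borel_measurable M" "\<bar>\<bar>f x - g k x\<bar>\<bar> \<le> 2 * B" for k x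
  proof -
    show "(\<lambda>x. \<bar>f x - g k x\<bar>) \<in> borel_measurable M" using f(1) g(1)[of k] by measurable
    show "\<bar>\<bar>f x - g k x\<bar>\<bar> \<le> 2 * B" using f(2)[of x] g(2)[of k x] by linarith
  qed
  have "0 \<le> B" using f(2)[of undefined] abs_ge_zero[of "f undefined"] by linarith
  have L: "(\<lambda>k. LINT x|M. H x * \<bar>f x - g k x\<bar>) \<longlonglongrightarrow> (LINT x|M. 0)"
  proof (rule integral_dominated_convergence[where w="\<lambda>x. norm (H x) * (2 * B)"])
    show "integrable M (\<lambda>x. norm (H x) * (2 * B))"
      by (intro integrable_mult_left integrable_norm H_int)
    show "(\<lambda>x. H x * \<bar>f x - g k x\<bar>) \<in> borel_measurable M" for k
      by (rule borel_measurable_integrable[OF int_H[OF d]])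
    show "AE x in M. (\<lambda>k. H x * \<bar>f x - g k x\<bar>) \<longlonglongrightarrow> 0"
    proof (rule AE_I2)
      fix x assume "x \<in> space M"
      from lim[OF this] have "(\<lambda>k. f x - g k x) \<longlonglongrightarrow> f x - f x" by (intro tendsto_diff tendsto_const)
      then have "(\<lambda>k. \<bar>f x - g k x\<bar>) \<longlonglongrightarrow> 0" by (intro tendsto_rabs_zero) simp
      then show "(\<lambda>k. H x * \<bar>f x - g k x\<bar>) \<longlonglongrightarrow> 0" by (rule tendsto_mult_right_zero)
    qed
    show "AE x in M. norm (H x * \<bar>f x - g k x\<bar>) \<le> norm (H x) * (2 * B)" for k
    proof (rule AE_I2)
      fix x show "norm (H x * \<bar>f x - g k x\<bar>) \<le> norm (H x) * (2 * B)"
        unfolding real_norm_def abs_mult[of "H x"] by (intro mult_left_mono d(2)) simp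
    qed
  qed simp
  show ?thesis
    unfolding wnull_def
  proof (rule LIMSEQ_I)
    fix e :: real assume e: "0 < e"
    obtain k where k: "norm ((LINT x|M. H x * \<bar>f x - g k x\<bar>) - (LINT x|M. 0)) < e / 2"
      using LIMSEQ_D[OF L, of "e / 2"] e by auto
    obtain N where N: "\<And>n. N \<le> n \<Longrightarrow> norm ((LINT x|M. h n x * g k x) - 0) < e / 2"
      using LIMSEQ_D[OF g(3)[of k, unfolded wnull_def], of "e / 2"] e by auto
    have "norm ((LINT x|M. h n x * f x) - 0) < e" if "N \<le> n" for n
    proof -
      have df: "(\<lambda>x. f x - g k x) \<in> borel_measurable M" "\<bar>f x - g k x\<bar> \<le> 2 * B" for x
        using f(1) g(1)[of k] d(2)[of x k] by auto
      have eq: "(LINT x|M. h n x * f x) = (LINT x|M. h n x * g k x) + (LINT x|M. h n x * (f x - g k x))"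
        by (subst Bochner_Integration.integral_add[symmetric, OF int_h[OF g(1,2)] int_h[OF df]])
           (simp add: right_diff_distrib)
      have "norm (LINT x|M. h n x * (f x - g k x)) \<le> (LINT x|M. norm (h n x * (f x - g k x)))"
        by (rule integral_norm_bound)
      also have "\<dots> \<le> (LINT x|M. H x * \<bar>f x - g k x\<bar>)"
      proof (rule integral_mono_AE)
        show "AE x in M. norm (h n x * (f x - g k x)) \<le> H x * \<bar>f x - g k x\<bar>"
          using h_le[of n] by eventually_elim (simp add: abs_mult mult_right_mono)
      qed (intro integrable_norm int_h[OF df] int_H[OF d])+
      finally have "norm (LINT x|M. h n x * (f x - g k x)) \<le> (LINT x|M. H x * \<bar>f x - g k x\<bar>)" .
      moreover have "\<bar>LINT x|M. H x * \<bar>f x - g k x\<bar>\<bar> < e / 2" using k by simp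
      moreover have "\<bar>LINT x|M. h n x * g k x\<bar> < e / 2" using N[OF that] by simp
      ultimately show ?thesis unfolding eq real_norm_def by linarith
    qed
    then show "\<exists>N. \<forall>n\<ge>N. norm ((LINT x|M. h n x * f x) - 0) < e" by blast
  qed
qed

lemma wnull_cong_AE:
  assumes "wnull f" "AE x in M. f x = g x" "f \<in> borel_measurable M" "g \<in> borel_measurable M"
  shows "wnull g"
proof -
  have "(LINT x|M. h n x * f x) = (LINT x|M. h n x * g x)" for n
  proof (rule integral_cong_AE)
    show "AE x in M. h n x * f x = h n x * g x" using assms(2) by eventually_elim simp
  qed (use h_meas assms in measurable)
  then show ?thesis using assms(1) by (simp add: wnull_def)
qed

text \<open>Finite partial unions by additivity, the full union by \<open>wnull_limit\<close>: this
  is the union step of the Dynkin argument below.\<close>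

lemma wnull_disjoint_union:
  fixes A :: "nat \<Rightarrow> 'a set"
  assumes A: "\<And>i. A i \<in> sets M" "disjoint_family A" "\<And>i. wnull (indicator (A i))"
  shows "wnull (indicator (\<Union>i. A i))"
proof -
  define B where "B k = (\<Union>i<k. A i)" for k
  have Bm: "B k \<in> sets M" for k unfolding B_def using A(1) by (intro sets.finite_UN) auto
  have meas: "indicator (C :: 'a set) \<in> borel_measurable M" if "C \<in> sets M" for C
    using that by (rule borel_measurable_indicator)
  have bd: "\<bar>indicator C x :: real\<bar> \<le> 1" for C :: "'a set" and x by (simp add: indicator_def)
  have Bw: "wnull (indicator (B k))" for k
  proof (induction k)
    case 0
    then show ?case by (simp add: B_def wnull_def)
  next
    case (Suc k)
    have dj: "B k \<inter> A k = {}"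
    proof (rule equals0I)
      fix x assume "x \<in> B k \<inter> A k"
      then obtain i where "i < k" "x \<in> A i \<inter> A k" unfolding B_def by auto
      moreover have "A i \<inter> A k = {}"
        using disjoint_family_onD[OF A(2), of i k] \<open>i < k\<close> by simp
      ultimately show False by simp
    qed
    have eq: "B (Suc k) = B k \<union> A k" by (auto simp: B_def less_Suc_eq)
    show ?case unfolding eq indicator_disj_union[OF dj]
      by (rule wnull_add[OF meas[OF Bm] bd meas[OF A(1)] bd Suc A(3)])
  qed
  show ?thesis
  proof (rule wnull_limit[where g="\<lambda>k. indicator (B k)" and B=1])
    show "(\<lambda>k. indicator (B k) x :: real) \<longlonglongrightarrow> indicator (\<Union>i. A i) x" for x
    proof (cases "x \<in> (\<Union>i. A i)")
      case True
      then obtain i where "x \<in> A i" by blast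
      have "\<forall>\<^sub>F k in sequentially. (indicator (B k) x :: real) = 1"
        using eventually_gt_at_top[of i]
      proof (rule eventually_mono)
        fix k assume "i < k"
        then have "x \<in> B k" using \<open>x \<in> A i\<close> by (auto simp: B_def)
        then show "(indicator (B k) x :: real) = 1" by simp
      qed
      then show ?thesis using True by (simp add: tendsto_eventually)
    qed (auto simp: B_def indicator_def)
    show "indicator (\<Union>i. A i) \<in> borel_measurable M" by (intro meas sets.countable_UN) (use A(1) in auto)
  qed (rule meas[OF Bm] bd Bw)+
qed

end

text \<open>Lindelof applied to the open boxes whose closed boxes still lie in \<open>S\<close>;
  closedness is what makes the bumps on them test functions of \<open>S\<close>.\<close>

lemma countable_box_cover:
  fixes S :: "'a::euclidean_space set"
  assumes "open S"
  obtains D where "countable D" "\<And>K. K \<in> D \<Longrightarrow> \<exists>a c. K = box a c \<and> cbox a c \<subseteq> S" "\<Union>D = S"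
proof -
  let ?F = "{K. \<exists>a c. K = box a c \<and> cbox a c \<subseteq> S}"
  have cov: "\<Union>?F = S"
  proof (intro equalityI subsetI)
    fix x assume "x \<in> \<Union>?F"
    then obtain a c where "x \<in> box a c" "cbox a c \<subseteq> S" by auto
    then show "x \<in> S" using box_subset_cbox[of a c] by auto
  next
    fix x assume "x \<in> S"
    then obtain e where e: "0 < e" "cball x e \<subseteq> S"
      using assms open_contains_cball[of S] by auto
    obtain a c where ac: "box a c \<subseteq> ball x e" "x \<in> box a c" "\<forall>i\<in>Basis. a \<bullet> i < c \<bullet> i"
      by (rule open_contains_box[of "ball x e" x]) (use e in auto)
    have "box a c \<noteq> {}" using ac(2) by auto
    then have "cbox a c = closure (box a c)" by (rule closure_box[symmetric])
    also have "\<dots> \<subseteq> cball x e"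
      using ac(1) ball_subset_cball[of x e] by (intro closure_minimal) auto
    finally have "cbox a c \<subseteq> S" using e(2) by auto
    then show "x \<in> \<Union>?F" using ac(2) by auto
  qed
  have "\<And>K. K \<in> ?F \<Longrightarrow> open K" using open_box by auto
  then obtain D where D: "D \<subseteq> ?F" "countable D" "\<Union>D = \<Union>?F" by (rule Lindelof)
  show ?thesis
  proof (rule that[OF D(2)])
    fix K assume "K \<in> D"
    then show "\<exists>a c. K = box a c \<and> cbox a c \<subseteq> S" using D(1) by auto
  qed (use D(3) cov in simp)
qed

lemma borel_sets_lebesgue_on:
  fixes S :: "'a::euclidean_space set"
  assumes "A \<in> sets borel" "A \<subseteq> S" shows "A \<in> sets (lebesgue_on S)"
proof -
  have "A \<in> sets lebesgue" using assms(1) by (simp add: sets_completionI_sets)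
  then show ?thesis using assms(2) unfolding sets_restrict_space
    by (intro image_eqI[of _ _ A]) auto
qed

locale test_null_sequence = dominated_sequence "lebesgue_on S" h H
  for S :: "'a::euclidean_space set" and h H +
  assumes S_open: "open S" and test_null: "\<And>\<phi>. \<phi> \<in> test_functions S \<Longrightarrow> wnull \<phi>"
begin

lemma indicator_measurable:
  assumes "A \<in> sets borel" "A \<subseteq> S" shows "indicator A \<in> borel_measurable (lebesgue_on S)"
  by (rule borel_measurable_indicator[OF borel_sets_lebesgue_on[OF assms]])

lemma indicator_bound: "\<bar>indicator C x :: real\<bar> \<le> 1"
  by (simp add: indicator_def)

lemma wnull_box:
  assumes "cbox a c \<subseteq> S" shows "wnull (indicator (box a c))"
proof (rule wnull_limit[where g="box_bump a c" and B=1])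
  fix k x
  show "box_bump a c k \<in> borel_measurable (lebesgue_on S)"
    by (rule continuous_measurable_lebesgue_on[OF test_function_continuous[OF box_bump_test[OF assms]]])
  show "\<bar>box_bump a c k x\<bar> \<le> 1" using box_bump_bounds[of a c k x] by simp
  show "wnull (box_bump a c k)" by (rule test_null[OF box_bump_test[OF assms]])
  show "(\<lambda>k. box_bump a c k x) \<longlonglongrightarrow> indicator (box a c) x" by (rule box_bump_tendsto)
  show "indicator (box a c) \<in> borel_measurable (lebesgue_on S)"
    using assms box_subset_cbox[of a c] by (intro indicator_measurable) auto
qed (rule indicator_bound)

text \<open>The Dynkin argument runs inside one box \<open>K\<close>, because complements must be
  taken in a set already known to be \<open>wnull\<close>; for \<open>S\<close> itself this is not
  yet available. The generator consists of the traces of boxes on \<open>K\<close>.\<close>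

lemma wnull_borel_box:
  assumes ac: "cbox a c \<subseteq> S" and A: "A \<in> sets borel"
  shows "wnull (indicator (box a c \<inter> A))"
proof -
  define K where "K = box a c"
  define G where "G = (\<inter>) K ` range (\<lambda>(a, b). box a b :: 'a set)"
  have KS: "K \<subseteq> S" using ac box_subset_cbox[of a c] by (auto simp: K_def)
  have KU: "K \<in> sigma_sets UNIV (range (\<lambda>(a, b). box a b :: 'a set))"
    unfolding K_def by (rule sigma_sets.Basic, rule image_eqI[of _ _ "(a, c)"]) simp_all
  have bor: "sets borel = sigma_sets UNIV (range (\<lambda>(a, b). box a b :: 'a set))"
    by (subst borel_eq_box) simp
  have sig: "(\<inter>) K ` sets borel = sigma_sets K G"
    unfolding G_def bor by (rule sigma_sets_Int[OF KU]) simp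
  have sigD: "X \<in> sets borel \<and> X \<subseteq> K" if "X \<in> sigma_sets K G" for X
  proof -
    have "X \<in> (\<inter>) K ` sets borel" using that unfolding sig .
    then obtain A' where A': "X = K \<inter> A'" "A' \<in> sets borel" by (rule imageE)
    then show ?thesis by (simp add: K_def)
  qed
  have m: "indicator X \<in> borel_measurable (lebesgue_on S)" "X \<in> sets (lebesgue_on S)" if "X \<in> sigma_sets K G" for X
  proof -
    have "X \<in> sets borel" "X \<subseteq> S" using sigD[OF that] KS by auto
    then show "indicator X \<in> borel_measurable (lebesgue_on S)" "X \<in> sets (lebesgue_on S)"
      by (rule indicator_measurable borel_sets_lebesgue_on; assumption)+
  qed
  have wK: "wnull (indicator K)" unfolding K_def by (rule wnull_box[OF ac])
  have IS: "Int_stable G"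
  proof (rule Int_stableI)
    fix X Y assume "X \<in> G" "Y \<in> G"
    then obtain p q r s where "X = K \<inter> box p q" "Y = K \<inter> box r s" unfolding G_def by auto
    then have "X \<inter> Y = K \<inter> (box p q \<inter> box r s)" by auto
    then show "X \<inter> Y \<in> G" unfolding G_def box_Int_box by auto
  qed
  have "K \<inter> A \<in> sigma_sets K G" unfolding sig[symmetric] using A by (rule imageI)
  have Gsub: "G \<subseteq> Pow K" by (auto simp: G_def)
  from IS Gsub \<open>K \<inter> A \<in> sigma_sets K G\<close> have "wnull (indicator (K \<inter> A))"
  proof (induction rule: sigma_sets_induct_disjoint)
    case (basic X)
    then obtain p q where X: "X = box a c \<inter> box p q" unfolding G_def K_def by auto
    \<comment> \<open>The corners of the intersection, chosen explicitly so that its closed box is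
      also seen to lie in \<open>S\<close>.\<close>
    define a' where "a' = (\<Sum>i\<in>Basis. max (a \<bullet> i) (p \<bullet> i) *\<^sub>R i)"
    define c' where "c' = (\<Sum>i\<in>Basis. min (c \<bullet> i) (q \<bullet> i) *\<^sub>R i)"
    have "X = box a' c'" unfolding X box_Int_box a'_def c'_def ..
    moreover have "cbox a' c' \<subseteq> S"
      using ac unfolding a'_def c'_def Int_interval[symmetric] by auto
    ultimately show ?case using wnull_box by simp
  next
    case empty
    then show ?case by (simp add: wnull_def)
  next
    case (compl X)
    have XK: "X \<subseteq> K" "K \<in> sigma_sets K G" using sigD[OF compl(1)] by (auto intro: sigma_sets_top)
    have "indicator (K - X) = (\<lambda>x. indicator K x - indicator X x :: real)"
      using XK(1) by (auto simp: indicator_def fun_eq_iff)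
    then show ?case
      using wnull_diff[OF m(1)[OF XK(2)] indicator_bound m(1)[OF compl(1)] indicator_bound wK compl(2)] by simp
  next
    case (union X)
    show ?case by (rule wnull_disjoint_union[OF m(2) union(1) union(3)]) (use union(2) in auto)
  qed
  then show ?thesis by (simp add: K_def)
qed

text \<open>A countable cover by boxes, made disjoint, cuts \<open>A\<close> into pieces that each
  lie in one box.\<close>

lemma wnull_borel:
  assumes A: "A \<in> sets borel" "A \<subseteq> S"
  shows "wnull (indicator A)"
proof (cases "S = {}")
  case True
  then have "indicator A = (\<lambda>x. 0 :: real)" using A by auto
  then show ?thesis by (simp add: wnull_def)
next
  case False
  obtain D where D: "countable D" "\<And>K. K \<in> D \<Longrightarrow> \<exists>a c. K = box a c \<and> cbox a c \<subseteq> S" "\<Union>D = S"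
    by (rule countable_box_cover[OF S_open], rule that)
  have "D \<noteq> {}" using D(3) False by auto
  define K where "K = from_nat_into D"
  have KD: "K i \<in> D" for i unfolding K_def by (rule from_nat_into[OF \<open>D \<noteq> {}\<close>])
  have UK: "(\<Union>i. K i) = S"
    using range_from_nat_into[OF \<open>D \<noteq> {}\<close> D(1)] D(3) by (simp add: K_def)
  have Kb: "K i \<in> sets borel" for i using D(2)[OF KD[of i]] by auto
  define B where "B i = A \<inter> disjointed K i" for i
  have Bb: "B i \<in> sets borel" for i
    unfolding B_def disjointed_def using A Kb by (intro sets.Int sets.Diff sets.finite_UN) auto
  have BS: "B i \<subseteq> S" for i unfolding B_def using A by auto
  have UB: "(\<Union>i. B i) = A"
    unfolding B_def Int_UN_distrib[symmetric] UN_disjointed_eq UK using A by auto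
  have dj: "disjoint_family B"
    using disjoint_family_disjointed[of K] unfolding disjoint_family_on_def B_def by auto
  have w: "wnull (indicator (B i))" for i
  proof -
    obtain a c where ac: "K i = box a c" "cbox a c \<subseteq> S" using D(2)[OF KD[of i]] by auto
    have "box a c \<inter> B i = B i" using disjointed_subset[of K i] unfolding B_def ac(1)[symmetric] by auto
    then show ?thesis using wnull_borel_box[OF ac(2) Bb[of i]] by simp
  qed
  have "wnull (indicator (\<Union>i. B i))"
    by (rule wnull_disjoint_union[OF borel_sets_lebesgue_on[OF Bb BS] dj w])
  then show ?thesis by (simp add: UB)
qed

lemma wnull_lebesgue:
  assumes A: "A \<in> sets (lebesgue_on S)"
  shows "wnull (indicator A)"
proof -
  have S: "S \<in> sets borel" "S \<in> sets lebesgue" using S_open by auto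
  have AL: "A \<in> sets lebesgue" "A \<subseteq> S" using A S(2) by (auto simp: sets_restrict_space_iff)
  define B where "B = main_part lborel A \<inter> S"
  have B: "B \<in> sets borel" "B \<subseteq> S"
    using main_part_sets[OF AL(1)] S(1) by (auto simp: B_def)
  obtain N where N: "N \<in> null_sets lborel" "null_part lborel A \<subseteq> N" using null_part[OF AL(1)] by auto
  have "AE x in lebesgue. x \<notin> N" by (rule AE_completion[OF AE_not_in[OF N(1)]])
  then have "AE x in lebesgue. x \<in> S \<longrightarrow> (indicator B x :: real) = indicator A x"
  proof eventually_elim
    case (elim x)
    have "x \<in> A \<longleftrightarrow> x \<in> main_part lborel A \<union> null_part lborel A"
      using main_part_null_part_Un[OF AL(1)] by simp
    moreover have "x \<notin> null_part lborel A" using elim N(2) by auto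
    ultimately show ?case by (simp add: B_def indicator_def)
  qed
  then have "AE x in lebesgue_on S. (indicator B x :: real) = indicator A x"
    using S(2) by (subst AE_restrict_space_iff) auto
  then show ?thesis
    by (rule wnull_cong_AE[OF wnull_borel[OF B] _ indicator_measurable[OF B] borel_measurable_indicator[OF A]])
qed

end

text \<open>Weak-star convergence in \<open>L\<^sup>\<infinity>\<close> for a bounded sequence: test
  functions control all measurable sets by the Dynkin argument, sets control simple functions, and
  the uniform bound \<open>C\<close> carries the limit over to every integrable
  \<open>y\<close>.\<close>

lemma weak_null_of_test_null:
  fixes h :: "nat \<Rightarrow> 'a::euclidean_space \<Rightarrow> real"
  assumes S: "open S" "emeasure lebesgue S < \<infinity>"
    and h: "\<And>n. h n \<in> borel_measurable (lebesgue_on S)" "\<And>n. AE x in lebesgue_on S. \<bar>h n x\<bar> \<le> C"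
    and test: "\<And>\<phi>. \<phi> \<in> test_functions S \<Longrightarrow> (\<lambda>n. LINT x|lebesgue_on S. h n x * \<phi> x) \<longlonglongrightarrow> 0"
    and y: "integrable (lebesgue_on S) y"
  shows "(\<lambda>n. LINT x|lebesgue_on S. h n x * y x) \<longlonglongrightarrow> 0"
proof -
  let ?M = "lebesgue_on S"
  have SL: "S \<in> sets lebesgue" using S(1) by auto
  interpret M: finite_measure ?M
    using S(2) SL by (intro finite_measureI) (simp add: emeasure_restrict_space)
  have dom: "dominated_sequence ?M h (\<lambda>_. C)"
    by unfold_locales (use h in auto)
  interpret test_null_sequence S h "\<lambda>_. C"
    using dom S(1) test
    by (simp add: test_null_sequence_def test_null_sequence_axioms_def dominated_sequence.wnull_def)
  have int: "integrable ?M (\<lambda>x. h n x * f x)" if f: "integrable ?M f" for n f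
  proof (rule Bochner_Integration.integrable_bound[of _ "\<lambda>x. C * f x"])
    show "integrable ?M (\<lambda>x. C * f x)" using f by (rule integrable_mult_right)
    show "(\<lambda>x. h n x * f x) \<in> borel_measurable ?M"
      using h(1) borel_measurable_integrable[OF f] by (rule borel_measurable_times)
    show "AE x in ?M. norm (h n x * f x) \<le> norm (C * f x)"
      using h(2)[of n]
    proof eventually_elim
      case (elim x)
      then have "\<bar>h n x\<bar> * \<bar>f x\<bar> \<le> \<bar>C\<bar> * \<bar>f x\<bar>" by (intro mult_right_mono) auto
      then show ?case by (simp add: abs_mult)
    qed
  qed
  show ?thesis
    using y
  proof (induction rule: integrable_induct)
    case (base A c)
    have "(\<lambda>n. c * (LINT x|?M. h n x * indicator A x)) \<longlonglongrightarrow> c * 0"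
      using wnull_lebesgue[OF base(1)] unfolding wnull_def by (rule tendsto_mult_left)
    moreover have "(LINT x|?M. h n x * (indicator A x *\<^sub>R c)) = c * (LINT x|?M. h n x * indicator A x)" for n
      by (subst integral_mult_right_zero[symmetric]) (simp add: ac_simps)
    ultimately show ?case by simp
  next
    case (add f g)
    have "(LINT x|?M. h n x * (f x + g x)) = (LINT x|?M. h n x * f x) + (LINT x|?M. h n x * g x)" for n
      unfolding distrib_left by (rule Bochner_Integration.integral_add[OF int[OF add(1)] int[OF add(2)]])
    then show ?case using tendsto_add[OF add(3,4)] by simp
  next
    case (lim f s)
    \<comment> \<open>The approximating functions satisfy
      \<open>\<bar>s k x\<bar> \<le> 2 * \<bar>f x\<bar>\<close>, hence the factor \<open>3\<close>
      in the dominating function.\<close>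
    have L: "(\<lambda>k. LINT x|?M. \<bar>C\<bar> * \<bar>f x - s k x\<bar>) \<longlonglongrightarrow> (LINT x|?M. 0)"
    proof (rule integral_dominated_convergence[where w="\<lambda>x. \<bar>C\<bar> * (3 * \<bar>f x\<bar>)"])
      show "integrable ?M (\<lambda>x. \<bar>C\<bar> * (3 * \<bar>f x\<bar>))"
        by (intro integrable_mult_right integrable_abs lim(4))
      show "(\<lambda>x. \<bar>C\<bar> * \<bar>f x - s k x\<bar>) \<in> borel_measurable ?M" for k
        using borel_measurable_integrable[OF lim(1)] borel_measurable_integrable[OF lim(4)] by measurable
      show "AE x in ?M. (\<lambda>k. \<bar>C\<bar> * \<bar>f x - s k x\<bar>) \<longlonglongrightarrow> 0"
      proof (rule AE_I2)
        fix x assume "x \<in> space ?M"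
        from lim(2)[OF this] have "(\<lambda>k. f x - s k x) \<longlonglongrightarrow> f x - f x" by (intro tendsto_diff tendsto_const)
        then have "(\<lambda>k. \<bar>f x - s k x\<bar>) \<longlonglongrightarrow> 0" by (intro tendsto_rabs_zero) simp
        then show "(\<lambda>k. \<bar>C\<bar> * \<bar>f x - s k x\<bar>) \<longlonglongrightarrow> 0" by (rule tendsto_mult_right_zero)
      qed
      show "AE x in ?M. norm (\<bar>C\<bar> * \<bar>f x - s k x\<bar>) \<le> \<bar>C\<bar> * (3 * \<bar>f x\<bar>)" for k
      proof (rule AE_I2)
        fix x assume "x \<in> space ?M"
        then have "\<bar>f x - s k x\<bar> \<le> 3 * \<bar>f x\<bar>" using lim(3)[of x k] by simp
        then have "\<bar>C\<bar> * \<bar>f x - s k x\<bar> \<le> \<bar>C\<bar> * (3 * \<bar>f x\<bar>)" by (rule mult_left_mono) simp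
        then show "norm (\<bar>C\<bar> * \<bar>f x - s k x\<bar>) \<le> \<bar>C\<bar> * (3 * \<bar>f x\<bar>)" by simp
      qed
    qed simp
    show ?case
    proof (rule LIMSEQ_I)
      fix e :: real assume e: "0 < e"
      obtain k where k: "norm ((LINT x|?M. \<bar>C\<bar> * \<bar>f x - s k x\<bar>) - (LINT x|?M. 0)) < e / 2"
        using LIMSEQ_D[OF L, of "e / 2"] e by auto
      obtain N where N: "\<And>n. N \<le> n \<Longrightarrow> norm ((LINT x|?M. h n x * s k x) - 0) < e / 2"
        using LIMSEQ_D[OF lim(5)[of k], of "e / 2"] e by auto
      have "norm ((LINT x|?M. h n x * f x) - 0) < e" if "N \<le> n" for n
      proof -
        have d: "integrable ?M (\<lambda>x. f x - s k x)" by (intro Bochner_Integration.integrable_diff lim(1) lim(4))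
        have eq: "(LINT x|?M. h n x * f x) = (LINT x|?M. h n x * s k x) + (LINT x|?M. h n x * (f x - s k x))"
          by (subst Bochner_Integration.integral_add[symmetric, OF int[OF lim(1)] int[OF d]])
             (simp add: right_diff_distrib)
        have "norm (LINT x|?M. h n x * (f x - s k x)) \<le> (LINT x|?M. norm (h n x * (f x - s k x)))"
          by (rule integral_norm_bound)
        also have "\<dots> \<le> (LINT x|?M. \<bar>C\<bar> * \<bar>f x - s k x\<bar>)"
        proof (rule integral_mono_AE)
          show "AE x in ?M. norm (h n x * (f x - s k x)) \<le> \<bar>C\<bar> * \<bar>f x - s k x\<bar>"
            using h(2)[of n]
          proof eventually_elim
            case (elim x)
            then have "\<bar>h n x\<bar> * \<bar>f x - s k x\<bar> \<le> \<bar>C\<bar> * \<bar>f x - s k x\<bar>" by (intro mult_right_mono) auto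
            then show ?case by (simp add: abs_mult)
          qed
        qed (intro integrable_norm int[OF d] integrable_mult_right integrable_abs d)+
        finally have "norm (LINT x|?M. h n x * (f x - s k x)) \<le> (LINT x|?M. \<bar>C\<bar> * \<bar>f x - s k x\<bar>)" .
        moreover have "\<bar>LINT x|?M. \<bar>C\<bar> * \<bar>f x - s k x\<bar>\<bar> < e / 2" using k by simp
        moreover have "\<bar>LINT x|?M. h n x * s k x\<bar> < e / 2" using N[OF that] by simp
        ultimately show ?thesis unfolding eq real_norm_def by linarith
      qed
      then show "\<exists>N. \<forall>n\<ge>N. norm ((LINT x|?M. h n x * f x) - 0) < e" by blast
    qed
  qed
qed

text \<open>With the constant sequence \<open>g\<close>, \<open>wnull\<close> of an indicator says
  that the integral of \<open>g\<close> over the set is zero; this holds for all measurable sets,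
  and a density is determined by such integrals.\<close>

lemma fundamental_lemma_variations:
  fixes g :: "'a::euclidean_space \<Rightarrow> real"
  assumes S: "open S" and g: "integrable (lebesgue_on S) g"
    and test: "\<And>\<phi>. \<phi> \<in> test_functions S \<Longrightarrow> (LINT x|lebesgue_on S. g x * \<phi> x) = 0"
  shows "AE x in lebesgue_on S. g x = 0"
proof -
  let ?M = "lebesgue_on S"
  have dom: "dominated_sequence ?M (\<lambda>_. g) (\<lambda>x. \<bar>g x\<bar>)"
    by unfold_locales (use g in auto)
  interpret test_null_sequence S "\<lambda>_. g" "\<lambda>x. \<bar>g x\<bar>"
    using dom S test
    by (simp add: test_null_sequence_def test_null_sequence_axioms_def dominated_sequence.wnull_def)
  show ?thesis
  proof (rule density_unique_real[OF g])
    show "integrable ?M (\<lambda>x. 0 :: real)" by simp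
    fix A assume "A \<in> sets ?M"
    from wnull_lebesgue[OF this] have "(LINT x|?M. g x * indicator A x) = 0"
      by (simp add: wnull_def LIMSEQ_const_iff)
    then show "(LINT x:A|?M. g x) = (LINT x:A|?M. 0)"
      by (simp add: set_lebesgue_integral_def mult.commute)
  qed
qed

section \<open>Completeness of Lebesgue measure and almost everywhere limits\<close>

lemma complete_measure_lebesgue_on:
  assumes "S \<in> sets lebesgue" shows "complete_measure (lebesgue_on S)"
proof
  fix A B assume "B \<subseteq> A" "A \<in> null_sets (lebesgue_on S)"
  then have A: "A \<subseteq> S" "A \<in> null_sets lebesgue"
    using null_sets_restrict_space[OF assms] by auto
  have "B \<in> null_sets lebesgue" by (rule completion.complete2[OF \<open>B \<subseteq> A\<close> A(2)])
  then have "B \<in> null_sets (lebesgue_on S)"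
    using null_sets_restrict_space[OF assms] A(1) \<open>B \<subseteq> A\<close> by auto
  then show "B \<in> sets (lebesgue_on S)" by auto
qed

lemma borel_measurable_cong_AE_complete:
  assumes "complete_measure M" "g \<in> borel_measurable M" "AE x in M. f x = g x"
  shows "f \<in> borel_measurable M"
proof (rule measurableI)
  fix B :: "'b set" assume B: "B \<in> sets borel"
  show "f -` B \<inter> space M \<in> sets M"
  proof (rule complete_measure.in_sets_AE[OF assms(1)])
    show "AE x in M. x \<in> g -` B \<inter> space M \<longleftrightarrow> x \<in> f -` B \<inter> space M"
      using assms(3) by eventually_elim simp
    show "g -` B \<inter> space M \<in> sets M" by (rule measurable_sets[OF assms(2) B])
  qed auto
qed simp

text \<open>Intended for pairings in time, which are limits of measurable functions only off an
  uncontrolled null set of times; completeness absorbs the change on that set.\<close>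

lemma borel_measurable_AE_LIMSEQ:
  fixes f :: "'a \<Rightarrow> real"
  assumes "complete_measure M" "\<And>n. s n \<in> borel_measurable M" "AE x in M. (\<lambda>n. s n x) \<longlonglongrightarrow> f x"
  shows "f \<in> borel_measurable M"
proof (rule borel_measurable_cong_AE_complete[OF assms(1)])
  show "(\<lambda>x. lim (\<lambda>n. s n x)) \<in> borel_measurable M"
    by (rule borel_measurable_lim_metric[OF assms(2)])
  show "AE x in M. f x = lim (\<lambda>n. s n x)"
    using assms(3) by eventually_elim (simp add: limI)
qed

section \<open>Gradients and the predual of $V$\<close>

locale bounded_open_domain =
  fixes \<Omega> \<Gamma>D :: "'a::euclidean_space set" and T :: real
  assumes open_\<Omega>: "open \<Omega>" and bounded_\<Omega>: "bounded \<Omega>" and T_pos: "0 < T"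
begin

abbreviation M where "M \<equiv> lebesgue_on \<Omega>"
abbreviation MI where "MI \<equiv> lebesgue_on {0<..<T}"
abbreviation V where "V \<equiv> W1infD \<Omega> \<Gamma>D"
abbreviation ip where "ip \<equiv> L2_inner (lebesgue_on \<Omega>)"

lemma \<Omega>_lebesgue: "\<Omega> \<in> sets lebesgue" "emeasure lebesgue \<Omega> < \<infinity>"
proof -
  show "\<Omega> \<in> sets lebesgue" using open_\<Omega> by auto
  have "\<Omega> \<in> lmeasurable" using bounded_\<Omega> open_\<Omega> by (intro lmeasurable_open) auto
  then show "emeasure lebesgue \<Omega> < \<infinity>" unfolding fmeasurable_def by blast
qed

lemma finite_M: "finite_measure M"
  using \<Omega>_lebesgue by (intro finite_measureI) (simp add: emeasure_restrict_space less_top del: emeasure_completion)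

lemma finite_MI: "finite_measure MI"
  using T_pos by (intro finite_measureI) (simp add: emeasure_restrict_space)

lemma complete_MI: "complete_measure MI"
  by (rule complete_measure_lebesgue_on) simp

lemma grad_V:
  assumes "w \<in> V"
  shows grad_Linf: "grad \<Omega> w \<in> Linf M" and weak_gradient_grad: "weak_gradient \<Omega> w (grad \<Omega> w)"
proof -
  have "\<exists>g. g \<in> Linf M \<and> weak_gradient \<Omega> w g" using assms by (auto simp: W1infD_def W1inf_def)
  from someI_ex[OF this] show "grad \<Omega> w \<in> Linf M" "weak_gradient \<Omega> w (grad \<Omega> w)"
    by (auto simp: grad_def)
qed

lemma V_Linf: "w \<in> V \<Longrightarrow> w \<in> Linf M"
  by (simp add: W1infD_def W1inf_def)

lemma V_norm_props:
  assumes "w \<in> V"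
  shows AE_grad_le: "AE x in M. norm (grad \<Omega> w x) \<le> V_norm \<Omega> w" and V_norm_nonneg: "0 \<le> V_norm \<Omega> w"
  using AE_Linf_norm[OF grad_Linf[OF assms]] by (auto simp: V_norm_def)

lemma predual_norm_nonneg: "F \<in> predual \<Omega> \<Gamma>D \<Longrightarrow> 0 \<le> predual_norm \<Omega> \<Gamma>D F"
  unfolding predual_norm_def predual_def by (intro cINF_greatest) auto

text \<open>Every representative of the coset gives the estimate with its own
  \<open>L\<^sup>1\<close> norm; dividing by \<open>V_norm\<close> and taking the infimum yields the
  quotient norm.\<close>

lemma predual_le:
  assumes F: "F \<in> predual \<Omega> \<Gamma>D" and w: "w \<in> V"
  shows "\<bar>F w\<bar> \<le> predual_norm \<Omega> \<Gamma>D F * V_norm \<Omega> w"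
proof -
  have le: "\<bar>F w\<bar> \<le> (LINT x|M. norm (y x)) * V_norm \<Omega> w" if y: "y \<in> predual_coset \<Omega> \<Gamma>D F" for y
  proof -
    have yi: "integrable M y" and Fw: "F w = (LINT x|M. y x \<bullet> grad \<Omega> w x)"
      using y w by (auto simp: predual_coset_def)
    have "\<bar>F w\<bar> \<le> (LINT x|M. norm (y x \<bullet> grad \<Omega> w x))"
      unfolding Fw real_norm_def[symmetric] by (rule integral_norm_bound)
    also have "\<dots> \<le> (LINT x|M. norm (y x) * V_norm \<Omega> w)"
    proof (rule integral_mono_AE)
      show "integrable M (\<lambda>x. norm (y x \<bullet> grad \<Omega> w x))"
        by (intro integrable_norm integrable_inner_Linf yi grad_Linf w)
      show "integrable M (\<lambda>x. norm (y x) * V_norm \<Omega> w)"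
        by (intro integrable_mult_left integrable_norm yi)
      show "AE x in M. norm (y x \<bullet> grad \<Omega> w x) \<le> norm (y x) * V_norm \<Omega> w"
        using AE_grad_le[OF w]
      proof eventually_elim
        case (elim x)
        have "norm (y x \<bullet> grad \<Omega> w x) \<le> norm (y x) * norm (grad \<Omega> w x)"
          using Cauchy_Schwarz_ineq2 by simp
        also have "\<dots> \<le> norm (y x) * V_norm \<Omega> w" using elim by (intro mult_left_mono) auto
        finally show ?case .
      qed
    qed
    also have "\<dots> = (LINT x|M. norm (y x)) * V_norm \<Omega> w" by simp
    finally show ?thesis .
  qed
  obtain y0 where y0: "y0 \<in> predual_coset \<Omega> \<Gamma>D F" using F by (auto simp: predual_def)
  show ?thesis
  \<comment> \<open>Division is impossible in this case, but a single representative already forces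
    \<open>F w = 0\<close>.\<close>
  proof (cases "V_norm \<Omega> w = 0")
    case True
    then show ?thesis using le[OF y0] by simp
  next
    case False
    then have pos: "0 < V_norm \<Omega> w" using V_norm_nonneg[OF w] by simp
    have "\<bar>F w\<bar> / V_norm \<Omega> w \<le> predual_norm \<Omega> \<Gamma>D F"
      unfolding predual_norm_def
    proof (rule cINF_greatest)
      fix y assume "y \<in> predual_coset \<Omega> \<Gamma>D F"
      then show "\<bar>F w\<bar> / V_norm \<Omega> w \<le> (LINT x|M. norm (y x))"
        using le pos by (simp add: pos_divide_le_eq)
    qed (use y0 in auto)
    then show ?thesis using pos by (simp add: pos_divide_le_eq)
  qed
qed

lemma predual_diff:
  assumes "F \<in> predual \<Omega> \<Gamma>D" "G \<in> predual \<Omega> \<Gamma>D"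
  shows "(\<lambda>w. F w - G w) \<in> predual \<Omega> \<Gamma>D"
proof -
  obtain y z where y: "y \<in> predual_coset \<Omega> \<Gamma>D F" and z: "z \<in> predual_coset \<Omega> \<Gamma>D G"
    using assms by (auto simp: predual_def)
  then have i: "integrable M y" "integrable M z" by (auto simp: predual_coset_def)
  have "(\<lambda>x. y x - z x) \<in> predual_coset \<Omega> \<Gamma>D (\<lambda>w. F w - G w)"
    unfolding predual_coset_def
  proof (intro CollectI conjI ballI)
    show "integrable M (\<lambda>x. y x - z x)" using i by (rule Bochner_Integration.integrable_diff)
    fix w assume w: "w \<in> V"
    have "F w - G w = (LINT x|M. y x \<bullet> grad \<Omega> w x) - (LINT x|M. z x \<bullet> grad \<Omega> w x)"
      using y z w by (simp add: predual_coset_def)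
    also have "\<dots> = (LINT x|M. (y x - z x) \<bullet> grad \<Omega> w x)"
      unfolding inner_diff_left
      by (rule Bochner_Integration.integral_diff[symmetric])
         (intro integrable_inner_Linf i grad_Linf w)+
    finally show "F w - G w = (LINT x|M. (y x - z x) \<bullet> grad \<Omega> w x)" .
  qed
  then show ?thesis by (auto simp: predual_def)
qed

lemma predual_diff_le:
  assumes "F \<in> predual \<Omega> \<Gamma>D" "G \<in> predual \<Omega> \<Gamma>D" "w \<in> V"
  shows "\<bar>F w - G w\<bar> \<le> predual_norm \<Omega> \<Gamma>D (\<lambda>w. F w - G w) * V_norm \<Omega> w"
  using predual_le[OF predual_diff[OF assms(1,2)] assms(3)] .

section \<open>Measurability and integrability of the pairing in time\<close>

lemma Linf_wstarD:
  assumes "w \<in> Linf_wstar \<Omega> \<Gamma>D T"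
  shows Linf_wstar_V: "t \<in> {0<..<T} \<Longrightarrow> w t \<in> V"
    and Linf_wstar_bound: "\<exists>C\<ge>0. AE t in MI. V_norm \<Omega> (w t) \<le> C"
proof -
  show "t \<in> {0<..<T} \<Longrightarrow> w t \<in> V" using assms by (simp add: Linf_wstar_def)
  obtain C where "0 \<le> C" "AE t in MI. norm (V_norm \<Omega> (w t)) \<le> C"
    by (rule Linf_bound[of "\<lambda>t. V_norm \<Omega> (w t)" MI]) (use assms in \<open>simp_all add: Linf_wstar_def\<close>)
  then show "\<exists>C\<ge>0. AE t in MI. V_norm \<Omega> (w t) \<le> C"
    by (intro exI[of _ C]) auto
qed

lemma const_Linf_wstar: "w \<in> V \<Longrightarrow> (\<lambda>t. w) \<in> Linf_wstar \<Omega> \<Gamma>D T"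
  by (auto simp: Linf_wstar_def intro!: LinfI[of _ _ "\<bar>V_norm \<Omega> w\<bar>"])

lemma predual_apply_measurable:
  assumes F: "F \<in> predual \<Omega> \<Gamma>D" and w: "w \<in> Linf_wstar \<Omega> \<Gamma>D T"
  shows "(\<lambda>t. F (w t)) \<in> borel_measurable MI"
proof -
  obtain y where y: "y \<in> predual_coset \<Omega> \<Gamma>D F" using F by (auto simp: predual_def)
  have "(\<lambda>t. LINT x|M. grad \<Omega> (w t) x \<bullet> y x) \<in> borel_measurable MI"
    using w y by (auto simp: Linf_wstar_def predual_coset_def)
  moreover have "F (w t) = (LINT x|M. grad \<Omega> (w t) x \<bullet> y x)" if "t \<in> space MI" for t
    using y Linf_wstar_V[OF w, of t] that by (simp add: predual_coset_def inner_commute)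
  ultimately show ?thesis by (rule measurable_cong[THEN iffD2, rotated])
qed

lemma predual_simple_apply_measurable:
  assumes s: "predual_simple \<Omega> \<Gamma>D T s" and w: "w \<in> Linf_wstar \<Omega> \<Gamma>D T"
  shows "(\<lambda>t. s t (w t)) \<in> borel_measurable MI"
proof -
  define R where "R = s ` {0<..<T}"
  have fin: "finite R" using s unfolding predual_simple_def R_def by blast
  have R: "F \<in> predual \<Omega> \<Gamma>D" if "F \<in> R" for F
    using s that unfolding predual_simple_def R_def by blast
  have sets: "{t \<in> {0<..<T}. s t = F} \<in> sets MI" for F
  proof -
    have "{t \<in> {0<..<T}. s t = F} \<in> sets lebesgue" using s by (simp add: predual_simple_def)
    then show ?thesis by (subst sets_restrict_space_iff) auto
  qed
  have "(\<lambda>t. \<Sum>F\<in>R. indicator {t \<in> {0<..<T}. s t = F} t * F (w t)) \<in> borel_measurable MI"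
  proof (rule borel_measurable_sum)
    fix F assume "F \<in> R"
    show "(\<lambda>t. indicator {t \<in> {0<..<T}. s t = F} t * F (w t)) \<in> borel_measurable MI"
      by (rule borel_measurable_times[OF borel_measurable_indicator[OF sets]
            predual_apply_measurable[OF R[OF \<open>F \<in> R\<close>] w]])
  qed
  moreover have "s t (w t) = (\<Sum>F\<in>R. indicator {t \<in> {0<..<T}. s t = F} t * F (w t))" if "t \<in> space MI" for t
  proof -
    have "(\<Sum>F\<in>R. indicator {t \<in> {0<..<T}. s t = F} t * F (w t)) = (\<Sum>F\<in>R. if F = s t then F (w t) else 0)"
      using that by (intro sum.cong) (auto simp: indicator_def)
    also have "\<dots> = s t (w t)" using fin that by (simp add: sum.delta R_def)
    finally show ?thesis by simp
  qed
  ultimately show ?thesis by (rule measurable_cong[THEN iffD2, rotated])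
qed

lemma L1_predualD:
  assumes "f \<in> L1_predual \<Omega> \<Gamma>D T"
  shows L1_predual_in: "t \<in> {0<..<T} \<Longrightarrow> f t \<in> predual \<Omega> \<Gamma>D"
    and L1_predual_norm_int: "integrable MI (\<lambda>t. predual_norm \<Omega> \<Gamma>D (f t))"
  using assms by (simp_all add: L1_predual_def)

lemma L1_predual_approx:
  assumes "f \<in> L1_predual \<Omega> \<Gamma>D T"
  obtains s where "\<And>n. predual_simple \<Omega> \<Gamma>D T (s n)"
    "AE t in MI. (\<lambda>n. predual_norm \<Omega> \<Gamma>D (\<lambda>w. f t w - s n t w)) \<longlonglongrightarrow> 0"
  using assms unfolding L1_predual_def by auto

lemma AE_MI_in: "AE t in MI. t \<in> {0<..<T}"
  by (rule AE_I2) simp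

text \<open>Strong measurability of \<open>f\<close> compensates for the weak measurability of
  \<open>w\<close>: a simple function reduces to finitely many fixed functionals, and at a fixed
  time the error is at most a vanishing predual norm times
  \<open>V_norm \<Omega> (w t)\<close>.\<close>

lemma L1_predual_apply_measurable:
  assumes f: "f \<in> L1_predual \<Omega> \<Gamma>D T" and w: "w \<in> Linf_wstar \<Omega> \<Gamma>D T"
  shows "(\<lambda>t. f t (w t)) \<in> borel_measurable MI"
proof -
  obtain s where s: "\<And>n. predual_simple \<Omega> \<Gamma>D T (s n)"
    and lim: "AE t in MI. (\<lambda>n. predual_norm \<Omega> \<Gamma>D (\<lambda>w. f t w - s n t w)) \<longlonglongrightarrow> 0"
    by (rule L1_predual_approx[OF f], rule that)
  show ?thesis
  proof (rule borel_measurable_AE_LIMSEQ[OF complete_MI])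
    show "(\<lambda>t. s n t (w t)) \<in> borel_measurable MI" for n
      by (rule predual_simple_apply_measurable[OF s w])
    show "AE t in MI. (\<lambda>n. s n t (w t)) \<longlonglongrightarrow> f t (w t)"
      using lim AE_MI_in
    proof eventually_elim
      case (elim t)
      have sp: "s n t \<in> predual \<Omega> \<Gamma>D" for n using s[of n] elim(2) by (simp add: predual_simple_def)
      have b: "norm (s n t (w t) - f t (w t)) \<le> predual_norm \<Omega> \<Gamma>D (\<lambda>w. f t w - s n t w) * V_norm \<Omega> (w t)" for n
        using predual_diff_le[OF L1_predual_in[OF f elim(2)] sp Linf_wstar_V[OF w elim(2)], of n]
        by (simp add: abs_minus_commute)
      have "(\<lambda>n. s n t (w t) - f t (w t)) \<longlonglongrightarrow> 0"
        by (rule Lim_null_comparison[OF always_eventually[OF allI[OF b]] tendsto_mult_left_zero[OF elim(1)]])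
      then show ?case by (rule LIM_zero_cancel)
    qed
  qed
qed

lemma L1_predual_apply_integrable:
  assumes f: "f \<in> L1_predual \<Omega> \<Gamma>D T" and w: "w \<in> Linf_wstar \<Omega> \<Gamma>D T"
  shows "integrable MI (\<lambda>t. f t (w t))"
proof -
  obtain C where C: "0 \<le> C" "AE t in MI. V_norm \<Omega> (w t) \<le> C" using Linf_wstar_bound[OF w] by auto
  show ?thesis
  proof (rule Bochner_Integration.integrable_bound[OF integrable_mult_left[OF L1_predual_norm_int[OF f], of C]])
    show "(\<lambda>t. f t (w t)) \<in> borel_measurable MI" by (rule L1_predual_apply_measurable[OF f w])
    show "AE t in MI. norm (f t (w t)) \<le> norm (predual_norm \<Omega> \<Gamma>D (f t) * C)"
      using C(2) AE_MI_in
    proof eventually_elim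
      case (elim t)
      have "\<bar>f t (w t)\<bar> \<le> predual_norm \<Omega> \<Gamma>D (f t) * V_norm \<Omega> (w t)"
        by (rule predual_le[OF L1_predual_in[OF f elim(2)] Linf_wstar_V[OF w elim(2)]])
      also have "\<dots> \<le> predual_norm \<Omega> \<Gamma>D (f t) * C"
        by (rule mult_left_mono[OF elim(1) predual_norm_nonneg[OF L1_predual_in[OF f elim(2)]]])
      finally show ?case by simp
    qed
  qed
qed

lemma L1_predual_apply_const_integrable:
  "f \<in> L1_predual \<Omega> \<Gamma>D T \<Longrightarrow> w \<in> V \<Longrightarrow> integrable MI (\<lambda>t. f t w)"
  using L1_predual_apply_integrable[OF _ const_Linf_wstar] by auto

text \<open>A three-epsilon argument: on the ball of radius \<open>B\<close> the functional
  \<open>F\<close> is uniformly close to some \<open>s n\<close>, so convergence along the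
  approximants \<open>s n\<close> carries over to \<open>F\<close>.\<close>

lemma predual_seq_tendsto:
  assumes F: "F \<in> predual \<Omega> \<Gamma>D" and s: "\<And>n. s n \<in> predual \<Omega> \<Gamma>D"
    and lim: "(\<lambda>n. predual_norm \<Omega> \<Gamma>D (\<lambda>w. F w - s n w)) \<longlonglongrightarrow> 0"
    and c: "\<And>i. c i \<in> V" "\<And>i. V_norm \<Omega> (c i) \<le> B" and w: "w \<in> V" "V_norm \<Omega> w \<le> B"
    and sc: "\<And>n. (\<lambda>i. s n (c i)) \<longlonglongrightarrow> s n w"
  shows "(\<lambda>i. F (c i)) \<longlonglongrightarrow> F w"
proof (rule LIMSEQ_I)
  fix e :: real assume e: "0 < e"
  have "0 \<le> B" using V_norm_nonneg[OF w(1)] w(2) by simp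
  have "(\<lambda>n. predual_norm \<Omega> \<Gamma>D (\<lambda>w. F w - s n w) * B) \<longlonglongrightarrow> 0"
    by (rule tendsto_mult_left_zero[OF lim])
  from LIMSEQ_D[OF this, of "e / 3"] e
  obtain n where "norm (predual_norm \<Omega> \<Gamma>D (\<lambda>w. F w - s n w) * B - 0) < e / 3" by auto
  then have n: "predual_norm \<Omega> \<Gamma>D (\<lambda>w. F w - s n w) * B < e / 3" by simp
  have d: "\<bar>F v - s n v\<bar> < e / 3" if v: "v \<in> V" "V_norm \<Omega> v \<le> B" for v
  proof -
    have "\<bar>F v - s n v\<bar> \<le> predual_norm \<Omega> \<Gamma>D (\<lambda>w. F w - s n w) * V_norm \<Omega> v"
      by (rule predual_diff_le[OF F s v(1)])
    also have "\<dots> \<le> predual_norm \<Omega> \<Gamma>D (\<lambda>w. F w - s n w) * B"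
      by (rule mult_left_mono[OF v(2) predual_norm_nonneg[OF predual_diff[OF F s]]])
    finally show ?thesis using n by simp
  qed
  obtain N where N: "\<And>i. N \<le> i \<Longrightarrow> norm (s n (c i) - s n w) < e / 3"
    using LIMSEQ_D[OF sc[of n], of "e / 3"] e by auto
  have "norm (F (c i) - F w) < e" if "N \<le> i" for i
    using d[OF c(1)[of i] c(2)[of i]] d[OF w] N[OF that] unfolding real_norm_def by linarith
  then show "\<exists>N. \<forall>i\<ge>N. norm (F (c i) - F w) < e" by blast
qed

end

section \<open>Weak time derivatives\<close>

lemma test_functionD:
  assumes "\<phi> \<in> test_functions S"
  shows test_function_Ck: "Ck k \<phi>" and test_function_compact: "compact (closure {x. \<phi> x \<noteq> 0})"
    and test_function_support: "closure {x. \<phi> x \<noteq> 0} \<subseteq> S"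
  using assms by (simp_all add: test_functions_def)

lemma test_functionI:
  assumes "\<And>k. Ck k \<phi>" "compact K" "K \<subseteq> S" "\<And>x. x \<notin> K \<Longrightarrow> \<phi> x = 0"
  shows "\<phi> \<in> test_functions S"
proof -
  have sub: "closure {x. \<phi> x \<noteq> 0} \<subseteq> K"
    using assms(4) compact_imp_closed[OF assms(2)] by (intro closure_minimal) auto
  have "compact (K \<inter> closure {x. \<phi> x \<noteq> 0})"
    by (rule compact_Int_closed[OF assms(2) closed_closure])
  moreover have "K \<inter> closure {x. \<phi> x \<noteq> 0} = closure {x. \<phi> x \<noteq> 0}" using sub by auto
  ultimately show ?thesis using assms(1,3) sub by (simp add: test_functions_def)
qed

lemma zero_off_support:
  assumes "x \<notin> closure {x. \<phi> x \<noteq> 0}" shows "\<phi> x = 0"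
proof (rule ccontr)
  assume "\<phi> x \<noteq> 0"
  then have "x \<in> {x. \<phi> x \<noteq> 0}" by simp
  from subsetD[OF closure_subset this] assms show False by simp
qed

lemma test_function_lincomb:
  fixes \<phi> \<psi> :: "'a::euclidean_space \<Rightarrow> real"
  assumes "\<phi> \<in> test_functions S" "\<psi> \<in> test_functions S"
  shows "(\<lambda>x. \<phi> x + c * \<psi> x) \<in> test_functions S"
proof (rule test_functionI[where K = "closure {x. \<phi> x \<noteq> 0} \<union> closure {x. \<psi> x \<noteq> 0}"])
  show "Ck k (\<lambda>x. \<phi> x + c * \<psi> x)" for k
    by (intro Ck_add Ck_mult Ck_const test_function_Ck[OF assms(1)] test_function_Ck[OF assms(2)])
  show "closure {x. \<phi> x \<noteq> 0} \<union> closure {x. \<psi> x \<noteq> 0} \<subseteq> S"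
    using test_function_support[OF assms(1)] test_function_support[OF assms(2)] by (rule Un_least)
  fix x assume "x \<notin> closure {x. \<phi> x \<noteq> 0} \<union> closure {x. \<psi> x \<noteq> 0}"
  then show "\<phi> x + c * \<psi> x = 0"
    using zero_off_support[of x \<phi>] zero_off_support[of x \<psi>] by simp
qed (rule compact_Un[OF test_function_compact[OF assms(1)] test_function_compact[OF assms(2)]])

text \<open>Smoothness is defined through Frechet derivatives, while \<open>has_time_deriv\<close>
  uses \<open>deriv\<close>; on the line the two are linked by evaluation in direction
  \<open>1\<close>.\<close>

lemma test_function_real_deriv:
  fixes \<phi> :: "real \<Rightarrow> real"
  assumes "\<phi> \<in> test_functions S"
  shows "(\<phi> has_real_derivative deriv \<phi> t) (at t)" and "continuous_on UNIV (deriv \<phi>)"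
    and "t \<notin> S \<Longrightarrow> deriv \<phi> t = 0" and "t \<notin> S \<Longrightarrow> \<phi> t = 0"
proof -
  have d: "(\<phi> has_derivative frechet_derivative \<phi> (at t)) (at t)" for t
    by (rule Ck_deriv(1)[OF test_function_Ck[OF assms, of "Suc 0"]])
  have lin: "frechet_derivative \<phi> (at t) h = h * frechet_derivative \<phi> (at t) 1" for t h
    using linear_scale[OF has_derivative_linear[OF d[of t]], of h 1] by simp
  have d': "(\<phi> has_real_derivative frechet_derivative \<phi> (at t) 1) (at t)" for t
  proof -
    have "frechet_derivative \<phi> (at t) = (*) (frechet_derivative \<phi> (at t) 1)"
      by (rule ext, subst lin, rule mult.commute)
    then show ?thesis unfolding has_field_derivative_def by (rule has_derivative_eq_rhs[OF d])
  qed
  have eq: "deriv \<phi> t = frechet_derivative \<phi> (at t) 1" for t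
    by (rule DERIV_imp_deriv[OF d'])
  show D: "(\<phi> has_real_derivative deriv \<phi> t) (at t)" using d' eq by simp
  have "Ck 0 (\<lambda>x. frechet_derivative \<phi> (at x) 1)"
    by (rule Ck_deriv(2)[OF test_function_Ck[OF assms]]) simp
  then show "continuous_on UNIV (deriv \<phi>)" by (simp add: eq[symmetric, abs_def])
  assume "t \<notin> S"
  then have nt: "t \<notin> closure {x. \<phi> x \<noteq> 0}" using test_function_support[OF assms] by auto
  then show "\<phi> t = 0" by (rule zero_off_support[of t \<phi>])
  have "eventually (\<lambda>s. s \<in> - closure {x. \<phi> x \<noteq> 0}) (nhds t)"
    by (rule eventually_nhds_in_open) (use nt in auto)
  then have "eventually (\<lambda>s. \<phi> s = 0) (nhds t)"
  proof (rule eventually_mono)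
    fix s assume "s \<in> - closure {x. \<phi> x \<noteq> 0}"
    then show "\<phi> s = 0" by (intro zero_off_support[of s \<phi>]) simp
  qed
  then have "deriv \<phi> t = deriv (\<lambda>_. 0) t" by (rule deriv_cong_ev) simp
  then show "deriv \<phi> t = 0" by simp
qed

section \<open>Weak derivatives of scalar functions on an interval\<close>

lemma compact_bounds_open_interval:
  fixes K :: "real set"
  assumes "compact K" "K \<subseteq> {0<..<T}" "0 < T"
  obtains \<alpha> \<beta> where "0 < \<alpha>" "\<beta> < T" "K \<subseteq> {\<alpha>..\<beta>}"
proof (cases "K = {}")
  case True
  then show ?thesis using that[of "T/2" "T/2"] assms(3) by simp
next
  case False
  obtain \<alpha> where \<alpha>: "\<alpha> \<in> K" "\<forall>x\<in>K. \<alpha> \<le> x" using compact_attains_inf[OF assms(1) False] by auto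
  obtain \<beta> where \<beta>: "\<beta> \<in> K" "\<forall>x\<in>K. x \<le> \<beta>" using compact_attains_sup[OF assms(1) False] by auto
  show ?thesis
  proof (rule that[of \<alpha> \<beta>])
    show "0 < \<alpha>" "\<beta> < T" using \<alpha>(1) \<beta>(1) assms(2) by auto
    show "K \<subseteq> {\<alpha>..\<beta>}" using \<alpha>(2) \<beta>(2) by auto
  qed
qed

lemma bounded_integrable_lebesgue_on:
  fixes f :: "real \<Rightarrow> real"
  assumes "f \<in> borel_measurable (lebesgue_on {0<..<T})" "\<And>x. \<bar>f x\<bar> \<le> B"
  shows "integrable (lebesgue_on {0<..<T}) f"
proof -
  interpret finite_measure "lebesgue_on {0<..<T}"
    by (intro finite_measureI; cases "0 \<le> T") (simp_all add: emeasure_restrict_space)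
  show ?thesis by (rule integrable_const_bound[of _ B]) (use assms in auto)
qed

text \<open>The primitive vanishes to the left of the support of \<open>\<rho>\<close>, and to the
  right of it because \<open>\<rho>\<close> has mean zero.\<close>

lemma test_antiderivative:
  fixes \<rho> :: "real \<Rightarrow> real"
  assumes T: "0 < T" and \<rho>: "\<rho> \<in> test_functions {0<..<T}" and zero: "(LINT t|lebesgue_on {0<..<T}. \<rho> t) = 0"
  obtains \<phi> where "\<phi> \<in> test_functions {0<..<T}" "deriv \<phi> = \<rho>"
proof -
  obtain \<alpha> \<beta> where ab: "0 < \<alpha>" "\<beta> < T" "closure {x. \<rho> x \<noteq> 0} \<subseteq> {\<alpha>..\<beta>}"
    by (rule compact_bounds_open_interval[OF test_function_compact[OF \<rho>] test_function_support[OF \<rho>] T], rule that)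
  have off: "\<rho> t = 0" if "t < \<alpha> \<or> \<beta> < t" for t
  proof (rule zero_off_support[of t \<rho>], rule notI)
    assume "t \<in> closure {x. \<rho> x \<noteq> 0}"
    from subsetD[OF ab(3) this] that show False by auto
  qed
  have cont: "continuous_on S \<rho>" for S
    by (rule continuous_on_subset[OF test_function_continuous[OF \<rho>]]) simp
  \<comment> \<open>Starting at \<open>-1\<close> makes every \<open>t \<ge> \<alpha>\<close> an
    interior point of the interval of integration, so that the derivative there is
    two-sided.\<close>
  define \<phi> where "\<phi> t = integral {-1..t} \<rho>" for t
  have lo: "\<phi> t = 0" if "t < \<alpha>" for t
  proof -
    have "\<phi> t = integral {-1..t} (\<lambda>_. 0)" unfolding \<phi>_def using that by (intro integral_cong off) auto
    then show ?thesis by simp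
  qed
  have hi: "\<phi> t = 0" if "\<beta> < t" for t
  proof -
    obtain B where B: "\<And>x. \<bar>\<rho> x\<bar> \<le> B" "0 \<le> B" by (rule test_function_bounded[OF \<rho>], rule that)
    have "integrable (lebesgue_on {0<..<T}) \<rho>"
      by (rule bounded_integrable_lebesgue_on[OF continuous_measurable_lebesgue_on[OF test_function_continuous[OF \<rho>]] B(1)])
    then have 0: "integral {0<..<T} \<rho> = 0" using zero lebesgue_integral_eq_integral[of "{0<..<T}" \<rho>] by simp
    have "(\<lambda>x. if x \<in> {-1..t} then \<rho> x else 0) = (\<lambda>x. if x \<in> {0<..<T} then \<rho> x else 0)"
    proof
      fix x
      have "x < \<alpha> \<or> \<beta> < x \<or> (x \<in> {-1..t} \<and> x \<in> {0<..<T})" using ab that by auto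
      then show "(if x \<in> {-1..t} then \<rho> x else 0) = (if x \<in> {0<..<T} then \<rho> x else 0)" using off[of x] by auto
    qed
    then have "integral {-1..t} \<rho> = integral {0<..<T} \<rho>"
      using integral_restrict_UNIV[of "{-1..t}" \<rho>] integral_restrict_UNIV[of "{0<..<T}" \<rho>] by simp
    then show ?thesis using 0 by (simp add: \<phi>_def)
  qed
  have D: "(\<phi> has_real_derivative \<rho> t) (at t)" for t
  proof (cases "t < \<alpha>")
    case True
    have "eventually (\<lambda>s. s \<in> {..<\<alpha>}) (nhds t)" by (rule eventually_nhds_in_open) (use True in auto)
    then have "eventually (\<lambda>s. \<phi> s = 0) (nhds t)" by (rule eventually_mono) (use lo in auto)
    then show ?thesis using DERIV_cong_ev[OF refl, of \<phi> "\<lambda>_. 0" t "\<rho> t" 0] off[of t] True by simp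
  next
    case False
    then have "(\<phi> has_real_derivative \<rho> t) (at t within {-1..t+1})"
      unfolding \<phi>_def using ab by (intro integral_has_real_derivative cont) auto
    moreover have "at t within {-1..t+1} = at t" using False ab by (intro at_within_interior) auto
    ultimately show ?thesis by simp
  qed
  have "Ck k \<phi>" for k
  proof (rule Ck_SucD, rule CkI)
    show "(\<phi> has_derivative (\<lambda>h. \<rho> x * h)) (at x)" for x
      using D[of x] by (simp add: has_field_derivative_def)
    show "Ck k (\<lambda>x. \<rho> x * b)" for b by (intro Ck_mult Ck_const test_function_Ck[OF \<rho>])
  qed
  then have "\<phi> \<in> test_functions {0<..<T}"
    by (rule test_functionI[where K = "{\<alpha>..\<beta>}"]) (use ab lo hi in \<open>auto simp: not_le\<close>)
  moreover have "deriv \<phi> = \<rho>" using DERIV_imp_deriv[OF D] by auto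
  ultimately show ?thesis by (rule that)
qed

lemma test_deriv_integral:
  assumes \<phi>: "\<phi> \<in> test_functions {0<..<T}" and s: "s \<in> {0<..<T}"
  shows "(LINT t|lebesgue_on {0<..<T}. (if s \<le> t then deriv \<phi> t else 0)) = - \<phi> s"
proof -
  note d = test_function_real_deriv[OF \<phi>]
  have meas: "(\<lambda>t. (if s \<le> t then deriv \<phi> t else 0)) \<in> borel_measurable (lebesgue_on {0<..<T})"
  proof -
    have "(\<lambda>t. (if s \<le> t then deriv \<phi> t else 0)) \<in> borel_measurable lborel"
      using borel_measurable_continuous_onI[OF d(2)] by measurable
    from measurable_restrict_space1[OF measurable_completion[OF this]] show ?thesis .
  qed
  have "compact (deriv \<phi> ` {0..T})"
    by (rule compact_continuous_image[OF continuous_on_subset[OF d(2)]]) auto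
  then have "bounded (deriv \<phi> ` {0..T})" by (rule compact_imp_bounded)
  then obtain B where B: "\<forall>y\<in>deriv \<phi> ` {0..T}. norm y \<le> B" unfolding bounded_iff by (elim exE)
  have bd: "\<bar>if s \<le> t then deriv \<phi> t else 0\<bar> \<le> max B 0" for t
  proof (cases "t \<in> {0<..<T}")
    case True
    then have "norm (deriv \<phi> t) \<le> B" by (intro bspec[OF B] imageI) auto
    then show ?thesis by auto
  qed (simp add: d(3))
  have "(LINT t|lebesgue_on {0<..<T}. (if s \<le> t then deriv \<phi> t else 0))
      = integral {0<..<T} (\<lambda>t. (if s \<le> t then deriv \<phi> t else 0))"
    by (rule lebesgue_integral_eq_integral[OF bounded_integrable_lebesgue_on[OF meas bd]]) simp
  also have "\<dots> = integral UNIV (\<lambda>t. if t \<in> {0<..<T} then if s \<le> t then deriv \<phi> t else 0 else 0)"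
    by (rule integral_restrict_UNIV[symmetric])
  \<comment> \<open>The open and the closed interval differ at \<open>T\<close> only, where the
    derivative vanishes.\<close>
  also have "(\<lambda>t. if t \<in> {0<..<T} then if s \<le> t then deriv \<phi> t else 0 else 0) = (\<lambda>t. if t \<in> {s..T} then deriv \<phi> t else 0)"
  proof
    fix t show "(if t \<in> {0<..<T} then if s \<le> t then deriv \<phi> t else 0 else 0) = (if t \<in> {s..T} then deriv \<phi> t else 0)"
      using s d(3)[of T] by (cases "t = T") auto
  qed
  also have "integral UNIV \<dots> = integral {s..T} (deriv \<phi>)" by (rule integral_restrict_UNIV)
  also have "\<dots> = \<phi> T - \<phi> s"
  proof (rule integral_unique, rule fundamental_theorem_of_calculus)
    show "(\<phi> has_vector_derivative deriv \<phi> x) (at x within {s..T})" for x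
      using d(1)[of x] by (simp add: has_real_derivative_iff_has_vector_derivative has_vector_derivative_at_within)
  qed (use s in simp)
  finally show ?thesis using d(4)[of T] by simp
qed

text \<open>The argument of du Bois-Reymond. The primitive \<open>A\<close> of \<open>k\<close> has
  weak derivative \<open>k\<close> as well, so \<open>a - A\<close> is orthogonal to all derivatives
  of test functions, that is, to all test functions with mean zero; hence it is constant
  a.e.\<close>

lemma weak_derivative_imp_absolutely_continuous:
  fixes a k :: "real \<Rightarrow> real"
  assumes T: "0 < T" and a: "integrable (lebesgue_on {0<..<T}) a" and k: "integrable (lebesgue_on {0<..<T}) k"
    and weak: "\<And>\<phi>. \<phi> \<in> test_functions {0<..<T} \<Longrightarrow>
      (LINT t|lebesgue_on {0<..<T}. deriv \<phi> t * a t) = - (LINT t|lebesgue_on {0<..<T}. \<phi> t * k t)"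
  obtains c where "AE t in lebesgue_on {0<..<T}. a t = c + (LINT s|lebesgue_on {0<..<T}. (if s \<le> t then k s else 0))"
proof -
  let ?M = "lebesgue_on {0<..<T}"
  define A where "A t = (LINT s|?M. (if s \<le> t then k s else 0))" for t
  interpret F: finite_measure ?M
    using T by (intro finite_measureI) (simp add: emeasure_restrict_space)
  interpret P: pair_sigma_finite ?M ?M ..
  have km: "k \<in> borel_measurable ?M" using k by simp
  have idm: "(\<lambda>x. x) \<in> borel_measurable ?M"
    by (rule continuous_measurable_lebesgue_on) (rule continuous_on_id)
  have fm: "fst \<in> borel_measurable (?M \<Otimes>\<^sub>M ?M)" and sm: "snd \<in> borel_measurable (?M \<Otimes>\<^sub>M ?M)"
    by (rule measurable_compose[OF measurable_fst idm], rule measurable_compose[OF measurable_snd idm])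
  have jm: "(\<lambda>p. if snd p \<le> fst p then k (snd p) else 0) \<in> borel_measurable (?M \<Otimes>\<^sub>M ?M)"
  proof (rule measurable_If)
    show "(\<lambda>p. k (snd p)) \<in> borel_measurable (?M \<Otimes>\<^sub>M ?M)" by (rule measurable_compose[OF measurable_snd km])
    show "{p \<in> space (?M \<Otimes>\<^sub>M ?M). snd p \<le> fst p} \<in> sets (?M \<Otimes>\<^sub>M ?M)"
      by (rule borel_measurable_le[OF sm fm])
  qed simp
  have ki: "integrable ?M (\<lambda>s. (if s \<le> t then k s else 0))" for t
  proof (rule Bochner_Integration.integrable_bound[OF k])
    show "(\<lambda>s. (if s \<le> t then k s else 0)) \<in> borel_measurable ?M"
      using km idm by measurable
  qed auto
  have Am: "A \<in> borel_measurable ?M"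
    unfolding A_def by (rule F.borel_measurable_lebesgue_integral) (use jm in \<open>simp add: case_prod_beta'\<close>)
  have Ab: "\<bar>A t\<bar> \<le> (LINT s|?M. \<bar>k s\<bar>)" for t
  proof -
    have "\<bar>A t\<bar> \<le> (LINT s|?M. norm (if s \<le> t then k s else 0))"
      unfolding A_def real_norm_def[symmetric] by (rule integral_norm_bound)
    also have "\<dots> \<le> (LINT s|?M. \<bar>k s\<bar>)"
      by (intro integral_mono integrable_norm ki integrable_abs k) auto
    finally show ?thesis .
  qed
  have Ai: "integrable ?M A" by (rule bounded_integrable_lebesgue_on[OF Am Ab])
  have mult_int: "integrable ?M (\<lambda>t. \<psi> t * b t)"
    if \<psi>: "\<psi> \<in> borel_measurable ?M" "\<And>t. \<bar>\<psi> t\<bar> \<le> B" and b: "integrable ?M b" for \<psi> b :: "real \<Rightarrow> real" and B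
  proof (rule Bochner_Integration.integrable_bound[of _ "\<lambda>t. B * b t"])
    show "integrable ?M (\<lambda>t. B * b t)" using b by (rule integrable_mult_right)
    show "(\<lambda>t. \<psi> t * b t) \<in> borel_measurable ?M" using \<psi>(1) b by (intro borel_measurable_times) auto
    show "AE t in ?M. norm (\<psi> t * b t) \<le> norm (B * b t)"
    proof (rule AE_I2)
      fix t
      have "\<bar>\<psi> t\<bar> \<le> \<bar>B\<bar>" using \<psi>(2)[of t] by linarith
      then show "norm (\<psi> t * b t) \<le> norm (B * b t)" by (simp add: abs_mult mult_right_mono)
    qed
  qed
  \<comment> \<open>Fubini on the triangle \<open>s \<le> t\<close>: the inner integral of
    \<open>deriv \<phi>\<close> from \<open>s\<close> to \<open>T\<close> is
    \<open>- \<phi> s\<close>.\<close>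
  have weakA: "(LINT t|?M. deriv \<phi> t * A t) = - (LINT t|?M. \<phi> t * k t)" if \<phi>: "\<phi> \<in> test_functions {0<..<T}" for \<phi>
  proof -
    note d = test_function_real_deriv[OF \<phi>]
    have dm: "deriv \<phi> \<in> borel_measurable ?M" by (rule continuous_measurable_lebesgue_on[OF d(2)])
    have "compact (deriv \<phi> ` {0..T})"
      by (rule compact_continuous_image[OF continuous_on_subset[OF d(2)]]) auto
    then have "bounded (deriv \<phi> ` {0..T})" by (rule compact_imp_bounded)
    then obtain B0 where B0: "\<forall>y\<in>deriv \<phi> ` {0..T}. norm y \<le> B0" unfolding bounded_iff by (elim exE)
    define B where "B = max B0 0"
    have B: "\<bar>deriv \<phi> t\<bar> \<le> B" for t
    proof (cases "t \<in> {0<..<T}")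
      case True
      then have "norm (deriv \<phi> t) \<le> B0" by (intro bspec[OF B0] imageI) auto
      then show ?thesis by (auto simp: B_def)
    qed (simp add: d(3) B_def)
    define j where "j t s = deriv \<phi> t * (if s \<le> t then k s else 0)" for t s
    have jm': "case_prod j \<in> borel_measurable (?M \<Otimes>\<^sub>M ?M)"
      unfolding j_def case_prod_beta'
      by (intro borel_measurable_times measurable_compose[OF measurable_fst dm] jm)
    have ji: "integrable ?M (j t)" for t
      unfolding j_def by (rule integrable_mult_right[OF ki])
    have jint: "integrable (?M \<Otimes>\<^sub>M ?M) (case_prod j)"
    proof (rule P.Fubini_integrable[OF jm'])
      show "AE x in ?M. integrable ?M (\<lambda>y. case_prod j (x, y))" using ji by simp
      show "integrable ?M (\<lambda>x. LINT y|?M. norm (case_prod j (x, y)))"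
      proof (rule bounded_integrable_lebesgue_on[where B = "B * (LINT s|?M. \<bar>k s\<bar>)"])
        show "(\<lambda>x. LINT y|?M. norm (case_prod j (x, y))) \<in> borel_measurable ?M"
          by (rule F.borel_measurable_lebesgue_integral)
             (use measurable_compose[OF jm' borel_measurable_norm] in \<open>simp add: case_prod_beta'\<close>)
        fix x
        have "(LINT y|?M. norm (j x y)) \<le> (LINT y|?M. B * \<bar>k y\<bar>)"
        proof (rule integral_mono)
          fix y show "norm (j x y) \<le> B * \<bar>k y\<bar>"
            using B[of x] order_trans[OF abs_ge_zero B[of x]] unfolding j_def
            by (auto simp: abs_mult intro: mult_right_mono)
        qed (intro integrable_norm ji integrable_mult_right integrable_abs k)+
        then show "\<bar>LINT y|?M. norm (case_prod j (x, y))\<bar> \<le> B * (LINT s|?M. \<bar>k s\<bar>)"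
          by (simp add: integral_nonneg_AE)
      qed
    qed
    have "(LINT t|?M. deriv \<phi> t * A t) = (LINT t|?M. LINT s|?M. j t s)"
      unfolding A_def j_def by simp
    also have "\<dots> = (LINT s|?M. LINT t|?M. j t s)"
      by (rule P.Fubini_integral[OF jint, symmetric])
    also have "\<dots> = (LINT s|?M. - (\<phi> s * k s))"
    proof (rule Bochner_Integration.integral_cong[OF refl])
      fix s assume "s \<in> space ?M"
      then have s: "s \<in> {0<..<T}" by simp
      have "(LINT t|?M. j t s) = (LINT t|?M. (if s \<le> t then deriv \<phi> t else 0) * k s)"
        unfolding j_def by (intro Bochner_Integration.integral_cong) auto
      also have "\<dots> = (LINT t|?M. (if s \<le> t then deriv \<phi> t else 0)) * k s" by simp
      also have "\<dots> = - (\<phi> s * k s)" unfolding test_deriv_integral[OF \<phi> s] by simp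
      finally show "(LINT t|?M. j t s) = - (\<phi> s * k s)" .
    qed
    finally show ?thesis by simp
  qed
  define b where "b t = a t - A t" for t
  have bi: "integrable ?M b" unfolding b_def by (intro Bochner_Integration.integrable_diff a Ai)
  have b0: "(LINT t|?M. \<rho> t * b t) = 0" if \<rho>: "\<rho> \<in> test_functions {0<..<T}" and z: "(LINT t|?M. \<rho> t) = 0" for \<rho>
  proof -
    obtain \<phi> where \<phi>: "\<phi> \<in> test_functions {0<..<T}" "deriv \<phi> = \<rho>" by (rule test_antiderivative[OF T \<rho> z], rule that)
    obtain B where B: "\<And>x. \<bar>\<rho> x\<bar> \<le> B" "0 \<le> B" by (rule test_function_bounded[OF \<rho>], rule that)
    have \<rho>m: "\<rho> \<in> borel_measurable ?M" by (rule continuous_measurable_lebesgue_on[OF test_function_continuous[OF \<rho>]])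
    have "(LINT t|?M. \<rho> t * b t) = (LINT t|?M. \<rho> t * a t) - (LINT t|?M. \<rho> t * A t)"
      unfolding b_def right_diff_distrib
      by (rule Bochner_Integration.integral_diff[OF mult_int[OF \<rho>m B(1) a] mult_int[OF \<rho>m B(1) Ai]])
    then show ?thesis using weak[OF \<phi>(1)] weakA[OF \<phi>(1)] \<phi>(2) by simp
  qed
  \<comment> \<open>Treating separately the case that all test functions have mean zero avoids
    exhibiting one with nonzero mean.\<close>
  have "\<exists>c. \<forall>\<eta>\<in>test_functions {0<..<T}. (LINT t|?M. \<eta> t * b t) = c * (LINT t|?M. \<eta> t)"
  proof (cases "\<forall>\<eta>\<in>test_functions {0<..<T}. (LINT t|?M. \<eta> t) = 0")
    case True
    then show ?thesis using b0 by (intro exI[of _ 0]) auto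
  next
    case False
    then obtain \<theta> where \<theta>: "\<theta> \<in> test_functions {0<..<T}" "(LINT t|?M. \<theta> t) \<noteq> 0" by auto
    show ?thesis
    proof (intro exI ballI)
      fix \<eta> assume \<eta>: "\<eta> \<in> test_functions {0<..<T}"
      obtain B where B: "\<And>x. \<bar>\<theta> x\<bar> \<le> B" "0 \<le> B" by (rule test_function_bounded[OF \<theta>(1)], rule that)
      obtain C where C: "\<And>x. \<bar>\<eta> x\<bar> \<le> C" "0 \<le> C" by (rule test_function_bounded[OF \<eta>], rule that)
      have m: "\<theta> \<in> borel_measurable ?M" "\<eta> \<in> borel_measurable ?M"
        by (rule continuous_measurable_lebesgue_on[OF test_function_continuous[OF \<theta>(1)]]
            continuous_measurable_lebesgue_on[OF test_function_continuous[OF \<eta>]])+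
      \<comment> \<open>The multiple of \<open>\<theta>\<close> that corrects the mean of
        \<open>\<eta>\<close> to zero.\<close>
      define r where "r = - (LINT t|?M. \<eta> t) / (LINT t|?M. \<theta> t)"
      note i = bounded_integrable_lebesgue_on[OF m(1) B(1)] bounded_integrable_lebesgue_on[OF m(2) C(1)]
      have "(LINT t|?M. \<eta> t + r * \<theta> t) = (LINT t|?M. \<eta> t) + r * (LINT t|?M. \<theta> t)"
        using Bochner_Integration.integral_add[OF i(2) integrable_mult_right[OF i(1), of r]] by simp
      also have "\<dots> = 0" using \<theta>(2) by (simp add: r_def)
      finally have "(LINT t|?M. (\<eta> t + r * \<theta> t) * b t) = 0"
        by (rule b0[OF test_function_lincomb[OF \<eta> \<theta>(1)]])
      moreover have "(LINT t|?M. (\<eta> t + r * \<theta> t) * b t) = (LINT t|?M. \<eta> t * b t) + r * (LINT t|?M. \<theta> t * b t)"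
        using Bochner_Integration.integral_add[OF mult_int[OF m(2) C(1) bi] integrable_mult_right[OF mult_int[OF m(1) B(1) bi], of r]]
        by (simp add: distrib_right mult.assoc)
      ultimately show "(LINT t|?M. \<eta> t * b t) = ((LINT t|?M. \<theta> t * b t) / (LINT t|?M. \<theta> t)) * (LINT t|?M. \<eta> t)"
        using \<theta>(2) by (simp add: r_def field_simps)
    qed
  qed
  then obtain c where c: "\<forall>\<eta>\<in>test_functions {0<..<T}. (LINT t|?M. \<eta> t * b t) = c * (LINT t|?M. \<eta> t)"
    by (elim exE)
  have "AE t in ?M. b t - c = 0"
  proof (rule fundamental_lemma_variations)
    show "integrable ?M (\<lambda>t. b t - c)" by (intro Bochner_Integration.integrable_diff bi) simp
    fix \<phi> assume \<phi>: "\<phi> \<in> test_functions {0<..<T}"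
    obtain C where C: "\<And>x. \<bar>\<phi> x\<bar> \<le> C" "0 \<le> C" by (rule test_function_bounded[OF \<phi>], rule that)
    have m: "\<phi> \<in> borel_measurable ?M" by (rule continuous_measurable_lebesgue_on[OF test_function_continuous[OF \<phi>]])
    have "(LINT t|?M. (b t - c) * \<phi> t) = (LINT t|?M. \<phi> t * b t - c * \<phi> t)"
      by (simp add: algebra_simps)
    also have "\<dots> = (LINT t|?M. \<phi> t * b t) - c * (LINT t|?M. \<phi> t)"
      using Bochner_Integration.integral_diff[OF mult_int[OF m C(1) bi]
          integrable_mult_right[OF bounded_integrable_lebesgue_on[OF m C(1)], of c]] by simp
    finally show "(LINT t|?M. (b t - c) * \<phi> t) = 0" using bspec[OF c \<phi>] by simp
  qed simp
  then have "AE t in ?M. a t = c + A t" by eventually_elim (simp add: b_def)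
  then show ?thesis unfolding A_def by (rule that)
qed

text \<open>Separability passes to arbitrary subsets in the presence of a countable base: one point
  is picked from each basic set that meets \<open>S\<close>.\<close>

lemma countable_dense_subset:
  fixes S :: "'a::second_countable_topology set"
  obtains D where "countable D" "D \<subseteq> S" "S \<subseteq> closure D"
proof -
  obtain B :: "'a set set" where B: "countable B" "topological_basis B"
    using ex_countable_basis by auto
  define D where "D = (\<lambda>b. SOME x. x \<in> b \<inter> S) ` {b \<in> B. b \<inter> S \<noteq> {}}"
  have pick: "(SOME x. x \<in> b \<inter> S) \<in> b \<inter> S" if "b \<inter> S \<noteq> {}" for b
    by (rule someI_ex) (use that in auto)
  show ?thesis
  proof (rule that[of D])
    show "countable D" unfolding D_def using B(1) by (intro countable_image countable_Collect)
    show "D \<subseteq> S" unfolding D_def using pick by auto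
    show "S \<subseteq> closure D"
    proof
      fix x assume x: "x \<in> S"
      show "x \<in> closure D"
        unfolding closure_iff_nhds_not_empty
      proof (intro allI impI)
        fix A U assume AU: "U \<subseteq> A" "open U" "x \<in> U"
        obtain b where b: "b \<in> B" "x \<in> b" "b \<subseteq> U" by (rule topological_basisE[OF B(2) AU(2,3)], rule that)
        have ne: "b \<inter> S \<noteq> {}" using b(2) x by auto
        have "(SOME x. x \<in> b \<inter> S) \<in> D" unfolding D_def using b(1) ne by auto
        moreover have "(SOME x. x \<in> b \<inter> S) \<in> A" using pick[OF ne] b(3) AU(1) by auto
        ultimately show "D \<inter> A \<noteq> {}" by auto
      qed
    qed
  qed
qed

section \<open>Time increments and weak-star continuity\<close>

context bounded_open_domain
begin

lemma has_time_derivD: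
  assumes "has_time_deriv \<Omega> \<Gamma>D T u g"
  shows "(\<lambda>t. ip (u t)) \<in> L1_predual \<Omega> \<Gamma>D T" "g \<in> L1_predual \<Omega> \<Gamma>D T"
    "\<phi> \<in> test_functions {0<..<T} \<Longrightarrow> w \<in> V \<Longrightarrow>
      (LINT t|MI. deriv \<phi> t * ip (u t) w) = - (LINT t|MI. \<phi> t * g t w)"
  using assms by (simp_all add: has_time_deriv_def)

text \<open>The exceptional null set of times must not depend on \<open>w\<close>. Up to null sets, \<open>u\<close> and \<open>g\<close> are limits
  of simple functions, hence only countably many functionals \<open>F j\<close> matter, and on bounded sets every
  \<open>w\<close> is a limit, in the sense of all the \<open>F j\<close>, of elements of a countable set.\<close>

lemma countable_approximation:
  fixes F :: "nat \<Rightarrow> ('a \<Rightarrow> real) \<Rightarrow> real"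
  obtains C where "countable C" "C \<subseteq> V"
    "\<And>w. w \<in> V \<Longrightarrow> \<exists>B c. (\<forall>i. c i \<in> C \<and> V_norm \<Omega> (c i) \<le> B) \<and> V_norm \<Omega> w \<le> B \<and> (\<forall>j. (\<lambda>i. F j (c i)) \<longlonglongrightarrow> F j w)"
proof -
  \<comment> \<open>The target is a countable product of lines: it has a countable base, and
    convergence in it means convergence of every \<open>F j\<close>.\<close>
  define \<Phi> where "\<Phi> w = (\<lambda>j. F j w)" for w
  \<comment> \<open>Separate dense sets for the balls keep the approximants of \<open>w\<close>
    bounded in \<open>V\<close>.\<close>
  define B where "B m = {w \<in> V. V_norm \<Omega> w \<le> real m}" for m
  have "\<exists>C. countable C \<and> C \<subseteq> B m \<and> \<Phi> ` B m \<subseteq> closure (\<Phi> ` C)" for m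
  proof -
    obtain D where D: "countable D" "D \<subseteq> \<Phi> ` B m" "\<Phi> ` B m \<subseteq> closure D"
      by (rule countable_dense_subset[of "\<Phi> ` B m"], rule that)
    then obtain C where "countable C" "C \<subseteq> B m" "D = \<Phi> ` C"
      using countable_subset_image[of D \<Phi> "B m"] by auto
    then show ?thesis using D(3) by (intro exI[of _ C]) simp
  qed
  then obtain C where C': "\<forall>m. countable (C m) \<and> C m \<subseteq> B m \<and> \<Phi> ` B m \<subseteq> closure (\<Phi> ` C m)"
    using choice[of "\<lambda>m C. countable C \<and> C \<subseteq> B m \<and> \<Phi> ` B m \<subseteq> closure (\<Phi> ` C)"] by auto
  then have C: "countable (C m)" "C m \<subseteq> B m" "\<Phi> ` B m \<subseteq> closure (\<Phi> ` C m)" for m by simp_all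
  show ?thesis
  proof (rule that[of "\<Union>m. C m"])
    show "countable (\<Union>m. C m)" by (intro countable_UN C(1)) simp
    show "(\<Union>m. C m) \<subseteq> V" using C(2) unfolding B_def by blast
    fix w assume w: "w \<in> V"
    obtain m where m: "V_norm \<Omega> w \<le> real m" using real_arch_simple by auto
    then have "\<Phi> w \<in> closure (\<Phi> ` C m)" using C(3)[of m] w unfolding B_def by auto
    then obtain x where x: "\<forall>n. x n \<in> \<Phi> ` C m" "x \<longlonglongrightarrow> \<Phi> w" unfolding closure_sequential by auto
    then have "\<forall>n. \<exists>c. c \<in> C m \<and> x n = \<Phi> c" by auto
    then obtain c where c: "\<forall>n. c n \<in> C m \<and> x n = \<Phi> (c n)" using choice[of "\<lambda>n c. c \<in> C m \<and> x n = \<Phi> c"] by auto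
    have "(\<lambda>i. F j (c i)) \<longlonglongrightarrow> F j w" for j
    proof -
      have "isCont (\<lambda>f :: nat \<Rightarrow> real. f j) (\<Phi> w)"
        by (rule bspec[OF iffD1[OF continuous_on_eq_continuous_at[OF open_UNIV] continuous_on_product_coordinates] UNIV_I])
      from isCont_tendsto_compose[OF this x(2)] have "(\<lambda>i. x i j) \<longlonglongrightarrow> \<Phi> w j" .
      moreover have "x i j = F j (c i)" for i using c by (simp add: \<Phi>_def)
      ultimately show ?thesis by (simp add: \<Phi>_def)
    qed
    moreover have "c i \<in> (\<Union>m. C m)" "V_norm \<Omega> (c i) \<le> real m" for i
      using c C(2)[of m] unfolding B_def by auto
    ultimately show "\<exists>B c. (\<forall>i. c i \<in> (\<Union>m. C m) \<and> V_norm \<Omega> (c i) \<le> B) \<and> V_norm \<Omega> w \<le> B \<and> (\<forall>j. (\<lambda>i. F j (c i)) \<longlonglongrightarrow> F j w)"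
      using m by (intro exI[of _ "real m"] exI[of _ c]) simp
  qed
qed

lemma predual_simple_in: "predual_simple \<Omega> \<Gamma>D T s \<Longrightarrow> t \<in> {0<..<T} \<Longrightarrow> s t \<in> predual \<Omega> \<Gamma>D"
  unfolding predual_simple_def by blast

lemma predual_simple_finite: "predual_simple \<Omega> \<Gamma>D T s \<Longrightarrow> finite (s ` {0<..<T})"
  unfolding predual_simple_def by blast

lemma indicator_MI: "(indicator {a<..b} :: real \<Rightarrow> real) \<in> borel_measurable MI"
proof -
  have "(indicator {a<..b} :: real \<Rightarrow> real) \<in> borel_measurable lborel"
    by (rule borel_measurable_indicator) simp
  from measurable_restrict_space1[OF measurable_completion[OF this]] show ?thesis .
qed

lemma integrable_indicator_MI:
  fixes f :: "real \<Rightarrow> real"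
  assumes f: "integrable MI f" shows "integrable MI (\<lambda>t. indicator {a<..b} t * f t)"
proof (rule Bochner_Integration.integrable_bound[OF f])
  show "(\<lambda>t. indicator {a<..b} t * f t) \<in> borel_measurable MI"
    by (rule borel_measurable_times[OF indicator_MI borel_measurable_integrable[OF f]])
  show "AE t in MI. norm (indicator {a<..b} t * f t) \<le> norm (f t)"
    by (rule AE_I2) (simp add: indicator_def)
qed

text \<open>For each \<open>w\<close> in a countable set the scalar result makes the pairing
  absolutely continuous, with one common null set of times. Both sides then pass to the limit along
  approximants of an arbitrary \<open>w\<close>: the left side at every time in \<open>G\<close>,
  the right side by dominated convergence.\<close>

lemma time_increment:
  assumes u: "has_time_deriv \<Omega> \<Gamma>D T u g"
  obtains G where "AE t in MI. t \<in> G" "G \<subseteq> {0<..<T}"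
    "\<And>t1 t2 w. t1 \<in> G \<Longrightarrow> t2 \<in> G \<Longrightarrow> t1 \<le> t2 \<Longrightarrow> w \<in> V \<Longrightarrow>
      ip (u t2) w - ip (u t1) w = (LINT \<tau>|MI. indicator {t1<..t2} \<tau> * g \<tau> w)"
proof -
  define D where "D t = ip (u t)" for t
  note ud = has_time_derivD[OF u]
  have DL: "D \<in> L1_predual \<Omega> \<Gamma>D T" using ud(1) by (simp add: D_def[abs_def])
  note gL = ud(2)
  obtain sD where sD: "\<And>n. predual_simple \<Omega> \<Gamma>D T (sD n)"
    and limD: "AE t in MI. (\<lambda>n. predual_norm \<Omega> \<Gamma>D (\<lambda>w. D t w - sD n t w)) \<longlonglongrightarrow> 0"
    by (rule L1_predual_approx[OF DL], rule that)
  obtain sg where sg: "\<And>n. predual_simple \<Omega> \<Gamma>D T (sg n)"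
    and limg: "AE t in MI. (\<lambda>n. predual_norm \<Omega> \<Gamma>D (\<lambda>w. g t w - sg n t w)) \<longlonglongrightarrow> 0"
    by (rule L1_predual_approx[OF gL], rule that)
  \<comment> \<open>All functionals taken as values by the simple approximations of the pairing with
    \<open>u\<close> and of \<open>g\<close>; finitely many for each index.\<close>
  define Fam where "Fam = (\<Union>n. sD n ` {0<..<T}) \<union> (\<Union>n. sg n ` {0<..<T})"
  have "countable (sD n ` {0<..<T})" "countable (sg n ` {0<..<T})" for n
    by (rule countable_finite[OF predual_simple_finite[OF sD]], rule countable_finite[OF predual_simple_finite[OF sg]])
  then have cF: "countable Fam" unfolding Fam_def by (intro countable_Un countable_UN) simp_all
  have FamI: "sD n t \<in> Fam" "sg n t \<in> Fam" if "t \<in> {0<..<T}" for n t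
    unfolding Fam_def by (rule UnI1, rule UN_I[of n], rule UNIV_I, rule imageI[OF that],
        rule UnI2, rule UN_I[of n], rule UNIV_I, rule imageI[OF that])
  have "sD 0 (T/2) \<in> Fam" by (rule FamI(1)) (use T_pos in simp)
  then have neF: "Fam \<noteq> {}" by auto
  define F where "F = from_nat_into Fam"
  have F: "\<exists>j. F j = f" if "f \<in> Fam" for f
  proof -
    have "f \<in> range F" unfolding F_def range_from_nat_into[OF neF cF] by (rule that)
    then show ?thesis by auto
  qed
  obtain C where C: "countable C" "C \<subseteq> V"
    "\<And>w. w \<in> V \<Longrightarrow> \<exists>B c. (\<forall>i. c i \<in> C \<and> V_norm \<Omega> (c i) \<le> B) \<and> V_norm \<Omega> w \<le> B \<and> (\<forall>j. (\<lambda>i. F j (c i)) \<longlonglongrightarrow> F j w)"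
    by (rule countable_approximation[of F], rule that)
  define A where "A w t = (LINT s|MI. (if s \<le> t then g s w else 0))" for w t
  have "\<exists>c. AE t in MI. D t w = c + A w t" if w: "w \<in> V" for w
  proof -
    note i1 = L1_predual_apply_const_integrable[OF DL w] and i2 = L1_predual_apply_const_integrable[OF gL w]
    have wk: "(LINT t|MI. deriv \<phi> t * D t w) = - (LINT t|MI. \<phi> t * g t w)" if "\<phi> \<in> test_functions {0<..<T}" for \<phi>
      unfolding D_def by (rule ud(3)[OF that w])
    show ?thesis unfolding A_def
      by (rule weak_derivative_imp_absolutely_continuous[OF T_pos i1 i2 wk], assumption, erule exI)
  qed
  then have "\<forall>w. \<exists>c. w \<in> V \<longrightarrow> (AE t in MI. D t w = c + A w t)" by blast
  from choice[OF this] obtain c where c: "\<forall>w. w \<in> V \<longrightarrow> (AE t in MI. D t w = c w + A w t)"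
    by (elim exE)
  \<comment> \<open>Convergence of the simple approximations at \<open>t\<close> is recorded as
    well, since it is what extends the formula from \<open>C\<close> to \<open>V\<close> at that
    time.\<close>
  define G where "G = {t \<in> {0<..<T}. (\<forall>w\<in>C. D t w = c w + A w t)
    \<and> (\<lambda>n. predual_norm \<Omega> \<Gamma>D (\<lambda>w. D t w - sD n t w)) \<longlonglongrightarrow> 0}"
  show ?thesis
  proof (rule that[of G])
    have "AE t in MI. \<forall>w\<in>C. D t w = c w + A w t"
    proof (rule AE_ball_countable'[OF _ C(1)])
      fix w assume "w \<in> C"
      then show "AE t in MI. D t w = c w + A w t" using c C(2) by blast
    qed
    with limD AE_MI_in show "AE t in MI. t \<in> G" by eventually_elim (unfold G_def, blast)
    show "G \<subseteq> {0<..<T}" by (auto simp: G_def)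
    fix t1 t2 w assume t: "t1 \<in> G" "t2 \<in> G" "t1 \<le> t2" and w: "w \<in> V"
    obtain B d where d: "\<forall>i. d i \<in> C \<and> V_norm \<Omega> (d i) \<le> B" and wB: "V_norm \<Omega> w \<le> B"
      and Fd: "\<forall>j. (\<lambda>i. F j (d i)) \<longlonglongrightarrow> F j w" using C(3)[OF w] by (elim exE conjE)
    have dC: "d i \<in> C" and dV: "d i \<in> V" and dB: "V_norm \<Omega> (d i) \<le> B" for i using d C(2) by auto
    have Fam: "(\<lambda>i. f (d i)) \<longlonglongrightarrow> f w" if fF: "f \<in> Fam" for f
    proof -
      obtain j where "F j = f" using F[OF fF] by (elim exE)
      then show ?thesis using spec[OF Fd, of j] by simp
    qed
    have limDt: "(\<lambda>i. D s (d i)) \<longlonglongrightarrow> D s w" if s: "s \<in> G" for s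
    proof (rule predual_seq_tendsto[OF _ _ _ dV dB w wB])
      have sI: "s \<in> {0<..<T}" using s by (simp add: G_def)
      show "D s \<in> predual \<Omega> \<Gamma>D" by (rule L1_predual_in[OF DL sI])
      show "sD n s \<in> predual \<Omega> \<Gamma>D" for n by (rule predual_simple_in[OF sD sI])
      show "(\<lambda>n. predual_norm \<Omega> \<Gamma>D (\<lambda>w. D s w - sD n s w)) \<longlonglongrightarrow> 0" using s by (simp add: G_def)
      show "(\<lambda>i. sD n s (d i)) \<longlonglongrightarrow> sD n s w" for n
        by (rule Fam[OF FamI(1)[OF sI]])
    qed
    have inc: "D t2 (d i) - D t1 (d i) = (LINT \<tau>|MI. indicator {t1<..t2} \<tau> * g \<tau> (d i))" for i
    proof -
      have gi: "integrable MI (\<lambda>s. g s (d i))" by (rule L1_predual_apply_const_integrable[OF gL dV])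
      have ci: "integrable MI (\<lambda>s. (if s \<le> r then g s (d i) else 0))" for r
      proof -
        have eq: "(if s \<le> r then g s (d i) else 0) = indicator {0<..r} s * g s (d i)" if "s \<in> space MI" for s
          using that by (auto simp: indicator_def)
        show ?thesis
          by (rule iffD2[OF Bochner_Integration.integrable_cong[OF refl eq] integrable_indicator_MI[OF gi]])
      qed
      have "D t2 (d i) - D t1 (d i) = A (d i) t2 - A (d i) t1"
        using t dC[of i] by (simp add: G_def)
      also have "\<dots> = (LINT s|MI. (if s \<le> t2 then g s (d i) else 0) - (if s \<le> t1 then g s (d i) else 0))"
        unfolding A_def by (rule Bochner_Integration.integral_diff[OF ci ci, symmetric])
      also have "\<dots> = (LINT \<tau>|MI. indicator {t1<..t2} \<tau> * g \<tau> (d i))"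
        using t(3) by (intro Bochner_Integration.integral_cong) (auto simp: indicator_def)
      finally show ?thesis .
    qed
    have "(\<lambda>i. LINT \<tau>|MI. indicator {t1<..t2} \<tau> * g \<tau> (d i)) \<longlonglongrightarrow> (LINT \<tau>|MI. indicator {t1<..t2} \<tau> * g \<tau> w)"
    proof (rule integral_dominated_convergence[where w = "\<lambda>\<tau>. predual_norm \<Omega> \<Gamma>D (g \<tau>) * B"])
      show "integrable MI (\<lambda>\<tau>. predual_norm \<Omega> \<Gamma>D (g \<tau>) * B)"
        by (rule integrable_mult_left[OF L1_predual_norm_int[OF gL]])
      show "(\<lambda>\<tau>. indicator {t1<..t2} \<tau> * g \<tau> w) \<in> borel_measurable MI"
        by (rule borel_measurable_integrable[OF integrable_indicator_MI[OF L1_predual_apply_const_integrable[OF gL w]]])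
      show "(\<lambda>\<tau>. indicator {t1<..t2} \<tau> * g \<tau> (d i)) \<in> borel_measurable MI" for i
        by (rule borel_measurable_integrable[OF integrable_indicator_MI[OF L1_predual_apply_const_integrable[OF gL dV]]])
      show "AE \<tau> in MI. (\<lambda>i. indicator {t1<..t2} \<tau> * g \<tau> (d i)) \<longlonglongrightarrow> indicator {t1<..t2} \<tau> * g \<tau> w"
        using limg AE_MI_in
      proof eventually_elim
        case (elim \<tau>)
        have "(\<lambda>i. g \<tau> (d i)) \<longlonglongrightarrow> g \<tau> w"
        proof (rule predual_seq_tendsto[OF _ _ elim(1) dV dB w wB])
          show "g \<tau> \<in> predual \<Omega> \<Gamma>D" by (rule L1_predual_in[OF gL elim(2)])
          show "sg n \<tau> \<in> predual \<Omega> \<Gamma>D" for n by (rule predual_simple_in[OF sg elim(2)])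
          show "(\<lambda>i. sg n \<tau> (d i)) \<longlonglongrightarrow> sg n \<tau> w" for n
            by (rule Fam[OF FamI(2)[OF elim(2)]])
        qed
        then show ?case by (rule tendsto_mult_left)
      qed
      show "AE \<tau> in MI. norm (indicator {t1<..t2} \<tau> * g \<tau> (d i)) \<le> predual_norm \<Omega> \<Gamma>D (g \<tau>) * B" for i
        using AE_MI_in
      proof eventually_elim
        case (elim \<tau>)
        have gp: "g \<tau> \<in> predual \<Omega> \<Gamma>D" by (rule L1_predual_in[OF gL elim])
        have "norm (indicator {t1<..t2} \<tau> * g \<tau> (d i)) \<le> \<bar>g \<tau> (d i)\<bar>" by (simp add: indicator_def)
        also have "\<dots> \<le> predual_norm \<Omega> \<Gamma>D (g \<tau>) * V_norm \<Omega> (d i)" by (rule predual_le[OF gp dV])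
        also have "\<dots> \<le> predual_norm \<Omega> \<Gamma>D (g \<tau>) * B" by (rule mult_left_mono[OF dB predual_norm_nonneg[OF gp]])
        finally show ?case .
      qed
    qed
    then have "(\<lambda>i. D t2 (d i) - D t1 (d i)) \<longlonglongrightarrow> (LINT \<tau>|MI. indicator {t1<..t2} \<tau> * g \<tau> w)"
      unfolding inc .
    from LIMSEQ_unique[OF tendsto_diff[OF limDt[OF t(2)] limDt[OF t(1)]] this]
    have "D t2 w - D t1 w = (LINT \<tau>|MI. indicator {t1<..t2} \<tau> * g \<tau> w)" .
    then show "ip (u t2) w - ip (u t1) w = (LINT \<tau>|MI. indicator {t1<..t2} \<tau> * g \<tau> w)" by (simp add: D_def)
  qed
qed

text \<open>The differences of gradients are bounded and, paired with a test function, can be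
  integrated by parts, so convergence of the functions in \<open>L\<^sup>1\<close> suffices there.
  \<open>weak_null_of_test_null\<close> extends this, component by component, to the integrable
  field that represents \<open>F\<close>.\<close>

lemma predual_tendsto_of_L1:
  assumes F: "F \<in> predual \<Omega> \<Gamma>D" and w: "\<And>n. w n \<in> V" "\<And>n. V_norm \<Omega> (w n) \<le> B" and v: "v \<in> V" "V_norm \<Omega> v \<le> B"
    and lim: "(\<lambda>n. LINT x|M. \<bar>w n x - v x\<bar>) \<longlonglongrightarrow> 0"
  shows "(\<lambda>n. F (w n)) \<longlonglongrightarrow> F v"
proof -
  obtain y where yi: "integrable M y" and Fy: "\<And>w. w \<in> V \<Longrightarrow> F w = (LINT x|M. y x \<bullet> grad \<Omega> w x)"
    using F unfolding predual_def predual_coset_def by blast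
  define h where "h b n x = (grad \<Omega> (w n) x - grad \<Omega> v x) \<bullet> b" for b n x
  have gm: "grad \<Omega> (w n) \<in> borel_measurable M" "grad \<Omega> v \<in> borel_measurable M" for n
    by (rule Linf_measurable[OF grad_Linf[OF w(1)]], rule Linf_measurable[OF grad_Linf[OF v(1)]])
  have hm: "h b n \<in> borel_measurable M" for b n unfolding h_def using gm(1)[of n] gm(2) by measurable
  have hb: "AE x in M. \<bar>h b n x\<bar> \<le> 2 * B" if b: "b \<in> Basis" for b n
    using AE_grad_le[OF w(1)[of n]] AE_grad_le[OF v(1)]
  proof eventually_elim
    case (elim x)
    have "\<bar>h b n x\<bar> \<le> norm (grad \<Omega> (w n) x - grad \<Omega> v x)" unfolding h_def by (rule Basis_le_norm[OF b])
    also have "\<dots> \<le> norm (grad \<Omega> (w n) x) + norm (grad \<Omega> v x)" by (rule norm_triangle_ineq4)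
    finally show ?case using elim w(2)[of n] v(2) by linarith
  qed
  have test: "(\<lambda>n. LINT x|M. h b n x * \<phi> x) \<longlonglongrightarrow> 0" if b: "b \<in> Basis" and \<phi>: "\<phi> \<in> test_functions \<Omega>" for b \<phi>
  proof -
    \<comment> \<open>The partial derivative that receives the gradient after integration by parts;
      it is again a test function and therefore bounded.\<close>
    define \<psi> where "\<psi> x = frechet_derivative \<phi> (at x) b" for x
    obtain P where P: "\<And>x. \<bar>\<phi> x\<bar> \<le> P" "0 \<le> P" by (rule test_function_bounded[OF \<phi>], rule that)
    have "Ck k \<psi>" for k unfolding \<psi>_def by (rule Ck_deriv(2)[OF test_function_Ck[OF \<phi>] b])
    moreover have "\<psi> x = 0" if x: "x \<notin> closure {x. \<phi> x \<noteq> 0}" for x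
    proof -
      have "eventually (\<lambda>s. s \<in> - closure {x. \<phi> x \<noteq> 0}) (nhds x)"
        by (rule eventually_nhds_in_open) (use x in auto)
      then have "eventually (\<lambda>s. \<phi> s = 0) (nhds x)"
        by (rule eventually_mono) (intro zero_off_support[of _ \<phi>], simp)
      then have ev: "eventually (\<lambda>s. (0::real) = \<phi> s) (at x within UNIV)"
        using eventually_nhds_x_imp_x by (auto simp: eventually_at_filter elim: eventually_mono)
      have "(\<phi> has_derivative (\<lambda>_. 0)) (at x)"
        by (rule has_derivative_transform_eventually[OF has_derivative_const[of 0] ev])
           (use zero_off_support[OF x] in simp_all)
      then have "frechet_derivative \<phi> (at x) = (\<lambda>_. 0)" by (rule frechet_derivative_at[symmetric])
      then show ?thesis by (simp add: \<psi>_def)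
    qed
    ultimately have \<psi>: "\<psi> \<in> test_functions \<Omega>"
      by (intro test_functionI[where K = "closure {x. \<phi> x \<noteq> 0}"] test_function_compact[OF \<phi>] test_function_support[OF \<phi>])
    obtain R where R: "\<And>x. \<bar>\<psi> x\<bar> \<le> R" "0 \<le> R" by (rule test_function_bounded[OF \<psi>], rule that)
    have \<phi>m: "\<phi> \<in> borel_measurable M" "\<psi> \<in> borel_measurable M"
      by (rule continuous_measurable_lebesgue_on[OF test_function_continuous[OF \<phi>]],
          rule continuous_measurable_lebesgue_on[OF test_function_continuous[OF \<psi>]])
    have Linf_int: "integrable M (\<lambda>x. q x * p x)" if q: "q \<in> Linf M" and p: "p \<in> borel_measurable M" "\<And>x. \<bar>p x\<bar> \<le> K" for q p :: "'a \<Rightarrow> real" and K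
    proof -
      have "integrable M p"
        by (rule finite_measure.integrable_const_bound[OF finite_M, of _ K]) (use p in auto)
      from integrable_inner_Linf[OF this q] show ?thesis by (simp add: mult.commute)
    qed
    have gL: "(\<lambda>x. grad \<Omega> w x \<bullet> b) \<in> Linf M" if "w \<in> V" for w
    proof (rule LinfI[of _ _ "V_norm \<Omega> w"])
      show "(\<lambda>x. grad \<Omega> w x \<bullet> b) \<in> borel_measurable M"
        using Linf_measurable[OF grad_Linf[OF that]] by measurable
      show "AE x in M. norm (grad \<Omega> w x \<bullet> b) \<le> V_norm \<Omega> w"
        using AE_grad_le[OF that]
      proof eventually_elim
        case (elim x)
        then show ?case using Basis_le_norm[OF b, of "grad \<Omega> w x"] by simp
      qed
    qed
    have wg: "(LINT x|M. (grad \<Omega> w x \<bullet> b) * \<phi> x) = - (LINT x|M. w x * \<psi> x)" if "w \<in> V" for w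
      using weak_gradient_grad[OF that] \<phi> b by (simp add: weak_gradient_def \<psi>_def)
    have eq: "(LINT x|M. h b n x * \<phi> x) = - (LINT x|M. (w n x - v x) * \<psi> x)" for n
    proof -
      have "(LINT x|M. h b n x * \<phi> x) = (LINT x|M. (grad \<Omega> (w n) x \<bullet> b) * \<phi> x) - (LINT x|M. (grad \<Omega> v x \<bullet> b) * \<phi> x)"
        unfolding h_def inner_diff_left left_diff_distrib
        by (rule Bochner_Integration.integral_diff[OF Linf_int[OF gL[OF w(1)] \<phi>m(1) P(1)] Linf_int[OF gL[OF v(1)] \<phi>m(1) P(1)]])
      also have "\<dots> = - ((LINT x|M. w n x * \<psi> x) - (LINT x|M. v x * \<psi> x))"
        unfolding wg[OF w(1)] wg[OF v(1)] by simp
      also have "(LINT x|M. w n x * \<psi> x) - (LINT x|M. v x * \<psi> x) = (LINT x|M. (w n x - v x) * \<psi> x)"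
        unfolding left_diff_distrib
        by (rule Bochner_Integration.integral_diff[symmetric, OF Linf_int[OF V_Linf[OF w(1)] \<phi>m(2) R(1)] Linf_int[OF V_Linf[OF v(1)] \<phi>m(2) R(1)]])
      finally show ?thesis .
    qed
    have wv: "(\<lambda>x. w n x - v x) \<in> Linf M" for n by (rule Linf_diff[OF V_Linf[OF w(1)] V_Linf[OF v(1)]])
    have bound: "norm (LINT x|M. h b n x * \<phi> x) \<le> R * (LINT x|M. \<bar>w n x - v x\<bar>)" for n
    proof -
      have "norm (LINT x|M. h b n x * \<phi> x) = norm (LINT x|M. (w n x - v x) * \<psi> x)" unfolding eq by simp
      also have "\<dots> \<le> (LINT x|M. norm ((w n x - v x) * \<psi> x))" by (rule integral_norm_bound)
      also have "\<dots> \<le> (LINT x|M. R * \<bar>w n x - v x\<bar>)"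
      proof (rule integral_mono)
        show "integrable M (\<lambda>x. norm ((w n x - v x) * \<psi> x))"
          by (rule integrable_norm[OF Linf_int[OF wv \<phi>m(2) R(1)]])
        show "integrable M (\<lambda>x. R * \<bar>w n x - v x\<bar>)"
          using Linf_int[OF wv, of "\<lambda>_. 1" 1 n] by (intro integrable_mult_right integrable_abs) simp
        show "norm ((w n x - v x) * \<psi> x) \<le> R * \<bar>w n x - v x\<bar>" for x
          using mult_right_mono[OF R(1)[of x], of "\<bar>w n x - v x\<bar>"] by (simp add: abs_mult mult.commute)
      qed
      finally show ?thesis by simp
    qed
    show ?thesis
      by (rule Lim_null_comparison[OF always_eventually[OF allI[OF bound]] tendsto_mult_right_zero[OF lim]])
  qed
  have yb: "integrable M (\<lambda>x. y x \<bullet> b)" for b by (rule integrable_inner_left[OF yi])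
  have "(\<lambda>n. \<Sum>b\<in>Basis. LINT x|M. h b n x * (y x \<bullet> b)) \<longlonglongrightarrow> (\<Sum>b\<in>(Basis::'a set). 0)"
  proof (rule tendsto_sum)
    fix b :: 'a assume b: "b \<in> Basis"
    show "(\<lambda>n. LINT x|M. h b n x * (y x \<bullet> b)) \<longlonglongrightarrow> 0"
      by (rule weak_null_of_test_null[OF open_\<Omega> \<Omega>_lebesgue(2) hm hb[OF b] test[OF b] yb])
  qed
  moreover have "(\<Sum>b\<in>Basis. LINT x|M. h b n x * (y x \<bullet> b)) = F (w n) - F v" for n
  proof -
    have "(\<Sum>b\<in>Basis. LINT x|M. h b n x * (y x \<bullet> b)) = (LINT x|M. (\<Sum>b\<in>Basis. h b n x * (y x \<bullet> b)))"
    proof (rule Bochner_Integration.integral_sum[symmetric])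
      fix b :: 'a assume b: "b \<in> Basis"
      have "(\<lambda>x. h b n x) \<in> Linf M" by (rule LinfI[OF hm]) (use hb[OF b] in simp)
      from integrable_inner_Linf[OF yb this] show "integrable M (\<lambda>x. h b n x * (y x \<bullet> b))"
        by (simp add: mult.commute)
    qed
    also have "\<dots> = (LINT x|M. y x \<bullet> grad \<Omega> (w n) x - y x \<bullet> grad \<Omega> v x)"
    proof -
      have "(\<Sum>b\<in>Basis. h b n x * (y x \<bullet> b)) = y x \<bullet> grad \<Omega> (w n) x - y x \<bullet> grad \<Omega> v x" for x
        unfolding h_def euclidean_inner[symmetric] inner_commute[of _ "y x"] inner_diff_right by (rule refl)
      then show ?thesis by (simp only:)
    qed
    also have "\<dots> = F (w n) - F v"
      unfolding Fy[OF w(1)] Fy[OF v(1)]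
      by (rule Bochner_Integration.integral_diff[OF integrable_inner_Linf[OF yi grad_Linf[OF w(1)]] integrable_inner_Linf[OF yi grad_Linf[OF v(1)]]])
    finally show ?thesis .
  qed
  ultimately have "(\<lambda>n. F (w n) - F v) \<longlonglongrightarrow> 0" by simp
  then show ?thesis by (rule LIM_zero_cancel)
qed

end

section \<open>Square integrable functions\<close>

lemma L2D:
  fixes p :: "'a \<Rightarrow> real"
  assumes "p \<in> L2 M" shows "p \<in> borel_measurable M" "integrable M (\<lambda>x. (p x)\<^sup>2)"
  using assms by (simp_all add: L2_def)

lemma L2I:
  fixes p :: "'a \<Rightarrow> real"
  shows "p \<in> borel_measurable M \<Longrightarrow> integrable M (\<lambda>x. (p x)\<^sup>2) \<Longrightarrow> p \<in> L2 M"
  by (simp add: L2_def)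

lemma L2_mult_integrable:
  fixes p q :: "'a \<Rightarrow> real"
  assumes "p \<in> L2 M" "q \<in> L2 M" shows "integrable M (\<lambda>x. p x * q x)"
proof (rule Bochner_Integration.integrable_bound[OF Bochner_Integration.integrable_add[OF L2D(2)[OF assms(1)] L2D(2)[OF assms(2)]]])
  show "(\<lambda>x. p x * q x) \<in> borel_measurable M"
    by (rule borel_measurable_times[OF L2D(1)[OF assms(1)] L2D(1)[OF assms(2)]])
  show "AE x in M. norm (p x * q x) \<le> norm ((p x)\<^sup>2 + (q x)\<^sup>2)"
  proof (rule AE_I2)
    fix x
    have "2 * \<bar>p x\<bar> * \<bar>q x\<bar> \<le> \<bar>p x\<bar>\<^sup>2 + \<bar>q x\<bar>\<^sup>2" by (rule sum_squares_bound)
    moreover have "0 \<le> \<bar>p x\<bar> * \<bar>q x\<bar>" by simp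
    moreover have "norm ((p x)\<^sup>2 + (q x)\<^sup>2) = \<bar>p x\<bar>\<^sup>2 + \<bar>q x\<bar>\<^sup>2" by simp
    ultimately show "norm (p x * q x) \<le> norm ((p x)\<^sup>2 + (q x)\<^sup>2)"
      unfolding real_norm_def abs_mult by linarith
  qed
qed

lemma L2_diff:
  fixes p q :: "'a \<Rightarrow> real"
  assumes "p \<in> L2 M" "q \<in> L2 M" shows "(\<lambda>x. p x - q x) \<in> L2 M"
proof (rule L2I)
  show "(\<lambda>x. p x - q x) \<in> borel_measurable M"
    by (rule borel_measurable_diff[OF L2D(1)[OF assms(1)] L2D(1)[OF assms(2)]])
  have "integrable M (\<lambda>x. (p x)\<^sup>2 + (q x)\<^sup>2 - 2 * (p x * q x))"
    by (intro Bochner_Integration.integrable_diff Bochner_Integration.integrable_add integrable_mult_right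
        L2D(2) L2_mult_integrable assms)
  then show "integrable M (\<lambda>x. (p x - q x)\<^sup>2)" by (simp add: power2_diff mult.assoc)
qed

lemma L2_Cauchy_Schwarz:
  fixes p q :: "'a \<Rightarrow> real"
  assumes p: "p \<in> L2 M" and q: "q \<in> L2 M"
  shows "(LINT x|M. p x * q x)\<^sup>2 \<le> (LINT x|M. (p x)\<^sup>2) * (LINT x|M. (q x)\<^sup>2)"
proof -
  define A B C where "A = (LINT x|M. (p x)\<^sup>2)" and "B = (LINT x|M. (q x)\<^sup>2)" and "C = (LINT x|M. p x * q x)"
  note i = L2D(2)[OF p] L2D(2)[OF q] L2_mult_integrable[OF p q]
  have B0: "0 \<le> B" unfolding B_def by (intro integral_nonneg_AE) simp
  show ?thesis
  proof (cases "B = 0")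
    case True
    then have "AE x in M. (q x)\<^sup>2 = 0"
      using integral_nonneg_eq_0_iff_AE[OF i(2)] by (simp add: B_def)
    then have ae: "AE x in M. p x * q x = 0" by eventually_elim simp
    have "C = (LINT x|M. 0)" unfolding C_def
      by (rule integral_cong_AE[OF borel_measurable_integrable[OF i(3)] _ ae]) simp
    then have "C = 0" by simp
    moreover have "0 \<le> A" unfolding A_def by (intro integral_nonneg_AE) simp
    ultimately show ?thesis using B0 by (simp flip: A_def B_def C_def)
  next
    case False
    \<comment> \<open>Expansion yields \<open>B * (A * B - C\<^sup>2)\<close>, from which the
      positive factor \<open>B\<close> is removed.\<close>
    have "0 \<le> (LINT x|M. (B * p x - C * q x)\<^sup>2)" by (intro integral_nonneg_AE) simp
    also have "(LINT x|M. (B * p x - C * q x)\<^sup>2) = (LINT x|M. B\<^sup>2 * (p x)\<^sup>2 + C\<^sup>2 * (q x)\<^sup>2 - (2 * B * C) * (p x * q x))"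
      by (simp add: power2_diff power_mult_distrib algebra_simps)
    also have "\<dots> = B\<^sup>2 * A + C\<^sup>2 * B - (2 * B * C) * C"
      using i unfolding A_def B_def C_def by simp
    also have "\<dots> = B * (A * B - C\<^sup>2)" by (simp add: power2_eq_square algebra_simps)
    finally have "0 \<le> A * B - C\<^sup>2" using False B0 by (simp add: zero_le_mult_iff)
    then show ?thesis by (simp add: A_def B_def C_def)
  qed
qed

text \<open>The square of the distance is what the increment formula delivers; working with it
  avoids roots at the price of factors \<open>2\<close> in the triangle inequality.\<close>

definition L2_dist2 :: "'a measure \<Rightarrow> ('a \<Rightarrow> real) \<Rightarrow> ('a \<Rightarrow> real) \<Rightarrow> real" where
  "L2_dist2 M p q = (LINT x|M. (p x - q x)\<^sup>2)"

lemma L2_dist2_nonneg: "0 \<le> L2_dist2 M p q"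
  unfolding L2_dist2_def by (intro integral_nonneg_AE) simp

lemma L2_dist2_commute: "L2_dist2 M p q = L2_dist2 M q p"
  unfolding L2_dist2_def by (simp add: power2_commute)

lemma L2_dist2_triangle:
  assumes "p \<in> L2 M" "q \<in> L2 M" "r \<in> L2 M"
  shows "L2_dist2 M p r \<le> 2 * L2_dist2 M p q + 2 * L2_dist2 M q r"
proof -
  note i = L2D(2)[OF L2_diff[OF assms(1,2)]] L2D(2)[OF L2_diff[OF assms(2,3)]] L2D(2)[OF L2_diff[OF assms(1,3)]]
  have "L2_dist2 M p r \<le> (LINT x|M. 2 * (p x - q x)\<^sup>2 + 2 * (q x - r x)\<^sup>2)"
    unfolding L2_dist2_def
  proof (rule integral_mono[OF i(3)])
    show "integrable M (\<lambda>x. 2 * (p x - q x)\<^sup>2 + 2 * (q x - r x)\<^sup>2)"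
      by (intro Bochner_Integration.integrable_add integrable_mult_right i)
    fix x
    have "0 \<le> ((p x - q x) - (q x - r x))\<^sup>2" by simp
    then show "(p x - r x)\<^sup>2 \<le> 2 * (p x - q x)\<^sup>2 + 2 * (q x - r x)\<^sup>2"
      by (simp add: power2_eq_square algebra_simps)
  qed
  also have "\<dots> = 2 * L2_dist2 M p q + 2 * L2_dist2 M q r"
    using i unfolding L2_dist2_def by simp
  finally show ?thesis .
qed

lemma L1_le_L2_dist2:
  assumes fin: "finite_measure M" and p: "p \<in> L2 M" and q: "q \<in> L2 M"
  shows "integrable M (\<lambda>x. \<bar>p x - q x\<bar>)"
    and "(LINT x|M. \<bar>p x - q x\<bar>) \<le> sqrt (measure M (space M)) * sqrt (L2_dist2 M p q)"
proof -
  interpret finite_measure M by (rule fin)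
  have one: "(\<lambda>x. 1 :: real) \<in> L2 M" by (rule L2I) auto
  have d: "(\<lambda>x. \<bar>p x - q x\<bar>) \<in> L2 M"
    by (rule L2I) (use L2D[OF L2_diff[OF p q]] in \<open>auto intro: borel_measurable_abs\<close>)
  show "integrable M (\<lambda>x. \<bar>p x - q x\<bar>)" using L2_mult_integrable[OF d one] by simp
  have "(LINT x|M. \<bar>p x - q x\<bar>)\<^sup>2 \<le> L2_dist2 M p q * measure M (space M)"
    using L2_Cauchy_Schwarz[OF d one] by (simp add: L2_dist2_def)
  then have "sqrt ((LINT x|M. \<bar>p x - q x\<bar>)\<^sup>2) \<le> sqrt (L2_dist2 M p q * measure M (space M))"
    by (rule real_sqrt_le_mono)
  then show "(LINT x|M. \<bar>p x - q x\<bar>) \<le> sqrt (measure M (space M)) * sqrt (L2_dist2 M p q)"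
    by (simp add: real_sqrt_mult mult.commute integral_nonneg_AE)
qed

lemma L2_inner_tendsto:
  assumes p: "\<And>n. p n \<in> L2 M" "p' \<in> L2 M" "(\<lambda>n. L2_dist2 M (p n) p') \<longlonglongrightarrow> 0"
    and q: "\<And>n. q n \<in> L2 M" "q' \<in> L2 M" "(\<lambda>n. L2_dist2 M (q n) q') \<longlonglongrightarrow> 0"
  shows "(\<lambda>n. L2_inner M (p n) (q n)) \<longlonglongrightarrow> L2_inner M p' q'"
proof -
  \<comment> \<open>The three errors of a product of perturbed factors, each controlled by
    Cauchy-Schwarz.\<close>
  define A B C where "A n = (LINT x|M. (p n x - p' x) * (q n x - q' x))" and "B n = (LINT x|M. (p n x - p' x) * q' x)"
    and "C n = (LINT x|M. p' x * (q n x - q' x))" for n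
  have z: "(\<lambda>x. 0 :: real) \<in> L2 M" by (rule L2I) auto
  have dp: "(\<lambda>x. p n x - p' x) \<in> L2 M" and dq: "(\<lambda>x. q n x - q' x) \<in> L2 M" for n
    by (rule L2_diff[OF p(1,2)], rule L2_diff[OF q(1,2)])
  have eq: "L2_inner M (p n) (q n) - L2_inner M p' q' = A n + B n + C n" for n
  proof -
    have "A n + B n + C n = (LINT x|M. (p n x - p' x) * (q n x - q' x) + (p n x - p' x) * q' x + p' x * (q n x - q' x))"
      unfolding A_def B_def C_def
      using L2_mult_integrable[OF dp dq] L2_mult_integrable[OF dp q(2)] L2_mult_integrable[OF p(2) dq] by simp
    also have "\<dots> = (LINT x|M. p n x * q n x - p' x * q' x)" by (simp add: algebra_simps)
    also have "\<dots> = L2_inner M (p n) (q n) - L2_inner M p' q'"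
      unfolding L2_inner_def using L2_mult_integrable[OF p(1) q(1)] L2_mult_integrable[OF p(2) q(2)] by simp
    finally show ?thesis by simp
  qed
  have sq0: "X \<longlonglongrightarrow> 0" if "\<And>n. (X n)\<^sup>2 \<le> Y n" "Y \<longlonglongrightarrow> 0" for X Y :: "nat \<Rightarrow> real"
  proof (rule Lim_null_comparison[OF always_eventually])
    show "\<forall>n. norm (X n) \<le> sqrt (Y n)" using that(1) by (auto intro: real_le_rsqrt simp: abs_le_square_iff power2_abs)
    show "(\<lambda>n. sqrt (Y n)) \<longlonglongrightarrow> 0" using tendsto_real_sqrt[OF that(2)] by simp
  qed
  have "A \<longlonglongrightarrow> 0"
  proof (rule sq0)
    show "(A n)\<^sup>2 \<le> L2_dist2 M (p n) p' * L2_dist2 M (q n) q'" for n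
      unfolding A_def L2_dist2_def by (rule L2_Cauchy_Schwarz[OF dp dq])
    show "(\<lambda>n. L2_dist2 M (p n) p' * L2_dist2 M (q n) q') \<longlonglongrightarrow> 0" using tendsto_mult[OF p(3) q(3)] by simp
  qed
  moreover have "B \<longlonglongrightarrow> 0"
  proof (rule sq0)
    show "(B n)\<^sup>2 \<le> L2_dist2 M (p n) p' * (LINT x|M. (q' x)\<^sup>2)" for n
      unfolding B_def L2_dist2_def by (rule L2_Cauchy_Schwarz[OF dp q(2)])
  qed (rule tendsto_mult_left_zero[OF p(3)])
  moreover have "C \<longlonglongrightarrow> 0"
  proof (rule sq0)
    show "(C n)\<^sup>2 \<le> (LINT x|M. (p' x)\<^sup>2) * L2_dist2 M (q n) q'" for n
      unfolding C_def L2_dist2_def by (rule L2_Cauchy_Schwarz[OF p(2) dq])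
  qed (rule tendsto_mult_right_zero[OF q(3)])
  ultimately have "(\<lambda>n. A n + B n + C n) \<longlonglongrightarrow> 0 + 0 + 0" by (intro tendsto_add)
  then have "(\<lambda>n. L2_inner M (p n) (q n) - L2_inner M p' q') \<longlonglongrightarrow> 0" unfolding eq by simp
  then show ?thesis by (rule LIM_zero_cancel)
qed

text \<open>On a finite measure the sequence is also Cauchy in \<open>L\<^sup>1\<close>, which
  supplies a subsequence converging a.e.; Fatou's lemma then bounds the distance to the pointwise
  limit.\<close>

lemma L2_complete:
  fixes s :: "nat \<Rightarrow> 'a \<Rightarrow> real"
  assumes fin: "finite_measure M" and s: "\<And>n. s n \<in> L2 M"
    and cauchy: "\<And>e. 0 < e \<Longrightarrow> \<exists>N. \<forall>i\<ge>N. \<forall>j\<ge>N. L2_dist2 M (s i) (s j) < e"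
  obtains l where "l \<in> L2 M" "(\<lambda>n. L2_dist2 M (s n) l) \<longlonglongrightarrow> 0"
proof -
  interpret finite_measure M by (rule fin)
  have sm: "s n \<in> borel_measurable M" for n by (rule L2D(1)[OF s])
  have z: "(\<lambda>x. 0 :: real) \<in> L2 M" by (rule L2I) auto
  have si: "integrable M (s n)" for n
    using L1_le_L2_dist2(1)[OF fin s z, of n] unfolding diff_zero integrable_abs_iff[OF sm] .
  have L1: "\<exists>N. \<forall>i\<ge>N. \<forall>j\<ge>N. (LINT x|M. norm (s i x - s j x)) < e" if e: "0 < e" for e
  proof -
    \<comment> \<open>The added \<open>1\<close> keeps the divisor positive when the measure is
      null.\<close>
    define m where "m = measure M (space M) + 1"
    have m: "0 < m" unfolding m_def by (rule add_nonneg_pos[OF measure_nonneg zero_less_one])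
    obtain N where N: "\<forall>i\<ge>N. \<forall>j\<ge>N. L2_dist2 M (s i) (s j) < e\<^sup>2 / m"
      using cauchy[of "e\<^sup>2 / m"] e m by auto
    have "(LINT x|M. norm (s i x - s j x)) < e" if "N \<le> i" "N \<le> j" for i j
    proof -
      have "(LINT x|M. norm (s i x - s j x)) \<le> sqrt (measure M (space M)) * sqrt (L2_dist2 M (s i) (s j))"
        using L1_le_L2_dist2(2)[OF fin s s] by simp
      also have "\<dots> \<le> sqrt m * sqrt (L2_dist2 M (s i) (s j))"
        by (intro mult_right_mono real_sqrt_le_mono) (simp_all add: m_def L2_dist2_nonneg)
      also have "\<dots> < sqrt m * sqrt (e\<^sup>2 / m)"
        using N that m by (intro mult_strict_left_mono real_sqrt_less_mono) auto
      also have "\<dots> = e" using m e by (simp add: real_sqrt_divide)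
      finally show ?thesis .
    qed
    then show ?thesis by blast
  qed
  obtain r where r: "strict_mono r" "AE x in M. Cauchy (\<lambda>i. s (r i) x)"
    by (rule cauchy_L1_AE_cauchy_subseq[OF si L1]; (rule that)?)
  define l where "l x = lim (\<lambda>i. s (r i) x)" for x
  have lm: "l \<in> borel_measurable M" unfolding l_def by (rule borel_measurable_lim_metric[OF sm])
  have conv: "AE x in M. (\<lambda>i. s (r i) x) \<longlonglongrightarrow> l x"
    using r(2) by eventually_elim (simp add: l_def Cauchy_convergent_iff convergent_LIMSEQ_iff)
  \<comment> \<open>Stated with the nonnegative integral, because integrability of the square is a
    consequence of this bound.\<close>
  have key: "(\<integral>\<^sup>+x. ennreal ((s n x - l x)\<^sup>2) \<partial>M) \<le> ennreal e"
    if N: "\<forall>i\<ge>N. \<forall>j\<ge>N. L2_dist2 M (s i) (s j) < e" and n: "N \<le> n" for n N e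
  proof -
    have "(\<integral>\<^sup>+x. ennreal ((s n x - l x)\<^sup>2) \<partial>M) \<le> (\<integral>\<^sup>+x. liminf (\<lambda>k. ennreal ((s n x - s (r k) x)\<^sup>2)) \<partial>M)"
    proof (rule nn_integral_mono_AE)
      show "AE x in M. ennreal ((s n x - l x)\<^sup>2) \<le> liminf (\<lambda>k. ennreal ((s n x - s (r k) x)\<^sup>2))"
        using conv
      proof eventually_elim
        case (elim x)
        have "(\<lambda>k. ennreal ((s n x - s (r k) x)\<^sup>2)) \<longlonglongrightarrow> ennreal ((s n x - l x)\<^sup>2)"
          by (intro tendsto_ennrealI tendsto_power tendsto_diff tendsto_const elim)
        from lim_imp_Liminf[OF _ this] show ?case by simp
      qed
    qed
    also have "\<dots> \<le> liminf (\<lambda>k. \<integral>\<^sup>+x. ennreal ((s n x - s (r k) x)\<^sup>2) \<partial>M)"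
      using sm by (intro nn_integral_liminf) measurable
    also have "\<dots> \<le> liminf (\<lambda>k. ennreal e)"
    proof (rule Liminf_mono)
      have "\<forall>\<^sub>F k in sequentially. N \<le> k" by (rule eventually_ge_at_top)
      then show "\<forall>\<^sub>F k in sequentially. (\<integral>\<^sup>+x. ennreal ((s n x - s (r k) x)\<^sup>2) \<partial>M) \<le> ennreal e"
      proof (rule eventually_mono)
        fix k assume "N \<le> k"
        then have "N \<le> r k" using seq_suble[OF r(1), of k] by simp
        then have "L2_dist2 M (s n) (s (r k)) < e" using N n by simp
        moreover have "(\<integral>\<^sup>+x. ennreal ((s n x - s (r k) x)\<^sup>2) \<partial>M) = ennreal (L2_dist2 M (s n) (s (r k)))"
          unfolding L2_dist2_def by (rule nn_integral_eq_integral[OF L2D(2)[OF L2_diff[OF s s]]]) simp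
        ultimately show "(\<integral>\<^sup>+x. ennreal ((s n x - s (r k) x)\<^sup>2) \<partial>M) \<le> ennreal e" by (simp add: ennreal_leI)
      qed
    qed
    also have "\<dots> = ennreal e" by (simp add: Liminf_const)
    finally show ?thesis .
  qed
  have sl: "(\<lambda>x. s n x - l x) \<in> borel_measurable M" for n by (rule borel_measurable_diff[OF sm lm])
  have fin_int: "integrable M (\<lambda>x. (s n x - l x)\<^sup>2)" if "(\<integral>\<^sup>+x. ennreal ((s n x - l x)\<^sup>2) \<partial>M) \<le> ennreal e" for n e
  proof (rule integrableI_nonneg)
    show "(\<lambda>x. (s n x - l x)\<^sup>2) \<in> borel_measurable M" using sl[of n] by (intro borel_measurable_power)
    show "(\<integral>\<^sup>+x. ennreal ((s n x - l x)\<^sup>2) \<partial>M) < \<infinity>"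
      using that by (rule le_less_trans) (simp add: ennreal_less_top)
  qed simp
  obtain N0 where N0: "\<forall>i\<ge>N0. \<forall>j\<ge>N0. L2_dist2 M (s i) (s j) < 1" using cauchy[of 1] by auto
  have "(\<lambda>x. s N0 x - l x) \<in> L2 M" by (rule L2I[OF sl fin_int[OF key[OF N0 order_refl]]])
  from L2_diff[OF s[of N0] this] have l: "l \<in> L2 M" by simp
  have "(\<lambda>n. L2_dist2 M (s n) l) \<longlonglongrightarrow> 0"
  proof (rule LIMSEQ_I)
    fix e :: real assume e: "0 < e"
    obtain N where N: "\<forall>i\<ge>N. \<forall>j\<ge>N. L2_dist2 M (s i) (s j) < e / 2" using cauchy[of "e / 2"] e by auto
    have "norm (L2_dist2 M (s n) l - 0) < e" if n: "N \<le> n" for n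
    proof -
      note k = key[OF N n]
      have eq: "(\<integral>\<^sup>+x. ennreal ((s n x - l x)\<^sup>2) \<partial>M) = ennreal (L2_dist2 M (s n) l)"
        unfolding L2_dist2_def by (rule nn_integral_eq_integral[OF fin_int[OF k]]) simp
      have "0 \<le> e / 2" using e by simp
      from iffD1[OF ennreal_le_iff[OF this] k[unfolded eq]] have "L2_dist2 M (s n) l \<le> e / 2" .
      then show ?thesis using e L2_dist2_nonneg[of M "s n" l] by simp
    qed
    then show "\<exists>N. \<forall>n\<ge>N. norm (L2_dist2 M (s n) l - 0) < e" by blast
  qed
  with l show ?thesis by (rule that)
qed

lemma Linf_imp_L2:
  fixes p :: "'a \<Rightarrow> real"
  assumes "finite_measure M" "p \<in> Linf M" shows "p \<in> L2 M"
  using Linf_norm_sq_integrable[OF assms] Linf_measurable[OF assms(2)] by (intro L2I) simp_all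

section \<open>Continuous representatives with values in \<open>H\<close>\<close>

context bounded_open_domain
begin

lemma AE_MI_dense:
  assumes G: "AE t in MI. t \<in> G" and xy: "0 \<le> x" "x < y" "y \<le> T"
  obtains q where "q \<in> G" "x < q" "q < y"
proof (rule ccontr)
  assume nt: "\<not> thesis"
  note found = that
  have "t \<notin> G" if "x < t" "t < y" for t
    using found[OF _ that] nt by blast
  then have "AE t in MI. t \<notin> {x<..<y}" using G by (elim eventually_mono) auto
  moreover have s: "{x<..<y} \<in> sets lebesgue" "{x<..<y} \<subseteq> {0<..<T}" using xy by auto
  then have sM: "{x<..<y} \<in> sets MI" by (subst sets_restrict_space_iff) auto
  moreover have "{t \<in> space MI. \<not> t \<notin> {x<..<y}} = {x<..<y}" using s by auto
  ultimately have "emeasure MI {x<..<y} = 0" by (subst (asm) AE_iff_measurable[OF sM]) auto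
  then have "emeasure lebesgue {x<..<y} = 0" using s by (subst (asm) emeasure_restrict_space) auto
  then show False using xy by simp
qed

lemma V_L2: "w \<in> V \<Longrightarrow> w \<in> L2 M"
  by (rule Linf_imp_L2[OF finite_M V_Linf])

lemma measure_MI_Ioc:
  assumes "s \<in> {0<..<T}" "t \<in> {0<..<T}" "s \<le> t"
  shows "(LINT \<tau>|MI. indicator {s<..t} \<tau>) = t - s"
proof -
  have sub: "{s<..t} \<subseteq> {0<..<T}" using assms by auto
  have "(LINT \<tau>|MI. indicator {s<..t} \<tau>) = measure MI ({s<..t} \<inter> space MI)" by (rule Bochner_Integration.integral_indicator)
  also have "{s<..t} \<inter> space MI = {s<..t}" using sub by auto
  also have "measure MI {s<..t} = measure lebesgue {s<..t}"
    by (rule measure_restrict_space) (use sub in auto)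
  also have "\<dots> = t - s" using assms(3) by simp
  finally show ?thesis .
qed

text \<open>Absolute continuity of the integral: the part of \<open>m\<close> above a level
  \<open>K\<close> has a small integral, and the part below contributes at most \<open>K\<close>
  times the length of the interval.\<close>

lemma integral_small:
  fixes m :: "real \<Rightarrow> real"
  assumes m: "integrable MI m" and nn: "\<And>t. t \<in> {0<..<T} \<Longrightarrow> 0 \<le> m t" and e: "0 < e"
  obtains \<delta> where "0 < \<delta>"
    "\<And>s t. s \<in> {0<..<T} \<Longrightarrow> t \<in> {0<..<T} \<Longrightarrow> s \<le> t \<Longrightarrow> t - s < \<delta> \<Longrightarrow> (LINT \<tau>|MI. indicator {s<..t} \<tau> * m \<tau>) < e"
proof -
  have mm: "m \<in> borel_measurable MI" using m by simp
  have mi: "integrable MI (\<lambda>t. min (m t) (real k))" for k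
  proof (rule Bochner_Integration.integrable_bound[OF m])
    show "(\<lambda>t. min (m t) (real k)) \<in> borel_measurable MI" using mm by measurable
    show "AE t in MI. norm (min (m t) (real k)) \<le> norm (m t)"
      using AE_MI_in
    proof eventually_elim
      case (elim t)
      then show ?case using nn[OF elim] by simp
    qed
  qed
  have "(\<lambda>k. LINT t|MI. m t - min (m t) (real k)) \<longlonglongrightarrow> (LINT t|MI. 0)"
  proof (rule integral_dominated_convergence[where w = "\<lambda>t. norm (m t)"])
    show "integrable MI (\<lambda>t. norm (m t))" by (rule integrable_norm[OF m])
    show "(\<lambda>t. m t - min (m t) (real k)) \<in> borel_measurable MI" for k using mm by measurable
    show "AE t in MI. (\<lambda>k. m t - min (m t) (real k)) \<longlonglongrightarrow> 0"
    proof (rule AE_I2)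
      fix t
      obtain K where K: "m t \<le> real K" using real_arch_simple by auto
      have "\<forall>\<^sub>F k in sequentially. m t - min (m t) (real k) = 0"
        using eventually_ge_at_top[of K]
      proof (rule eventually_mono)
        fix k assume "K \<le> k"
        then have "m t \<le> real k" using K by (meson of_nat_mono order_trans)
        then show "m t - min (m t) (real k) = 0" by simp
      qed
      then show "(\<lambda>k. m t - min (m t) (real k)) \<longlonglongrightarrow> 0" by (rule tendsto_eventually)
    qed
    show "AE t in MI. norm (m t - min (m t) (real k)) \<le> norm (m t)" for k
      using AE_MI_in
    proof eventually_elim
      case (elim t)
      then show ?case using nn[OF elim] by (simp add: min_def)
    qed
  qed simp
  from LIMSEQ_D[OF this, of "e / 2"] e
  obtain K where K: "norm ((LINT t|MI. m t - min (m t) (real K)) - (LINT t|MI. 0)) < e / 2" by auto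
  \<comment> \<open>\<open>K + 1\<close> instead of \<open>K\<close>, since \<open>K\<close> may be
    zero.\<close>
  define \<delta> where "\<delta> = e / (2 * (real K + 1))"
  show ?thesis
  proof (rule that[of \<delta>])
    show "0 < \<delta>" using e by (simp add: \<delta>_def add_nonneg_pos)
    fix s t assume st: "s \<in> {0<..<T}" "t \<in> {0<..<T}" "s \<le> t" "t - s < \<delta>"
    have one: "integrable MI (\<lambda>\<tau>. indicator {s<..t} \<tau> :: real)"
      using integrable_indicator_MI[of "\<lambda>_. 1" s t] finite_MI by (simp add: finite_measure.integrable_const)
    have d: "integrable MI (\<lambda>\<tau>. m \<tau> - min (m \<tau>) (real K))" by (rule Bochner_Integration.integrable_diff[OF m mi])
    have "(LINT \<tau>|MI. indicator {s<..t} \<tau> * m \<tau>) \<le> (LINT \<tau>|MI. (m \<tau> - min (m \<tau>) (real K)) + real K * indicator {s<..t} \<tau>)"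
    proof (rule integral_mono[OF integrable_indicator_MI[OF m] Bochner_Integration.integrable_add[OF d integrable_mult_right[OF one]]])
      fix \<tau>
      show "indicator {s<..t} \<tau> * m \<tau> \<le> (m \<tau> - min (m \<tau>) (real K)) + real K * indicator {s<..t} \<tau>"
        by (simp add: indicator_def min_def)
    qed
    also have "\<dots> = (LINT \<tau>|MI. m \<tau> - min (m \<tau>) (real K)) + real K * (t - s)"
      unfolding Bochner_Integration.integral_add[OF d integrable_mult_right[OF one]]
      using measure_MI_Ioc[OF st(1-3)] by simp
    also have "\<dots> < e / 2 + e / 2"
    proof (rule add_less_le_mono)
      show "(LINT \<tau>|MI. m \<tau> - min (m \<tau>) (real K)) < e / 2" using K by simp
      have "real K * (t - s) \<le> (real K + 1) * \<delta>" using st by (intro mult_mono) auto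
      also have "\<dots> = e / 2" by (simp add: \<delta>_def field_simps add_nonneg_eq_0_iff)
      finally show "real K * (t - s) \<le> e / 2" .
    qed
    finally show "(LINT \<tau>|MI. indicator {s<..t} \<tau> * m \<tau>) < e" by simp
  qed
qed

text \<open>Extension of a uniformly continuous map from the dense set \<open>G\<close> to the
  closed interval, using completeness of \<open>L\<^sup>2\<close>. At times in \<open>G\<close> the
  value \<open>u t\<close> is kept, so that the extension represents \<open>u\<close>.\<close>

lemma C0H_rep_exists:
  assumes G: "AE t in MI. t \<in> G" "G \<subseteq> {0<..<T}" and uL: "\<And>t. t \<in> G \<Longrightarrow> u t \<in> L2 M"
    and mod: "\<And>e. 0 < e \<Longrightarrow> \<exists>\<delta>>0. \<forall>s\<in>G. \<forall>t\<in>G. \<bar>s - t\<bar> < \<delta> \<longrightarrow> L2_dist2 M (u s) (u t) < e"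
  obtains c where "is_C0H_rep \<Omega> T u c"
proof -
  have "\<exists>l. l \<in> L2 M \<and> (\<forall>e>0. \<exists>\<delta>>0. \<forall>s\<in>G. \<bar>s - t\<bar> < \<delta> \<longrightarrow> L2_dist2 M (u s) l < e) \<and> (t \<in> G \<longrightarrow> l = u t)"
    if t: "t \<in> {0..T}" for t
  proof (cases "t \<in> G")
    case True
    have "\<exists>\<delta>>0. \<forall>s\<in>G. \<bar>s - t\<bar> < \<delta> \<longrightarrow> L2_dist2 M (u s) (u t) < e" if e: "0 < e" for e
    proof -
      obtain \<delta> where "0 < \<delta>" "\<forall>s\<in>G. \<forall>t\<in>G. \<bar>s - t\<bar> < \<delta> \<longrightarrow> L2_dist2 M (u s) (u t) < e"
        using mod[OF e] by (elim exE conjE)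
      then show ?thesis using True by (intro exI[of _ \<delta>]) simp
    qed
    then show ?thesis using uL[OF True] by (intro exI[of _ "u t"]) simp
  next
    case False
    have "\<exists>q. q \<in> G \<and> \<bar>q - t\<bar> < 1 / real (Suc n)" for n
    proof -
      define \<epsilon> where "\<epsilon> = 1 / real (Suc n)"
      have p: "0 < \<epsilon>" by (simp add: \<epsilon>_def)
      define x y where "x = max 0 (t - \<epsilon>)" and "y = min T (t + \<epsilon>)"
      have xy: "0 \<le> x" "x < y" "y \<le> T" using t p T_pos by (auto simp: x_def y_def)
      obtain q where "q \<in> G" "x < q" "q < y" by (rule AE_MI_dense[OF G(1) xy], rule that)
      then show ?thesis by (intro exI[of _ q]) (unfold \<epsilon>_def[symmetric], auto simp: x_def y_def abs_less_iff)
    qed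
    then have "\<forall>n. \<exists>q. q \<in> G \<and> \<bar>q - t\<bar> < 1 / real (Suc n)" by simp
    from choice[OF this] obtain q where q: "\<forall>n. q n \<in> G \<and> \<bar>q n - t\<bar> < 1 / real (Suc n)" by (elim exE)
    have qG: "q n \<in> G" for n using q by simp
    have qt: "q \<longlonglongrightarrow> t"
    proof -
      have "(\<lambda>n. q n - t) \<longlonglongrightarrow> 0"
        by (rule Lim_null_comparison[OF always_eventually LIMSEQ_Suc[OF lim_1_over_n]])
           (use q in \<open>auto intro: less_imp_le\<close>)
      then show ?thesis by (rule LIM_zero_cancel)
    qed
    have cauchy: "\<exists>N. \<forall>i\<ge>N. \<forall>j\<ge>N. L2_dist2 M (u (q i)) (u (q j)) < e" if e: "0 < e" for e
    proof -
      obtain \<delta> where \<delta>: "0 < \<delta>" "\<forall>s\<in>G. \<forall>t\<in>G. \<bar>s - t\<bar> < \<delta> \<longrightarrow> L2_dist2 M (u s) (u t) < e"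
        using mod[OF e] by auto
      obtain N where N: "\<forall>n\<ge>N. norm (q n - t) < \<delta> / 2" using LIMSEQ_D[OF qt, of "\<delta> / 2"] \<delta>(1) by auto
      have "L2_dist2 M (u (q i)) (u (q j)) < e" if "N \<le> i" "N \<le> j" for i j
      proof -
        have "norm (q i - t) < \<delta> / 2" "norm (q j - t) < \<delta> / 2" using N that by auto
        then have "\<bar>q i - q j\<bar> < \<delta>" unfolding real_norm_def by linarith
        then show ?thesis using \<delta>(2) qG by blast
      qed
      then show ?thesis by blast
    qed
    obtain l where l: "l \<in> L2 M" "(\<lambda>n. L2_dist2 M (u (q n)) l) \<longlonglongrightarrow> 0"
      by (rule L2_complete[OF finite_M uL[OF qG] cauchy], assumption, rule that)
    have "\<exists>\<delta>>0. \<forall>s\<in>G. \<bar>s - t\<bar> < \<delta> \<longrightarrow> L2_dist2 M (u s) l < e" if e: "0 < e" for e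
    proof -
      \<comment> \<open>The squared triangle inequality doubles each of its two terms, hence a
        quarter of \<open>e\<close> for each.\<close>
      have "0 < e / 4" using e by simp
      then obtain \<delta> where \<delta>: "0 < \<delta>" "\<forall>s\<in>G. \<forall>t\<in>G. \<bar>s - t\<bar> < \<delta> \<longrightarrow> L2_dist2 M (u s) (u t) < e / 4"
        using mod[of "e / 4"] by auto
      obtain N where N: "\<forall>n\<ge>N. norm (q n - t) < \<delta> / 2" using LIMSEQ_D[OF qt, of "\<delta> / 2"] \<delta>(1) by auto
      obtain N' where N': "\<forall>n\<ge>N'. norm (L2_dist2 M (u (q n)) l - 0) < e / 4" using LIMSEQ_D[OF l(2), of "e / 4"] e by auto
      define n where "n = max N N'"
      have n: "norm (q n - t) < \<delta> / 2" "L2_dist2 M (u (q n)) l < e / 4"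
        using spec[OF N, of n] spec[OF N', of n] by (simp_all add: n_def)
      have "L2_dist2 M (u s) l < e" if s: "s \<in> G" "\<bar>s - t\<bar> < \<delta> / 2" for s
      proof -
        have "\<bar>s - q n\<bar> < \<delta>" using s(2) n(1) unfolding real_norm_def by linarith
        then have "L2_dist2 M (u s) (u (q n)) < e / 4" using \<delta>(2) s(1) qG by blast
        then show ?thesis using L2_dist2_triangle[OF uL[OF s(1)] uL[OF qG[of n]] l(1)] n(2) by linarith
      qed
      then show ?thesis using \<delta>(1) by (intro exI[of _ "\<delta> / 2"]) auto
    qed
    then show ?thesis using l(1) False by blast
  qed
  then have "\<forall>t. \<exists>l. t \<in> {0..T} \<longrightarrow> l \<in> L2 M \<and> (\<forall>e>0. \<exists>\<delta>>0. \<forall>s\<in>G. \<bar>s - t\<bar> < \<delta> \<longrightarrow> L2_dist2 M (u s) l < e) \<and> (t \<in> G \<longrightarrow> l = u t)"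
    by blast
  from choice[OF this] obtain c where c: "\<forall>t. t \<in> {0..T} \<longrightarrow> c t \<in> L2 M \<and>
      (\<forall>e>0. \<exists>\<delta>>0. \<forall>s\<in>G. \<bar>s - t\<bar> < \<delta> \<longrightarrow> L2_dist2 M (u s) (c t) < e) \<and> (t \<in> G \<longrightarrow> c t = u t)"
    by (elim exE)
  then have cL: "c t \<in> L2 M" and cd: "0 < e \<Longrightarrow> \<exists>\<delta>>0. \<forall>s\<in>G. \<bar>s - t\<bar> < \<delta> \<longrightarrow> L2_dist2 M (u s) (c t) < e"
    if "t \<in> {0..T}" for t e using that by simp_all
  have cG: "c t = u t" if "t \<in> G" for t
  proof -
    have "t \<in> {0..T}" using subsetD[OF G(2) that] by simp
    then show ?thesis using c that by simp
  qed
  have cont: "\<exists>d>0. \<forall>s\<in>{0..T}. \<bar>s - t\<bar> < d \<longrightarrow> L2_dist2 M (c s) (c t) < e" if t: "t \<in> {0..T}" and e: "0 < e" for t e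
  proof -
    have "0 < e / 4" using e by simp
    then obtain \<delta> where \<delta>: "0 < \<delta>" "\<forall>s\<in>G. \<bar>s - t\<bar> < \<delta> \<longrightarrow> L2_dist2 M (u s) (c t) < e / 4"
      using cd[OF t, of "e / 4"] by auto
    have "L2_dist2 M (c s) (c t) < e" if s: "s \<in> {0..T}" "\<bar>s - t\<bar> < \<delta> / 2" for s
    proof -
      obtain \<eta> where \<eta>: "0 < \<eta>" "\<forall>r\<in>G. \<bar>r - s\<bar> < \<eta> \<longrightarrow> L2_dist2 M (u r) (c s) < e / 4"
        using cd[OF s(1), of "e / 4"] \<open>0 < e / 4\<close> by auto
      \<comment> \<open>The intermediate time \<open>r\<close> in \<open>G\<close> must lie within
        \<open>\<eta>\<close> of \<open>s\<close> and, as \<open>s\<close> is within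
        \<open>\<delta> / 2\<close> of \<open>t\<close>, within \<open>\<delta>\<close> of
        \<open>t\<close>.\<close>
      define m where "m = min \<eta> (\<delta> / 2)"
      have m: "0 < m" using \<eta>(1) \<delta>(1) by (simp add: m_def)
      define x y where "x = max 0 (s - m)" and "y = min T (s + m)"
      have xy: "0 \<le> x" "x < y" "y \<le> T" using s m T_pos by (auto simp: x_def y_def)
      obtain r where r: "r \<in> G" "x < r" "r < y" by (rule AE_MI_dense[OF G(1) xy], rule that)
      have rs: "\<bar>r - s\<bar> < m" using r by (auto simp: x_def y_def abs_less_iff)
      have 1: "L2_dist2 M (c s) (u r) < e / 4"
        using \<eta>(2) r(1) rs L2_dist2_commute[of M "c s"] by (simp add: m_def)
      have "\<bar>r - t\<bar> < \<delta>" using rs s(2) unfolding m_def by linarith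
      then have 2: "L2_dist2 M (u r) (c t) < e / 4" using \<delta>(2) r(1) by blast
      show ?thesis using L2_dist2_triangle[OF cL[OF s(1)] uL[OF r(1)] cL[OF t]] 1 2 by linarith
    qed
    then show ?thesis using \<delta>(1) by (intro exI[of _ "\<delta> / 2"]) auto
  qed
  have nrm: "L2_norm M (\<lambda>x. c s x - c t x) = sqrt (L2_dist2 M (c s) (c t))" for s t
    by (simp add: L2_norm_def L2_dist2_def)
  have "is_C0H_rep \<Omega> T u c"
    unfolding is_C0H_rep_def
  proof (intro conjI ballI)
    fix t assume t: "t \<in> {0..T}"
    show "c t \<in> L2 M" by (rule cL[OF t])
    show "((\<lambda>s. L2_norm M (\<lambda>x. c s x - c t x)) \<longlongrightarrow> 0) (at t within {0..T})"
    proof (rule tendstoI)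
      fix e :: real assume e: "0 < e"
      then have "0 < e\<^sup>2" by simp
      from cont[OF t this] obtain d where d: "0 < d" "\<forall>s\<in>{0..T}. \<bar>s - t\<bar> < d \<longrightarrow> L2_dist2 M (c s) (c t) < e\<^sup>2" by auto
      have "dist (L2_norm M (\<lambda>x. c s x - c t x)) 0 < e" if "s \<in> {0..T}" "dist s t < d" for s
      proof -
        have "L2_dist2 M (c s) (c t) < e\<^sup>2" using d(2) that by (simp add: dist_real_def)
        then have "sqrt (L2_dist2 M (c s) (c t)) < sqrt (e\<^sup>2)" by (rule real_sqrt_less_mono)
        then show ?thesis using e L2_dist2_nonneg[of M "c s" "c t"] by (simp add: nrm dist_real_def)
      qed
      then show "\<forall>\<^sub>F s in at t within {0..T}. dist (L2_norm M (\<lambda>x. c s x - c t x)) 0 < e"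
        using d(1) unfolding eventually_at by blast
    qed
  next
    show "AE t in MI. AE x in M. c t x = u t x"
      using G(1) by (rule eventually_mono) (simp add: cG)
  qed
  then show ?thesis by (rule that)
qed

text \<open>The expansion is grouped as the increment from \<open>q\<close> to \<open>p\<close>
  tested with \<open>p\<close>, minus the same increment tested with \<open>q\<close>, so that the
  increment formula applies to each group.\<close>

lemma ip_diff_self:
  assumes "p \<in> L2 M" "q \<in> L2 M"
  shows "L2_dist2 M p q = (ip p p - ip q p) - (ip p q - ip q q)"
proof -
  note i = L2_mult_integrable[OF assms(1,1)] L2_mult_integrable[OF assms(2,1)] L2_mult_integrable[OF assms(1,2)] L2_mult_integrable[OF assms(2,2)]
  have "L2_dist2 M p q = (LINT x|M. (p x * p x - q x * p x) - (p x * q x - q x * q x))"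
    unfolding L2_dist2_def by (simp add: power2_eq_square algebra_simps)
  also have "\<dots> = (ip p p - ip q p) - (ip p q - ip q q)"
    using i by (simp add: L2_inner_def mult.commute)
  finally show ?thesis .
qed

lemma ip_commute: "ip p q = ip q p"
  by (simp add: L2_inner_def inner_commute)

text \<open>Testing the increment formula with \<open>u t - u s\<close> itself makes \<open>u\<close> uniformly continuous into \<open>H\<close>.\<close>

lemma time_regularity:
  assumes u: "u \<in> Linf_wstar \<Omega> \<Gamma>D T" and g: "has_time_deriv \<Omega> \<Gamma>D T u g"
  obtains G C where "AE t in MI. t \<in> G" "G \<subseteq> {0<..<T}" "0 \<le> C"
    "\<And>t. t \<in> G \<Longrightarrow> u t \<in> V" "\<And>t. t \<in> G \<Longrightarrow> V_norm \<Omega> (u t) \<le> C"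
    "\<And>t1 t2 w. t1 \<in> G \<Longrightarrow> t2 \<in> G \<Longrightarrow> t1 \<le> t2 \<Longrightarrow> w \<in> V \<Longrightarrow>
      ip (u t2) w - ip (u t1) w = (LINT \<tau>|MI. indicator {t1<..t2} \<tau> * g \<tau> w)"
    "\<And>e. 0 < e \<Longrightarrow> \<exists>\<delta>>0. \<forall>s\<in>G. \<forall>t\<in>G. \<bar>s - t\<bar> < \<delta> \<longrightarrow> L2_dist2 M (u s) (u t) < e"
proof -
  obtain G0 where G0: "AE t in MI. t \<in> G0" "G0 \<subseteq> {0<..<T}"
    and inc0: "\<And>t1 t2 w. t1 \<in> G0 \<Longrightarrow> t2 \<in> G0 \<Longrightarrow> t1 \<le> t2 \<Longrightarrow> w \<in> V \<Longrightarrow>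
      ip (u t2) w - ip (u t1) w = (LINT \<tau>|MI. indicator {t1<..t2} \<tau> * g \<tau> w)"
    by (rule time_increment[OF g], rule that)
  obtain C where C: "0 \<le> C" "AE t in MI. V_norm \<Omega> (u t) \<le> C" using Linf_wstar_bound[OF u] by auto
  \<comment> \<open>The slices serve as test elements themselves and therefore need a common bound
    in \<open>V\<close>.\<close>
  define G where "G = {t \<in> G0. V_norm \<Omega> (u t) \<le> C}"
  have GG0: "t \<in> G0" if "t \<in> G" for t using that by (simp add: G_def)
  have uV: "u t \<in> V" if "t \<in> G" for t using Linf_wstar_V[OF u] G0(2) GG0[OF that] by blast
  have uC: "V_norm \<Omega> (u t) \<le> C" if "t \<in> G" for t using that by (simp add: G_def)
  note gL = has_time_derivD(2)[OF g]
  define m where "m \<tau> = predual_norm \<Omega> \<Gamma>D (g \<tau>)" for \<tau>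
  have m: "integrable MI m" unfolding m_def by (rule L1_predual_norm_int[OF gL])
  have m0: "0 \<le> m t" if "t \<in> {0<..<T}" for t unfolding m_def by (rule predual_norm_nonneg[OF L1_predual_in[OF gL that]])
  have bd: "\<bar>LINT \<tau>|MI. indicator {s<..t} \<tau> * g \<tau> w\<bar> \<le> C * (LINT \<tau>|MI. indicator {s<..t} \<tau> * m \<tau>)"
    if w: "w \<in> V" "V_norm \<Omega> w \<le> C" for s t w
  proof -
    note gi = integrable_indicator_MI[OF L1_predual_apply_const_integrable[OF gL w(1)], of s t]
    have "\<bar>LINT \<tau>|MI. indicator {s<..t} \<tau> * g \<tau> w\<bar> \<le> (LINT \<tau>|MI. norm (indicator {s<..t} \<tau> * g \<tau> w))"
      unfolding real_norm_def[symmetric] by (rule integral_norm_bound)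
    also have "\<dots> \<le> (LINT \<tau>|MI. C * (indicator {s<..t} \<tau> * m \<tau>))"
    proof (rule integral_mono_AE[OF integrable_norm[OF gi] integrable_mult_right[OF integrable_indicator_MI[OF m]]])
      show "AE \<tau> in MI. norm (indicator {s<..t} \<tau> * g \<tau> w) \<le> C * (indicator {s<..t} \<tau> * m \<tau>)"
        using AE_MI_in
      proof eventually_elim
        case (elim \<tau>)
        have "\<bar>g \<tau> w\<bar> \<le> m \<tau> * V_norm \<Omega> w" unfolding m_def by (rule predual_le[OF L1_predual_in[OF gL elim] w(1)])
        also have "\<dots> \<le> m \<tau> * C" by (rule mult_left_mono[OF w(2) m0[OF elim]])
        finally show ?case by (simp add: indicator_def mult.commute)
      qed
    qed
    also have "\<dots> = C * (LINT \<tau>|MI. indicator {s<..t} \<tau> * m \<tau>)" by simp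
    finally show ?thesis .
  qed
  have d2: "L2_dist2 M (u t) (u s) \<le> 2 * C * (LINT \<tau>|MI. indicator {s<..t} \<tau> * m \<tau>)"
    if st: "s \<in> G" "t \<in> G" "s \<le> t" for s t
  proof -
    have "L2_dist2 M (u t) (u s) = (ip (u t) (u t) - ip (u s) (u t)) - (ip (u t) (u s) - ip (u s) (u s))"
      by (rule ip_diff_self[OF V_L2[OF uV[OF st(2)]] V_L2[OF uV[OF st(1)]]])
    also have "\<dots> = (LINT \<tau>|MI. indicator {s<..t} \<tau> * g \<tau> (u t)) - (LINT \<tau>|MI. indicator {s<..t} \<tau> * g \<tau> (u s))"
      unfolding inc0[OF GG0[OF st(1)] GG0[OF st(2)] st(3) uV[OF st(2)]]
        inc0[OF GG0[OF st(1)] GG0[OF st(2)] st(3) uV[OF st(1)]] ..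
    also have "\<dots> \<le> 2 * C * (LINT \<tau>|MI. indicator {s<..t} \<tau> * m \<tau>)"
      using bd[OF uV[OF st(2)] uC[OF st(2)], of s t] bd[OF uV[OF st(1)] uC[OF st(1)], of s t] by linarith
    finally show ?thesis .
  qed
  show ?thesis
  proof (rule that[of G C])
    show "AE t in MI. t \<in> G" using G0(1) C(2) by eventually_elim (simp add: G_def)
    show "G \<subseteq> {0<..<T}" using G0(2) by (auto simp: G_def)
    show "0 \<le> C" by (rule C(1))
    show "u t \<in> V" "V_norm \<Omega> (u t) \<le> C" if "t \<in> G" for t by (rule uV[OF that], rule uC[OF that])
    show "ip (u t2) w - ip (u t1) w = (LINT \<tau>|MI. indicator {t1<..t2} \<tau> * g \<tau> w)"
      if "t1 \<in> G" "t2 \<in> G" "t1 \<le> t2" "w \<in> V" for t1 t2 w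
      by (rule inc0[OF GG0[OF that(1)] GG0[OF that(2)] that(3,4)])
    fix e :: real assume e: "0 < e"
    \<comment> \<open>The factor from the two test elements is \<open>2 * C\<close>; the added
      \<open>1\<close> permits division when \<open>C = 0\<close>.\<close>
    have C1: "0 < 2 * C + 1" using C(1) by simp
    have eC: "0 < e / (2 * C + 1)" using e C1 by simp
    obtain \<delta> where \<delta>: "0 < \<delta>"
      "\<And>s t. s \<in> {0<..<T} \<Longrightarrow> t \<in> {0<..<T} \<Longrightarrow> s \<le> t \<Longrightarrow> t - s < \<delta> \<Longrightarrow> (LINT \<tau>|MI. indicator {s<..t} \<tau> * m \<tau>) < e / (2 * C + 1)"
      by (rule integral_small[OF m m0 eC], assumption, rule that)
    have main: "L2_dist2 M (u t) (u s) < e" if st: "s \<in> G" "t \<in> G" "s \<le> t" "t - s < \<delta>" for s t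
    proof -
      have sI: "s \<in> {0<..<T}" "t \<in> {0<..<T}" using st(1,2) G0(2) by (auto simp: G_def)
      have i0: "0 \<le> (LINT \<tau>|MI. indicator {s<..t} \<tau> * m \<tau>)"
        by (rule integral_nonneg_AE) (use AE_MI_in in eventually_elim, simp add: m0)
      have "2 * C * (LINT \<tau>|MI. indicator {s<..t} \<tau> * m \<tau>) \<le> (2 * C + 1) * (LINT \<tau>|MI. indicator {s<..t} \<tau> * m \<tau>)"
        using i0 by (intro mult_right_mono) simp_all
      also have "\<dots> < (2 * C + 1) * (e / (2 * C + 1))"
        by (rule mult_strict_left_mono[OF \<delta>(2)[OF sI st(3,4)] C1])
      also have "\<dots> = e" using C1 by simp
      finally show ?thesis using d2[OF st(1-3)] by simp
    qed
    have "L2_dist2 M (u s) (u t) < e" if st: "s \<in> G" "t \<in> G" "\<bar>s - t\<bar> < \<delta>" for s t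
    proof (cases "s \<le> t")
      case True
      then show ?thesis using main[OF st(1,2)] st(3) L2_dist2_commute[of M "u s"] by simp
    next
      case False
      then show ?thesis using main[OF st(2,1)] st(3) by simp
    qed
    then show "\<exists>\<delta>>0. \<forall>s\<in>G. \<forall>t\<in>G. \<bar>s - t\<bar> < \<delta> \<longrightarrow> L2_dist2 M (u s) (u t) < e" using \<delta>(1) by blast
  qed
qed

text \<open>Shows that the choice in \<open>C0H_rep\<close> is not void, so that the initial and
  terminal values have the intended meaning.\<close>

lemma Winf_C0H_rep:
  assumes "v \<in> Winf \<Omega> \<Gamma>D T"
  shows "is_C0H_rep \<Omega> T v (C0H_rep \<Omega> T v)"
proof -
  obtain g where v: "v \<in> Linf_wstar \<Omega> \<Gamma>D T" and g: "has_time_deriv \<Omega> \<Gamma>D T v g" using assms by (auto simp: Winf_def)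
  obtain G C where G: "AE t in MI. t \<in> G" "G \<subseteq> {0<..<T}" and vV: "\<And>t. t \<in> G \<Longrightarrow> v t \<in> V"
    and mod: "\<And>e. 0 < e \<Longrightarrow> \<exists>\<delta>>0. \<forall>s\<in>G. \<forall>t\<in>G. \<bar>s - t\<bar> < \<delta> \<longrightarrow> L2_dist2 M (v s) (v t) < e"
    by (rule time_regularity[OF v g], rule that)
  obtain c where "is_C0H_rep \<Omega> T v c"
    by (rule C0H_rep_exists[OF G V_L2[OF vV] mod], assumption, assumption, rule that)
  then show ?thesis unfolding C0H_rep_def by (rule someI[of "is_C0H_rep \<Omega> T v"])
qed

end

section \<open>Integration by parts in time\<close>

lemma finite_partition_index:
  fixes p :: "nat \<Rightarrow> real"
  assumes n: "p 0 < t" "t \<le> p n"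
  obtains i where "i < n" "p i < t" "t \<le> p (Suc i)"
proof -
  define j where "j = (LEAST j. t \<le> p j)"
  have j: "t \<le> p j" unfolding j_def by (rule LeastI[of "\<lambda>j. t \<le> p j", OF n(2)])
  have jn: "j \<le> n" unfolding j_def by (rule Least_le[of "\<lambda>j. t \<le> p j", OF n(2)])
  have "j \<noteq> 0" using j n(1) by (intro notI) simp
  then obtain i where i: "j = Suc i" by (cases j) auto
  have "\<not> t \<le> p i" using not_less_Least[of i "\<lambda>j. t \<le> p j"] i by (simp add: j_def[symmetric])
  then show ?thesis using that[of i] i j jn by simp
qed

context bounded_open_domain
begin

lemma L2_dist2_tendsto_L1:
  assumes w: "\<And>n. w n \<in> L2 M" "v \<in> L2 M" and lim: "(\<lambda>n. L2_dist2 M (w n) v) \<longlonglongrightarrow> 0"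
  shows "(\<lambda>n. LINT x|M. \<bar>w n x - v x\<bar>) \<longlonglongrightarrow> 0"
proof (rule Lim_null_comparison[OF always_eventually])
  show "\<forall>n. norm (LINT x|M. \<bar>w n x - v x\<bar>) \<le> sqrt (measure M (space M)) * sqrt (L2_dist2 M (w n) v)"
    using L1_le_L2_dist2(2)[OF finite_M w(1) w(2)] by (simp add: integral_nonneg_AE)
  show "(\<lambda>n. sqrt (measure M (space M)) * sqrt (L2_dist2 M (w n) v)) \<longlonglongrightarrow> 0"
    by (rule tendsto_mult_right_zero) (use tendsto_real_sqrt[OF lim] in simp)
qed

lemma modulus_imp_tendsto:
  fixes r :: "nat \<Rightarrow> real"
  assumes mod: "\<And>e. 0 < e \<Longrightarrow> \<exists>\<delta>>0. \<forall>s\<in>G. \<forall>t\<in>G. \<bar>s - t\<bar> < \<delta> \<longrightarrow> L2_dist2 M (u s) (u t) < e"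
    and r: "\<And>n. r n \<in> G" "t \<in> G" "r \<longlonglongrightarrow> t"
  shows "(\<lambda>n. L2_dist2 M (u (r n)) (u t)) \<longlonglongrightarrow> 0"
proof (rule LIMSEQ_I)
  fix e :: real assume e: "0 < e"
  obtain \<delta> where \<delta>: "0 < \<delta>" "\<forall>s\<in>G. \<forall>t\<in>G. \<bar>s - t\<bar> < \<delta> \<longrightarrow> L2_dist2 M (u s) (u t) < e"
    using mod[OF e] by (elim exE conjE)
  obtain N where N: "\<forall>n\<ge>N. norm (r n - t) < \<delta>" using LIMSEQ_D[OF r(3) \<delta>(1)] by (elim exE)
  have "norm (L2_dist2 M (u (r n)) (u t) - 0) < e" if "N \<le> n" for n
  proof -
    have "\<bar>r n - t\<bar> < \<delta>" using N that by simp
    then show ?thesis using \<delta>(2) r(1)[of n] r(2) L2_dist2_nonneg[of M "u (r n)" "u t"] by simp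
  qed
  then show "\<exists>N. \<forall>n\<ge>N. norm (L2_dist2 M (u (r n)) (u t) - 0) < e" by blast
qed

text \<open>Discrete product rule: over one cell the change of the product is the increment of
  \<open>u\<close> paired with the later value of \<open>v\<close> plus the increment of
  \<open>v\<close> paired with the earlier value of \<open>u\<close>. The sum telescopes and equals
  the integral of a function that freezes \<open>v\<close> and \<open>u\<close> at partition points;
  refinement replaces them by their values at \<open>\<tau>\<close> through
  \<open>predual_tendsto_of_L1\<close>.\<close>

lemma increment_product:
  assumes G: "AE t in MI. t \<in> G" "G \<subseteq> {0<..<T}"
    and u: "u \<in> Linf_wstar \<Omega> \<Gamma>D T" "\<And>t. t \<in> G \<Longrightarrow> u t \<in> V" "\<And>t. t \<in> G \<Longrightarrow> V_norm \<Omega> (u t) \<le> C"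
    and v: "v \<in> Linf_wstar \<Omega> \<Gamma>D T" "\<And>t. t \<in> G \<Longrightarrow> v t \<in> V" "\<And>t. t \<in> G \<Longrightarrow> V_norm \<Omega> (v t) \<le> C"
    and g: "g \<in> L1_predual \<Omega> \<Gamma>D T" and k: "k \<in> L1_predual \<Omega> \<Gamma>D T"
    and incu: "\<And>t1 t2 w. t1 \<in> G \<Longrightarrow> t2 \<in> G \<Longrightarrow> t1 \<le> t2 \<Longrightarrow> w \<in> V \<Longrightarrow>
      ip (u t2) w - ip (u t1) w = (LINT \<tau>|MI. indicator {t1<..t2} \<tau> * g \<tau> w)"
    and incv: "\<And>t1 t2 w. t1 \<in> G \<Longrightarrow> t2 \<in> G \<Longrightarrow> t1 \<le> t2 \<Longrightarrow> w \<in> V \<Longrightarrow>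
      ip (v t2) w - ip (v t1) w = (LINT \<tau>|MI. indicator {t1<..t2} \<tau> * k \<tau> w)"
    and modu: "\<And>e. 0 < e \<Longrightarrow> \<exists>\<delta>>0. \<forall>s\<in>G. \<forall>t\<in>G. \<bar>s - t\<bar> < \<delta> \<longrightarrow> L2_dist2 M (u s) (u t) < e"
    and modv: "\<And>e. 0 < e \<Longrightarrow> \<exists>\<delta>>0. \<forall>s\<in>G. \<forall>t\<in>G. \<bar>s - t\<bar> < \<delta> \<longrightarrow> L2_dist2 M (v s) (v t) < e"
    and ab: "a \<in> G" "b \<in> G" "a < b"
  shows "ip (u b) (v b) - ip (u a) (v a) = (LINT \<tau>|MI. indicator {a<..b} \<tau> * (g \<tau> (v \<tau>) + k \<tau> (u \<tau>)))"
proof -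
  define h where "h n = (b - a) / real (Suc n)" for n
  have h0: "0 < h n" for n using ab(3) by (simp add: h_def)
  have hS: "a + real (Suc n) * h n = b" for n by (simp add: h_def)
  \<comment> \<open>The increment formula holds only at times in \<open>G\<close>, so each inner
    partition point is picked from \<open>G\<close> in its own cell of an equidistant grid; this
    keeps the points ordered with gaps at most \<open>2 * h n\<close>. Beyond \<open>Suc n\<close>
    the default \<open>a\<close> keeps membership in \<open>G\<close> unconditional.\<close>
  have "\<exists>q. (i = 0 \<longrightarrow> q = a) \<and> (i = Suc n \<longrightarrow> q = b) \<and> q \<in> G \<and> (i \<le> Suc n \<longrightarrow> a + (real i - 1) * h n \<le> q \<and> q \<le> a + real i * h n)" for n i
  proof -
    consider "i = 0" | "i = Suc n" | "0 < i" "i < Suc n" | "i > Suc n" by linarith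
    then show ?thesis
    proof cases
      case 1
      then show ?thesis using ab(1) h0[of n] by (intro exI[of _ a]) simp
    next
      case 2
      have "a + (real (Suc n) - 1) * h n \<le> b" using hS[of n] h0[of n] by (simp add: algebra_simps)
      then show ?thesis using 2 ab(2) hS[of n] by (intro exI[of _ b]) simp
    next
      case 3
      define x y where "x = a + (real i - 1) * h n" and "y = a + real i * h n"
      have "0 \<le> (real i - 1) * h n" using 3 h0[of n] by (intro mult_nonneg_nonneg) simp_all
      moreover have "real i * h n \<le> real (Suc n) * h n" using 3 h0[of n] by (intro mult_right_mono) simp_all
      moreover have "0 < a" "b < T" using ab G(2) by auto
      moreover have "x = y - h n" by (simp add: x_def y_def left_diff_distrib)
      ultimately have xy: "0 \<le> x" "x < y" "y \<le> T"
        using h0[of n] hS[of n] unfolding x_def y_def by linarith+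
      obtain q where "q \<in> G" "x < q" "q < y" by (rule AE_MI_dense[OF G(1) xy], rule that)
      then show ?thesis using 3 by (intro exI[of _ q]) (simp add: x_def y_def)
    next
      case 4
      then show ?thesis using ab(1) by (intro exI[of _ a]) simp
    qed
  qed
  then have "\<forall>n. \<forall>i. \<exists>q. (i = 0 \<longrightarrow> q = a) \<and> (i = Suc n \<longrightarrow> q = b) \<and> q \<in> G \<and> (i \<le> Suc n \<longrightarrow> a + (real i - 1) * h n \<le> q \<and> q \<le> a + real i * h n)"
    by (intro allI)
  then have "\<forall>n. \<exists>p. \<forall>i. (i = 0 \<longrightarrow> p i = a) \<and> (i = Suc n \<longrightarrow> p i = b) \<and> p i \<in> G \<and> (i \<le> Suc n \<longrightarrow> a + (real i - 1) * h n \<le> p i \<and> p i \<le> a + real i * h n)"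
    unfolding choice_iff .
  from choice[OF this] obtain p where p: "\<forall>n. \<forall>i. (i = 0 \<longrightarrow> p n i = a) \<and> (i = Suc n \<longrightarrow> p n i = b) \<and> p n i \<in> G \<and> (i \<le> Suc n \<longrightarrow> a + (real i - 1) * h n \<le> p n i \<and> p n i \<le> a + real i * h n)"
    by (elim exE)
  have p0: "p n 0 = a" and pn: "p n (Suc n) = b" and pG: "p n i \<in> G" for n i using p by simp_all
  have plo: "a + (real i - 1) * h n \<le> p n i" and phi: "p n i \<le> a + real i * h n" if "i \<le> Suc n" for n i
    using p that by simp_all
  have pmono: "p n i \<le> p n j" if "i < j" "j \<le> Suc n" for n i j
  proof -
    have "p n i \<le> a + real i * h n" using that by (intro phi) simp
    also have "\<dots> \<le> a + (real j - 1) * h n" using that h0[of n] by (intro add_left_mono mult_right_mono) simp_all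
    also have "\<dots> \<le> p n j" using that by (intro plo) simp
    finally show ?thesis .
  qed
  have pgap: "p n (Suc i) - p n i \<le> 2 * h n" if "i < Suc n" for n i
  proof -
    have "p n (Suc i) \<le> a + real (Suc i) * h n" by (rule phi) (use that in simp)
    moreover have "a + (real i - 1) * h n \<le> p n i" by (rule plo) (use that in simp)
    ultimately show ?thesis by (simp add: algebra_simps)
  qed
  define E where "E t = ip (u t) (v t)" for t
  define S where "S n \<tau> = (\<Sum>i<Suc n. indicator {p n i<..p n (Suc i)} \<tau> * g \<tau> (v (p n (Suc i))) + indicator {p n i<..p n (Suc i)} \<tau> * k \<tau> (u (p n i)))" for n \<tau>
  have gi: "integrable MI (\<lambda>\<tau>. indicator {s<..t} \<tau> * g \<tau> (v r))" if "r \<in> G" for s t r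
    by (rule integrable_indicator_MI[OF L1_predual_apply_const_integrable[OF g v(2)[OF that]]])
  have ki: "integrable MI (\<lambda>\<tau>. indicator {s<..t} \<tau> * k \<tau> (u r))" if "r \<in> G" for s t r
    by (rule integrable_indicator_MI[OF L1_predual_apply_const_integrable[OF k u(2)[OF that]]])
  have Si: "integrable MI (S n)" for n
    unfolding S_def by (intro Bochner_Integration.integrable_sum Bochner_Integration.integrable_add gi ki pG)
  have intS: "(LINT \<tau>|MI. S n \<tau>) = E b - E a" for n
  proof -
    have "(LINT \<tau>|MI. S n \<tau>) = (\<Sum>i<Suc n. LINT \<tau>|MI. indicator {p n i<..p n (Suc i)} \<tau> * g \<tau> (v (p n (Suc i))) + indicator {p n i<..p n (Suc i)} \<tau> * k \<tau> (u (p n i)))"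
      unfolding S_def by (intro Bochner_Integration.integral_sum Bochner_Integration.integrable_add gi ki pG)
    also have "\<dots> = (\<Sum>i<Suc n. E (p n (Suc i)) - E (p n i))"
    proof (rule sum.cong[OF refl])
      fix i assume "i \<in> {..<Suc n}"
      then have i: "i < Suc n" by simp
      have le: "p n i \<le> p n (Suc i)" by (rule pmono) (use i in simp_all)
      have "(LINT \<tau>|MI. indicator {p n i<..p n (Suc i)} \<tau> * g \<tau> (v (p n (Suc i))) + indicator {p n i<..p n (Suc i)} \<tau> * k \<tau> (u (p n i)))
        = (LINT \<tau>|MI. indicator {p n i<..p n (Suc i)} \<tau> * g \<tau> (v (p n (Suc i)))) + (LINT \<tau>|MI. indicator {p n i<..p n (Suc i)} \<tau> * k \<tau> (u (p n i)))"
        by (rule Bochner_Integration.integral_add[OF gi[OF pG] ki[OF pG]])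
      also have "\<dots> = (ip (u (p n (Suc i))) (v (p n (Suc i))) - ip (u (p n i)) (v (p n (Suc i)))) + (ip (v (p n (Suc i))) (u (p n i)) - ip (v (p n i)) (u (p n i)))"
        unfolding incu[OF pG pG le v(2)[OF pG]] incv[OF pG pG le u(2)[OF pG]] ..
      also have "\<dots> = E (p n (Suc i)) - E (p n i)"
        unfolding E_def using ip_commute[of "v (p n (Suc i))" "u (p n i)"] ip_commute[of "v (p n i)" "u (p n i)"] by linarith
      finally show "(LINT \<tau>|MI. indicator {p n i<..p n (Suc i)} \<tau> * g \<tau> (v (p n (Suc i))) + indicator {p n i<..p n (Suc i)} \<tau> * k \<tau> (u (p n i)))
        = E (p n (Suc i)) - E (p n i)" .
    qed
    also have "\<dots> = E (p n (Suc n)) - E (p n 0)" by (rule sum_lessThan_telescope)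
    finally show ?thesis by (simp only: p0 pn)
  qed
  \<comment> \<open>The half-open cells are disjoint, so exactly one summand survives at
    \<open>\<tau>\<close>.\<close>
  have Sin: "\<exists>i. i < Suc n \<and> p n i < \<tau> \<and> \<tau> \<le> p n (Suc i) \<and> S n \<tau> = g \<tau> (v (p n (Suc i))) + k \<tau> (u (p n i))"
    if \<tau>: "a < \<tau>" "\<tau> \<le> b" for n \<tau>
  proof -
    obtain i where i: "i < Suc n" "p n i < \<tau>" "\<tau> \<le> p n (Suc i)"
      by (rule finite_partition_index[of "p n" \<tau> "Suc n"]) (use \<tau> p0 pn in simp_all)
    have ind: "(indicator {p n j<..p n (Suc j)} \<tau> :: real) = (if j = i then 1 else 0)" if j: "j < Suc n" for j
    proof (cases j i rule: linorder_cases)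
      case less
      have "p n (Suc j) \<le> p n i"
      proof (cases "Suc j = i")
        case False
        then show ?thesis using less i(1) by (intro pmono) simp_all
      qed simp
      then show ?thesis using i(2) less by simp
    next
      case equal
      then show ?thesis using i by simp
    next
      case greater
      have "p n (Suc i) \<le> p n j"
      proof (cases "Suc i = j")
        case False
        then show ?thesis using greater j by (intro pmono) simp_all
      qed simp
      then show ?thesis using i(3) greater by simp
    qed
    have "S n \<tau> = (\<Sum>j<Suc n. if j = i then g \<tau> (v (p n (Suc j))) + k \<tau> (u (p n j)) else 0)"
      unfolding S_def by (intro sum.cong refl) (simp add: ind)
    also have "\<dots> = g \<tau> (v (p n (Suc i))) + k \<tau> (u (p n i))" using i(1) by (simp add: sum.delta del: sum.lessThan_Suc)
    finally show ?thesis using i by (intro exI[of _ i]) simp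
  qed
  have Sout: "S n \<tau> = 0" if \<tau>: "\<not> (a < \<tau> \<and> \<tau> \<le> b)" for n \<tau>
  proof -
    have "(indicator {p n j<..p n (Suc j)} \<tau> :: real) = 0" if j: "j < Suc n" for j
    proof -
      have 1: "a \<le> p n j"
      proof (cases j)
        case (Suc j')
        then show ?thesis using pmono[of 0 j n] j p0 by simp
      qed (simp add: p0)
      have 2: "p n (Suc j) \<le> b"
      proof (cases "j = n")
        case False
        then show ?thesis using pmono[of "Suc j" "Suc n" n] j pn by simp
      qed (simp add: pn)
      have "\<not> (p n j < \<tau> \<and> \<tau> \<le> p n (Suc j))" using 1 2 \<tau> by linarith
      then show ?thesis by (simp add: indicator_def)
    qed
    then show ?thesis unfolding S_def by (intro sum.neutral) simp
  qed
  have C0: "0 \<le> C" using V_norm_nonneg[OF u(2)[OF ab(1)]] u(3)[OF ab(1)] by simp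
  have h_lim: "(\<lambda>n. 2 * h n) \<longlonglongrightarrow> 0"
    unfolding h_def by (rule tendsto_mult_right_zero) (rule LIMSEQ_Suc[OF lim_const_over_n])
  define W where "W \<tau> = C * predual_norm \<Omega> \<Gamma>D (g \<tau>) + C * predual_norm \<Omega> \<Gamma>D (k \<tau>)" for \<tau>
  have conv: "(\<lambda>n. S n \<tau>) \<longlonglongrightarrow> indicator {a<..b} \<tau> * (g \<tau> (v \<tau>) + k \<tau> (u \<tau>))" if \<tau>G: "\<tau> \<in> G" for \<tau>
  proof (cases "a < \<tau> \<and> \<tau> \<le> b")
    case True
    then have "\<forall>n. \<exists>i. i < Suc n \<and> p n i < \<tau> \<and> \<tau> \<le> p n (Suc i) \<and> S n \<tau> = g \<tau> (v (p n (Suc i))) + k \<tau> (u (p n i))"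
      using Sin by simp
    from choice[OF this] obtain i where i: "\<forall>n. i n < Suc n \<and> p n (i n) < \<tau> \<and> \<tau> \<le> p n (Suc (i n)) \<and> S n \<tau> = g \<tau> (v (p n (Suc (i n)))) + k \<tau> (u (p n (i n)))"
      by (elim exE)
    have near: "norm (p n (Suc (i n)) - \<tau>) \<le> 2 * h n" "norm (p n (i n) - \<tau>) \<le> 2 * h n" for n
      using pgap[of "i n" n] i by (simp_all add: abs_le_iff) (smt (verit) i)+
    have l1: "(\<lambda>n. p n (Suc (i n))) \<longlonglongrightarrow> \<tau>"
      by (rule LIM_zero_cancel[OF Lim_null_comparison[OF always_eventually[OF allI[OF near(1)]] h_lim]])
    have l2: "(\<lambda>n. p n (i n)) \<longlonglongrightarrow> \<tau>"
      by (rule LIM_zero_cancel[OF Lim_null_comparison[OF always_eventually[OF allI[OF near(2)]] h_lim]])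
    have \<tau>I: "\<tau> \<in> {0<..<T}" using G(2) \<tau>G by auto
    have 1: "(\<lambda>n. g \<tau> (v (p n (Suc (i n))))) \<longlonglongrightarrow> g \<tau> (v \<tau>)"
      by (rule predual_tendsto_of_L1[OF L1_predual_in[OF g \<tau>I] v(2)[OF pG] v(3)[OF pG] v(2)[OF \<tau>G] v(3)[OF \<tau>G]
            L2_dist2_tendsto_L1[OF V_L2[OF v(2)[OF pG]] V_L2[OF v(2)[OF \<tau>G]] modulus_imp_tendsto[OF modv pG \<tau>G l1]]])
    have 2: "(\<lambda>n. k \<tau> (u (p n (i n)))) \<longlonglongrightarrow> k \<tau> (u \<tau>)"
      by (rule predual_tendsto_of_L1[OF L1_predual_in[OF k \<tau>I] u(2)[OF pG] u(3)[OF pG] u(2)[OF \<tau>G] u(3)[OF \<tau>G]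
            L2_dist2_tendsto_L1[OF V_L2[OF u(2)[OF pG]] V_L2[OF u(2)[OF \<tau>G]] modulus_imp_tendsto[OF modu pG \<tau>G l2]]])
    have "S n \<tau> = g \<tau> (v (p n (Suc (i n)))) + k \<tau> (u (p n (i n)))" for n using i by simp
    then show ?thesis using tendsto_add[OF 1 2] True by simp
  next
    case False
    then have "(indicator {a<..b} \<tau> :: real) = 0" by (auto simp: indicator_def)
    then show ?thesis using Sout[OF False] by simp
  qed
  have "(\<lambda>n. LINT \<tau>|MI. S n \<tau>) \<longlonglongrightarrow> (LINT \<tau>|MI. indicator {a<..b} \<tau> * (g \<tau> (v \<tau>) + k \<tau> (u \<tau>)))"
  proof (rule integral_dominated_convergence[where w = W])
    show "integrable MI W" unfolding W_def
      by (intro Bochner_Integration.integrable_add integrable_mult_right L1_predual_norm_int g k)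
    show "S n \<in> borel_measurable MI" for n by (rule borel_measurable_integrable[OF Si])
    show "(\<lambda>\<tau>. indicator {a<..b} \<tau> * (g \<tau> (v \<tau>) + k \<tau> (u \<tau>))) \<in> borel_measurable MI"
      by (intro borel_measurable_times indicator_MI borel_measurable_add L1_predual_apply_measurable g k u(1) v(1))
    show "AE \<tau> in MI. (\<lambda>n. S n \<tau>) \<longlonglongrightarrow> indicator {a<..b} \<tau> * (g \<tau> (v \<tau>) + k \<tau> (u \<tau>))"
      using G(1) by (rule eventually_mono) (rule conv)
    show "AE \<tau> in MI. norm (S n \<tau>) \<le> W \<tau>" for n
      using AE_MI_in
    proof eventually_elim
      case (elim \<tau>)
      note gp = L1_predual_in[OF g elim] and kp = L1_predual_in[OF k elim]
      have gb: "\<bar>g \<tau> (v r)\<bar> \<le> C * predual_norm \<Omega> \<Gamma>D (g \<tau>)" if "r \<in> G" for r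
        using order_trans[OF predual_le[OF gp v(2)[OF that]] mult_left_mono[OF v(3)[OF that] predual_norm_nonneg[OF gp]]]
        by (simp add: mult.commute)
      have kb: "\<bar>k \<tau> (u r)\<bar> \<le> C * predual_norm \<Omega> \<Gamma>D (k \<tau>)" if "r \<in> G" for r
        using order_trans[OF predual_le[OF kp u(2)[OF that]] mult_left_mono[OF u(3)[OF that] predual_norm_nonneg[OF kp]]]
        by (simp add: mult.commute)
      show ?case
      proof (cases "a < \<tau> \<and> \<tau> \<le> b")
        case True
        obtain i where "S n \<tau> = g \<tau> (v (p n (Suc i))) + k \<tau> (u (p n i))" using Sin[of \<tau> n] True by auto
        then show ?thesis using gb[OF pG[of n "Suc i"]] kb[OF pG[of n i]] unfolding W_def real_norm_def by linarith
      next
        case False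
        have "0 \<le> W \<tau>" unfolding W_def using C0 predual_norm_nonneg[OF gp] predual_norm_nonneg[OF kp] by simp
        then show ?thesis using Sout[OF False] by simp
      qed
    qed
  qed
  then have "(\<lambda>n::nat. E b - E a) \<longlonglongrightarrow> (LINT \<tau>|MI. indicator {a<..b} \<tau> * (g \<tau> (v \<tau>) + k \<tau> (u \<tau>)))"
    unfolding intS .
  then show ?thesis unfolding E_def by (simp only: LIMSEQ_const_iff)
qed

lemma C0H_rep_tendsto:
  assumes c: "is_C0H_rep \<Omega> T u c" and t: "t \<in> {0..T}" and r: "\<And>n. r n \<in> {0..T}" "r \<longlonglongrightarrow> t"
  shows "(\<lambda>n. L2_dist2 M (c (r n)) (c t)) \<longlonglongrightarrow> 0"
proof -
  define f where "f s = L2_norm M (\<lambda>x. c s x - c t x)" for s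
  have f: "(f \<longlongrightarrow> 0) (at t within {0..T})" unfolding f_def using c t by (simp add: is_C0H_rep_def)
  have ft: "f t = 0" by (simp add: f_def L2_norm_def)
  have "(\<lambda>n. f (r n)) \<longlonglongrightarrow> f t"
  proof (rule continuous_within_tendsto_compose[of t "{0..T}" f])
    show "continuous (at t within {0..T}) f" using f ft by (simp add: continuous_within)
  qed (use r in simp_all)
  then have "(\<lambda>n. (f (r n))\<^sup>2) \<longlonglongrightarrow> 0\<^sup>2" unfolding ft by (rule tendsto_power)
  moreover have "(f s)\<^sup>2 = L2_dist2 M (c s) (c t)" for s
    unfolding f_def L2_norm_def using L2_dist2_nonneg[of M "c s" "c t"] by (simp add: L2_dist2_def)
  ultimately show ?thesis by simp
qed

text \<open>The product formula holds between good times, where the continuous representatives agree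
  with \<open>u\<close> and \<open>v\<close>. Letting these times tend to \<open>0\<close> and
  \<open>T\<close> uses continuity in \<open>H\<close> for the boundary terms and integrability for
  the integral. With \<open>u = v\<close> it is the energy identity.\<close>

lemma integration_by_parts:
  assumes u: "u \<in> Linf_wstar \<Omega> \<Gamma>D T" "has_time_deriv \<Omega> \<Gamma>D T u g" "is_C0H_rep \<Omega> T u cu"
    and v: "v \<in> Linf_wstar \<Omega> \<Gamma>D T" "has_time_deriv \<Omega> \<Gamma>D T v k" "is_C0H_rep \<Omega> T v cv"
  shows "(LINT t|MI. g t (v t)) + (LINT t|MI. k t (u t)) = ip (cu T) (cv T) - ip (cu 0) (cv 0)"
proof -
  note gL = has_time_derivD(2)[OF u(2)] and kL = has_time_derivD(2)[OF v(2)]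
  obtain Gu Cu where Gu: "AE t in MI. t \<in> Gu" "Gu \<subseteq> {0<..<T}" "0 \<le> Cu"
    "\<And>t. t \<in> Gu \<Longrightarrow> u t \<in> V" "\<And>t. t \<in> Gu \<Longrightarrow> V_norm \<Omega> (u t) \<le> Cu"
    "\<And>t1 t2 w. t1 \<in> Gu \<Longrightarrow> t2 \<in> Gu \<Longrightarrow> t1 \<le> t2 \<Longrightarrow> w \<in> V \<Longrightarrow>
      ip (u t2) w - ip (u t1) w = (LINT \<tau>|MI. indicator {t1<..t2} \<tau> * g \<tau> w)"
    "\<And>e. 0 < e \<Longrightarrow> \<exists>\<delta>>0. \<forall>s\<in>Gu. \<forall>t\<in>Gu. \<bar>s - t\<bar> < \<delta> \<longrightarrow> L2_dist2 M (u s) (u t) < e"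
    by (rule time_regularity[OF u(1,2)], rule that)
  obtain Gv Cv where Gv: "AE t in MI. t \<in> Gv" "Gv \<subseteq> {0<..<T}" "0 \<le> Cv"
    "\<And>t. t \<in> Gv \<Longrightarrow> v t \<in> V" "\<And>t. t \<in> Gv \<Longrightarrow> V_norm \<Omega> (v t) \<le> Cv"
    "\<And>t1 t2 w. t1 \<in> Gv \<Longrightarrow> t2 \<in> Gv \<Longrightarrow> t1 \<le> t2 \<Longrightarrow> w \<in> V \<Longrightarrow>
      ip (v t2) w - ip (v t1) w = (LINT \<tau>|MI. indicator {t1<..t2} \<tau> * k \<tau> w)"
    "\<And>e. 0 < e \<Longrightarrow> \<exists>\<delta>>0. \<forall>s\<in>Gv. \<forall>t\<in>Gv. \<bar>s - t\<bar> < \<delta> \<longrightarrow> L2_dist2 M (v s) (v t) < e"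
    by (rule time_regularity[OF v(1,2)], rule that)
  have cu_ae: "AE t in MI. AE x in M. cu t x = u t x" and cv_ae: "AE t in MI. AE x in M. cv t x = v t x"
    using u(3) v(3) by (simp_all add: is_C0H_rep_def)
  have cuL: "cu t \<in> L2 M" and cvL: "cv t \<in> L2 M" if "t \<in> {0..T}" for t
    using u(3) v(3) that by (simp_all add: is_C0H_rep_def)
  define C where "C = max Cu Cv"
  define G where "G = {t \<in> Gu \<inter> Gv. (AE x in M. cu t x = u t x) \<and> (AE x in M. cv t x = v t x)}"
  have GU: "t \<in> Gu" and GV: "t \<in> Gv" if "t \<in> G" for t using that by (simp_all add: G_def)
  have G: "AE t in MI. t \<in> G" "G \<subseteq> {0<..<T}"
  proof -
    show "AE t in MI. t \<in> G" using Gu(1) Gv(1) cu_ae cv_ae by eventually_elim (simp add: G_def)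
    show "G \<subseteq> {0<..<T}" using Gu(2) by (auto simp: G_def)
  qed
  have modu: "\<exists>\<delta>>0. \<forall>s\<in>G. \<forall>t\<in>G. \<bar>s - t\<bar> < \<delta> \<longrightarrow> L2_dist2 M (u s) (u t) < e" if e: "0 < e" for e
  proof -
    obtain \<delta> where "0 < \<delta>" "\<forall>s\<in>Gu. \<forall>t\<in>Gu. \<bar>s - t\<bar> < \<delta> \<longrightarrow> L2_dist2 M (u s) (u t) < e"
      using Gu(7)[OF e] by (elim exE conjE)
    then show ?thesis using GU by (intro exI[of _ \<delta>]) simp
  qed
  have modv: "\<exists>\<delta>>0. \<forall>s\<in>G. \<forall>t\<in>G. \<bar>s - t\<bar> < \<delta> \<longrightarrow> L2_dist2 M (v s) (v t) < e" if e: "0 < e" for e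
  proof -
    obtain \<delta> where "0 < \<delta>" "\<forall>s\<in>Gv. \<forall>t\<in>Gv. \<bar>s - t\<bar> < \<delta> \<longrightarrow> L2_dist2 M (v s) (v t) < e"
      using Gv(7)[OF e] by (elim exE conjE)
    then show ?thesis using GV by (intro exI[of _ \<delta>]) simp
  qed
  have uC: "V_norm \<Omega> (u t) \<le> C" and vC: "V_norm \<Omega> (v t) \<le> C" if "t \<in> G" for t
    using Gu(5)[OF GU[OF that]] Gv(5)[OF GV[OF that]] by (simp_all add: C_def)
  define F where "F \<tau> = g \<tau> (v \<tau>) + k \<tau> (u \<tau>)" for \<tau>
  have gi: "integrable MI (\<lambda>t. g t (v t))" and ki: "integrable MI (\<lambda>t. k t (u t))"
    by (rule L1_predual_apply_integrable[OF gL v(1)], rule L1_predual_apply_integrable[OF kL u(1)])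
  have Fi: "integrable MI F" unfolding F_def by (rule Bochner_Integration.integrable_add[OF gi ki])
  have incr: "ip (u b) (v b) - ip (u a) (v a) = (LINT \<tau>|MI. indicator {a<..b} \<tau> * F \<tau>)" if "a \<in> G" "b \<in> G" "a < b" for a b
    unfolding F_def
    by (rule increment_product[OF G u(1) Gu(4)[OF GU] uC v(1) Gv(4)[OF GV] vC gL kL Gu(6)[OF GU GU] Gv(6)[OF GV GV] modu modv that])
  \<comment> \<open>At most \<open>T / 2\<close>, so that the two families of times never
    cross.\<close>
  define \<epsilon> where "\<epsilon> n = T / 2 / real (Suc n)" for n
  have \<epsilon>: "0 < \<epsilon> n" "\<epsilon> n \<le> T / 2" for n
    using T_pos by (simp_all add: \<epsilon>_def field_simps)
  have \<epsilon>_lim: "\<epsilon> \<longlonglongrightarrow> 0" unfolding \<epsilon>_def by (rule LIMSEQ_Suc[OF lim_const_over_n])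
  have "\<exists>a. a \<in> G \<and> 0 < a \<and> a < \<epsilon> n" for n
  proof -
    obtain q where "q \<in> G" "0 < q" "q < \<epsilon> n"
      by (rule AE_MI_dense[OF G(1), of 0 "\<epsilon> n"]) (use \<epsilon>[of n] T_pos in auto)
    then show ?thesis by auto
  qed
  then have "\<forall>n. \<exists>a. a \<in> G \<and> 0 < a \<and> a < \<epsilon> n" by simp
  from choice[OF this] obtain a where a: "\<forall>n. a n \<in> G \<and> 0 < a n \<and> a n < \<epsilon> n" by (elim exE)
  have "\<exists>b. b \<in> G \<and> T - \<epsilon> n < b \<and> b < T" for n
  proof -
    obtain q where "q \<in> G" "T - \<epsilon> n < q" "q < T"
      by (rule AE_MI_dense[OF G(1), of "T - \<epsilon> n" T]) (use \<epsilon>[of n] T_pos in auto)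
    then show ?thesis by auto
  qed
  then have "\<forall>n. \<exists>b. b \<in> G \<and> T - \<epsilon> n < b \<and> b < T" by simp
  from choice[OF this] obtain b where b: "\<forall>n. b n \<in> G \<and> T - \<epsilon> n < b n \<and> b n < T" by (elim exE)
  have ab: "a n < b n" for n
  proof -
    have "a n < \<epsilon> n" "T - \<epsilon> n < b n" using a b by simp_all
    then show ?thesis using \<epsilon>(2)[of n] by linarith
  qed
  have a_lim: "a \<longlonglongrightarrow> 0"
    by (rule Lim_null_comparison[OF always_eventually \<epsilon>_lim]) (use a in \<open>simp add: less_imp_le\<close>)
  have b_lim: "b \<longlonglongrightarrow> T"
  proof (rule LIM_zero_cancel[OF Lim_null_comparison[OF always_eventually \<epsilon>_lim]], rule allI)
    fix n
    have "T - \<epsilon> n < b n" "b n < T" using b by simp_all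
    then show "norm (b n - T) \<le> \<epsilon> n" by simp
  qed
  have ipeq: "ip (u t) (v t) = ip (cu t) (cv t)" if t: "t \<in> G" for t
  proof -
    have "AE x in M. cu t x = u t x" "AE x in M. cv t x = v t x" using t by (simp_all add: G_def)
    then have ae: "AE x in M. u t x \<bullet> v t x = cu t x \<bullet> cv t x" by eventually_elim simp
    have tI: "t \<in> {0..T}" using subsetD[OF G(2) t] by simp
    have m: "u t \<in> borel_measurable M" "v t \<in> borel_measurable M" "cu t \<in> borel_measurable M" "cv t \<in> borel_measurable M"
      by (rule L2D(1)[OF V_L2[OF Gu(4)[OF GU[OF t]]]], rule L2D(1)[OF V_L2[OF Gv(4)[OF GV[OF t]]]],
          rule L2D(1)[OF cuL[OF tI]], rule L2D(1)[OF cvL[OF tI]])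
    show ?thesis unfolding L2_inner_def
      by (rule integral_cong_AE[OF borel_measurable_inner[OF m(1,2)] borel_measurable_inner[OF m(3,4)] ae])
  qed
  have aI: "a n \<in> {0..T}" and bI: "b n \<in> {0..T}" for n
  proof -
    have "a n \<in> G" "b n \<in> G" using a b by simp_all
    from this[THEN subsetD[OF G(2)]] show "a n \<in> {0..T}" "b n \<in> {0..T}" by simp_all
  qed
  have T0: "0 \<in> {0..T}" "T \<in> {0..T}" using T_pos by simp_all
  have "(\<lambda>n. ip (cu (b n)) (cv (b n)) - ip (cu (a n)) (cv (a n))) \<longlonglongrightarrow> ip (cu T) (cv T) - ip (cu 0) (cv 0)"
    by (intro tendsto_diff L2_inner_tendsto cuL cvL aI bI T0 C0H_rep_tendsto[OF u(3)] C0H_rep_tendsto[OF v(3)] a_lim b_lim)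
  moreover have "(\<lambda>n. LINT \<tau>|MI. indicator {a n<..b n} \<tau> * F \<tau>) \<longlonglongrightarrow> (LINT \<tau>|MI. F \<tau>)"
  proof (rule integral_dominated_convergence[where w = "\<lambda>\<tau>. norm (F \<tau>)"])
    show "integrable MI (\<lambda>\<tau>. norm (F \<tau>))" by (rule integrable_norm[OF Fi])
    show "F \<in> borel_measurable MI" by (rule borel_measurable_integrable[OF Fi])
    show "(\<lambda>\<tau>. indicator {a n<..b n} \<tau> * F \<tau>) \<in> borel_measurable MI" for n
      by (rule borel_measurable_integrable[OF integrable_indicator_MI[OF Fi]])
    show "AE \<tau> in MI. (\<lambda>n. indicator {a n<..b n} \<tau> * F \<tau>) \<longlonglongrightarrow> F \<tau>"
      using AE_MI_in
    proof eventually_elim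
      case (elim \<tau>)
      have "\<forall>\<^sub>F n in sequentially. a n < \<tau>" by (rule order_tendstoD(2)[OF a_lim]) (use elim in simp)
      moreover have "\<forall>\<^sub>F n in sequentially. \<tau> < b n" by (rule order_tendstoD(1)[OF b_lim]) (use elim in simp)
      ultimately have "\<forall>\<^sub>F n in sequentially. indicator {a n<..b n} \<tau> * F \<tau> = F \<tau>"
        by eventually_elim simp
      then show ?case by (rule tendsto_eventually)
    qed
    show "AE \<tau> in MI. norm (indicator {a n<..b n} \<tau> * F \<tau>) \<le> norm (F \<tau>)" for n
      by (rule AE_I2) (simp add: indicator_def)
  qed
  moreover have "ip (cu (b n)) (cv (b n)) - ip (cu (a n)) (cv (a n)) = (LINT \<tau>|MI. indicator {a n<..b n} \<tau> * F \<tau>)" for n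
  proof -
    have "a n \<in> G" "b n \<in> G" using a b by simp_all
    then show ?thesis using incr[OF _ _ ab[of n]] ipeq by simp
  qed
  ultimately have "(LINT \<tau>|MI. F \<tau>) = ip (cu T) (cv T) - ip (cu 0) (cv 0)"
    using LIMSEQ_unique by simp
  then show ?thesis unfolding F_def Bochner_Integration.integral_add[OF gi ki] .
qed

end

section \<open>Joint measurability of the space-time gradient\<close>

text \<open>A family of densities that is weakly measurable in the parameter has a jointly measurable
  representative: the Radon--Nikodym density of the measure that it defines on the product.\<close>

lemma joint_density_exists:
  fixes f :: "real \<Rightarrow> 'a::euclidean_space \<Rightarrow> real"
  assumes fm: "\<And>t. f t \<in> borel_measurable lebesgue"
    and fin: "\<And>t. (\<integral>\<^sup>+x. ennreal (f t x) \<partial>lebesgue) < \<infinity>"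
    and tm: "\<And>B. B \<in> sets borel \<Longrightarrow> (\<lambda>t. \<integral>\<^sup>+x. ennreal (f t x) * indicator B x \<partial>lebesgue) \<in> borel_measurable lebesgue"
  obtains H :: "real \<times> 'a \<Rightarrow> ennreal" where "H \<in> borel_measurable borel"
    "AE t in lebesgue. AE x in lebesgue. H (t, x) = ennreal (f t x)"
proof -
  \<comment> \<open>The slices form a kernel of finite measures; measurability in \<open>t\<close>
    is available only for the masses of fixed Borel sets, not for the densities.\<close>
  define \<kappa> where "\<kappa> t = density lebesgue (\<lambda>x. ennreal (f t x))" for t
  have fme: "(\<lambda>x. ennreal (f t x)) \<in> borel_measurable lebesgue" for t using fm[of t] by measurable
  have \<kappa>e: "emeasure (\<kappa> t) B = (\<integral>\<^sup>+x. ennreal (f t x) * indicator B x \<partial>lebesgue)" if "B \<in> sets borel" for t B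
    unfolding \<kappa>_def by (rule emeasure_density[OF fme]) (use that in \<open>simp add: sets_completionI_sets\<close>)
  have \<kappa>m: "(\<lambda>t. emeasure (\<kappa> t) B) \<in> borel_measurable lebesgue" if "B \<in> sets borel" for B
    unfolding \<kappa>e[OF that] by (rule tm[OF that])
  have \<kappa>s: "B \<in> sets (\<kappa> t)" if "B \<in> sets borel" for B t
    unfolding \<kappa>_def using that by (simp add: sets_completionI_sets)
  have \<kappa>fin: "emeasure (\<kappa> t) B \<noteq> \<infinity>" if "B \<in> sets borel" for t B
  proof -
    have "emeasure (\<kappa> t) B \<le> emeasure (\<kappa> t) UNIV" by (rule emeasure_mono) (use \<kappa>s in auto)
    also have "\<dots> < \<infinity>" using fin[of t] by (simp add: \<kappa>e)
    finally show ?thesis by simp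
  qed
  define \<phi> where "\<phi> A t = emeasure (\<kappa> t) (Pair t -` A)" for A t
  have sec: "Pair t -` A \<in> sets borel" if "A \<in> sets (borel \<Otimes>\<^sub>M borel)" for A :: "(real \<times> 'a) set" and t
    by (rule sets_Pair1[OF that])
  have \<phi>_UN: "\<phi> (\<Union>i. A i) t = (\<Sum>i. \<phi> (A i) t)"
    if A: "disjoint_family A" "\<And>i. A i \<in> sets (borel \<Otimes>\<^sub>M borel)" for A :: "nat \<Rightarrow> (real \<times> 'a) set" and t
  proof -
    have "\<phi> (\<Union>i. A i) t = emeasure (\<kappa> t) (\<Union>i. Pair t -` A i)" by (simp add: \<phi>_def vimage_UN)
    also have "\<dots> = (\<Sum>i. emeasure (\<kappa> t) (Pair t -` A i))"
      by (rule suminf_emeasure[symmetric]) (use A(1) \<kappa>s[OF sec[OF A(2)]] in \<open>auto simp: disjoint_family_on_def\<close>)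
    finally show ?thesis by (simp add: \<phi>_def)
  qed
  let ?G = "{a \<times> b | a b. a \<in> sets (borel :: real measure) \<and> b \<in> sets (borel :: 'a measure)}"
  have rect: "\<phi> (a \<times> b) = (\<lambda>t. indicator a t * emeasure (\<kappa> t) b)" for a b
    by (auto simp: \<phi>_def fun_eq_iff indicator_def)
  have \<phi>m: "\<phi> A \<in> borel_measurable lebesgue" if A: "A \<in> sets (borel \<Otimes>\<^sub>M borel)" for A
  proof -
    have "Int_stable ?G" by (rule Int_stable_pair_measure_generator)
    moreover have "?G \<subseteq> Pow (space (borel :: real measure) \<times> space (borel :: 'a measure))" by auto
    moreover have "A \<in> sigma_sets (space (borel :: real measure) \<times> space (borel :: 'a measure)) ?G"
      using A unfolding sets_pair_measure .
    ultimately show ?thesis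
    proof (induction rule: sigma_sets_induct_disjoint)
      case (basic A)
      then obtain a b where ab: "A = a \<times> b" "a \<in> sets borel" "b \<in> sets borel" by auto
      show ?case unfolding ab(1) rect
        by (rule borel_measurable_times_ennreal[OF borel_measurable_indicator \<kappa>m[OF ab(3)]])
           (use ab(2) in \<open>simp add: sets_completionI_sets\<close>)
    next
      case empty
      then show ?case by (simp add: \<phi>_def)
    next
      case (compl A)
      have As: "A \<in> sets (borel \<Otimes>\<^sub>M borel)" using compl(1) unfolding sets_pair_measure .
      have "\<phi> (space borel \<times> space borel - A) t = emeasure (\<kappa> t) UNIV - \<phi> A t" for t
      proof -
        have "Pair t -` (space borel \<times> space borel - A) = UNIV - Pair t -` A" by auto
        moreover have "emeasure (\<kappa> t) (UNIV - Pair t -` A) = emeasure (\<kappa> t) UNIV - emeasure (\<kappa> t) (Pair t -` A)"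
          by (rule emeasure_Diff) (use \<kappa>s[OF sec[OF As]] \<kappa>s[of UNIV] \<kappa>fin[OF sec[OF As]] in auto)
        ultimately show ?thesis by (simp add: \<phi>_def)
      qed
      moreover have "(\<lambda>t. emeasure (\<kappa> t) UNIV - \<phi> A t) \<in> borel_measurable lebesgue"
        by (rule borel_measurable_minus_ennreal[OF \<kappa>m compl(2)]) simp
      ultimately show ?case by (simp add: fun_eq_iff[symmetric])
    next
      case (union A)
      have As: "A i \<in> sets (borel \<Otimes>\<^sub>M borel)" for i using union(2) unfolding sets_pair_measure by auto
      have "\<phi> (\<Union>i. A i) = (\<lambda>t. \<Sum>i. \<phi> (A i) t)" using \<phi>_UN[OF union(1) As] by (rule ext)
      then show ?case using borel_measurable_suminf_order[OF union(3)] by simp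
    qed
  qed
  define \<nu> where "\<nu> A = (\<integral>\<^sup>+t. \<phi> A t \<partial>lebesgue)" for A
  define N where "N = measure_of UNIV (sets (borel :: (real \<times> 'a) measure)) \<nu>"
  have bp: "sets (borel :: (real \<times> 'a) measure) = sets (borel \<Otimes>\<^sub>M borel)"
    unfolding borel_prod ..
  have sN: "sets N = sets borel"
    using sets.sigma_sets_eq[of "borel :: (real \<times> 'a) measure"] by (simp add: N_def)
  have eN: "emeasure N A = \<nu> A" if A: "A \<in> sets borel" for A
  proof (rule emeasure_measure_of[OF N_def])
    show "positive (sets N) \<nu>" by (simp add: positive_def \<nu>_def \<phi>_def)
    show "countably_additive (sets N) \<nu>"
    proof (rule countably_additiveI)
      fix A :: "nat \<Rightarrow> (real \<times> 'a) set" assume A: "range A \<subseteq> sets N" "disjoint_family A"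
      have As: "A i \<in> sets (borel \<Otimes>\<^sub>M borel)" for i using A(1) unfolding sN bp by auto
      have "\<nu> (\<Union>i. A i) = (\<integral>\<^sup>+t. (\<Sum>i. \<phi> (A i) t) \<partial>lebesgue)" unfolding \<nu>_def \<phi>_UN[OF A(2) As] ..
      also have "\<dots> = (\<Sum>i. \<nu> (A i))" unfolding \<nu>_def by (rule nn_integral_suminf[OF \<phi>m[OF As]])
      finally show "(\<Sum>i. \<nu> (A i)) = \<nu> (\<Union>i. A i)" by simp
    qed
  qed (use A sN in auto)
  \<comment> \<open>Almost all sections of a null set are null, and each slice has a
    density.\<close>
  have ac: "absolutely_continuous lborel N"
    unfolding absolutely_continuous_def
  proof
    fix A :: "(real \<times> 'a) set" assume A: "A \<in> null_sets lborel"
    have "AE p in lborel \<Otimes>\<^sub>M lborel. p \<notin> A" unfolding lborel_prod by (rule AE_not_in[OF A])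
    then have "AE t in lborel. AE x in lborel. (t, x) \<notin> A" by (rule lborel_pair.AE_pair)
    then have "AE t in lebesgue. AE x in lborel. (t, x) \<notin> A" by (rule AE_completion)
    then have "AE t in lebesgue. \<phi> A t = 0"
    proof eventually_elim
      case (elim t)
      have As: "Pair t -` A \<in> sets borel" using A by (intro sec) (simp add: bp[symmetric] null_sets_def)
      have "(\<integral>\<^sup>+x. ennreal (f t x) * indicator (Pair t -` A) x \<partial>lebesgue) = (\<integral>\<^sup>+x. 0 \<partial>(lebesgue :: 'a measure))"
      proof (rule nn_integral_cong_AE)
        show "AE x in lebesgue. ennreal (f t x) * indicator (Pair t -` A) x = 0"
          using AE_completion[OF elim] by eventually_elim (simp add: indicator_def)
      qed
      then show ?case by (simp add: \<phi>_def \<kappa>e[OF As])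
    qed
    then have "\<nu> A = (\<integral>\<^sup>+t. 0 \<partial>(lebesgue :: real measure))" unfolding \<nu>_def by (rule nn_integral_cong_AE[where v = "\<lambda>_. 0"])
    moreover have "A \<in> sets borel" using A by (simp add: null_sets_def)
    ultimately show "A \<in> null_sets N" using sN eN by (simp add: null_sets_def)
  qed
  obtain H where H: "H \<in> borel_measurable lborel" "density lborel H = N"
    using sigma_finite_measure.Radon_Nikodym[OF sigma_finite_lborel ac] sN by auto
  have Hb: "H \<in> borel_measurable borel" using H(1) by simp
  have Hp: "H \<in> borel_measurable (borel \<Otimes>\<^sub>M borel)" using Hb by (simp add: borel_prod)
  have Ht: "(\<lambda>x. H (t, x)) \<in> borel_measurable borel" for t
    by (rule measurable_compose[OF measurable_Pair1' Hp]) simp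
  \<comment> \<open>Both sides are densities in \<open>t\<close> of the measure that sends
    \<open>a\<close> to the mass of \<open>a \<times> b\<close>. The right side is only Lebesgue
    measurable and is replaced by a Borel version \<open>g'\<close>.\<close>
  have slice: "AE t in lebesgue. (\<integral>\<^sup>+x. H (t, x) * indicator b x \<partial>lborel) = emeasure (\<kappa> t) b" if b: "b \<in> sets borel" for b
  proof -
    obtain g' where g': "g' \<in> borel_measurable lborel" "AE t in lborel. emeasure (\<kappa> t) b = g' t"
      using completion_ex_borel_measurable[OF \<kappa>m[OF b]] by auto
    define k where "k t = (\<integral>\<^sup>+x. H (t, x) * indicator b x \<partial>lborel)" for t
    have bi: "(\<lambda>p. indicator b (snd p) :: ennreal) \<in> borel_measurable (borel \<Otimes>\<^sub>M borel)"
      by (rule measurable_compose[OF measurable_snd]) (use b in simp)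
    have km: "k \<in> borel_measurable lborel"
    proof -
      have "(\<lambda>(t, x). H (t, x) * indicator b x) \<in> borel_measurable (lborel \<Otimes>\<^sub>M lborel)"
        using borel_measurable_times_ennreal[OF Hp bi] by (simp add: case_prod_beta' cong: measurable_cong_sets)
      from lborel.borel_measurable_nn_integral[OF this] show ?thesis by (simp add: k_def[abs_def])
    qed
    have "AE t in lborel. k t = g' t"
    proof (rule sigma_finite_measure.density_unique2[OF sigma_finite_lborel km g'(1)])
      fix a :: "real set" assume "a \<in> sets lborel"
      then have a: "a \<in> sets borel" by simp
      have ab: "a \<times> b \<in> sets borel" using a b by (simp add: bp)
      have "(\<integral>\<^sup>+t\<in>a. k t \<partial>lborel) = (\<integral>\<^sup>+t. (\<integral>\<^sup>+x. H (t, x) * indicator (a \<times> b) (t, x) \<partial>lborel) \<partial>lborel)"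
      proof (rule nn_integral_cong)
        fix t :: real
        show "k t * indicator a t = (\<integral>\<^sup>+x. H (t, x) * indicator (a \<times> b) (t, x) \<partial>lborel)"
          by (cases "t \<in> a") (simp_all add: k_def indicator_times)
      qed
      also have "\<dots> = (\<integral>\<^sup>+p. H p * indicator (a \<times> b) p \<partial>(lborel \<Otimes>\<^sub>M lborel))"
      proof (rule lborel.nn_integral_fst)
        show "(\<lambda>p. H p * indicator (a \<times> b) p) \<in> borel_measurable (lborel \<Otimes>\<^sub>M lborel)"
          unfolding lborel_prod using Hb ab by (intro borel_measurable_times_ennreal borel_measurable_indicator) simp_all
      qed
      also have "\<dots> = emeasure N (a \<times> b)"
        unfolding lborel_prod H(2)[symmetric] by (rule emeasure_density[symmetric, OF H(1)]) (use ab in simp)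
      also have "\<dots> = (\<integral>\<^sup>+t. indicator a t * emeasure (\<kappa> t) b \<partial>lebesgue)"
        unfolding eN[OF ab] \<nu>_def rect ..
      also have "\<dots> = (\<integral>\<^sup>+t. indicator a t * emeasure (\<kappa> t) b \<partial>lborel)" by (rule nn_integral_completion)
      also have "\<dots> = (\<integral>\<^sup>+t\<in>a. g' t \<partial>lborel)"
      proof (rule nn_integral_cong_AE)
        show "AE t in lborel. indicator a t * emeasure (\<kappa> t) b = g' t * indicator a t"
          using g'(2) by eventually_elim (simp add: mult.commute)
      qed
      finally show "(\<integral>\<^sup>+t\<in>a. k t \<partial>lborel) = (\<integral>\<^sup>+t\<in>a. g' t \<partial>lborel)" .
    qed
    with g'(2) have "AE t in lborel. k t = emeasure (\<kappa> t) b" by eventually_elim simp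
    then show ?thesis unfolding k_def by (rule AE_completion)
  qed
  obtain B :: "'a set set" where B: "countable B" "topological_basis B" using ex_countable_basis by auto
  \<comment> \<open>The null set in \<open>slice\<close> depends on \<open>b\<close>. A countable
    generator closed under intersections allows one null set for all its members and still
    determines finite measures.\<close>
  define D where "D = (\<lambda>F. \<Inter>F) ` {F. finite F \<and> F \<subseteq> B}"
  have cD: "countable D" unfolding D_def by (intro countable_image countable_Collect_finite_subset B(1))
  have Db: "b \<in> sets borel" if "b \<in> D" for b
  proof -
    obtain F where F: "finite F" "F \<subseteq> B" "b = \<Inter>F" using \<open>b \<in> D\<close> unfolding D_def by auto
    have "open b" unfolding F(3) using F(1,2) topological_basis_open[OF B(2)] by (intro open_Inter) auto
    then show ?thesis by simp
  qed
  \<comment> \<open>The empty intersection; it supplies the set of finite mass needed for uniqueness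
    of measures.\<close>
  have UD: "UNIV \<in> D" unfolding D_def by (rule image_eqI[of _ _ "{}"]) simp_all
  have DI: "Int_stable D"
  proof (rule Int_stableI)
    fix x y assume "x \<in> D" "y \<in> D"
    then obtain F G where "x = \<Inter>F" "y = \<Inter>G" "finite F" "F \<subseteq> B" "finite G" "G \<subseteq> B" unfolding D_def by auto
    then show "x \<inter> y \<in> D" unfolding D_def by (intro image_eqI[of _ _ "F \<union> G"]) auto
  qed
  have sD: "sigma_sets UNIV D = sets (borel :: 'a measure)"
  proof
    show "sigma_sets UNIV D \<subseteq> sets borel" using sets.sigma_sets_subset[of D borel] Db by auto
    have "B \<subseteq> D"
    proof
      fix b assume "b \<in> B"
      then show "b \<in> D" unfolding D_def by (intro image_eqI[of _ _ "{b}"]) auto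
    qed
    have "sets (borel :: 'a measure) = sigma_sets UNIV B"
      unfolding borel_eq_countable_basis[OF B] by simp
    also have "\<dots> \<subseteq> sigma_sets UNIV D" by (rule sigma_sets_mono'[OF \<open>B \<subseteq> D\<close>])
    finally show "sets (borel :: 'a measure) \<subseteq> sigma_sets UNIV D" .
  qed
  have "AE t in lebesgue. \<forall>b\<in>D. (\<integral>\<^sup>+x. H (t, x) * indicator b x \<partial>lborel) = emeasure (\<kappa> t) b"
    by (rule AE_ball_countable'[OF slice[OF Db] cD])
  then have "AE t in lebesgue. AE x in lebesgue. H (t, x) = ennreal (f t x)"
  proof eventually_elim
    case (elim t)
    obtain f' where f': "f' \<in> borel_measurable lborel" "AE x in lborel. f t x = f' x"
      using completion_ex_borel_measurable_real[OF fm[of t]] by auto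
    have f'e: "(\<lambda>x. ennreal (f' x)) \<in> borel_measurable lborel" using f'(1) by measurable
    have \<kappa>f': "emeasure (\<kappa> t) b = (\<integral>\<^sup>+x. ennreal (f' x) * indicator b x \<partial>lborel)" if b: "b \<in> sets borel" for b
    proof -
      have "emeasure (\<kappa> t) b = (\<integral>\<^sup>+x. ennreal (f t x) * indicator b x \<partial>lborel)"
        unfolding \<kappa>e[OF b] by (rule nn_integral_completion)
      also have "\<dots> = (\<integral>\<^sup>+x. ennreal (f' x) * indicator b x \<partial>lborel)"
      proof (rule nn_integral_cong_AE)
        show "AE x in lborel. ennreal (f t x) * indicator b x = ennreal (f' x) * indicator b x"
          using f'(2) by eventually_elim simp
      qed
      finally show ?thesis .
    qed
    have Htl: "(\<lambda>x. H (t, x)) \<in> borel_measurable lborel" using Ht[of t] by simp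
    have "density lborel (\<lambda>x. H (t, x)) = density lborel (\<lambda>x. ennreal (f' x))"
    proof (rule measure_eqI_generator_eq[OF DI, where \<Omega> = UNIV and A = "\<lambda>_. UNIV"])
      fix b assume b: "b \<in> D"
      have "emeasure (density lborel (\<lambda>x. H (t, x))) b = (\<integral>\<^sup>+x. H (t, x) * indicator b x \<partial>lborel)"
        by (rule emeasure_density[OF Htl]) (use Db[OF b] in simp)
      also have "\<dots> = (\<integral>\<^sup>+x. ennreal (f' x) * indicator b x \<partial>lborel)" using elim b \<kappa>f'[OF Db[OF b]] by simp
      also have "\<dots> = emeasure (density lborel (\<lambda>x. ennreal (f' x))) b"
        by (rule emeasure_density[symmetric, OF f'e]) (use Db[OF b] in simp)
      finally show "emeasure (density lborel (\<lambda>x. H (t, x))) b = emeasure (density lborel (\<lambda>x. ennreal (f' x))) b" .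
    next
      fix i :: nat
      have "emeasure (density lborel (\<lambda>x. H (t, x))) UNIV = (\<integral>\<^sup>+x. H (t, x) * indicator UNIV x \<partial>lborel)"
        by (rule emeasure_density[OF Htl]) simp
      also have "\<dots> = emeasure (\<kappa> t) UNIV" using elim UD by blast
      finally show "emeasure (density lborel (\<lambda>x. H (t, x))) UNIV \<noteq> \<infinity>" using \<kappa>fin[of UNIV t] by simp
    qed (use sD UD in simp_all)
    then have "AE x in lborel. H (t, x) = ennreal (f' x)"
      by (rule sigma_finite_measure.density_unique[OF sigma_finite_lborel Htl f'e])
    with f'(2) have "AE x in lborel. H (t, x) = ennreal (f t x)" by eventually_elim simp
    then show ?case by (rule AE_completion)
  qed
  with Hb show ?thesis by (rule that)
qed

lemma borel_measurable_lebesgue_on_of_borel: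
  fixes f :: "'a::euclidean_space \<Rightarrow> 'b::euclidean_space"
  assumes "f \<in> borel_measurable borel" shows "f \<in> borel_measurable (lebesgue_on S)"
proof -
  have "f \<in> borel_measurable lborel" using assms by simp
  from measurable_restrict_space1[OF measurable_completion[OF this]] show ?thesis .
qed

context bounded_open_domain
begin

text \<open>Radon-Nikodym densities are nonnegative, so the component is clipped to the range from
  \<open>- C\<close> to \<open>C\<close>, shifted up by \<open>C\<close>, and shifted back at the
  end. Clipping makes the bounds hold at all times, not merely almost all.\<close>

lemma grad_component_joint:
  assumes w: "w \<in> Linf_wstar \<Omega> \<Gamma>D T" and C: "0 \<le> C" "AE t in MI. V_norm \<Omega> (w t) \<le> C" and b: "b \<in> Basis"
  shows "\<exists>H. H \<in> borel_measurable borel \<and> (\<forall>p. \<bar>H p\<bar> \<le> C) \<and> (AE t in MI. AE x in M. H (t, x) = grad \<Omega> (w t) x \<bullet> b)"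
proof -
  define clip where "clip r = max (- C) (min C r)" for r :: real
  have clip: "\<bar>clip r\<bar> \<le> C" "\<bar>r\<bar> \<le> C \<Longrightarrow> clip r = r" for r
    using C(1) by (auto simp: clip_def)
  define f where "f t x = (if t \<in> {0<..<T} then if x \<in> \<Omega> then clip (grad \<Omega> (w t) x \<bullet> b) + C else 0 else 0)" for t x
  have f0: "0 \<le> f t x" "f t x \<le> 2 * C * indicator \<Omega> x" for t x
    using clip(1)[of "grad \<Omega> (w t) x \<bullet> b"] C(1) by (auto simp: f_def indicator_def abs_le_iff)
  have foff: "f t = (\<lambda>x. 0)" if t: "t \<notin> {0<..<T}" for t
    unfolding f_def using t by (intro ext if_not_P)
  have gm: "(\<lambda>x. clip (grad \<Omega> (w t) x \<bullet> b) + C) \<in> borel_measurable M" if t: "t \<in> {0<..<T}" for t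
    unfolding clip_def using Linf_measurable[OF grad_Linf[OF Linf_wstar_V[OF w t]]] by measurable
  have fm: "f t \<in> borel_measurable lebesgue" for t
  proof (cases "t \<in> {0<..<T}")
    case True
    have "(\<lambda>x. if x \<in> \<Omega> then clip (grad \<Omega> (w t) x \<bullet> b) + C else 0) \<in> borel_measurable lebesgue"
      by (rule iffD1[OF measurable_restrict_space_iff gm[OF True]]) (use \<Omega>_lebesgue in simp_all)
    then show ?thesis using True by (simp add: f_def[abs_def])
  next
    case False
    then have "f t = (\<lambda>x. 0)" by (rule foff)
    then show ?thesis by simp
  qed
  have fin: "(\<integral>\<^sup>+x. ennreal (f t x) \<partial>lebesgue) < \<infinity>" for t
  proof -
    have "(\<integral>\<^sup>+x. ennreal (f t x) \<partial>lebesgue) \<le> (\<integral>\<^sup>+x. ennreal (2 * C) * indicator \<Omega> x \<partial>lebesgue)"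
    proof (rule nn_integral_mono)
      fix x
      show "ennreal (f t x) \<le> ennreal (2 * C) * indicator \<Omega> x"
        using f0(2)[of t x] by (cases "x \<in> \<Omega>") (simp_all add: ennreal_leI ennreal_eq_0_iff)
    qed
    also have "\<dots> = ennreal (2 * C) * emeasure lebesgue \<Omega>"
      by (rule nn_integral_cmult_indicator[OF \<Omega>_lebesgue(1)])
    also have "\<dots> < \<infinity>" using \<Omega>_lebesgue(2) by (simp add: ennreal_mult_less_top del: emeasure_completion)
    finally show ?thesis .
  qed
  have good: "AE t in MI. t \<in> {0<..<T} \<and> (AE x in M. f t x = grad \<Omega> (w t) x \<bullet> b + C)"
    using C(2) AE_MI_in
  proof eventually_elim
    case (elim t)
    have "AE x in M. x \<in> \<Omega>" by (rule AE_I2) simp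
    with AE_grad_le[OF Linf_wstar_V[OF w elim(2)]]
    have "AE x in M. f t x = grad \<Omega> (w t) x \<bullet> b + C"
    proof eventually_elim
      case (elim x)
      have "\<bar>grad \<Omega> (w t) x \<bullet> b\<bar> \<le> C"
        using Basis_le_norm[OF b, of "grad \<Omega> (w t) x"] elim(1) \<open>V_norm \<Omega> (w t) \<le> C\<close> by linarith
      then show ?case using elim(2) \<open>t \<in> {0<..<T}\<close> by (simp add: f_def clip(2))
    qed
    then show ?case using elim(2) by blast
  qed
  have tm: "(\<lambda>t. \<integral>\<^sup>+x. ennreal (f t x) * indicator B x \<partial>lebesgue) \<in> borel_measurable lebesgue" if B: "B \<in> sets borel" for B
  proof -
    have BM: "(indicator B :: 'a \<Rightarrow> real) \<in> borel_measurable M"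
      by (rule borel_measurable_lebesgue_on_of_borel) (use B in simp)
    have Bi: "integrable M (indicator B :: 'a \<Rightarrow> real)"
      by (rule finite_measure.integrable_const_bound[OF finite_M, of _ 1]) (use BM in \<open>simp_all add: indicator_def\<close>)
    have Bb: "integrable M (\<lambda>x. indicator B x *\<^sub>R b)"
      by (rule integrable_scaleR_left[OF Bi])
    \<comment> \<open>The mass of \<open>B\<close> is a pairing of the gradient with one integrable
      field plus a constant, and such pairings are measurable by the definition of
      \<open>Linf_wstar\<close>.\<close>
    define R where "R t = (LINT x|M. grad \<Omega> (w t) x \<bullet> (indicator B x *\<^sub>R b)) + C * (LINT x|M. indicator B x)" for t
    have Rm: "(\<lambda>t. ennreal (R t)) \<in> borel_measurable MI"
    proof -
      have "(\<lambda>t. LINT x|M. grad \<Omega> (w t) x \<bullet> (indicator B x *\<^sub>R b)) \<in> borel_measurable MI"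
        using w Bb unfolding Linf_wstar_def by blast
      then show ?thesis unfolding R_def by measurable
    qed
    have "AE t in MI. (\<integral>\<^sup>+x. ennreal (f t x) * indicator B x \<partial>lebesgue) = ennreal (R t)"
      using good
    proof eventually_elim
      case (elim t)
      have gi: "integrable M (\<lambda>x. grad \<Omega> (w t) x \<bullet> (indicator B x *\<^sub>R b))"
        using integrable_inner_Linf[OF Bb grad_Linf[OF Linf_wstar_V[OF w conjunct1[OF elim]]]]
        by (simp add: inner_commute)
      have eq: "AE x in M. f t x * indicator B x = grad \<Omega> (w t) x \<bullet> (indicator B x *\<^sub>R b) + C * indicator B x"
        using conjunct2[OF elim] by eventually_elim (simp add: algebra_simps)
      have Ri: "integrable M (\<lambda>x. grad \<Omega> (w t) x \<bullet> (indicator B x *\<^sub>R b) + C * indicator B x)"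
        by (intro Bochner_Integration.integrable_add gi integrable_mult_right Bi)
      have fBm: "(\<lambda>x. f t x * indicator B x) \<in> borel_measurable M"
        by (rule borel_measurable_times[OF measurable_restrict_space1[OF fm] BM])
      have fi: "integrable M (\<lambda>x. f t x * indicator B x)"
        by (rule iffD2[OF integrable_cong_AE[OF fBm borel_measurable_integrable[OF Ri] eq] Ri])
      have "(\<integral>\<^sup>+x. ennreal (f t x) * indicator B x \<partial>lebesgue)
          = (\<integral>\<^sup>+x. ennreal (f t x * indicator B x) * indicator \<Omega> x \<partial>lebesgue)"
      proof (rule nn_integral_cong)
        fix x
        show "ennreal (f t x) * indicator B x = ennreal (f t x * indicator B x) * indicator \<Omega> x"
          by (cases "x \<in> \<Omega>"; cases "x \<in> B") (simp_all add: f_def)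
      qed
      also have "\<dots> = (\<integral>\<^sup>+x. ennreal (f t x * indicator B x) \<partial>M)"
        by (rule nn_integral_restrict_space[symmetric]) (use \<Omega>_lebesgue in simp)
      also have "\<dots> = ennreal (LINT x|M. f t x * indicator B x)"
        by (rule nn_integral_eq_integral[OF fi]) (intro AE_I2 mult_nonneg_nonneg f0(1), simp)
      also have "(LINT x|M. f t x * indicator B x) = (LINT x|M. grad \<Omega> (w t) x \<bullet> (indicator B x *\<^sub>R b) + C * indicator B x)"
        by (rule integral_cong_AE[OF fBm borel_measurable_integrable[OF Ri] eq])
      also have "\<dots> = R t"
        unfolding R_def by (subst Bochner_Integration.integral_add[OF gi integrable_mult_right[OF Bi]]) simp
      finally show ?case .
    qed
    then have "(\<lambda>t. \<integral>\<^sup>+x. ennreal (f t x) * indicator B x \<partial>lebesgue) \<in> borel_measurable MI"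
      by (rule borel_measurable_cong_AE_complete[OF complete_MI Rm])
    then have "(\<lambda>t. if t \<in> {0<..<T} then \<integral>\<^sup>+x. ennreal (f t x) * indicator B x \<partial>lebesgue else 0) \<in> borel_measurable lebesgue"
      by (rule iffD1[OF measurable_restrict_space_iff, rotated 2]) simp_all
    moreover have "(\<lambda>t. if t \<in> {0<..<T} then \<integral>\<^sup>+x. ennreal (f t x) * indicator B x \<partial>lebesgue else 0)
        = (\<lambda>t. \<integral>\<^sup>+x. ennreal (f t x) * indicator B x \<partial>lebesgue)"
    proof
      fix t
      show "(if t \<in> {0<..<T} then \<integral>\<^sup>+x. ennreal (f t x) * indicator B x \<partial>lebesgue else 0) = (\<integral>\<^sup>+x. ennreal (f t x) * indicator B x \<partial>lebesgue)"
      proof (cases "t \<in> {0<..<T}")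
        case False
        then have "f t = (\<lambda>x. 0)" by (rule foff)
        then show ?thesis by simp
      qed simp
    qed
    ultimately show ?thesis by (simp only:)
  qed
  obtain H where H: "H \<in> borel_measurable borel" "AE t in lebesgue. AE x in lebesgue. H (t, x) = ennreal (f t x)"
    by (rule joint_density_exists[of f, OF fm fin tm], assumption, rule that)
  \<comment> \<open>The second clipping bounds \<open>K\<close> everywhere, including points where
    \<open>H\<close> is unrelated to \<open>f\<close>.\<close>
  define K where "K p = clip (enn2real (H p) - C)" for p
  show ?thesis
  proof (intro exI[of _ K] conjI allI)
    show "K \<in> borel_measurable borel" unfolding K_def clip_def using H(1) by measurable
    show "\<bar>K p\<bar> \<le> C" for p unfolding K_def by (rule clip(1))
    have "AE t in MI. AE x in lebesgue. H (t, x) = ennreal (f t x)"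
      by (subst AE_restrict_space_iff) (use H(2) in \<open>auto elim: eventually_mono\<close>)
    with C(2) good show "AE t in MI. AE x in M. K (t, x) = grad \<Omega> (w t) x \<bullet> b"
    proof eventually_elim
      case (elim t)
      have tI: "t \<in> {0<..<T}" using elim(2) by (rule conjunct1)
      have "AE x in M. H (t, x) = ennreal (f t x)"
        by (subst AE_restrict_space_iff) (use \<Omega>_lebesgue(1) elim(3) in \<open>auto elim: eventually_mono\<close>)
      with conjunct2[OF elim(2)] AE_grad_le[OF Linf_wstar_V[OF w tI]]
      show "AE x in M. K (t, x) = grad \<Omega> (w t) x \<bullet> b"
      proof eventually_elim
        case (elim x)
        have "\<bar>grad \<Omega> (w t) x \<bullet> b\<bar> \<le> C"
          using Basis_le_norm[OF b, of "grad \<Omega> (w t) x"] elim(2) \<open>V_norm \<Omega> (w t) \<le> C\<close> by linarith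
        then show ?case using elim(1,3) f0(1)[of t x] by (simp add: K_def clip(2))
      qed
    qed
  qed
qed

text \<open>Joint representatives of the components are assembled into a field that witnesses the
  choice in \<open>st_grad\<close>; only then are functionals on \<open>Linf (Qm T \<Omega>)\<close>
  meaningful at it.\<close>

lemma st_grad_Linf:
  assumes w: "w \<in> Linf_wstar \<Omega> \<Gamma>D T"
  shows "st_grad \<Omega> T w \<in> Linf (Qm T \<Omega>)"
proof -
  obtain C where C: "0 \<le> C" "AE t in MI. V_norm \<Omega> (w t) \<le> C" using Linf_wstar_bound[OF w] by auto
  have "\<forall>b. \<exists>H. b \<in> Basis \<longrightarrow> H \<in> borel_measurable borel \<and> (\<forall>p. \<bar>H p\<bar> \<le> C) \<and> (AE t in MI. AE x in M. H (t, x) = grad \<Omega> (w t) x \<bullet> b)"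
    using grad_component_joint[OF w C] by blast
  from choice[OF this] obtain H where H: "\<forall>b. b \<in> Basis \<longrightarrow> H b \<in> borel_measurable borel \<and> (\<forall>p. \<bar>H b p\<bar> \<le> C) \<and> (AE t in MI. AE x in M. H b (t, x) = grad \<Omega> (w t) x \<bullet> b)"
    by (elim exE)
  have Hm: "H b \<in> borel_measurable borel" and Hb: "\<bar>H b p\<bar> \<le> C"
    and He: "AE t in MI. AE x in M. H b (t, x) = grad \<Omega> (w t) x \<bullet> b" if "b \<in> Basis" for b p
    using mp[OF spec[OF H, of b] that] by blast+
  define G where "G p = (\<Sum>b\<in>Basis. H b p *\<^sub>R b)" for p
  have Gb: "G \<in> borel_measurable borel"
    unfolding G_def by (intro borel_measurable_sum borel_measurable_scaleR Hm borel_measurable_const)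
  have "norm (G p) \<le> (\<Sum>b\<in>(Basis::'a set). C)" for p
    unfolding G_def by (rule order_trans[OF norm_sum sum_mono]) (use Hb in simp)
  then have GL: "G \<in> Linf (Qm T \<Omega>)"
    unfolding Qm_def by (intro LinfI[OF borel_measurable_lebesgue_on_of_borel[OF Gb]] AE_I2)
  have "AE t in MI. \<forall>b\<in>Basis. AE x in M. H b (t, x) = grad \<Omega> (w t) x \<bullet> b"
    by (rule AE_ball_countable'[OF He]) (simp_all add: countable_finite)
  then have Ge: "AE t in MI. AE x in M. G (t, x) = grad \<Omega> (w t) x"
  proof eventually_elim
    case (elim t)
    have "AE x in M. \<forall>b\<in>Basis. H b (t, x) = grad \<Omega> (w t) x \<bullet> b"
      by (rule AE_ball_countable'[OF bspec[OF elim]]) (simp_all add: countable_finite)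
    then show ?case
    proof eventually_elim
      case (elim x)
      have "G (t, x) = (\<Sum>b\<in>Basis. (grad \<Omega> (w t) x \<bullet> b) *\<^sub>R b)"
        unfolding G_def using elim by (intro sum.cong) simp_all
      then show ?case by (simp only: euclidean_representation)
    qed
  qed
  have "\<exists>G. G \<in> Linf (Qm T \<Omega>) \<and> (AE t in MI. AE x in M. G (t, x) = grad \<Omega> (w t) x)"
    using GL Ge by blast
  from someI_ex[OF this] show ?thesis unfolding st_grad_def by (rule conjunct1)
qed

lemma Qm_finite: "finite_measure (Qm T \<Omega>)"
proof -
  have "{0<..<T} \<times> \<Omega> \<in> lmeasurable"
    by (rule lmeasurable_open) (use bounded_\<Omega> open_\<Omega> in \<open>auto intro: bounded_Times open_Times\<close>)
  then have "emeasure lebesgue ({0<..<T} \<times> \<Omega>) < \<infinity>" "{0<..<T} \<times> \<Omega> \<in> sets lebesgue"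
    unfolding fmeasurable_def by blast+
  then show ?thesis unfolding Qm_def
    by (intro finite_measureI) (simp add: emeasure_restrict_space less_top del: emeasure_completion)
qed

lemma Winf_time_deriv:
  assumes "v \<in> Winf \<Omega> \<Gamma>D T"
  shows "v \<in> Linf_wstar \<Omega> \<Gamma>D T" "has_time_deriv \<Omega> \<Gamma>D T v (time_deriv \<Omega> \<Gamma>D T v)"
proof -
  have ex: "\<exists>g. has_time_deriv \<Omega> \<Gamma>D T v g" and L: "v \<in> Linf_wstar \<Omega> \<Gamma>D T" using assms by (auto simp: Winf_def)
  show "v \<in> Linf_wstar \<Omega> \<Gamma>D T" by (rule L)
  show "has_time_deriv \<Omega> \<Gamma>D T v (time_deriv \<Omega> \<Gamma>D T v)"
    unfolding time_deriv_def by (rule someI_ex[OF ex])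
qed

end

section \<open>The error identity\<close>

text \<open>Because \<open>c\<close> is real it can be cancelled in the extended reals, which covers
  the infimum over an empty set and an infimum of \<open>-\<infinity>\<close>.\<close>

lemma INF_ereal_add_const:
  fixes g :: "'a \<Rightarrow> real"
  shows "(INF s\<in>S. ereal (c + g s)) = ereal c + (INF s\<in>S. ereal (g s))"
proof (rule antisym)
  let ?X = "INF s\<in>S. ereal (c + g s)"
  have "ereal (- c) + ?X \<le> (INF s\<in>S. ereal (g s))"
  proof (rule INF_greatest)
    fix s assume "s \<in> S"
    then have "?X \<le> ereal (c + g s)" by (rule INF_lower)
    then have "ereal (- c) + ?X \<le> ereal (- c) + ereal (c + g s)" by (rule add_left_mono)
    then show "ereal (- c) + ?X \<le> ereal (g s)" by simp
  qed
  then have "ereal c + (ereal (- c) + ?X) \<le> ereal c + (INF s\<in>S. ereal (g s))" by (rule add_left_mono)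
  moreover have "ereal c + (ereal (- c) + ?X) = ?X" by (cases ?X) simp_all
  ultimately show "?X \<le> ereal c + (INF s\<in>S. ereal (g s))" by simp
  show "ereal c + (INF s\<in>S. ereal (g s)) \<le> ?X"
  proof (rule INF_greatest)
    fix s assume "s \<in> S"
    then have "(INF s\<in>S. ereal (g s)) \<le> ereal (g s)" by (rule INF_lower)
    then have "ereal c + (INF s\<in>S. ereal (g s)) \<le> ereal c + ereal (g s)" by (rule add_left_mono)
    then show "ereal c + (INF s\<in>S. ereal (g s)) \<le> ereal (c + g s)" by simp
  qed
qed

theorem lemma5p12:
  fixes \<Omega> \<Gamma>D \<Gamma>N :: "'a::euclidean_space set"
    and T \<zeta>0 :: real
    and \<zeta> u v :: "real \<Rightarrow> 'a \<Rightarrow> real"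
    and f :: "real \<Rightarrow> ('a \<Rightarrow> real) \<Rightarrow> real"
    and u0 :: "'a \<Rightarrow> real"
    and z zs :: "(real \<times> 'a \<Rightarrow> 'a) \<Rightarrow> real"
    and za :: "real \<times> 'a \<Rightarrow> 'a"
  defines "Q \<equiv> Qm T \<Omega>"
    and "\<zeta>Q \<equiv> (\<lambda>(t, x). \<zeta> t x)"
    and "Du \<equiv> st_grad \<Omega> T u"
    and "Dv \<equiv> st_grad \<Omega> T v"
  assumes "bounded_lipschitz_domain \<Omega>"
    and "boundary_split \<Omega> \<Gamma>D \<Gamma>N"
    and "0 < T"
    and "admissible_yield \<Omega> T \<zeta> \<zeta>0"
    and "f \<in> L1_predual \<Omega> \<Gamma>D T"
    and "u0 \<in> W1infD \<Omega> \<Gamma>D"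
    and "grad \<Omega> u0 \<in> Kset \<Omega> \<zeta> 0"
    and "torsion_solution \<Omega> \<Gamma>D T \<zeta> f u0 u"
    and "dual_flux \<Omega> \<Gamma>D T \<zeta> f u z"
    and "yosida_hewitt Q z za zs"
    and "v \<in> Winf \<Omega> \<Gamma>D T"
    and "AE x in lebesgue_on \<Omega>. C0H_rep \<Omega> T v 0 x = u0 x"
    and "AE t in lebesgue_on {0<..<T}. grad \<Omega> (v t) \<in> Kset \<Omega> \<zeta> t"
  shows "ereal (1/2 * (L2_norm Q (\<lambda>p. Dv p - Du p))\<^sup>2
           + (LINT p|lebesgue_on {p \<in> {0<..<T} \<times> \<Omega>. norm (Du p) = \<zeta>Q p}.
                (norm (za p) / \<zeta>Q p - 1) * ((\<zeta>Q p)\<^sup>2 - Du p \<bullet> Dv p))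
           + weighted_variation Q \<zeta>Q zs - zs Dv
           + 1/2 * (L2_norm (lebesgue_on \<Omega>) (\<lambda>x. C0H_rep \<Omega> T v T x - C0H_rep \<Omega> T u T x))\<^sup>2)
         + (INF (y, ya, ys) \<in> equilibrated \<Omega> \<Gamma>D T f v.
              ereal (I_phi_conj Q \<zeta>Q ya - (LINT p|Q. ya p \<bullet> Du p) + 1/2 * (L2_norm Q Du)\<^sup>2
                + weighted_variation Q \<zeta>Q ys - ys Du))
       = (INF (y, ya, ys) \<in> equilibrated \<Omega> \<Gamma>D T f v.
              ereal (I_phi_conj Q \<zeta>Q ya - (LINT p|Q. ya p \<bullet> Dv p) + 1/2 * (L2_norm Q Dv)\<^sup>2
                + weighted_variation Q \<zeta>Q ys - ys Dv))"
proof -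
  let ?MI = "lebesgue_on {0<..<T}" and ?M = "lebesgue_on \<Omega>"
  let ?E = "equilibrated \<Omega> \<Gamma>D T f v"
  have dom: "bounded_open_domain \<Omega> T"
    using assms(5,7) by (simp add: bounded_open_domain_def bounded_lipschitz_domain_def)
  interpret bounded_open_domain \<Omega> \<Gamma>D T by (rule dom)
  have u: "u \<in> Winf \<Omega> \<Gamma>D T" using assms(12) by (simp add: torsion_solution_def)
  have v: "v \<in> Winf \<Omega> \<Gamma>D T" by (rule assms(15))
  note uL = Winf_time_deriv(1)[OF u] and ut = Winf_time_deriv(2)[OF u]
  note vL = Winf_time_deriv(1)[OF v] and vt = Winf_time_deriv(2)[OF v]
  define gu gv where "gu = time_deriv \<Omega> \<Gamma>D T u" and "gv = time_deriv \<Omega> \<Gamma>D T v"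
  define cu cv where "cu = C0H_rep \<Omega> T u" and "cv = C0H_rep \<Omega> T v"
  have cu: "is_C0H_rep \<Omega> T u cu" and cv: "is_C0H_rep \<Omega> T v cv"
    unfolding cu_def cv_def by (rule Winf_C0H_rep[OF u], rule Winf_C0H_rep[OF v])
  have DuL: "Du \<in> Linf Q" and DvL: "Dv \<in> Linf Q"
    unfolding Du_def Dv_def Q_def by (rule st_grad_Linf[OF uL], rule st_grad_Linf[OF vL])
  have finQ: "finite_measure Q" unfolding Q_def by (rule Qm_finite)
  have \<zeta>L: "\<zeta>Q \<in> Linf Q" and \<zeta>pos: "AE p in Q. 0 < \<zeta>Q p"
  proof -
    show "\<zeta>Q \<in> Linf Q" using assms(8) by (simp add: admissible_yield_def Q_def \<zeta>Q_def)
    have "\<zeta>0 > 0" "AE (t, x) in Q. \<zeta> t x \<ge> \<zeta>0" using assms(8) unfolding admissible_yield_def Q_def by blast+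
    then show "AE p in Q. 0 < \<zeta>Q p" unfolding \<zeta>Q_def by (auto elim!: eventually_mono)
  qed
  have zsub: "z \<in> subdifferential Q (I_G Q \<zeta>Q) Du"
    using assms(13) by (simp add: dual_flux_def Q_def \<zeta>Q_def Du_def)
  have zw: "z (st_grad \<Omega> T w) + (LINT t|?MI. gu t (w t)) = (LINT t|?MI. f t (w t))"
    if "w \<in> Linf_wstar \<Omega> \<Gamma>D T" for w
    using assms(13) that by (simp add: dual_flux_def Lstar_def L1_pairing_def gu_def)
  note flux = flux_identity[OF finQ \<zeta>L \<zeta>pos DuL DvL zsub assms(14)]
  have nrm: "(L2_norm Q q)\<^sup>2 = (LINT p|Q. (norm (q p))\<^sup>2)" for q :: "real \<times> 'a \<Rightarrow> 'a"
    unfolding L2_norm_def by (rule real_sqrt_pow2) (intro integral_nonneg_AE, simp)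
  \<comment> \<open>The contact set is measurable, so the integral over it may be written over
    \<open>Q\<close> with a zero extension, as in \<open>flux_identity\<close>.\<close>
  have region: "(LINT p|lebesgue_on {p \<in> {0<..<T} \<times> \<Omega>. norm (Du p) = \<zeta>Q p}.
        (norm (za p) / \<zeta>Q p - 1) * ((\<zeta>Q p)\<^sup>2 - Du p \<bullet> Dv p))
      = (LINT p|Q. (if norm (Du p) = \<zeta>Q p then (norm (za p) / \<zeta>Q p - 1) * ((\<zeta>Q p)\<^sup>2 - Du p \<bullet> Dv p) else 0))"
    (is "?lhs = ?rhs")
  proof -
    define F where "F p = (norm (za p) / \<zeta>Q p - 1) * ((\<zeta>Q p)\<^sup>2 - Du p \<bullet> Dv p)" for p
    let ?S = "{0<..<T} \<times> \<Omega>" and ?A = "{p \<in> {0<..<T} \<times> \<Omega>. norm (Du p) = \<zeta>Q p}"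
    have "open ?S" using open_\<Omega> by (intro open_Times) auto
    then have S: "?S \<in> sets lebesgue" by auto
    have "{p \<in> space Q. norm (Du p) = \<zeta>Q p} \<in> sets Q"
      by (rule borel_measurable_eq[OF measurable_compose[OF Linf_measurable[OF DuL] borel_measurable_norm] Linf_measurable[OF \<zeta>L]])
    then have "?A \<in> sets (lebesgue_on ?S)" by (simp add: Q_def Qm_def)
    then have A: "?A \<in> sets lebesgue" using S by (subst (asm) sets_restrict_space_iff) auto
    have "?lhs = (LINT p|lebesgue. indicator ?A p *\<^sub>R F p)"
      unfolding F_def by (rule integral_restrict_space) (use A in simp)
    also have "\<dots> = (LINT p|lebesgue. indicator ?S p *\<^sub>R (if norm (Du p) = \<zeta>Q p then F p else 0))"
      by (intro Bochner_Integration.integral_cong refl) (simp add: indicator_def)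
    also have "\<dots> = ?rhs"
      unfolding F_def Q_def Qm_def by (rule integral_restrict_space[symmetric]) (use S in simp)
    finally show ?thesis .
  qed
  define uu vv uv P where "uu = ip (cu T) (cu T)" and "vv = ip (cv T) (cv T)" and "uv = ip (cu T) (cv T)"
    and "P = ip (cu 0) (cu 0)"
  have T0: "0 \<in> {0..T}" "T \<in> {0..T}" using T_pos by simp_all
  have cL: "cu t \<in> L2 ?M" "cv t \<in> L2 ?M" if "t \<in> {0..T}" for t
    using cu cv that by (simp_all add: is_C0H_rep_def)
  have cu0: "AE x in ?M. cu 0 x = u0 x" and cv0: "AE x in ?M. cv 0 x = u0 x"
    using assms(12,16) by (simp_all add: torsion_solution_def cu_def cv_def)
  \<comment> \<open>The common initial value makes all three initial products equal, so they cancel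
    in the combination below.\<close>
  have P: "ip (cv 0) (cv 0) = P" "ip (cu 0) (cv 0) = P"
  proof -
    have "AE x in ?M. cv 0 x \<bullet> cv 0 x = cu 0 x \<bullet> cu 0 x" "AE x in ?M. cu 0 x \<bullet> cv 0 x = cu 0 x \<bullet> cu 0 x"
      using cu0 cv0 by (eventually_elim, simp)+
    note ae = this
    note m = L2D(1)[OF cL(1)[OF T0(1)]] L2D(1)[OF cL(2)[OF T0(1)]]
    show "ip (cv 0) (cv 0) = P" "ip (cu 0) (cv 0) = P" unfolding P_def L2_inner_def
      by (rule integral_cong_AE[OF borel_measurable_inner[OF m(2,2)] borel_measurable_inner[OF m(1,1)] ae(1)],
          rule integral_cong_AE[OF borel_measurable_inner[OF m(1,2)] borel_measurable_inner[OF m(1,1)] ae(2)])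
  qed
  define Iuu Ivv Iuv Ivu Fu Fv where "Iuu = (LINT t|?MI. gu t (u t))" and "Ivv = (LINT t|?MI. gv t (v t))"
    and "Iuv = (LINT t|?MI. gu t (v t))" and "Ivu = (LINT t|?MI. gv t (u t))"
    and "Fu = (LINT t|?MI. f t (u t))" and "Fv = (LINT t|?MI. f t (v t))"
  have parts: "Iuu + Iuu = uu - P" "Ivv + Ivv = vv - P" "Iuv + Ivu = uv - P"
  proof -
    show "Iuu + Iuu = uu - P"
      unfolding Iuu_def gu_def uu_def P_def by (rule integration_by_parts[OF uL ut cu uL ut cu])
    show "Ivv + Ivv = vv - P"
      unfolding Ivv_def gv_def vv_def P(1)[symmetric] by (rule integration_by_parts[OF vL vt cv vL vt cv])
    show "Iuv + Ivu = uv - P"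
      unfolding Iuv_def Ivu_def gu_def gv_def uv_def P(2)[symmetric] by (rule integration_by_parts[OF uL ut cu vL vt cv])
  qed
  have final: "(L2_norm ?M (\<lambda>x. cv T x - cu T x))\<^sup>2 = vv - 2 * uv + uu"
  proof -
    have "(L2_norm ?M (\<lambda>x. cv T x - cu T x))\<^sup>2 = L2_dist2 ?M (cv T) (cu T)"
      unfolding L2_norm_def using L2_dist2_nonneg[of ?M "cv T" "cu T"] by (simp add: L2_dist2_def)
    also have "\<dots> = vv - 2 * uv + uu"
      unfolding ip_diff_self[OF cL(2)[OF T0(2)] cL(1)[OF T0(2)]] vv_def uv_def uu_def
      using ip_commute[of "cv T" "cu T"] by simp
    finally show ?thesis .
  qed
  have zu: "z Du + Iuu = Fu" and zv: "z Dv + Iuv = Fv"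
    unfolding Du_def Dv_def Iuu_def Iuv_def Fu_def Fv_def by (rule zw[OF uL], rule zw[OF vL])
  define c where "c = 1/2 * (L2_norm Q (\<lambda>p. Dv p - Du p))\<^sup>2
    + (LINT p|lebesgue_on {p \<in> {0<..<T} \<times> \<Omega>. norm (Du p) = \<zeta>Q p}.
         (norm (za p) / \<zeta>Q p - 1) * ((\<zeta>Q p)\<^sup>2 - Du p \<bullet> Dv p))
    + weighted_variation Q \<zeta>Q zs - zs Dv
    + 1/2 * (L2_norm ?M (\<lambda>x. C0H_rep \<Omega> T v T x - C0H_rep \<Omega> T u T x))\<^sup>2"
  have c: "c = z Du - z Dv + (L2_norm Q Dv)\<^sup>2 / 2 - (L2_norm Q Du)\<^sup>2 / 2 + (vv - 2 * uv + uu) / 2"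
    unfolding c_def region nrm using flux final by (simp add: cu_def cv_def)
  define eu where "eu = (\<lambda>(y :: (real \<times> 'a \<Rightarrow> 'a) \<Rightarrow> real, ya, ys). I_phi_conj Q \<zeta>Q ya - (LINT p|Q. ya p \<bullet> Du p)
    + 1/2 * (L2_norm Q Du)\<^sup>2 + weighted_variation Q \<zeta>Q ys - ys Du)"
  have shift: "I_phi_conj Q \<zeta>Q ya - (LINT p|Q. ya p \<bullet> Dv p) + 1/2 * (L2_norm Q Dv)\<^sup>2 + weighted_variation Q \<zeta>Q ys - ys Dv
      = c + eu (y, ya, ys)" if y: "(y, ya, ys) \<in> ?E" for y ya ys
  proof -
    have yh: "yosida_hewitt Q y ya ys" using y by (simp add: equilibrated_def Q_def)
    have yd: "y q = (LINT p|Q. ya p \<bullet> q p) + ys q" if "q \<in> Linf Q" for q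
      using yh that by (simp add: yosida_hewitt_def)
    have yw: "y (st_grad \<Omega> T w) = (LINT t|?MI. f t (w t)) - (LINT t|?MI. gv t (w t))"
      if w: "w \<in> Linf_wstar \<Omega> \<Gamma>D T" for w
    proof -
      have "y (st_grad \<Omega> T w) = (LINT t|?MI. f t (w t) - gv t (w t))"
        using y w by (simp add: equilibrated_def Lstar_def L1_pairing_def gv_def)
      also have "\<dots> = (LINT t|?MI. f t (w t)) - (LINT t|?MI. gv t (w t))"
        unfolding gv_def
        by (rule Bochner_Integration.integral_diff[OF L1_predual_apply_integrable[OF assms(9) w]
              L1_predual_apply_integrable[OF has_time_derivD(2)[OF vt] w]])
      finally show ?thesis .
    qed
    have yu: "y Du = Fu - Ivu" and yv: "y Dv = Fv - Ivv"
      unfolding Du_def Dv_def Fu_def Fv_def Ivu_def Ivv_def by (rule yw[OF uL], rule yw[OF vL])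
    \<comment> \<open>The terms in \<open>f\<close> cancel between \<open>y\<close> and
      \<open>z\<close>, leaving \<open>z Du - z Dv\<close> and the pairing
      \<open>Ivv - Ivu - Iuv + Iuu\<close> of \<open>gv - gu\<close> with \<open>v - u\<close>; by
      \<open>parts\<close> the latter is \<open>(vv - 2 * uv + uu) / 2\<close>.\<close>
    show ?thesis
      unfolding eu_def prod.case c using yd[OF DuL] yd[OF DvL] yu yv zu zv parts by argo
  qed
  have "(INF (y, ya, ys) \<in> ?E. ereal (I_phi_conj Q \<zeta>Q ya - (LINT p|Q. ya p \<bullet> Dv p) + 1/2 * (L2_norm Q Dv)\<^sup>2
      + weighted_variation Q \<zeta>Q ys - ys Dv)) = (INF s \<in> ?E. ereal (c + eu s))"
    by (rule INF_cong[OF refl]) (use shift in auto)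
  also have "\<dots> = ereal c + (INF s \<in> ?E. ereal (eu s))" by (rule INF_ereal_add_const)
  also have "(INF s \<in> ?E. ereal (eu s)) = (INF (y, ya, ys) \<in> ?E. ereal (I_phi_conj Q \<zeta>Q ya - (LINT p|Q. ya p \<bullet> Du p)
      + 1/2 * (L2_norm Q Du)\<^sup>2 + weighted_variation Q \<zeta>Q ys - ys Du))"
    by (rule INF_cong[OF refl]) (auto simp: eu_def)
  finally show ?thesis unfolding c_def by (rule sym)
qed

end
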